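(* Let $R$ be a unital commutative ring and $D$ a unital superdialgebra over $R$. The universal central extension of the Leibniz superalgebra $\mathfrak{sl}(4,0,D)$ is $\mathfrak{stl}(4,0,D)\oplus D_2^6$; that is, the $R$-supermodule $\mathfrak{stl}(4,0,D)\oplus D_2^6$ carries a Leibniz superalgebra structure for which the projection onto $\mathfrak{stl}(4,0,D)$ followed by the canonical homomorphism $\mathfrak{stl}(4,0,D)\to\mathfrak{sl}(4,0,D)$, $F_{ij}(a)\mapsto E_{ij}(a)$, is a universal central extension of $\mathfrak{sl}(4,0,D)$.
   Context: $R$ is a fixed unital commutative ring; $|x|\in\mathbb{Z}_2$ denotes the degree of a homogeneous element, and formulas involving degrees are for homogeneous elements and extended linearly. A superdialgebra $D=D_{\bar 0}\oplus D_{\bar 1}$ is a $\mathbb{Z}_2$-graded $R$-module with two associative $R$-linear operations $\vdash,\dashv\colon D\otimes_R D\to D$, compatible with the grading, such that $a\dashv(b\dashv c)=a\dashv(b\vdash c)$, $(a\vdash b)\dashv c=a\vdash(b\dashv c)$, $(a\dashv b)\vdash c=(a\vdash b)\vdash c$. It is unital if it has a chosen bar-unit, i.e. an (even) element $1$ with $a\dashv 1=a=1\vdash a$ for all $a$. An ideal of $D$ is an $R$-submodule $I$ such that $x\dashv y,\ x\vdash y\in I$ whenever $x\in I$ or $y\in I$. For an integer $k$, $D_k=D/\mathcal{I}_k$, where $\mathcal{I}_k$ is the ideal generated by all elements $ka$ and $a\dashv b-(-1)^{|a||b|}b\vdash a$ with $a,b\in D$. $D_2^6$ is the direct sum of six copies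 of $D_2$, with the induced grading. A Leibniz superalgebra $L$ is an $R$-supermodule with an even $R$-linear map $[-,-]\colon L\otimes_R L\to L$ satisfying $[x,[y,z]]=[[x,y],z]-(-1)^{|y||z|}[[x,z],y]$. Its centre $\mathrm{Z}(L)$ is the set of $z$ with $[z,x]=[x,z]=0$ for all $x$. A central extension of $L$ is a surjective homomorphism $\phi\colon M\to L$ with $\mathrm{Ker}\,\phi\subseteq\mathrm{Z}(M)$; a central extension $\mathfrak{u}\colon U\to L$ is universal if for every central extension $\phi\colon M\to L$ there is a unique homomorphism $f\colon U\to M$ with $\mathfrak{u}=\phi\circ f$. For non-negative integers $m,n$ with $m+n\ge 3$ put $|i|=\bar 0$ for $1\le i\le m$ and $|i|=\bar 1$ for $m+1\le i\le m+n$. $\mathfrak{gl}(m,n,D)$ is the $R$-module of $(m+n)\times(m+n)$ matrices over $D$, where $E_{ij}(a)$ (the matrix with $a$ in position $(i,j)$ and zeros elsewhere) has degree $|i|+|j|+|a|$, with bracket $[x,y]=x\dashv y-(-1)^{|x||y|}y\vdash x$, where $(x\dashv y)_{ij}=\sum_k x_{ik}\dashv y_{kj}$ and $(x\vdash y)_{ij}=\sum_k x_{ik}\vdash y_{kj}$. $\mathfrak{sl}(m,n,D)=[\mathfrak{gl}(m,n,D),\mathfrak{gl}(m,n,D)]$. The Steinberg Leibniz superalgebra $\mathfrak{stl}(m,n,D)$ is the Leibniz superalgebra over $R$ generated by elements $F_{ij}(a)$, $a\in D_{\bar 0}\cup D_{\bar 1}$, $1\le i\ne j\le m+n$, of degree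 $|i|+|j|+|a|$, subject to: $a\mapsto F_{ij}(a)$ is $R$-linear; $[F_{ij}(a),F_{kl}(b)]=F_{il}(a\dashv b)$ if $i\ne l$ and $j=k$; $[F_{ij}(a),F_{kl}(b)]=-(-1)^{|F_{ij}(a)||F_{kl}(b)|}F_{kj}(b\vdash a)$ if $i=l$ and $j\ne k$; $[F_{ij}(a),F_{kl}(b)]=0$ if $i\ne l$ and $j\ne k$. *)

theory Defs
  imports "HOL-Algebra.Module" "HOL-Algebra.AbelCoset" "HOL-Library.Z2"
begin

section \<open>Supermodules\<close>

text \<open>
  Degrees live in the field \<^typ>\<open>bit\<close> of integers mod 2. All structures are carrier based and
  extend the HOL-Algebra record \<open>module\<close>; the fields \<open>mult\<close> and \<open>one\<close> inherited from there
  are never used.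
\<close>

record ('r, 'a) supermodule = "('r, 'a) module" +
  grade :: "bit \<Rightarrow> 'a set"

locale supermodule = module R M
  for R (structure) and M :: "('r, 'a, 'z) supermodule_scheme" (structure) +
  assumes grade_submodule: "submodule (grade M p) R M"
    and grade_span: "x \<in> carrier M \<Longrightarrow> \<exists>y\<in>grade M 0. \<exists>z\<in>grade M 1. x = y \<oplus>\<^bsub>M\<^esub> z"
    and grade_disjoint: "grade M 0 \<inter> grade M 1 = {\<zero>\<^bsub>M\<^esub>}"

definition homog_comp :: "('r, 'a, 'z) supermodule_scheme \<Rightarrow> bit \<Rightarrow> 'a \<Rightarrow> 'a" where
  "homog_comp M p x = (THE y. y \<in> grade M p \<and> (\<exists>z\<in>grade M (p + 1). x = y \<oplus>\<^bsub>M\<^esub> z))"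

text \<open>\<open>koszul M p q x\<close> is $(-1)^{pq} x$.\<close>

definition koszul :: "('a, 'z) ring_scheme \<Rightarrow> bit \<Rightarrow> bit \<Rightarrow> 'a \<Rightarrow> 'a" where
  "koszul M p q x = (if p * q = 1 then \<ominus>\<^bsub>M\<^esub> x else x)"

definition bilinear_op ::
  "('r, 's) ring_scheme \<Rightarrow> ('r, 'a, 'z) module_scheme \<Rightarrow> ('a \<Rightarrow> 'a \<Rightarrow> 'a) \<Rightarrow> bool" where
  "bilinear_op R M f \<longleftrightarrow>
     (\<forall>x\<in>carrier M. \<forall>y\<in>carrier M. f x y \<in> carrier M) \<and>
     (\<forall>x\<in>carrier M. \<forall>y\<in>carrier M. \<forall>z\<in>carrier M.
        f (x \<oplus>\<^bsub>M\<^esub> y) z = f x z \<oplus>\<^bsub>M\<^esub> f y z \<and> f x (y \<oplus>\<^bsub>M\<^esub> z) = f x y \<oplus>\<^bsub>M\<^esub> f x z) \<and>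
     (\<forall>r\<in>carrier R. \<forall>x\<in>carrier M. \<forall>y\<in>carrier M.
        f (r \<odot>\<^bsub>M\<^esub> x) y = r \<odot>\<^bsub>M\<^esub> f x y \<and> f x (r \<odot>\<^bsub>M\<^esub> y) = r \<odot>\<^bsub>M\<^esub> f x y)"

definition graded_op :: "('r, 'a, 'z) supermodule_scheme \<Rightarrow> ('a \<Rightarrow> 'a \<Rightarrow> 'a) \<Rightarrow> bool" where
  "graded_op M f \<longleftrightarrow> (\<forall>p q. \<forall>x\<in>grade M p. \<forall>y\<in>grade M q. f x y \<in> grade M (p + q))"

definition quotient_supermodule ::
  "('r, 'a, 'z) supermodule_scheme \<Rightarrow> 'a set \<Rightarrow> ('r, 'a set) supermodule" where
  "quotient_supermodule M I =
     \<lparr>carrier = a_rcosets\<^bsub>M\<^esub> I, mult = undefined, one = undefined, zero = I, add = set_add M,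
      smult = (\<lambda>r A. \<Union>x\<in>A. I +>\<^bsub>M\<^esub> (r \<odot>\<^bsub>M\<^esub> x)),
      grade = (\<lambda>p. (\<lambda>x. I +>\<^bsub>M\<^esub> x) ` grade M p)\<rparr>"

definition dsum_supermodule ::
  "('r, 'a, 'y) supermodule_scheme \<Rightarrow> ('r, 'b, 'z) supermodule_scheme \<Rightarrow>
   ('r, 'a \<times> 'b) supermodule" where
  "dsum_supermodule M N =
     \<lparr>carrier = carrier M \<times> carrier N, mult = undefined, one = undefined,
      zero = (\<zero>\<^bsub>M\<^esub>, \<zero>\<^bsub>N\<^esub>),
      add = (\<lambda>(x, u) (y, v). (x \<oplus>\<^bsub>M\<^esub> y, u \<oplus>\<^bsub>N\<^esub> v)),
      smult = (\<lambda>r (x, u). (r \<odot>\<^bsub>M\<^esub> x, r \<odot>\<^bsub>N\<^esub> u)),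
      grade = (\<lambda>p. grade M p \<times> grade N p)\<rparr>"

definition power_supermodule ::
  "('r, 'a, 'z) supermodule_scheme \<Rightarrow> nat \<Rightarrow> ('r, nat \<Rightarrow> 'a) supermodule" where
  "power_supermodule M n =
     \<lparr>carrier = {1..n} \<rightarrow>\<^sub>E carrier M, mult = undefined, one = undefined,
      zero = (\<lambda>s\<in>{1..n}. \<zero>\<^bsub>M\<^esub>),
      add = (\<lambda>u v. \<lambda>s\<in>{1..n}. u s \<oplus>\<^bsub>M\<^esub> v s),
      smult = (\<lambda>r u. \<lambda>s\<in>{1..n}. r \<odot>\<^bsub>M\<^esub> u s),
      grade = (\<lambda>p. {1..n} \<rightarrow>\<^sub>E grade M p)\<rparr>"

section \<open>Superdialgebras\<close>

record ('r, 'a) superdialgebra = "('r, 'a) supermodule" +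
  ldia :: "'a \<Rightarrow> 'a \<Rightarrow> 'a" (infixl "\<stileturn>\<index>" 70)
  rdia :: "'a \<Rightarrow> 'a \<Rightarrow> 'a" (infixl "\<turnstile>\<index>" 70)

locale superdialgebra = supermodule R D
  for R and D :: "('r, 'a, 'z) superdialgebra_scheme" (structure) +
  assumes ldia_bilinear: "bilinear_op R D (\<stileturn>)"
    and rdia_bilinear: "bilinear_op R D (\<turnstile>)"
    and ldia_graded: "graded_op D (\<stileturn>)"
    and rdia_graded: "graded_op D (\<turnstile>)"
    and ldia_assoc:
      "\<lbrakk>a \<in> carrier D; b \<in> carrier D; c \<in> carrier D\<rbrakk> \<Longrightarrow> (a \<stileturn> b) \<stileturn> c = a \<stileturn> (b \<stileturn> c)"
    and rdia_assoc:
      "\<lbrakk>a \<in> carrier D; b \<in> carrier D; c \<in> carrier D\<rbrakk> \<Longrightarrow> (a \<turnstile> b) \<turnstile> c = a \<turnstile> (b \<turnstile> c)"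
    and dia_right:
      "\<lbrakk>a \<in> carrier D; b \<in> carrier D; c \<in> carrier D\<rbrakk> \<Longrightarrow> a \<stileturn> (b \<stileturn> c) = a \<stileturn> (b \<turnstile> c)"
    and dia_mid:
      "\<lbrakk>a \<in> carrier D; b \<in> carrier D; c \<in> carrier D\<rbrakk> \<Longrightarrow> (a \<turnstile> b) \<stileturn> c = a \<turnstile> (b \<stileturn> c)"
    and dia_left:
      "\<lbrakk>a \<in> carrier D; b \<in> carrier D; c \<in> carrier D\<rbrakk> \<Longrightarrow> (a \<stileturn> b) \<turnstile> c = (a \<turnstile> b) \<turnstile> c"

definition bar_unit :: "('r, 'a, 'z) superdialgebra_scheme \<Rightarrow> 'a \<Rightarrow> bool" where
  "bar_unit D e \<longleftrightarrow>
     e \<in> grade D 0 \<and> (\<forall>a\<in>carrier D. a \<stileturn>\<^bsub>D\<^esub> e = a \<and> e \<turnstile>\<^bsub>D\<^esub> a = a)"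

definition dialgebra_ideal ::
  "('r, 's) ring_scheme \<Rightarrow> ('r, 'a, 'z) superdialgebra_scheme \<Rightarrow> 'a set \<Rightarrow> bool" where
  "dialgebra_ideal R D I \<longleftrightarrow>
     submodule I R D \<and>
     (\<forall>x\<in>carrier D. \<forall>y\<in>carrier D. x \<in> I \<or> y \<in> I \<longrightarrow> x \<stileturn>\<^bsub>D\<^esub> y \<in> I \<and> x \<turnstile>\<^bsub>D\<^esub> y \<in> I)"

definition dialgebra_ideal_generated ::
  "('r, 's) ring_scheme \<Rightarrow> ('r, 'a, 'z) superdialgebra_scheme \<Rightarrow> 'a set \<Rightarrow> 'a set" where
  "dialgebra_ideal_generated R D S = \<Inter>{I. dialgebra_ideal R D I \<and> S \<subseteq> I}"

definition commutator_ideal ::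
  "('r, 's) ring_scheme \<Rightarrow> ('r, 'a, 'z) superdialgebra_scheme \<Rightarrow> int \<Rightarrow> 'a set" where
  "commutator_ideal R D k = dialgebra_ideal_generated R D
     ({[k] \<cdot>\<^bsub>D\<^esub> a | a. a \<in> carrier D} \<union>
      {a \<stileturn>\<^bsub>D\<^esub> b \<ominus>\<^bsub>D\<^esub> koszul D p q (b \<turnstile>\<^bsub>D\<^esub> a) | a b p q. a \<in> grade D p \<and> b \<in> grade D q})"

text \<open>The $R$-supermodule underlying $D_k = D/\mathcal{I}_k$.\<close>

definition commutator_quotient ::
  "('r, 's) ring_scheme \<Rightarrow> ('r, 'a, 'z) superdialgebra_scheme \<Rightarrow> int \<Rightarrow>
   ('r, 'a set) supermodule" where
  "commutator_quotient R D k = quotient_supermodule D (commutator_ideal R D k)"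

section \<open>Leibniz superalgebras and their central extensions\<close>

record ('r, 'a) leibniz_superalgebra = "('r, 'a) supermodule" +
  bracket :: "'a \<Rightarrow> 'a \<Rightarrow> 'a"

locale leibniz_superalgebra = supermodule R L
  for R and L :: "('r, 'a, 'z) leibniz_superalgebra_scheme" (structure) +
  assumes bracket_bilinear: "bilinear_op R L (bracket L)"
    and bracket_graded: "graded_op L (bracket L)"
    and leibniz:
      "\<lbrakk>x \<in> grade L p; y \<in> grade L q; z \<in> grade L r\<rbrakk> \<Longrightarrow>
       bracket L x (bracket L y z) =
       bracket L (bracket L x y) z \<ominus> koszul L q r (bracket L (bracket L x z) y)"

definition with_bracket ::
  "('r, 'a, 'z) supermodule_scheme \<Rightarrow> ('a \<Rightarrow> 'a \<Rightarrow> 'a) \<Rightarrow> ('r, 'a) leibniz_superalgebra" where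
  "with_bracket M b =
     \<lparr>carrier = carrier M, mult = mult M, one = one M, zero = zero M, add = add M,
      smult = smult M, grade = grade M, bracket = b\<rparr>"

definition leibniz_centre :: "('r, 'a, 'z) leibniz_superalgebra_scheme \<Rightarrow> 'a set" where
  "leibniz_centre L =
     {z \<in> carrier L. \<forall>x\<in>carrier L. bracket L z x = \<zero>\<^bsub>L\<^esub> \<and> bracket L x z = \<zero>\<^bsub>L\<^esub>}"

definition leibniz_hom ::
  "('r, 's) ring_scheme \<Rightarrow> ('r, 'a, 'y) leibniz_superalgebra_scheme \<Rightarrow>
   ('r, 'b, 'z) leibniz_superalgebra_scheme \<Rightarrow> ('a \<Rightarrow> 'b) set" where
  "leibniz_hom R L M =
     {f. f \<in> carrier L \<rightarrow> carrier M \<and>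
       (\<forall>x\<in>carrier L. \<forall>y\<in>carrier L. f (x \<oplus>\<^bsub>L\<^esub> y) = f x \<oplus>\<^bsub>M\<^esub> f y) \<and>
       (\<forall>r\<in>carrier R. \<forall>x\<in>carrier L. f (r \<odot>\<^bsub>L\<^esub> x) = r \<odot>\<^bsub>M\<^esub> f x) \<and>
       (\<forall>p. f ` grade L p \<subseteq> grade M p) \<and>
       (\<forall>x\<in>carrier L. \<forall>y\<in>carrier L. f (bracket L x y) = bracket M (f x) (f y))}"

definition central_extension ::
  "('r, 's) ring_scheme \<Rightarrow> ('r, 'a) leibniz_superalgebra \<Rightarrow> ('r, 'b) leibniz_superalgebra \<Rightarrow>
   ('a \<Rightarrow> 'b) \<Rightarrow> bool" where
  "central_extension R M L \<phi> \<longleftrightarrow>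
     leibniz_superalgebra R M \<and> leibniz_superalgebra R L \<and>
     \<phi> \<in> leibniz_hom R M L \<and> \<phi> ` carrier M = carrier L \<and>
     {x \<in> carrier M. \<phi> x = \<zero>\<^bsub>L\<^esub>} \<subseteq> leibniz_centre M"

text \<open>
  HOL cannot quantify over types inside a formula, so the type \<open>'m\<close> of the elements of the
  competing central extensions is a parameter; a theorem with \<open>'m\<close> free covers all of them.
\<close>

definition universal_central_extension ::
  "'m itself \<Rightarrow> ('r, 's) ring_scheme \<Rightarrow> ('r, 'a) leibniz_superalgebra \<Rightarrow>
   ('r, 'b) leibniz_superalgebra \<Rightarrow> ('a \<Rightarrow> 'b) \<Rightarrow> bool" where
  "universal_central_extension (_ :: 'm itself) R U L u \<longleftrightarrow>
     central_extension R U L u \<and>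
     (\<forall>(M :: ('r, 'm) leibniz_superalgebra) \<phi>. central_extension R M L \<phi> \<longrightarrow>
        (\<exists>!f. f \<in> leibniz_hom R U M \<and> f \<in> extensional (carrier U) \<and>
              (\<forall>x\<in>carrier U. u x = \<phi> (f x))))"

text \<open>$[L,L]$ is the submodule spanned by all brackets.\<close>

definition derived_algebra ::
  "('r, 's) ring_scheme \<Rightarrow> ('r, 'a) leibniz_superalgebra \<Rightarrow> ('r, 'a) leibniz_superalgebra" where
  "derived_algebra R L =
     (let C = \<Inter>{N. submodule N R L \<and> (\<forall>x\<in>carrier L. \<forall>y\<in>carrier L. bracket L x y \<in> N)}
      in L\<lparr>carrier := C, grade := (\<lambda>p. grade L p \<inter> C)\<rparr>)"

section \<open>Matrix Leibniz superalgebras\<close>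

definition idx_deg :: "nat \<Rightarrow> nat \<Rightarrow> bit" where
  "idx_deg m i = (if i \<le> m then 0 else 1)"

text \<open>
  A matrix is a function of two indices in \<open>{1..m + n}\<close>, extended by zero outside that range.
\<close>

definition gl_supermodule ::
  "nat \<Rightarrow> nat \<Rightarrow> ('r, 'd, 'z) supermodule_scheme \<Rightarrow> ('r, nat \<Rightarrow> nat \<Rightarrow> 'd) supermodule" where
  "gl_supermodule m n D =
     (let C = {x. \<forall>i j. if i \<in> {1..m + n} \<and> j \<in> {1..m + n}
                        then x i j \<in> carrier D else x i j = \<zero>\<^bsub>D\<^esub>}
      in \<lparr>carrier = C, mult = undefined, one = undefined,
          zero = (\<lambda>i j. \<zero>\<^bsub>D\<^esub>),
          add = (\<lambda>x y i j. x i j \<oplus>\<^bsub>D\<^esub> y i j),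
          smult = (\<lambda>r x i j. r \<odot>\<^bsub>D\<^esub> x i j),
          grade = (\<lambda>p. {x \<in> C. \<forall>i\<in>{1..m + n}. \<forall>j\<in>{1..m + n}.
                          x i j \<in> grade D (p + idx_deg m i + idx_deg m j)})\<rparr>)"

definition mat_ldia ::
  "nat \<Rightarrow> ('r, 'd, 'z) superdialgebra_scheme \<Rightarrow>
   (nat \<Rightarrow> nat \<Rightarrow> 'd) \<Rightarrow> (nat \<Rightarrow> nat \<Rightarrow> 'd) \<Rightarrow> nat \<Rightarrow> nat \<Rightarrow> 'd" where
  "mat_ldia N D x y i j = (\<Oplus>\<^bsub>D\<^esub>k\<in>{1..N}. x i k \<stileturn>\<^bsub>D\<^esub> y k j)"

definition mat_rdia ::
  "nat \<Rightarrow> ('r, 'd, 'z) superdialgebra_scheme \<Rightarrow>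
   (nat \<Rightarrow> nat \<Rightarrow> 'd) \<Rightarrow> (nat \<Rightarrow> nat \<Rightarrow> 'd) \<Rightarrow> nat \<Rightarrow> nat \<Rightarrow> 'd" where
  "mat_rdia N D x y i j = (\<Oplus>\<^bsub>D\<^esub>k\<in>{1..N}. x i k \<turnstile>\<^bsub>D\<^esub> y k j)"

text \<open>
  $[x,y] = x \dashv y - (-1)^{|x||y|}\, y \vdash x$ on homogeneous matrices, extended bilinearly by
  summing over the homogeneous components of both arguments.
\<close>

definition gl_bracket ::
  "nat \<Rightarrow> nat \<Rightarrow> ('r, 'd, 'z) superdialgebra_scheme \<Rightarrow>
   (nat \<Rightarrow> nat \<Rightarrow> 'd) \<Rightarrow> (nat \<Rightarrow> nat \<Rightarrow> 'd) \<Rightarrow> nat \<Rightarrow> nat \<Rightarrow> 'd" where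
  "gl_bracket m n D x y i j =
     (\<Oplus>\<^bsub>D\<^esub>p\<in>UNIV. \<Oplus>\<^bsub>D\<^esub>q\<in>UNIV.
        (let x' = homog_comp (gl_supermodule m n D) p x;
             y' = homog_comp (gl_supermodule m n D) q y
         in mat_ldia (m + n) D x' y' i j \<ominus>\<^bsub>D\<^esub> koszul D p q (mat_rdia (m + n) D y' x' i j)))"

definition gl ::
  "nat \<Rightarrow> nat \<Rightarrow> ('r, 'd, 'z) superdialgebra_scheme \<Rightarrow>
   ('r, nat \<Rightarrow> nat \<Rightarrow> 'd) leibniz_superalgebra" where
  "gl m n D = with_bracket (gl_supermodule m n D) (gl_bracket m n D)"

definition sl ::
  "('r, 's) ring_scheme \<Rightarrow> nat \<Rightarrow> nat \<Rightarrow> ('r, 'd, 'z) superdialgebra_scheme \<Rightarrow>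
   ('r, nat \<Rightarrow> nat \<Rightarrow> 'd) leibniz_superalgebra" where
  "sl R m n D = derived_algebra R (gl m n D)"

definition mat_unit ::
  "('r, 'd, 'z) superdialgebra_scheme \<Rightarrow> nat \<Rightarrow> nat \<Rightarrow> 'd \<Rightarrow> nat \<Rightarrow> nat \<Rightarrow> 'd" where
  "mat_unit D i j a = (\<lambda>k l. if k = i \<and> l = j then a else \<zero>\<^bsub>D\<^esub>)"

section \<open>The Steinberg Leibniz superalgebra\<close>

text \<open>
  The presentation is realised as well-formed expressions in the generators \<open>Gen i j a\<close>,
  standing for $F_{ij}(a)$, modulo the least congruence that contains the axioms of a Leibniz
  superalgebra over $R$ and the defining relations.
\<close>

datatype ('r, 'd) stl_term =
    Gen nat nat 'd
  | Zer
  | Plus "('r, 'd) stl_term" "('r, 'd) stl_term"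
  | Minus "('r, 'd) stl_term"
  | Scal 'r "('r, 'd) stl_term"
  | Brk "('r, 'd) stl_term" "('r, 'd) stl_term"

definition offdiag :: "nat \<Rightarrow> nat \<Rightarrow> nat \<Rightarrow> nat \<Rightarrow> bool" where
  "offdiag m n i j \<longleftrightarrow> i \<in> {1..m + n} \<and> j \<in> {1..m + n} \<and> i \<noteq> j"

inductive stl_wf ::
  "('r, 's) ring_scheme \<Rightarrow> nat \<Rightarrow> nat \<Rightarrow> ('r, 'd) superdialgebra \<Rightarrow> ('r, 'd) stl_term \<Rightarrow> bool"
  for R m n D where
    "\<lbrakk>offdiag m n i j; a \<in> grade D 0 \<union> grade D 1\<rbrakk> \<Longrightarrow> stl_wf R m n D (Gen i j a)"
  | "stl_wf R m n D Zer"
  | "\<lbrakk>stl_wf R m n D s; stl_wf R m n D t\<rbrakk> \<Longrightarrow> stl_wf R m n D (Plus s t)"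
  | "stl_wf R m n D t \<Longrightarrow> stl_wf R m n D (Minus t)"
  | "\<lbrakk>r \<in> carrier R; stl_wf R m n D t\<rbrakk> \<Longrightarrow> stl_wf R m n D (Scal r t)"
  | "\<lbrakk>stl_wf R m n D s; stl_wf R m n D t\<rbrakk> \<Longrightarrow> stl_wf R m n D (Brk s t)"

inductive stl_deg ::
  "('r, 's) ring_scheme \<Rightarrow> nat \<Rightarrow> nat \<Rightarrow> ('r, 'd) superdialgebra \<Rightarrow> bit \<Rightarrow>
   ('r, 'd) stl_term \<Rightarrow> bool"
  for R m n D where
    "\<lbrakk>offdiag m n i j; a \<in> grade D p\<rbrakk> \<Longrightarrow>
       stl_deg R m n D (idx_deg m i + idx_deg m j + p) (Gen i j a)"
  | "stl_deg R m n D p Zer"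
  | "\<lbrakk>stl_deg R m n D p s; stl_deg R m n D p t\<rbrakk> \<Longrightarrow> stl_deg R m n D p (Plus s t)"
  | "stl_deg R m n D p t \<Longrightarrow> stl_deg R m n D p (Minus t)"
  | "\<lbrakk>r \<in> carrier R; stl_deg R m n D p t\<rbrakk> \<Longrightarrow> stl_deg R m n D p (Scal r t)"
  | "\<lbrakk>stl_deg R m n D p s; stl_deg R m n D q t\<rbrakk> \<Longrightarrow> stl_deg R m n D (p + q) (Brk s t)"

definition stl_koszul :: "bit \<Rightarrow> bit \<Rightarrow> ('r, 'd) stl_term \<Rightarrow> ('r, 'd) stl_term" where
  "stl_koszul p q t = (if p * q = 1 then Minus t else t)"

inductive stl_eq ::
  "('r, 's) ring_scheme \<Rightarrow> nat \<Rightarrow> nat \<Rightarrow> ('r, 'd) superdialgebra \<Rightarrow>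
   ('r, 'd) stl_term \<Rightarrow> ('r, 'd) stl_term \<Rightarrow> bool"
  for R m n D where
    refl: "stl_wf R m n D t \<Longrightarrow> stl_eq R m n D t t"
  | sym: "stl_eq R m n D s t \<Longrightarrow> stl_eq R m n D t s"
  | trans: "\<lbrakk>stl_eq R m n D s t; stl_eq R m n D t u\<rbrakk> \<Longrightarrow> stl_eq R m n D s u"
  | cong_Plus: "\<lbrakk>stl_eq R m n D s s'; stl_eq R m n D t t'\<rbrakk> \<Longrightarrow>
      stl_eq R m n D (Plus s t) (Plus s' t')"
  | cong_Minus: "stl_eq R m n D t t' \<Longrightarrow> stl_eq R m n D (Minus t) (Minus t')"
  | cong_Scal: "\<lbrakk>r \<in> carrier R; stl_eq R m n D t t'\<rbrakk> \<Longrightarrow>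
      stl_eq R m n D (Scal r t) (Scal r t')"
  | cong_Brk: "\<lbrakk>stl_eq R m n D s s'; stl_eq R m n D t t'\<rbrakk> \<Longrightarrow>
      stl_eq R m n D (Brk s t) (Brk s' t')"
  \<comment> \<open>abelian group\<close>
  | add_assoc: "\<lbrakk>stl_wf R m n D s; stl_wf R m n D t; stl_wf R m n D u\<rbrakk> \<Longrightarrow>
      stl_eq R m n D (Plus (Plus s t) u) (Plus s (Plus t u))"
  | add_comm: "\<lbrakk>stl_wf R m n D s; stl_wf R m n D t\<rbrakk> \<Longrightarrow>
      stl_eq R m n D (Plus s t) (Plus t s)"
  | add_zero: "stl_wf R m n D t \<Longrightarrow> stl_eq R m n D (Plus Zer t) t"
  | add_minus: "stl_wf R m n D t \<Longrightarrow> stl_eq R m n D (Plus t (Minus t)) Zer"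
  \<comment> \<open>\<open>R\<close>-module\<close>
  | scal_l: "\<lbrakk>r \<in> carrier R; r' \<in> carrier R; stl_wf R m n D t\<rbrakk> \<Longrightarrow>
      stl_eq R m n D (Scal (r \<oplus>\<^bsub>R\<^esub> r') t) (Plus (Scal r t) (Scal r' t))"
  | scal_r: "\<lbrakk>r \<in> carrier R; stl_wf R m n D s; stl_wf R m n D t\<rbrakk> \<Longrightarrow>
      stl_eq R m n D (Scal r (Plus s t)) (Plus (Scal r s) (Scal r t))"
  | scal_mult: "\<lbrakk>r \<in> carrier R; r' \<in> carrier R; stl_wf R m n D t\<rbrakk> \<Longrightarrow>
      stl_eq R m n D (Scal (r \<otimes>\<^bsub>R\<^esub> r') t) (Scal r (Scal r' t))"
  | scal_one: "stl_wf R m n D t \<Longrightarrow> stl_eq R m n D (Scal \<one>\<^bsub>R\<^esub> t) t"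
  \<comment> \<open>bilinearity of the bracket\<close>
  | brk_add_l: "\<lbrakk>stl_wf R m n D s; stl_wf R m n D t; stl_wf R m n D u\<rbrakk> \<Longrightarrow>
      stl_eq R m n D (Brk (Plus s t) u) (Plus (Brk s u) (Brk t u))"
  | brk_add_r: "\<lbrakk>stl_wf R m n D s; stl_wf R m n D t; stl_wf R m n D u\<rbrakk> \<Longrightarrow>
      stl_eq R m n D (Brk s (Plus t u)) (Plus (Brk s t) (Brk s u))"
  | brk_scal_l: "\<lbrakk>r \<in> carrier R; stl_wf R m n D s; stl_wf R m n D t\<rbrakk> \<Longrightarrow>
      stl_eq R m n D (Brk (Scal r s) t) (Scal r (Brk s t))"
  | brk_scal_r: "\<lbrakk>r \<in> carrier R; stl_wf R m n D s; stl_wf R m n D t\<rbrakk> \<Longrightarrow>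
      stl_eq R m n D (Brk s (Scal r t)) (Scal r (Brk s t))"
  \<comment> \<open>Leibniz superidentity\<close>
  | leibniz: "\<lbrakk>stl_deg R m n D p s; stl_deg R m n D q t; stl_deg R m n D r u\<rbrakk> \<Longrightarrow>
      stl_eq R m n D (Brk s (Brk t u))
        (Plus (Brk (Brk s t) u) (Minus (stl_koszul q r (Brk (Brk s u) t))))"
  \<comment> \<open>linearity of the generators\<close>
  | gen_add: "\<lbrakk>offdiag m n i j; a \<in> grade D p; b \<in> grade D p\<rbrakk> \<Longrightarrow>
      stl_eq R m n D (Gen i j (a \<oplus>\<^bsub>D\<^esub> b)) (Plus (Gen i j a) (Gen i j b))"
  | gen_scal: "\<lbrakk>offdiag m n i j; r \<in> carrier R; a \<in> grade D p\<rbrakk> \<Longrightarrow>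
      stl_eq R m n D (Gen i j (r \<odot>\<^bsub>D\<^esub> a)) (Scal r (Gen i j a))"
  \<comment> \<open>Steinberg relations\<close>
  | rel_left: "\<lbrakk>offdiag m n i j; offdiag m n j l; i \<noteq> l; a \<in> grade D p; b \<in> grade D q\<rbrakk> \<Longrightarrow>
      stl_eq R m n D (Brk (Gen i j a) (Gen j l b)) (Gen i l (a \<stileturn>\<^bsub>D\<^esub> b))"
  | rel_right: "\<lbrakk>offdiag m n i j; offdiag m n k i; j \<noteq> k; a \<in> grade D p; b \<in> grade D q\<rbrakk> \<Longrightarrow>
      stl_eq R m n D (Brk (Gen i j a) (Gen k i b))
        (Minus (stl_koszul (idx_deg m i + idx_deg m j + p) (idx_deg m k + idx_deg m i + q)
           (Gen k j (b \<turnstile>\<^bsub>D\<^esub> a))))"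
  | rel_zero: "\<lbrakk>offdiag m n i j; offdiag m n k l; i \<noteq> l; j \<noteq> k;
      a \<in> grade D p; b \<in> grade D q\<rbrakk> \<Longrightarrow>
      stl_eq R m n D (Brk (Gen i j a) (Gen k l b)) Zer"

definition stl_class ::
  "('r, 's) ring_scheme \<Rightarrow> nat \<Rightarrow> nat \<Rightarrow> ('r, 'd) superdialgebra \<Rightarrow>
   ('r, 'd) stl_term \<Rightarrow> ('r, 'd) stl_term set" where
  "stl_class R m n D t = {s. stl_eq R m n D t s}"

definition stl ::
  "('r, 's) ring_scheme \<Rightarrow> nat \<Rightarrow> nat \<Rightarrow> ('r, 'd) superdialgebra \<Rightarrow>
   ('r, ('r, 'd) stl_term set) leibniz_superalgebra" where
  "stl R m n D =
     \<lparr>carrier = stl_class R m n D ` {t. stl_wf R m n D t}, mult = undefined, one = undefined,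
      zero = stl_class R m n D Zer,
      add = (\<lambda>A B. \<Union>s\<in>A. \<Union>t\<in>B. stl_class R m n D (Plus s t)),
      smult = (\<lambda>r A. \<Union>t\<in>A. stl_class R m n D (Scal r t)),
      grade = (\<lambda>p. stl_class R m n D ` {t. stl_deg R m n D p t}),
      bracket = (\<lambda>A B. \<Union>s\<in>A. \<Union>t\<in>B. stl_class R m n D (Brk s t))\<rparr>"

primrec stl_eval ::
  "nat \<Rightarrow> nat \<Rightarrow> ('r, 'd) superdialgebra \<Rightarrow> ('r, 'd) stl_term \<Rightarrow> nat \<Rightarrow> nat \<Rightarrow> 'd" where
  "stl_eval m n D (Gen i j a) = mat_unit D i j a"
| "stl_eval m n D Zer = zero (gl m n D)"
| "stl_eval m n D (Plus s t) = stl_eval m n D s \<oplus>\<^bsub>gl m n D\<^esub> stl_eval m n D t"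
| "stl_eval m n D (Minus t) = (\<lambda>k l. \<ominus>\<^bsub>D\<^esub> stl_eval m n D t k l)"
| "stl_eval m n D (Scal r t) = r \<odot>\<^bsub>gl m n D\<^esub> stl_eval m n D t"
| "stl_eval m n D (Brk s t) = bracket (gl m n D) (stl_eval m n D s) (stl_eval m n D t)"

text \<open>The canonical homomorphism $F_{ij}(a) \mapsto E_{ij}(a)$.\<close>

definition stl_to_sl ::
  "nat \<Rightarrow> nat \<Rightarrow> ('r, 'd) superdialgebra \<Rightarrow> ('r, 'd) stl_term set \<Rightarrow> nat \<Rightarrow> nat \<Rightarrow> 'd" where
  "stl_to_sl m n D A = stl_eval m n D (SOME t. t \<in> A)"

section \<open>The bracket on $\mathfrak{stl}(4,0,D) \oplus D_2^6$\<close>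

text \<open>
  The six copies of $D_2$ correspond to the two-element subsets of \<open>{1..4}\<close>:
  \<open>pair_index\<close> numbers $\{1,2\},\{1,3\},\{1,4\},\{2,3\},\{2,4\},\{3,4\}$ as $1,\dots,6$.
\<close>

definition pair_index :: "nat \<Rightarrow> nat \<Rightarrow> nat" where
  "pair_index i k = (if min i k = 1 then max i k - 1 else i + k - 1)"

text \<open>
  The bilinear map with values in $D_2^6$ that, for $i,j,k,l$ distinct, sends
  $(E_{ij}(a), E_{kl}(b))$ to the class of $a \dashv b$ in the copy with index $\{i,k\}$ and
  vanishes on all other pairs of matrix units. No signs occur since $2 D_2 = 0$.
\<close>

definition stl4_cocycle ::
  "('r, 's) ring_scheme \<Rightarrow> ('r, 'd) superdialgebra \<Rightarrow>
   (nat \<Rightarrow> nat \<Rightarrow> 'd) \<Rightarrow> (nat \<Rightarrow> nat \<Rightarrow> 'd) \<Rightarrow> nat \<Rightarrow> 'd set" where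
  "stl4_cocycle R D x y =
     (\<lambda>s\<in>{1..6}. commutator_ideal R D 2 +>\<^bsub>D\<^esub>
        finsum D (\<lambda>(i, j, k, l). x i j \<stileturn>\<^bsub>D\<^esub> y k l)
          {(i, j, k, l). {i, j, k, l} = {1..4} \<and> pair_index i k = s})"

definition stl4_bracket ::
  "('r, 's) ring_scheme \<Rightarrow> ('r, 'd) superdialgebra \<Rightarrow>
   ('r, 'd) stl_term set \<times> (nat \<Rightarrow> 'd set) \<Rightarrow> ('r, 'd) stl_term set \<times> (nat \<Rightarrow> 'd set) \<Rightarrow>
   ('r, 'd) stl_term set \<times> (nat \<Rightarrow> 'd set)" where
  "stl4_bracket R D = (\<lambda>(x, u) (y, v).
     (bracket (stl R 4 0 D) x y, stl4_cocycle R D (stl_to_sl 4 0 D x) (stl_to_sl 4 0 D y)))"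

end

theory Submission
  imports Defs
begin

text \<open>
  Write \<open>S\<close> for the Steinberg algebra, \<open>G\<close> for the algebra of all matrices, \<open>L\<close> for the special
  linear algebra, \<open>E i j a\<close> for matrix units, \<open>\<phi>\<close> for the canonical map from \<open>S\<close> to \<open>L\<close>, and \<open>\<psi>\<close>
  for the bilinear map on matrices that is added to the bracket of \<open>S\<close>. Two things have to be
  seen: that the extended bracket defines a central extension of \<open>L\<close>, and that every central
  extension of \<open>L\<close> receives exactly one homomorphism from it.

  The kernel of \<open>\<phi>\<close> is central (\<open>kernel_central\<close>), because \<open>S\<close> has a root space decomposition.
  The generators with indices \<open>i \<noteq> j\<close> form a submodule \<open>W i j\<close>, on which \<open>\<phi>\<close> is injective, and the
  brackets of opposite generators normalise all these submodules. Hence every element of \<open>S\<close> is a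
  sum of generators and of an element that normalises all root spaces (\<open>root_decomposition\<close>). An
  element of the kernel has no components in the root spaces; its bracket with a generator
  therefore stays in a root space, is killed by \<open>\<phi>\<close>, and vanishes.

  Modulo the commutator ideal \<open>I2\<close> signs disappear and \<open>a \<stileturn> b\<close> agrees with \<open>b \<turnstile> a\<close>. The component
  of \<open>\<psi>\<close> that belongs to the rows \<open>i, k\<close> has the form of a polarised minor with these rows and
  with the other two indices as columns. The cocycle identity (\<open>\<psi>_cocycle\<close>) expands into
  products of three matrix entries. They cancel in pairs up to products that contain the trace of
  one of the three matrices, and the trace of an element of \<open>L\<close> lies in \<open>I2\<close>.

  For the universal property let \<open>\<chi>\<close> be a central extension of \<open>L\<close> by an algebra \<open>M\<close>. A bracket in
  \<open>M\<close> depends only on the images of its arguments in \<open>L\<close>; thus it is a map \<open>B\<close> on \<open>L\<close> with values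
  in \<open>M\<close> that satisfies the Leibniz identity. The bracket of the lifts of \<open>E i k a\<close> and \<open>E k j e\<close>
  does not depend on \<open>k\<close> and gives a canonical lift \<open>Ft i j a\<close> of the generators. These lifts
  satisfy the Steinberg relations whenever an index is left that avoids those already in use. With
  four indices this fails in one case only, namely for \<open>B (E i j a) (E k l b)\<close> with \<open>i, j, k, l\<close>
  distinct, which should be zero but need not be. The Leibniz identity shows that this element
  is \<open>\<Lambda> i j k l (a \<stileturn> b)\<close> for an additive map \<open>\<Lambda> i j k l\<close> that depends only on the set \<open>{i, k}\<close>,
  is killed by two, and vanishes on \<open>I2\<close> (\<open>BE_double\<close>, \<open>\<Lambda>_swap\<close>, \<open>\<Lambda>_vanishes\<close>). This is the origin
  of the six copies of the quotient of \<open>D\<close> by \<open>I2\<close>: the maps \<open>\<Lambda>\<close> combine to one map \<open>\<nu>\<close> from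
  their sum to \<open>M\<close>, and \<open>\<nu> \<circ> \<psi>\<close> is the failure of the Steinberg relation. After subtraction of
  \<open>\<nu> \<circ> \<psi>\<close> from the bracket of \<open>M\<close> all Steinberg relations hold, and the presentation of \<open>S\<close> yields
  a homomorphism \<open>g\<close>. The map \<open>(x, u) \<mapsto> g x + \<nu> u\<close> is then a homomorphism for the original
  brackets. It is unique, because two lifts of the same map agree on brackets and the extension is
  spanned by brackets (\<open>U_perfect\<close>).
\<close>

section \<open>Additive and linear maps\<close>

lemma (in abelian_group) a_inv_zero: "\<ominus> \<zero> = \<zero>"
  by (rule minus_equality) simp_all

text \<open>
  This makes the method \<open>algebra\<close> normalise expressions in abelian groups, hence in modules.
\<close>

lemmas (in abelian_group) abelian_group_simprules
  [algebra abelian_group "zero G" "add G" "a_inv G" "a_minus G"] =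
  a_closed zero_closed a_inv_closed minus_closed a_assoc l_zero l_neg a_comm minus_eq
  r_zero r_neg r_neg2 r_neg1 minus_add minus_minus a_inv_zero a_lcomm

text \<open>
  Degrees are added and multiplied as elements of the field with two elements, so their
  sums must not be rewritten into Boolean operations.
\<close>

declare add_bit_eq_xor [simp del] mult_bit_eq_and [simp del]

lemma bit_add_self [simp]: "(p::bit) + p = 0"
  by (cases p) simp_all

lemma bit_add_cancel [simp]: "(p::bit) + (p + q) = q"
  by (simp flip: add.assoc)

lemma UNIV_bit: "(UNIV :: bit set) = {p, p + 1}"
  by (cases p) (auto intro: bit.exhaust)

definition additive_map :: "('a, 'y) ring_scheme \<Rightarrow> ('b, 'z) ring_scheme \<Rightarrow> ('a \<Rightarrow> 'b) \<Rightarrow> bool" where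
  "additive_map G H f \<longleftrightarrow> f \<in> carrier G \<rightarrow> carrier H \<and>
     (\<forall>x\<in>carrier G. \<forall>y\<in>carrier G. f (x \<oplus>\<^bsub>G\<^esub> y) = f x \<oplus>\<^bsub>H\<^esub> f y)"

definition linear_map ::
  "('r, 's) ring_scheme \<Rightarrow> ('r, 'a, 'y) module_scheme \<Rightarrow> ('r, 'b, 'z) module_scheme \<Rightarrow>
   ('a \<Rightarrow> 'b) \<Rightarrow> bool" where
  "linear_map R M N f \<longleftrightarrow> additive_map M N f \<and>
     (\<forall>r\<in>carrier R. \<forall>x\<in>carrier M. f (r \<odot>\<^bsub>M\<^esub> x) = r \<odot>\<^bsub>N\<^esub> f x)"

context
  fixes G :: "('a, 'y) ring_scheme" and H :: "('b, 'z) ring_scheme" and f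
  assumes G: "abelian_group G" and H: "abelian_group H" and f: "additive_map G H f"
begin

interpretation G: abelian_group G by (rule G)
interpretation H: abelian_group H by (rule H)

lemma additive_map_closed: "x \<in> carrier G \<Longrightarrow> f x \<in> carrier H"
  using f by (auto simp: additive_map_def)

lemma additive_map_add:
  "\<lbrakk>x \<in> carrier G; y \<in> carrier G\<rbrakk> \<Longrightarrow> f (x \<oplus>\<^bsub>G\<^esub> y) = f x \<oplus>\<^bsub>H\<^esub> f y"
  using f by (auto simp: additive_map_def)

lemma additive_map_zero: "f \<zero>\<^bsub>G\<^esub> = \<zero>\<^bsub>H\<^esub>"
  using additive_map_add[of "\<zero>\<^bsub>G\<^esub>" "\<zero>\<^bsub>G\<^esub>"] additive_map_closed[of "\<zero>\<^bsub>G\<^esub>"]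
  by (metis G.l_zero G.zero_closed H.add.r_cancel_one)

lemma additive_map_minus: "x \<in> carrier G \<Longrightarrow> f (\<ominus>\<^bsub>G\<^esub> x) = \<ominus>\<^bsub>H\<^esub> f x"
  by (metis G.a_inv_closed G.l_neg H.minus_equality additive_map_add additive_map_closed
      additive_map_zero)

lemma additive_map_diff:
  "\<lbrakk>x \<in> carrier G; y \<in> carrier G\<rbrakk> \<Longrightarrow> f (x \<ominus>\<^bsub>G\<^esub> y) = f x \<ominus>\<^bsub>H\<^esub> f y"
  by (simp add: a_minus_def additive_map_add additive_map_minus)

lemma additive_map_finsum:
  "g \<in> S \<rightarrow> carrier G \<Longrightarrow> f (finsum G g S) = finsum H (\<lambda>s. f (g s)) S"
proof (induction S rule: infinite_finite_induct)
  case (insert s S)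
  then have "g s \<in> carrier G" "g \<in> S \<rightarrow> carrier G" by auto
  moreover from this have "(\<lambda>s. f (g s)) \<in> S \<rightarrow> carrier H" by (auto intro: additive_map_closed)
  ultimately show ?case
    using insert by (simp add: additive_map_add additive_map_closed)
qed (simp_all add: additive_map_zero)

lemma additive_map_koszul:
  "x \<in> carrier G \<Longrightarrow> f (koszul G p q x) = koszul H p q (f x)"
  by (simp add: koszul_def additive_map_minus)

end

context abelian_group
begin

lemma koszul_closed [simp, intro]: "x \<in> carrier G \<Longrightarrow> koszul G p q x \<in> carrier G"
  by (simp add: koszul_def)

lemma koszul_0 [simp]: "koszul G 0 q x = x" "koszul G p 0 x = x"
  by (simp_all add: koszul_def)

lemma koszul_add:
  "\<lbrakk>x \<in> carrier G; y \<in> carrier G\<rbrakk> \<Longrightarrow> koszul G p q (x \<oplus> y) = koszul G p q x \<oplus> koszul G p q y"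
  by (simp add: koszul_def minus_add)

lemma koszul_minus: "x \<in> carrier G \<Longrightarrow> koszul G p q (\<ominus> x) = \<ominus> koszul G p q x"
  by (simp add: koszul_def)

lemma koszul_zero [simp]: "koszul G p q \<zero> = \<zero>"
  by (simp add: koszul_def a_inv_zero)

lemma koszul_koszul [simp]: "x \<in> carrier G \<Longrightarrow> koszul G p q (koszul G p q x) = x"
  by (simp add: koszul_def)

lemma diff_self: "x \<in> carrier G \<Longrightarrow> x \<ominus> x = \<zero>"
  by (simp add: a_minus_def r_neg)

lemma diff_zero: "x \<in> carrier G \<Longrightarrow> x \<ominus> \<zero> = x"
  by (simp add: a_minus_def a_inv_zero)

lemma zero_diff: "x \<in> carrier G \<Longrightarrow> \<zero> \<ominus> x = \<ominus> x"
  by (simp add: a_minus_def)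

lemma diff_eq_zero_iff:
  "\<lbrakk>x \<in> carrier G; y \<in> carrier G\<rbrakk> \<Longrightarrow> x \<ominus> y = \<zero> \<longleftrightarrow> x = y"
  by (metis a_minus_def a_inv_closed minus_equality minus_minus r_neg)

lemma finsum_swap:
  assumes "finite A" "finite B" "\<And>a b. a \<in> A \<Longrightarrow> b \<in> B \<Longrightarrow> f a b \<in> carrier G"
  shows "(\<Oplus>a\<in>A. \<Oplus>b\<in>B. f a b) = (\<Oplus>b\<in>B. \<Oplus>a\<in>A. f a b)"
  using assms(1,3)
proof (induction A rule: finite_induct)
  case empty
  show ?case by (simp add: add.finprod_one_eqI)
next
  case (insert a A)
  then have [simp]: "(\<lambda>b. f a b) \<in> B \<rightarrow> carrier G"
    "(\<lambda>b. \<Oplus>a\<in>A. f a b) \<in> B \<rightarrow> carrier G"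
    "(\<lambda>a. \<Oplus>b\<in>B. f a b) \<in> A \<rightarrow> carrier G"
    by (auto intro!: finsum_closed)
  have "(\<Oplus>b\<in>B. \<Oplus>a\<in>insert a A. f a b) = (\<Oplus>b\<in>B. f a b \<oplus> (\<Oplus>a\<in>A. f a b))"
    using insert by (intro finsum_cong') (auto simp: Pi_def)
  also have "\<dots> = (\<Oplus>b\<in>B. f a b) \<oplus> (\<Oplus>b\<in>B. \<Oplus>a\<in>A. f a b)"
    by (rule finsum_addf) simp_all
  finally show ?case
    using insert by simp
qed

lemma finsum_bit:
  "f \<in> UNIV \<rightarrow> carrier G \<Longrightarrow> finsum G f (UNIV :: bit set) = f p \<oplus> f (p + 1)"
  unfolding UNIV_bit[of p] by (subst finsum_insert) (auto simp: finsum_insert)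

end

lemma linear_map_additive: "linear_map R M N f \<Longrightarrow> additive_map M N f"
  by (simp add: linear_map_def)

section \<open>Supermodules\<close>

lemma (in module) submodule_zero: "submodule N R M \<Longrightarrow> \<zero>\<^bsub>M\<^esub> \<in> N"
  using subgroup.one_closed[OF submodule.axioms(1)] by fastforce

lemma supermoduleI:
  fixes R (structure) and M (structure)
  assumes "cring R"
    and "\<And>x y. \<lbrakk>x \<in> carrier M; y \<in> carrier M\<rbrakk> \<Longrightarrow> x \<oplus>\<^bsub>M\<^esub> y \<in> carrier M"
    and zero: "\<zero>\<^bsub>M\<^esub> \<in> carrier M"
    and "\<And>x y z. \<lbrakk>x \<in> carrier M; y \<in> carrier M; z \<in> carrier M\<rbrakk> \<Longrightarrow>
           (x \<oplus>\<^bsub>M\<^esub> y) \<oplus>\<^bsub>M\<^esub> z = x \<oplus>\<^bsub>M\<^esub> (y \<oplus>\<^bsub>M\<^esub> z)"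
    and "\<And>x y. \<lbrakk>x \<in> carrier M; y \<in> carrier M\<rbrakk> \<Longrightarrow> x \<oplus>\<^bsub>M\<^esub> y = y \<oplus>\<^bsub>M\<^esub> x"
    and "\<And>x. x \<in> carrier M \<Longrightarrow> \<zero>\<^bsub>M\<^esub> \<oplus>\<^bsub>M\<^esub> x = x"
    and "\<And>x. x \<in> carrier M \<Longrightarrow> \<exists>y\<in>carrier M. y \<oplus>\<^bsub>M\<^esub> x = \<zero>\<^bsub>M\<^esub>"
    and "\<And>a x. \<lbrakk>a \<in> carrier R; x \<in> carrier M\<rbrakk> \<Longrightarrow> a \<odot>\<^bsub>M\<^esub> x \<in> carrier M"
    and "\<And>a b x. \<lbrakk>a \<in> carrier R; b \<in> carrier R; x \<in> carrier M\<rbrakk> \<Longrightarrow>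
           (a \<oplus> b) \<odot>\<^bsub>M\<^esub> x = a \<odot>\<^bsub>M\<^esub> x \<oplus>\<^bsub>M\<^esub> b \<odot>\<^bsub>M\<^esub> x"
    and "\<And>a x y. \<lbrakk>a \<in> carrier R; x \<in> carrier M; y \<in> carrier M\<rbrakk> \<Longrightarrow>
           a \<odot>\<^bsub>M\<^esub> (x \<oplus>\<^bsub>M\<^esub> y) = a \<odot>\<^bsub>M\<^esub> x \<oplus>\<^bsub>M\<^esub> a \<odot>\<^bsub>M\<^esub> y"
    and "\<And>a b x. \<lbrakk>a \<in> carrier R; b \<in> carrier R; x \<in> carrier M\<rbrakk> \<Longrightarrow>
           (a \<otimes> b) \<odot>\<^bsub>M\<^esub> x = a \<odot>\<^bsub>M\<^esub> (b \<odot>\<^bsub>M\<^esub> x)"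
    and "\<And>x. x \<in> carrier M \<Longrightarrow> \<one> \<odot>\<^bsub>M\<^esub> x = x"
    and sub: "\<And>p. grade M p \<subseteq> carrier M"
    and gzero: "\<And>p. \<zero>\<^bsub>M\<^esub> \<in> grade M p"
    and gadd: "\<And>p x y. \<lbrakk>x \<in> grade M p; y \<in> grade M p\<rbrakk> \<Longrightarrow> x \<oplus>\<^bsub>M\<^esub> y \<in> grade M p"
    and gsmult: "\<And>p a x. \<lbrakk>a \<in> carrier R; x \<in> grade M p\<rbrakk> \<Longrightarrow> a \<odot>\<^bsub>M\<^esub> x \<in> grade M p"
    and span: "\<And>x. x \<in> carrier M \<Longrightarrow> \<exists>y\<in>grade M 0. \<exists>z\<in>grade M 1. x = y \<oplus>\<^bsub>M\<^esub> z"
    and disj: "\<And>x. \<lbrakk>x \<in> grade M 0; x \<in> grade M 1\<rbrakk> \<Longrightarrow> x = \<zero>\<^bsub>M\<^esub>"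
  shows "supermodule R M"
proof -
  interpret M: module R M
    by (rule moduleI) (use assms in \<open>auto intro!: abelian_groupI\<close>)
  show ?thesis
  proof (intro supermodule.intro supermodule_axioms.intro)
    fix p
    have "\<ominus>\<^bsub>M\<^esub> x \<in> grade M p" if "x \<in> grade M p" for x
      using M.smult_l_minus[of \<one> x] gsmult[of "\<ominus> \<one>" x p] that sub[of p] by auto
    then show "submodule (grade M p) R M"
      by (intro M.submoduleI) (use sub gzero gadd gsmult in auto)
  qed (use span disj gzero M.module_axioms in auto)
qed

context supermodule
begin

lemma grade_carrier: "x \<in> grade M p \<Longrightarrow> x \<in> carrier M"
  using submoduleE(1)[OF grade_submodule] by blast

lemma grade_zero [simp, intro]: "\<zero>\<^bsub>M\<^esub> \<in> grade M p"
proof -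
  obtain x where "x \<in> grade M p" using submoduleE(2)[OF grade_submodule] by blast
  then show ?thesis
    using submoduleE(4)[OF grade_submodule, of "\<zero>" x p] smult_l_null[of x] by (auto dest: grade_carrier)
qed

lemma grade_add [simp, intro]: "\<lbrakk>x \<in> grade M p; y \<in> grade M p\<rbrakk> \<Longrightarrow> x \<oplus>\<^bsub>M\<^esub> y \<in> grade M p"
  by (rule submoduleE(5)[OF grade_submodule])

lemma grade_minus [simp, intro]: "x \<in> grade M p \<Longrightarrow> \<ominus>\<^bsub>M\<^esub> x \<in> grade M p"
  by (rule submoduleE(3)[OF grade_submodule])

lemma grade_diff [simp, intro]: "\<lbrakk>x \<in> grade M p; y \<in> grade M p\<rbrakk> \<Longrightarrow> x \<ominus>\<^bsub>M\<^esub> y \<in> grade M p"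
  by (simp add: a_minus_def)

lemma grade_smult [simp, intro]: "\<lbrakk>r \<in> carrier R; x \<in> grade M p\<rbrakk> \<Longrightarrow> r \<odot>\<^bsub>M\<^esub> x \<in> grade M p"
  by (rule submoduleE(4)[OF grade_submodule])

lemma grade_koszul [simp, intro]: "x \<in> grade M p \<Longrightarrow> koszul M q r x \<in> grade M p"
  by (simp add: koszul_def)

lemma grade_finsum: "(\<And>s. s \<in> S \<Longrightarrow> f s \<in> grade M p) \<Longrightarrow> finsum M f S \<in> grade M p"
proof (induction S rule: infinite_finite_induct)
  case (insert s S)
  then show ?case by (subst M.finsum_insert) (auto intro: grade_carrier)
qed auto

lemma grade_both: "\<lbrakk>x \<in> grade M p; x \<in> grade M q; p \<noteq> q\<rbrakk> \<Longrightarrow> x = \<zero>\<^bsub>M\<^esub>"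
  using grade_disjoint by (cases p; cases q) auto

lemma grade_decomp: "x \<in> carrier M \<Longrightarrow> \<exists>y\<in>grade M p. \<exists>z\<in>grade M (p + 1). x = y \<oplus>\<^bsub>M\<^esub> z"
  using grade_span[of x] M.a_comm grade_carrier by (cases p) (simp, simp, metis)

lemma grade_decomp_unique:
  assumes "y \<in> grade M p" "z \<in> grade M (p + 1)" "y' \<in> grade M p" "z' \<in> grade M (p + 1)"
    and "y \<oplus>\<^bsub>M\<^esub> z = y' \<oplus>\<^bsub>M\<^esub> z'"
  shows "y = y'"
proof -
  note c = assms(1-4)[THEN grade_carrier]
  have d: "y \<ominus>\<^bsub>M\<^esub> y' = z' \<ominus>\<^bsub>M\<^esub> z"
  proof -
  have "y \<ominus>\<^bsub>M\<^esub> y' = (y \<oplus>\<^bsub>M\<^esub> z) \<ominus>\<^bsub>M\<^esub> y' \<ominus>\<^bsub>M\<^esub> z" using c by algebra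
  also have "\<dots> = z' \<ominus>\<^bsub>M\<^esub> z" unfolding assms(5) using c by algebra
  finally show ?thesis .
  qed
  then have "y \<ominus>\<^bsub>M\<^esub> y' \<in> grade M p" "y \<ominus>\<^bsub>M\<^esub> y' \<in> grade M (p + 1)"
    using assms by (blast, unfold d, blast)
  then have "y \<ominus>\<^bsub>M\<^esub> y' = \<zero>\<^bsub>M\<^esub>" by (rule grade_both) (cases p; simp)
  then show ?thesis using c by (simp add: M.diff_eq_zero_iff)
qed

lemma homog_comp_eq:
  assumes "y \<in> grade M p" "z \<in> grade M (p + 1)"
  shows "homog_comp M p (y \<oplus>\<^bsub>M\<^esub> z) = y"
  unfolding homog_comp_def
  by (rule the_equality) (use assms grade_decomp_unique in blast)+

lemma homog_comp_grade [simp, intro]: "x \<in> carrier M \<Longrightarrow> homog_comp M p x \<in> grade M p"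
  using grade_decomp[of x p] by (auto simp: homog_comp_eq)

lemma homog_comp_closed [simp, intro]: "x \<in> carrier M \<Longrightarrow> homog_comp M p x \<in> carrier M"
  by (rule grade_carrier[OF homog_comp_grade])

lemma homog_comp_sum: 
  assumes "x \<in> carrier M"
  shows "homog_comp M p x \<oplus>\<^bsub>M\<^esub> homog_comp M (p + 1) x = x"
proof -
  obtain y z where yz: "y \<in> grade M p" "z \<in> grade M (p + 1)" "x = y \<oplus>\<^bsub>M\<^esub> z"
    using grade_decomp[OF assms] by blast
  then have "x = z \<oplus>\<^bsub>M\<^esub> y" by (auto intro: M.a_comm grade_carrier)
  moreover have "p + 1 + 1 = p" by (cases p) simp_all
  ultimately have "homog_comp M (p + 1) x = z" using yz by (simp add: homog_comp_eq)
  then show ?thesis using yz by (simp add: homog_comp_eq)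
qed

lemma homog_comp_same [simp]: "x \<in> grade M p \<Longrightarrow> homog_comp M p x = x"
  using homog_comp_eq[of x p "\<zero>\<^bsub>M\<^esub>"] by (simp add: grade_carrier)

lemma homog_comp_other: "\<lbrakk>x \<in> grade M p; q \<noteq> p\<rbrakk> \<Longrightarrow> homog_comp M q x = \<zero>\<^bsub>M\<^esub>"
  using homog_comp_eq[of "\<zero>\<^bsub>M\<^esub>" q x] by (cases p; cases q) (auto simp: grade_carrier)

lemma homog_comp_linear: "linear_map R M M (homog_comp M p)"
proof -
  have "homog_comp M p (x \<oplus>\<^bsub>M\<^esub> y) = homog_comp M p x \<oplus>\<^bsub>M\<^esub> homog_comp M p y"
    if "x \<in> carrier M" "y \<in> carrier M" for x y
  proof -
    let ?h = "homog_comp M"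
    have c: "?h p x \<in> carrier M" "?h p y \<in> carrier M" "?h (p+1) x \<in> carrier M" "?h (p+1) y \<in> carrier M"
      using that by auto
    have "x \<oplus>\<^bsub>M\<^esub> y = (?h p x \<oplus>\<^bsub>M\<^esub> ?h (p+1) x) \<oplus>\<^bsub>M\<^esub> (?h p y \<oplus>\<^bsub>M\<^esub> ?h (p+1) y)"
      using that by (simp only: homog_comp_sum)
    also have "\<dots> = (?h p x \<oplus>\<^bsub>M\<^esub> ?h p y) \<oplus>\<^bsub>M\<^esub> (?h (p+1) x \<oplus>\<^bsub>M\<^esub> ?h (p+1) y)"
      using c by (simp add: M.a_ac)
    finally show ?thesis using that by (simp add: homog_comp_eq)
  qed
  moreover have "homog_comp M p (r \<odot>\<^bsub>M\<^esub> x) = r \<odot>\<^bsub>M\<^esub> homog_comp M p x"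
    if "r \<in> carrier R" "x \<in> carrier M" for r x
  proof -
    have "r \<odot>\<^bsub>M\<^esub> x = r \<odot>\<^bsub>M\<^esub> homog_comp M p x \<oplus>\<^bsub>M\<^esub> r \<odot>\<^bsub>M\<^esub> homog_comp M (p + 1) x"
      using that smult_r_distr[of r "homog_comp M p x" "homog_comp M (p + 1) x"]
      by (simp only: homog_comp_sum homog_comp_closed)
    then show ?thesis using that by (simp add: homog_comp_eq)
  qed
  ultimately show ?thesis by (auto simp: linear_map_def additive_map_def)
qed

lemma homog_comp_add: "\<lbrakk>x \<in> carrier M; y \<in> carrier M\<rbrakk> \<Longrightarrow>
    homog_comp M p (x \<oplus>\<^bsub>M\<^esub> y) = homog_comp M p x \<oplus>\<^bsub>M\<^esub> homog_comp M p y"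
  and homog_comp_smult: "\<lbrakk>r \<in> carrier R; x \<in> carrier M\<rbrakk> \<Longrightarrow>
    homog_comp M p (r \<odot>\<^bsub>M\<^esub> x) = r \<odot>\<^bsub>M\<^esub> homog_comp M p x"
  using homog_comp_linear by (auto simp: linear_map_def additive_map_def)

lemma homogeneous_induct [consumes 1, case_names homogeneous add]:
  assumes "x \<in> carrier M" "\<And>p x. x \<in> grade M p \<Longrightarrow> P x"
    "\<And>x y. \<lbrakk>x \<in> carrier M; y \<in> carrier M; P x; P y\<rbrakk> \<Longrightarrow> P (x \<oplus>\<^bsub>M\<^esub> y)"
  shows "P x"
proof -
  have "P (homog_comp M 0 x \<oplus>\<^bsub>M\<^esub> homog_comp M (0 + 1) x)"
    using assms by (intro assms(3)) (auto intro: assms(2)[OF homog_comp_grade])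
  then show ?thesis using assms(1) by (simp only: homog_comp_sum)
qed

end

context module
begin

context
  fixes f assumes f: "bilinear_op R M f"
begin

lemma bilinear_closed: "\<lbrakk>x \<in> carrier M; y \<in> carrier M\<rbrakk> \<Longrightarrow> f x y \<in> carrier M"
  using f by (simp add: bilinear_op_def)

lemma bilinear_linear_left: "y \<in> carrier M \<Longrightarrow> linear_map R M M (\<lambda>x. f x y)"
  using f by (simp add: bilinear_op_def linear_map_def additive_map_def)

lemma bilinear_linear_right: "x \<in> carrier M \<Longrightarrow> linear_map R M M (f x)"
  using f by (simp add: bilinear_op_def linear_map_def additive_map_def)

lemmas bilinear_additive_left = bilinear_linear_left[THEN linear_map_additive]
  and bilinear_additive_right = bilinear_linear_right[THEN linear_map_additive]

lemma bilinear_simps: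
  "\<lbrakk>x \<in> carrier M; y \<in> carrier M; z \<in> carrier M\<rbrakk> \<Longrightarrow> f (x \<oplus>\<^bsub>M\<^esub> y) z = f x z \<oplus>\<^bsub>M\<^esub> f y z"
  "\<lbrakk>x \<in> carrier M; y \<in> carrier M; z \<in> carrier M\<rbrakk> \<Longrightarrow> f x (y \<oplus>\<^bsub>M\<^esub> z) = f x y \<oplus>\<^bsub>M\<^esub> f x z"
  "\<lbrakk>r \<in> carrier R; x \<in> carrier M; y \<in> carrier M\<rbrakk> \<Longrightarrow> f (r \<odot>\<^bsub>M\<^esub> x) y = r \<odot>\<^bsub>M\<^esub> f x y"
  "\<lbrakk>r \<in> carrier R; x \<in> carrier M; y \<in> carrier M\<rbrakk> \<Longrightarrow> f x (r \<odot>\<^bsub>M\<^esub> y) = r \<odot>\<^bsub>M\<^esub> f x y"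
  using f by (simp_all add: bilinear_op_def)

lemma bilinear_zero:
  "x \<in> carrier M \<Longrightarrow> f \<zero>\<^bsub>M\<^esub> x = \<zero>\<^bsub>M\<^esub>" "x \<in> carrier M \<Longrightarrow> f x \<zero>\<^bsub>M\<^esub> = \<zero>\<^bsub>M\<^esub>"
  using additive_map_zero[OF M.abelian_group_axioms M.abelian_group_axioms bilinear_additive_left]
    additive_map_zero[OF M.abelian_group_axioms M.abelian_group_axioms bilinear_additive_right]
  by blast+

lemma bilinear_minus:
  "\<lbrakk>x \<in> carrier M; y \<in> carrier M\<rbrakk> \<Longrightarrow> f (\<ominus>\<^bsub>M\<^esub> x) y = \<ominus>\<^bsub>M\<^esub> f x y"
  "\<lbrakk>x \<in> carrier M; y \<in> carrier M\<rbrakk> \<Longrightarrow> f x (\<ominus>\<^bsub>M\<^esub> y) = \<ominus>\<^bsub>M\<^esub> f x y"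
  using additive_map_minus[OF M.abelian_group_axioms M.abelian_group_axioms bilinear_additive_left]
    additive_map_minus[OF M.abelian_group_axioms M.abelian_group_axioms bilinear_additive_right]
  by blast+

lemma bilinear_koszul:
  "\<lbrakk>x \<in> carrier M; y \<in> carrier M\<rbrakk> \<Longrightarrow> f (koszul M p q x) y = koszul M p q (f x y)"
  "\<lbrakk>x \<in> carrier M; y \<in> carrier M\<rbrakk> \<Longrightarrow> f x (koszul M p q y) = koszul M p q (f x y)"
  by (simp_all add: koszul_def bilinear_minus)

lemma bilinear_diff:
  "\<lbrakk>x \<in> carrier M; y \<in> carrier M; z \<in> carrier M\<rbrakk> \<Longrightarrow> f (x \<ominus>\<^bsub>M\<^esub> y) z = f x z \<ominus>\<^bsub>M\<^esub> f y z"
  "\<lbrakk>x \<in> carrier M; y \<in> carrier M; z \<in> carrier M\<rbrakk> \<Longrightarrow> f x (y \<ominus>\<^bsub>M\<^esub> z) = f x y \<ominus>\<^bsub>M\<^esub> f x z"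
  by (simp_all add: a_minus_def bilinear_simps bilinear_minus)

lemma bilinear_finsum:
  "\<lbrakk>g \<in> S \<rightarrow> carrier M; y \<in> carrier M\<rbrakk> \<Longrightarrow> f (finsum M g S) y = (\<Oplus>\<^bsub>M\<^esub>s\<in>S. f (g s) y)"
  "\<lbrakk>g \<in> S \<rightarrow> carrier M; x \<in> carrier M\<rbrakk> \<Longrightarrow> f x (finsum M g S) = (\<Oplus>\<^bsub>M\<^esub>s\<in>S. f x (g s))"
  using additive_map_finsum[OF M.abelian_group_axioms M.abelian_group_axioms bilinear_additive_left]
    additive_map_finsum[OF M.abelian_group_axioms M.abelian_group_axioms bilinear_additive_right]
  by blast+

end

end

section \<open>Leibniz superalgebras from superdialgebras\<close>

lemma with_bracket_simps [simp]:
  "carrier (with_bracket M b) = carrier M" "add (with_bracket M b) = add M"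
  "zero (with_bracket M b) = zero M" "smult (with_bracket M b) = smult M"
  "grade (with_bracket M b) = grade M" "bracket (with_bracket M b) = b"
  by (simp_all add: with_bracket_def)

lemma a_inv_cong:
  "\<lbrakk>carrier G = carrier H; add G = add H; zero G = zero H\<rbrakk> \<Longrightarrow> a_inv G = a_inv H"
  by (simp add: fun_eq_iff a_inv_def m_inv_def)

lemma a_inv_with_bracket [simp]: "a_inv (with_bracket M b) = a_inv M"
  by (rule a_inv_cong) simp_all

lemma a_minus_with_bracket [simp]: "a_minus (with_bracket M b) = a_minus M"
  by (simp add: a_minus_def fun_eq_iff)

lemma koszul_with_bracket [simp]: "koszul (with_bracket M b) = koszul M"
  by (simp add: koszul_def fun_eq_iff)

lemma bilinear_op_with_bracket [simp]: "bilinear_op R (with_bracket M b) f = bilinear_op R M f"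
  by (simp add: bilinear_op_def)

lemma graded_op_with_bracket [simp]: "graded_op (with_bracket M b) f = graded_op M f"
  by (simp add: graded_op_def)

lemma (in supermodule) supermodule_cong:
  assumes "carrier N = carrier M" "add N = add M" "zero N = zero M" "smult N = smult M"
    "grade N = grade M"
  shows "supermodule R N"
  by (rule supermoduleI)
    (use assms grade_span in \<open>auto simp: R.cring_axioms a_ac smult_l_distr smult_r_distr smult_assoc1
      intro: grade_carrier grade_both[of _ 0 1] intro!: bexI[of _ "\<ominus>\<^bsub>M\<^esub> _"] M.l_neg\<close>)

lemma (in supermodule) supermodule_with_bracket: "supermodule R (with_bracket M b)"
  by (rule supermodule_cong) simp_all

lemma (in supermodule) leibniz_superalgebra_with_bracketI:
  assumes "bilinear_op R M b" "graded_op M b"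
    "\<And>x y z p q r. \<lbrakk>x \<in> grade M p; y \<in> grade M q; z \<in> grade M r\<rbrakk> \<Longrightarrow>
       b x (b y z) = b (b x y) z \<ominus>\<^bsub>M\<^esub> koszul M q r (b (b x z) y)"
  shows "leibniz_superalgebra R (with_bracket M b)"
  using assms by (intro leibniz_superalgebra.intro leibniz_superalgebra_axioms.intro
      supermodule_with_bracket) simp_all

text \<open>
  The bracket $a \dashv b - (-1)^{|a||b|}\, b \vdash a$, extended bilinearly from homogeneous
  elements. It turns every superdialgebra into a Leibniz superalgebra; applied to matrices it
  gives the bracket of $\mathfrak{gl}(m,n,D)$.
\<close>

definition super_commutator ::
  "('r, 'd, 'z) superdialgebra_scheme \<Rightarrow> 'd \<Rightarrow> 'd \<Rightarrow> 'd" where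
  "super_commutator D x y = (\<Oplus>\<^bsub>D\<^esub>p\<in>UNIV. \<Oplus>\<^bsub>D\<^esub>q\<in>UNIV.
     homog_comp D p x \<stileturn>\<^bsub>D\<^esub> homog_comp D q y \<ominus>\<^bsub>D\<^esub>
     koszul D p q (homog_comp D q y \<turnstile>\<^bsub>D\<^esub> homog_comp D p x))"

context module
begin

lemma bilinear_op_add:
  assumes "bilinear_op R M f" "bilinear_op R M g"
  shows "bilinear_op R M (\<lambda>x y. f x y \<oplus>\<^bsub>M\<^esub> g x y)"
  using assms unfolding bilinear_op_def by (simp add: M.a_ac smult_r_distr)

lemma bilinear_op_cong:
  "(\<And>x y. \<lbrakk>x \<in> carrier M; y \<in> carrier M\<rbrakk> \<Longrightarrow> f x y = g x y) \<Longrightarrow>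
   bilinear_op R M f = bilinear_op R M g"
  unfolding bilinear_op_def by (intro conj_cong ball_cong refl) auto

end

context superdialgebra
begin

lemma dia_closed [simp, intro]:
  "\<lbrakk>x \<in> carrier D; y \<in> carrier D\<rbrakk> \<Longrightarrow> x \<stileturn> y \<in> carrier D"
  "\<lbrakk>x \<in> carrier D; y \<in> carrier D\<rbrakk> \<Longrightarrow> x \<turnstile> y \<in> carrier D"
  by (rule bilinear_closed[OF ldia_bilinear] bilinear_closed[OF rdia_bilinear]; assumption)+

lemmas dia_simps =
  bilinear_simps[OF ldia_bilinear] bilinear_simps[OF rdia_bilinear]
  bilinear_minus[OF ldia_bilinear] bilinear_minus[OF rdia_bilinear]
  bilinear_diff[OF ldia_bilinear] bilinear_diff[OF rdia_bilinear]
  bilinear_koszul[OF ldia_bilinear] bilinear_koszul[OF rdia_bilinear]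

lemmas dia_zero [simp] = bilinear_zero[OF ldia_bilinear] bilinear_zero[OF rdia_bilinear]

lemma dia_grade [simp, intro]:
  "\<lbrakk>x \<in> grade D p; y \<in> grade D q\<rbrakk> \<Longrightarrow> x \<stileturn> y \<in> grade D (p + q)"
  "\<lbrakk>x \<in> grade D p; y \<in> grade D q\<rbrakk> \<Longrightarrow> x \<turnstile> y \<in> grade D (p + q)"
  using ldia_graded rdia_graded by (auto simp: graded_op_def)

lemma super_commutator_homogeneous:
  assumes "x \<in> grade D p" "y \<in> grade D q"
  shows "super_commutator D x y = x \<stileturn> y \<ominus> koszul D p q (y \<turnstile> x)"
proof -
  have c: "x \<in> carrier D" "y \<in> carrier D" using assms by (auto intro: grade_carrier)
  define t where "t p' q' = homog_comp D p' x \<stileturn> homog_comp D q' y \<ominus>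
     koszul D p' q' (homog_comp D q' y \<turnstile> homog_comp D p' x)" for p' q'
  have "homog_comp D (p + 1) x = \<zero>" "homog_comp D (q + 1) y = \<zero>"
    using assms by (auto intro!: homog_comp_other simp del: bit_not_zero_iff)
  then have t0: "t p (q + 1) = \<zero>" "t (p + 1) q' = \<zero>" for q'
    using c by (simp_all add: t_def diff_zero)
  have [simp]: "t p' q' \<in> carrier D" for p' q' using c by (simp add: t_def)
  have "super_commutator D x y = (t p q \<oplus> t p (q + 1)) \<oplus> (t (p + 1) q \<oplus> t (p + 1) (q + 1))"
    unfolding super_commutator_def t_def[symmetric]
    by (subst finsum_bit[of _ p], force, subst (1 2) finsum_bit[of _ q]) simp_all
  also have "\<dots> = t p q" by (simp add: t0)
  finally show ?thesis using assms by (simp add: t_def)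
qed

lemma super_commutator_bilinear: "bilinear_op R D (super_commutator D)"
proof -
  define t where "t p q x y = homog_comp D p x \<stileturn> homog_comp D q y \<ominus>
     koszul D p q (homog_comp D q y \<turnstile> homog_comp D p x)" for p q x y
  have t: "bilinear_op R D (t p q)" for p q
    unfolding bilinear_op_def t_def
    by (auto simp: homog_comp_add homog_comp_smult dia_simps koszul_def a_minus_def minus_add a_ac
        smult_r_distr smult_r_minus)
  have "bilinear_op R D (\<lambda>x y. (t 0 0 x y \<oplus> t 0 1 x y) \<oplus> (t 1 0 x y \<oplus> t 1 1 x y))"
    by (intro bilinear_op_add t)
  moreover have "super_commutator D x y = (t 0 0 x y \<oplus> t 0 1 x y) \<oplus> (t 1 0 x y \<oplus> t 1 1 x y)"
    if "x \<in> carrier D" "y \<in> carrier D" for x y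
  proof -
    have "t p q x y \<in> carrier D" for p q using t that bilinear_closed by blast
    then show ?thesis
      unfolding super_commutator_def t_def[symmetric] by (simp add: finsum_bit[of _ 0] Pi_def a_ac)
  qed
  ultimately show ?thesis by (subst bilinear_op_cong) auto
qed

lemma super_commutator_graded: "graded_op D (super_commutator D)"
  unfolding graded_op_def
proof (intro allI ballI)
  fix p q x y assume "x \<in> grade D p" "y \<in> grade D q"
  then show "super_commutator D x y \<in> grade D (p + q)"
    using dia_grade(2)[of y q x p] by (simp add: super_commutator_homogeneous add.commute)
qed

text \<open>
  On homogeneous elements the dialgebra axioms reduce the products that occur in the three terms to
  six. Once these are treated as independent unknowns only their signs have to be compared.
\<close>

lemma super_commutator_leibniz:
  assumes "x \<in> grade D p" "y \<in> grade D q" "z \<in> grade D r"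
  shows "super_commutator D x (super_commutator D y z) =
    super_commutator D (super_commutator D x y) z \<ominus>
    koszul D q r (super_commutator D (super_commutator D x z) y)"
proof -
  let ?c = "super_commutator D"
  have c: "x \<in> carrier D" "y \<in> carrier D" "z \<in> carrier D" using assms by (auto intro: grade_carrier)
  have g: "?c y z \<in> grade D (q + r)" "?c x y \<in> grade D (p + q)" "?c x z \<in> grade D (p + r)"
    using assms super_commutator_graded by (auto simp: graded_op_def)
  define a where "a = [x \<stileturn> (y \<stileturn> z), x \<stileturn> (z \<stileturn> y), y \<turnstile> (z \<turnstile> x), z \<turnstile> (y \<turnstile> x), y \<turnstile> (x \<stileturn> z), z \<turnstile> (x \<stileturn> y)]"
  have a: "a ! i \<in> carrier D" if "i < 6" for i
    using that c unfolding a_def by (auto simp: less_Suc_eq numeral_eq_Suc)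
  have *: "x \<stileturn> (y \<stileturn> z) = a ! 0" "x \<stileturn> (z \<stileturn> y) = a ! 1" "y \<turnstile> (z \<turnstile> x) = a ! 2"
    "z \<turnstile> (y \<turnstile> x) = a ! 3" "y \<turnstile> (x \<stileturn> z) = a ! 4" "z \<turnstile> (x \<stileturn> y) = a ! 5"
    by (simp_all add: a_def)
  have ac: "a ! 0 \<in> carrier D" "a ! 1 \<in> carrier D" "a ! 2 \<in> carrier D" "a ! 3 \<in> carrier D"
    "a ! 4 \<in> carrier D" "a ! 5 \<in> carrier D"
    by (rule a, simp)+
  have "?c x (?c y z) = (a ! 0 \<ominus> koszul D q r (a ! 1)) \<ominus>
     koszul D p (q + r) (a ! 2 \<ominus> koszul D q r (a ! 3))"
    unfolding super_commutator_homogeneous[OF assms(1) g(1)]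
    unfolding super_commutator_homogeneous[OF assms(2,3)]
    using c by (simp add: dia_simps dia_left rdia_assoc dia_right[symmetric] *)
  moreover have "?c (?c x y) z = (a ! 0 \<ominus> koszul D p q (a ! 4)) \<ominus>
     koszul D (p + q) r (a ! 5 \<ominus> koszul D p q (a ! 3))"
    unfolding super_commutator_homogeneous[OF g(2) assms(3)]
    unfolding super_commutator_homogeneous[OF assms(1,2)]
    using c by (simp add: dia_simps ldia_assoc dia_mid *)
  moreover have "?c (?c x z) y = (a ! 1 \<ominus> koszul D p r (a ! 5)) \<ominus>
     koszul D (p + r) q (a ! 4 \<ominus> koszul D p r (a ! 2))"
    unfolding super_commutator_homogeneous[OF g(3) assms(2)]
    unfolding super_commutator_homogeneous[OF assms(1,3)]
    using c by (simp add: dia_simps ldia_assoc dia_mid *)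
  moreover have "(a ! 0 \<ominus> koszul D q r (a ! 1)) \<ominus> koszul D p (q + r) (a ! 2 \<ominus> koszul D q r (a ! 3)) =
    ((a ! 0 \<ominus> koszul D p q (a ! 4)) \<ominus> koszul D (p + q) r (a ! 5 \<ominus> koszul D p q (a ! 3))) \<ominus>
    koszul D q r ((a ! 1 \<ominus> koszul D p r (a ! 5)) \<ominus> koszul D (p + r) q (a ! 4 \<ominus> koszul D p r (a ! 2)))"
    using ac by (cases p; cases q; cases r; simp add: koszul_def; algebra)
  ultimately show ?thesis by simp
qed

end

section \<open>Matrices over a superdialgebra\<close>

definition mat_dialgebra ::
  "nat \<Rightarrow> nat \<Rightarrow> ('r, 'd, 'z) superdialgebra_scheme \<Rightarrow> ('r, nat \<Rightarrow> nat \<Rightarrow> 'd) superdialgebra" where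
  "mat_dialgebra m n D =
     \<lparr>carrier = carrier (gl_supermodule m n D), mult = undefined, one = undefined,
      zero = zero (gl_supermodule m n D), add = add (gl_supermodule m n D),
      smult = smult (gl_supermodule m n D), grade = grade (gl_supermodule m n D),
      ldia = mat_ldia (m + n) D, rdia = mat_rdia (m + n) D\<rparr>"

lemma gl_supermodule_simps:
  "x \<in> carrier (gl_supermodule m n D) \<longleftrightarrow>
     (\<forall>i j. if i \<in> {1..m + n} \<and> j \<in> {1..m + n} then x i j \<in> carrier D else x i j = \<zero>\<^bsub>D\<^esub>)"
  "zero (gl_supermodule m n D) = (\<lambda>i j. \<zero>\<^bsub>D\<^esub>)"
  "add (gl_supermodule m n D) = (\<lambda>x y i j. x i j \<oplus>\<^bsub>D\<^esub> y i j)"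
  "smult (gl_supermodule m n D) = (\<lambda>r x i j. r \<odot>\<^bsub>D\<^esub> x i j)"
  "x \<in> grade (gl_supermodule m n D) p \<longleftrightarrow> x \<in> carrier (gl_supermodule m n D) \<and>
     (\<forall>i\<in>{1..m + n}. \<forall>j\<in>{1..m + n}. x i j \<in> grade D (p + idx_deg m i + idx_deg m j))"
  by (simp_all add: gl_supermodule_def)

context supermodule
begin

lemma gl_entry [simp]: "x \<in> carrier (gl_supermodule m n M) \<Longrightarrow> x i j \<in> carrier M"
  unfolding gl_supermodule_simps by (metis M.zero_closed)

lemma gl_entry_grade:
  "x \<in> grade (gl_supermodule m n M) p \<Longrightarrow> x i j \<in> grade M (p + idx_deg m i + idx_deg m j)"
  unfolding gl_supermodule_simps by (metis grade_zero)

lemma gl_outside: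
  "\<lbrakk>x \<in> carrier (gl_supermodule m n M); i \<notin> {1..m + n} \<or> j \<notin> {1..m + n}\<rbrakk> \<Longrightarrow> x i j = \<zero>\<^bsub>M\<^esub>"
  unfolding gl_supermodule_simps by metis

lemma gl_carrierI:
  "\<lbrakk>\<And>i j. x i j \<in> carrier M; \<And>i j. i \<notin> {1..m + n} \<or> j \<notin> {1..m + n} \<Longrightarrow> x i j = \<zero>\<^bsub>M\<^esub>\<rbrakk> \<Longrightarrow>
   x \<in> carrier (gl_supermodule m n M)"
  unfolding gl_supermodule_simps by auto

lemma gl_supermodule: "supermodule R (gl_supermodule m n M)"
proof (rule supermoduleI, goal_cases)
  \<comment> \<open>existence of additive inverses\<close>
  case (7 x)
  then show ?case
    by (intro bexI[of _ "\<lambda>i j. \<ominus>\<^bsub>M\<^esub> x i j"])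
      (auto simp: gl_supermodule_simps(2,3) M.l_neg M.a_inv_zero gl_outside intro!: gl_carrierI)
next
  \<comment> \<open>decomposition into homogeneous parts\<close>
  case (17 x)
  define c where "c p = (\<lambda>i j. homog_comp M (p + idx_deg m i + idx_deg m j) (x i j))" for p
  have "c p \<in> grade (gl_supermodule m n M) p" for p
    unfolding gl_supermodule_simps(5) using 17
    by (auto simp: c_def gl_outside intro!: gl_carrierI homog_comp_same)
  moreover have "x = c 0 \<oplus>\<^bsub>gl_supermodule m n M\<^esub> c 1"
    using homog_comp_sum[of "x _ _" "idx_deg m _ + idx_deg m _"] 17
    by (simp add: gl_supermodule_simps(3) c_def fun_eq_iff add.commute add.left_commute)
  ultimately show ?case by blast
next
  case (18 x)
  then have "x i j = \<zero>\<^bsub>M\<^esub>" for i j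
    using grade_both[OF gl_entry_grade[of x m n 0 i j] gl_entry_grade[of x m n 1 i j]] by simp
  then show ?case by (simp add: gl_supermodule_simps(2) fun_eq_iff)
next
  case (13 p)
  then show ?case by (auto simp: gl_supermodule_simps(5))
next
  case (14 p)
  then show ?case unfolding gl_supermodule_simps(5)
    by (auto simp: gl_supermodule_simps(2) intro!: gl_carrierI)
next
  case (15 p x y)
  then show ?case unfolding gl_supermodule_simps(5)
    by (auto simp: gl_supermodule_simps(3) gl_outside intro!: gl_carrierI)
next
  case (16 p a x)
  then show ?case unfolding gl_supermodule_simps(5)
    by (auto simp: gl_supermodule_simps(4) gl_outside intro!: gl_carrierI)
qed (auto simp: gl_supermodule_simps(2,3,4) R.cring_axioms M.a_ac smult_l_distr smult_r_distr smult_assoc1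
    gl_outside fun_eq_iff intro!: gl_carrierI)

end

lemma mat_dialgebra_simps [simp]:
  "carrier (mat_dialgebra m n D) = carrier (gl_supermodule m n D)"
  "zero (mat_dialgebra m n D) = zero (gl_supermodule m n D)"
  "add (mat_dialgebra m n D) = add (gl_supermodule m n D)"
  "smult (mat_dialgebra m n D) = smult (gl_supermodule m n D)"
  "grade (mat_dialgebra m n D) = grade (gl_supermodule m n D)"
  "ldia (mat_dialgebra m n D) = mat_ldia (m + n) D"
  "rdia (mat_dialgebra m n D) = mat_rdia (m + n) D"
  by (simp_all add: mat_dialgebra_def)

text \<open>
  Both products of matrices are the matrix product with respect to a bilinear operation on the
  entries; an arbitrary operation \<open>f\<close> covers them, and all their compositions, at once.
\<close>

definition mat_mult ::
  "nat \<Rightarrow> ('d, 'z) ring_scheme \<Rightarrow> ('d \<Rightarrow> 'd \<Rightarrow> 'd) \<Rightarrow>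
   (nat \<Rightarrow> nat \<Rightarrow> 'd) \<Rightarrow> (nat \<Rightarrow> nat \<Rightarrow> 'd) \<Rightarrow> nat \<Rightarrow> nat \<Rightarrow> 'd" where
  "mat_mult N D f x y i j = (\<Oplus>\<^bsub>D\<^esub>k\<in>{1..N}. f (x i k) (y k j))"

lemma mat_dia_eq_mat_mult:
  "mat_ldia N D = mat_mult N D (ldia D)" "mat_rdia N D = mat_mult N D (rdia D)"
  by (simp_all add: fun_eq_iff mat_ldia_def mat_rdia_def mat_mult_def)

context supermodule
begin

context
  fixes f assumes f: "bilinear_op R M f"
begin

lemma mat_mult_closed:
  assumes "x \<in> carrier (gl_supermodule m n M)" "y \<in> carrier (gl_supermodule m n M)"
  shows "mat_mult (m + n) M f x y \<in> carrier (gl_supermodule m n M)"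
proof (rule gl_carrierI)
  fix i j
  show "mat_mult (m + n) M f x y i j \<in> carrier M"
    unfolding mat_mult_def using assms by (auto intro!: M.finsum_closed bilinear_closed[OF f])
  assume "i \<notin> {1..m + n} \<or> j \<notin> {1..m + n}"
  then have "f (x i k) (y k j) = \<zero>\<^bsub>M\<^esub>" for k
  proof
    assume "i \<notin> {1..m + n}"
    then show ?thesis using gl_outside[OF assms(1), of i k] assms(2) bilinear_zero[OF f] by simp
  next
    assume "j \<notin> {1..m + n}"
    then show ?thesis using gl_outside[OF assms(2), of k j] assms(1) bilinear_zero[OF f] by simp
  qed
  then show "mat_mult (m + n) M f x y i j = \<zero>\<^bsub>M\<^esub>"
    by (simp add: mat_mult_def)
qed

lemma mat_mult_bilinear: "bilinear_op R (gl_supermodule m n M) (mat_mult (m + n) M f)"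
  unfolding bilinear_op_def
proof (intro conjI ballI)
  fix x y assume xy: "x \<in> carrier (gl_supermodule m n M)" "y \<in> carrier (gl_supermodule m n M)"
  then show "mat_mult (m + n) M f x y \<in> carrier (gl_supermodule m n M)" by (rule mat_mult_closed)
  fix r assume r: "r \<in> carrier R"
  have *: "(\<lambda>k. f (x i k) (y k j)) \<in> {1..m + n} \<rightarrow> carrier M" for i j
    using xy by (auto intro!: bilinear_closed[OF f])
  note fs = finsum_smult_ldistr[OF _ r *, simplified]
  show "mat_mult (m + n) M f (r \<odot>\<^bsub>gl_supermodule m n M\<^esub> x) y =
      r \<odot>\<^bsub>gl_supermodule m n M\<^esub> mat_mult (m + n) M f x y"
    "mat_mult (m + n) M f x (r \<odot>\<^bsub>gl_supermodule m n M\<^esub> y) =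
      r \<odot>\<^bsub>gl_supermodule m n M\<^esub> mat_mult (m + n) M f x y"
    unfolding fun_eq_iff mat_mult_def gl_supermodule_simps(2-4)
    using r xy by (auto intro!: M.finsum_cong' smult_closed bilinear_closed[OF f] simp: bilinear_simps[OF f] fs)
next
  fix x y z
  assume *: "x \<in> carrier (gl_supermodule m n M)" "y \<in> carrier (gl_supermodule m n M)"
    "z \<in> carrier (gl_supermodule m n M)"
  note c [simp] = bilinear_closed[OF f] and b = bilinear_simps[OF f]
  show "mat_mult (m + n) M f (x \<oplus>\<^bsub>gl_supermodule m n M\<^esub> y) z =
      mat_mult (m + n) M f x z \<oplus>\<^bsub>gl_supermodule m n M\<^esub> mat_mult (m + n) M f y z"
    "mat_mult (m + n) M f x (y \<oplus>\<^bsub>gl_supermodule m n M\<^esub> z) =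
      mat_mult (m + n) M f x y \<oplus>\<^bsub>gl_supermodule m n M\<^esub> mat_mult (m + n) M f x z"
    unfolding fun_eq_iff mat_mult_def gl_supermodule_simps(2-4)
    using * by (auto simp: b Pi_def simp flip: M.finsum_addf)
qed

lemma mat_mult_graded:
  assumes "graded_op M f"
  shows "graded_op (gl_supermodule m n M) (mat_mult (m + n) M f)"
  unfolding graded_op_def
proof (intro allI ballI)
  fix p q x y
  assume x: "x \<in> grade (gl_supermodule m n M) p" and y: "y \<in> grade (gl_supermodule m n M) q"
  have "mat_mult (m + n) M f x y i j \<in> grade M (p + q + idx_deg m i + idx_deg m j)" for i j
    unfolding mat_mult_def
  proof (rule grade_finsum)
    fix k
    have "p + idx_deg m i + idx_deg m k + (q + idx_deg m k + idx_deg m j) =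
        p + q + idx_deg m i + idx_deg m j" by (simp add: ac_simps)
    then show "f (x i k) (y k j) \<in> grade M (p + q + idx_deg m i + idx_deg m j)"
      using assms gl_entry_grade[OF x, of i k] gl_entry_grade[OF y, of k j]
      unfolding graded_op_def by metis
  qed
  then show "mat_mult (m + n) M f x y \<in> grade (gl_supermodule m n M) (p + q)"
    using mat_mult_closed x y unfolding gl_supermodule_simps(5) by blast
qed

context
  fixes g x y z m n
  assumes g: "bilinear_op R M g"
    and x: "x \<in> carrier (gl_supermodule m n M)" and y: "y \<in> carrier (gl_supermodule m n M)"
    and z: "z \<in> carrier (gl_supermodule m n M)"
begin

lemma mat_mult_mat_mult_left:
  "mat_mult N M f (mat_mult N M g x y) z i j =
   (\<Oplus>\<^bsub>M\<^esub>k\<in>{1..N}. \<Oplus>\<^bsub>M\<^esub>l\<in>{1..N}. f (g (x i k) (y k l)) (z l j))"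
proof -
  note [simp] = x[THEN gl_entry] y[THEN gl_entry] z[THEN gl_entry] bilinear_closed[OF f] bilinear_closed[OF g]
  have "mat_mult N M f (mat_mult N M g x y) z i j =
      (\<Oplus>\<^bsub>M\<^esub>l\<in>{1..N}. \<Oplus>\<^bsub>M\<^esub>k\<in>{1..N}. f (g (x i k) (y k l)) (z l j))"
    unfolding mat_mult_def by (simp add: bilinear_finsum[OF f] Pi_def)
  also have "\<dots> = (\<Oplus>\<^bsub>M\<^esub>k\<in>{1..N}. \<Oplus>\<^bsub>M\<^esub>l\<in>{1..N}. f (g (x i k) (y k l)) (z l j))"
    by (rule M.finsum_swap) simp_all
  finally show ?thesis .
qed

lemma mat_mult_mat_mult_right:
  "mat_mult N M f x (mat_mult N M g y z) i j =
   (\<Oplus>\<^bsub>M\<^esub>k\<in>{1..N}. \<Oplus>\<^bsub>M\<^esub>l\<in>{1..N}. f (x i k) (g (y k l) (z l j)))"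
proof -
  note [simp] = x[THEN gl_entry] y[THEN gl_entry] z[THEN gl_entry] bilinear_closed[OF f] bilinear_closed[OF g]
  show ?thesis
    unfolding mat_mult_def by (simp add: bilinear_finsum(2)[OF f] Pi_def)
qed

end

end

end

context superdialgebra
begin

text \<open>
  Each dialgebra axiom relates two composite products, and composite matrix products are sums of
  the composite products of entries; so the axioms pass from \<open>D\<close> to matrices.
\<close>

lemma superdialgebra_mat: "superdialgebra R (mat_dialgebra m n D)"
proof -
  interpret gl: supermodule R "gl_supermodule m n D" by (rule gl_supermodule)
  have [simp]: "bilinear_op R (mat_dialgebra m n D) h = bilinear_op R (gl_supermodule m n D) h"
    "graded_op (mat_dialgebra m n D) h = graded_op (gl_supermodule m n D) h" for h
    by (simp_all add: bilinear_op_def graded_op_def)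
  note l = mat_mult_mat_mult_left[where m = m and n = n] mat_mult_mat_mult_right[where m = m and n = n]
  note l = l[OF ldia_bilinear ldia_bilinear] l[OF ldia_bilinear rdia_bilinear]
    l[OF rdia_bilinear ldia_bilinear] l[OF rdia_bilinear rdia_bilinear]
  note rules = mat_mult_bilinear mat_mult_graded ldia_bilinear rdia_bilinear ldia_graded rdia_graded
  have s: "supermodule R (mat_dialgebra m n D)"
    by (rule gl.supermodule_cong) simp_all
  show ?thesis
    by (intro superdialgebra.intro superdialgebra_axioms.intro s)
      (simp_all add: mat_dia_eq_mat_mult rules fun_eq_iff
        l ldia_assoc rdia_assoc dia_right dia_mid dia_left)
qed

lemma gl_bracket_eq_super_commutator:
  assumes "x \<in> carrier (gl_supermodule m n D)" "y \<in> carrier (gl_supermodule m n D)"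
  shows "gl_bracket m n D x y = super_commutator (mat_dialgebra m n D) x y"
proof (intro ext)
  fix i j
  let ?M = "mat_dialgebra m n D"
  interpret gl: superdialgebra R ?M by (rule superdialgebra_mat)
  have inv: "(\<ominus>\<^bsub>?M\<^esub> x) i j = \<ominus> x i j" if "x \<in> carrier ?M" for x
  proof -
    have "(\<ominus>\<^bsub>?M\<^esub> x) = (\<lambda>i j. \<ominus> x i j)"
      by (rule gl.minus_equality) (use that in \<open>auto simp: gl_supermodule_simps(2-4) fun_eq_iff
          l_neg a_inv_zero gl_outside intro!: gl_carrierI\<close>)
    then show ?thesis by simp
  qed
  have sum: "finsum ?M h UNIV i j = (\<Oplus>s\<in>UNIV. h s i j)"
    if "\<And>s. h s \<in> carrier (gl_supermodule m n D)" for h :: "bit \<Rightarrow> _"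
    using additive_map_finsum[OF gl.abelian_group_axioms abelian_group_axioms, of "\<lambda>x. x i j" h UNIV] that
    by (simp add: additive_map_def gl_supermodule_simps(3) Pi_def)
  have kos: "koszul ?M p q x i j = koszul D p q (x i j)" if "x \<in> carrier (gl_supermodule m n D)" for p q x
    using that by (simp add: koszul_def inv)
  have diff: "(x \<ominus>\<^bsub>?M\<^esub> y) i j = x i j \<ominus> y i j" if "y \<in> carrier (gl_supermodule m n D)" for x y
    using that by (simp add: a_minus_def inv gl_supermodule_simps(3))
  have h: "homog_comp ?M = homog_comp (gl_supermodule m n D)"
    by (simp add: fun_eq_iff homog_comp_def)
  have [simp]: "homog_comp (gl_supermodule m n D) p x \<in> carrier (gl_supermodule m n D)"
    if "x \<in> carrier (gl_supermodule m n D)" for p x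
    using gl.homog_comp_closed[of x p] that by (simp add: h)
  have [simp]: "mat_ldia (m + n) D x y \<in> carrier (gl_supermodule m n D)"
    "mat_rdia (m + n) D x y \<in> carrier (gl_supermodule m n D)"
    if "x \<in> carrier (gl_supermodule m n D)" "y \<in> carrier (gl_supermodule m n D)" for x y
    using gl.dia_closed[of x y] that by simp_all
  have [simp]: "koszul ?M p q x \<in> carrier (gl_supermodule m n D)" 
    if "x \<in> carrier (gl_supermodule m n D)" for x p q
    using gl.koszul_closed[of x p q] that by simp
  have [simp]: "x \<ominus>\<^bsub>?M\<^esub> y \<in> carrier (gl_supermodule m n D)"
    if "x \<in> carrier (gl_supermodule m n D)" "y \<in> carrier (gl_supermodule m n D)" for x y
    using gl.minus_closed[of x y] that by simp
  have [simp]: "finsum ?M g (UNIV :: bit set) \<in> carrier (gl_supermodule m n D)"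
    if "\<And>s. g s \<in> carrier (gl_supermodule m n D)" for g
    using gl.finsum_closed[of g UNIV] that by (simp add: Pi_def)
  show "gl_bracket m n D x y i j = super_commutator ?M x y i j"
    using assms by (simp add: gl_bracket_def super_commutator_def Let_def sum kos diff h)
qed

lemma leibniz_superalgebra_gl: "leibniz_superalgebra R (gl m n D)"
  unfolding gl_def
proof (rule supermodule.leibniz_superalgebra_with_bracketI[OF gl_supermodule])
  let ?M = "mat_dialgebra m n D" and ?G = "gl_supermodule m n D"
  interpret gl: superdialgebra R ?M by (rule superdialgebra_mat)
  interpret G: supermodule R ?G by (rule gl_supermodule)
  note eq = gl_bracket_eq_super_commutator
  have ops: "bilinear_op R ?G h = bilinear_op R ?M h" "graded_op ?G h = graded_op ?M h" for h
    by (simp_all add: bilinear_op_def graded_op_def)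
  show "bilinear_op R ?G (gl_bracket m n D)"
    using gl.super_commutator_bilinear
    by (subst G.bilinear_op_cong[OF eq]) (simp_all add: ops)
  show "graded_op ?G (gl_bracket m n D)"
    using gl.super_commutator_graded G.grade_carrier
    unfolding graded_op_def mat_dialgebra_simps by (metis eq)
  fix x y z p q r assume *: "x \<in> grade ?G p" "y \<in> grade ?G q" "z \<in> grade ?G r"
  have c: "super_commutator ?M u v \<in> carrier ?G" if "u \<in> carrier ?G" "v \<in> carrier ?G" for u v
    using gl.bilinear_closed[OF gl.super_commutator_bilinear] that by simp
  have "a_inv ?G = a_inv ?M" by (rule a_inv_cong) simp_all
  then have "a_minus ?G x y = a_minus ?M x y" "koszul ?G p q x = koszul ?M p q x" for x y p q
    by (simp_all add: a_minus_def koszul_def)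
  then show "gl_bracket m n D x (gl_bracket m n D y z) =
      gl_bracket m n D (gl_bracket m n D x y) z \<ominus>\<^bsub>?G\<^esub>
      koszul ?G q r (gl_bracket m n D (gl_bracket m n D x z) y)"
    using gl.super_commutator_leibniz[of x p y q z r] * 
    by (simp add: eq c G.grade_carrier)
qed

end

section \<open>Leibniz superalgebras\<close>

context leibniz_superalgebra
begin

lemma bracket_closed [simp, intro]:
  "\<lbrakk>x \<in> carrier L; y \<in> carrier L\<rbrakk> \<Longrightarrow> bracket L x y \<in> carrier L"
  by (rule bilinear_closed[OF bracket_bilinear])

lemma bracket_grade [simp, intro]:
  "\<lbrakk>x \<in> grade L p; y \<in> grade L q\<rbrakk> \<Longrightarrow> bracket L x y \<in> grade L (p + q)"
  using bracket_graded by (auto simp: graded_op_def)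

lemmas bracket_add = bilinear_simps(1,2)[OF bracket_bilinear]
  and bracket_smult = bilinear_simps(3,4)[OF bracket_bilinear]
  and bracket_zero [simp] = bilinear_zero[OF bracket_bilinear]
  and bracket_minus = bilinear_minus[OF bracket_bilinear]
  and bracket_diff = bilinear_diff[OF bracket_bilinear]
  and bracket_finsum = bilinear_finsum[OF bracket_bilinear]

text \<open>
  The sign in the Leibniz identity does not involve the degree of the first argument, which
  therefore may be inhomogeneous.
\<close>

lemma leibniz_right_homogeneous:
  assumes "x \<in> carrier L" "y \<in> grade L q" "z \<in> grade L r"
  shows "bracket L x (bracket L y z) =
    bracket L (bracket L x y) z \<ominus> koszul L q r (bracket L (bracket L x z) y)"
  using assms
proof (induction x rule: homogeneous_induct)
  case (homogeneous p x)
  then show ?case using leibniz by blast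
next
  case (add u v)
  note c = add(1,2) add(5,6)[THEN grade_carrier]
  have "bracket L (u \<oplus> v) (bracket L y z) = bracket L u (bracket L y z) \<oplus> bracket L v (bracket L y z)"
    using c by (simp add: bracket_add)
  also have "\<dots> = bracket L (bracket L (u \<oplus> v) y) z \<ominus> koszul L q r (bracket L (bracket L (u \<oplus> v) z) y)"
    using c unfolding add(3)[OF add(5,6)] add(4)[OF add(5,6)]
    by (simp add: bracket_add koszul_add a_minus_def minus_add a_ac)
  finally show ?case .
qed

lemma bracket_bracket_left: 
  assumes "x \<in> carrier L" "y \<in> grade L q" "z \<in> grade L r"
  shows "bracket L (bracket L x y) z =
    bracket L x (bracket L y z) \<oplus> koszul L q r (bracket L (bracket L x z) y)"
proof -
  have "bracket L (bracket L x y) z \<in> carrier L" "koszul L q r (bracket L (bracket L x z) y) \<in> carrier L"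
    using assms grade_carrier by auto
  then show ?thesis unfolding leibniz_right_homogeneous[OF assms] by algebra
qed

lemma leibniz_superalgebra_sub:
  assumes C: "submodule C R L" and b: "\<And>x y. \<lbrakk>x \<in> C; y \<in> C\<rbrakk> \<Longrightarrow> bracket L x y \<in> C"
    and h: "\<And>x p. x \<in> C \<Longrightarrow> homog_comp L p x \<in> C"
  shows "leibniz_superalgebra R (L\<lparr>carrier := C, grade := (\<lambda>p. grade L p \<inter> C)\<rparr>)" (is "leibniz_superalgebra R ?S")
proof -
  note [simp] = submoduleE(4,5)[OF C] b
  have Cc [simp]: "x \<in> carrier L" if "x \<in> C" for x using submoduleE(1)[OF C] that by blast
  have z [simp]: "\<zero> \<in> C" by (rule submodule_zero[OF C])
  have i: "\<ominus> x \<in> C" if "x \<in> C" for x using submoduleE(3)[OF C] that .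
  have "supermodule R ?S"
  proof (rule supermoduleI, goal_cases)
    \<comment> \<open>existence of additive inverses\<close>
    case (7 x)
    then show ?case using i[of x] l_neg[of x] by (intro bexI[of _ "\<ominus> x"]) auto
  next
    \<comment> \<open>decomposition into homogeneous parts\<close>
    case (17 x)
    then show ?case
      using homog_comp_sum[of x 0] h[of x 0] h[of x 1] by (auto intro!: bexI[of _ "homog_comp L _ x"])
  qed (auto simp: R.cring_axioms a_ac smult_l_distr smult_r_distr smult_assoc1 intro: grade_both[of _ 0 1])
  then interpret S: supermodule R ?S .
  have inv: "\<ominus>\<^bsub>?S\<^esub> x = \<ominus> x" if "x \<in> C" for x
    by (rule S.minus_equality) (use that i l_neg in auto)
  show ?thesis
  proof (intro leibniz_superalgebra.intro leibniz_superalgebra_axioms.intro S.supermodule_axioms)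
    fix x y z p q r assume *: "x \<in> grade ?S p" "y \<in> grade ?S q" "z \<in> grade ?S r"
    then show "bracket ?S x (bracket ?S y z) =
      bracket ?S (bracket ?S x y) z \<ominus>\<^bsub>?S\<^esub> koszul ?S q r (bracket ?S (bracket ?S x z) y)"
      using leibniz[of x p y q z r] by (simp add: a_minus_def koszul_def inv i)
  qed (auto simp: bilinear_op_def graded_op_def bracket_add bracket_smult)
qed

text \<open>
  Central values of \<open>\<gamma>\<close> drop out of iterated brackets and, by \<open>null\<close>, iterated values of \<open>\<gamma>\<close>
  vanish. What remains of the Leibniz identity for the new bracket is the sum of the one for the
  old bracket and of the cocycle identity \<open>coc\<close>.
\<close>

lemma leibniz_superalgebra_twist:
  assumes bil: "bilinear_op R L \<gamma>" and gr: "graded_op L \<gamma>"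
    and cent: "\<And>x y. \<lbrakk>x \<in> carrier L; y \<in> carrier L\<rbrakk> \<Longrightarrow> \<gamma> x y \<in> leibniz_centre L"
    and null: "\<And>x y z. \<lbrakk>x \<in> carrier L; y \<in> carrier L; z \<in> carrier L\<rbrakk> \<Longrightarrow>
       \<gamma> (\<gamma> x y) z = \<zero> \<and> \<gamma> z (\<gamma> x y) = \<zero>"
    and coc: "\<And>x y z p q r. \<lbrakk>x \<in> grade L p; y \<in> grade L q; z \<in> grade L r\<rbrakk> \<Longrightarrow>
       \<gamma> x (bracket L y z) = \<gamma> (bracket L x y) z \<ominus> koszul L q r (\<gamma> (bracket L x z) y)"
  shows "leibniz_superalgebra R (with_bracket L (\<lambda>x y. bracket L x y \<oplus> \<gamma> x y))"
proof (rule leibniz_superalgebra_with_bracketI)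
  show "bilinear_op R L (\<lambda>x y. bracket L x y \<oplus> \<gamma> x y)"
    by (rule bilinear_op_add[OF bracket_bilinear bil])
  show "graded_op L (\<lambda>x y. bracket L x y \<oplus> \<gamma> x y)"
    using gr by (auto simp: graded_op_def)
  fix x y z p q r assume *: "x \<in> grade L p" "y \<in> grade L q" "z \<in> grade L r"
  note c [simp] = *[THEN grade_carrier] bilinear_closed[OF bil]
  note s = bilinear_simps[OF bil] bracket_add
  have [simp]: "bracket L (\<gamma> u v) w = \<zero>" "bracket L w (\<gamma> u v) = \<zero>"
    if "u \<in> carrier L" "v \<in> carrier L" "w \<in> carrier L" for u v w
    using cent[of u v] that by (auto simp: leibniz_centre_def)
  note [simp] = null
  show "bracket L x (bracket L y z \<oplus> \<gamma> y z) \<oplus> \<gamma> x (bracket L y z \<oplus> \<gamma> y z) =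
      bracket L (bracket L x y \<oplus> \<gamma> x y) z \<oplus> \<gamma> (bracket L x y \<oplus> \<gamma> x y) z \<ominus>
      koszul L q r (bracket L (bracket L x z \<oplus> \<gamma> x z) y \<oplus> \<gamma> (bracket L x z \<oplus> \<gamma> x z) y)"
    by (simp add: s leibniz[OF *] coc[OF *] koszul_add a_minus_def minus_add a_ac)
qed

text \<open>
  The Leibniz identity expresses brackets of \<open>x\<close> with \<open>[y, z]\<close> by iterated brackets that begin with
  a bracket of \<open>x\<close> with \<open>y\<close> or \<open>z\<close>. For \<open>[[y, z], x]\<close> the sign in this identity involves the
  degree of \<open>x\<close>.
\<close>

lemma annihilator_bracket:
  assumes x: "x \<in> carrier L" and y: "y \<in> grade L q" and z: "z \<in> grade L r"
    and "bracket L x y = \<zero>" "bracket L y x = \<zero>" "bracket L x z = \<zero>" "bracket L z x = \<zero>"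
    and hx: "x \<in> grade L p"
  shows "bracket L x (bracket L y z) = \<zero>" "bracket L (bracket L y z) x = \<zero>"
proof -
  note c = x y[THEN grade_carrier] z[THEN grade_carrier]
  show "bracket L x (bracket L y z) = \<zero>"
    using assms c by (simp add: leibniz_right_homogeneous[OF x y z] diff_zero)
  show "bracket L (bracket L y z) x = \<zero>"
    using bracket_bracket_left[OF c(2) z hx] assms c by simp
qed

end

lemma leibniz_homD:
  assumes "f \<in> leibniz_hom R L M"
  shows leibniz_hom_linear: "linear_map R L M f"
    and leibniz_hom_closed: "x \<in> carrier L \<Longrightarrow> f x \<in> carrier M"
    and leibniz_hom_add: "\<lbrakk>x \<in> carrier L; y \<in> carrier L\<rbrakk> \<Longrightarrow> f (x \<oplus>\<^bsub>L\<^esub> y) = f x \<oplus>\<^bsub>M\<^esub> f y"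
    and leibniz_hom_smult: "\<lbrakk>r \<in> carrier R; x \<in> carrier L\<rbrakk> \<Longrightarrow> f (r \<odot>\<^bsub>L\<^esub> x) = r \<odot>\<^bsub>M\<^esub> f x"
    and leibniz_hom_grade: "x \<in> grade L p \<Longrightarrow> f x \<in> grade M p"
    and leibniz_hom_bracket:
      "\<lbrakk>x \<in> carrier L; y \<in> carrier L\<rbrakk> \<Longrightarrow> f (bracket L x y) = bracket M (f x) (f y)"
  using assms by (auto simp: leibniz_hom_def linear_map_def additive_map_def) blast

section \<open>The Steinberg Leibniz superalgebra\<close>

lemma abelian_group_exchange:
  assumes "abelian_group G" "a \<in> carrier G" "b \<in> carrier G" "c \<in> carrier G" "d \<in> carrier G"
  shows "(a \<oplus>\<^bsub>G\<^esub> b) \<oplus>\<^bsub>G\<^esub> (c \<oplus>\<^bsub>G\<^esub> d) = (a \<oplus>\<^bsub>G\<^esub> d) \<oplus>\<^bsub>G\<^esub> (c \<oplus>\<^bsub>G\<^esub> b)"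
proof -
  interpret abelian_group G by fact
  show ?thesis using assms(2-) by algebra
qed

locale steinberg = superdialgebra R D
  for R :: "('r, 's) ring_scheme" and D :: "('r, 'd) superdialgebra" (structure) +
  fixes m n :: nat
begin

abbreviation wf :: "('r, 'd) stl_term \<Rightarrow> bool" where "wf \<equiv> stl_wf R m n D"
abbreviation deg :: "bit \<Rightarrow> ('r, 'd) stl_term \<Rightarrow> bool" where "deg \<equiv> stl_deg R m n D"
abbreviation eqv :: "('r, 'd) stl_term \<Rightarrow> ('r, 'd) stl_term \<Rightarrow> bool" (infix "\<approx>" 50)
  where "eqv \<equiv> stl_eq R m n D"
abbreviation cls :: "('r, 'd) stl_term \<Rightarrow> ('r, 'd) stl_term set" where "cls \<equiv> stl_class R m n D"
abbreviation S :: "('r, ('r, 'd) stl_term set) leibniz_superalgebra" where "S \<equiv> stl R m n D"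

lemma offdiag_trans: "\<lbrakk>offdiag m n i j; offdiag m n j l; i \<noteq> l\<rbrakk> \<Longrightarrow> offdiag m n i l"
  by (auto simp: offdiag_def)

lemma grade_in_hom: "x \<in> grade D p \<Longrightarrow> x \<in> grade D 0 \<union> grade D 1"
  by (cases p) auto

lemma deg_wf: "deg p t \<Longrightarrow> wf t"
  by (induction rule: stl_deg.induct) (auto intro: stl_wf.intros(2-) stl_wf.intros(1)[OF _ grade_in_hom])

lemma wf_koszul: "wf t \<Longrightarrow> wf (stl_koszul p q t)"
  by (simp add: stl_koszul_def stl_wf.intros)

lemma wf_gen: "\<lbrakk>offdiag m n i j; a \<in> grade D p\<rbrakk> \<Longrightarrow> wf (Gen i j a)"
  by (rule stl_wf.intros(1)[OF _ grade_in_hom])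

lemma eqv_wf: "s \<approx> t \<Longrightarrow> wf s \<and> wf t"
  by (induction rule: stl_eq.induct)
    (auto intro!: stl_wf.intros(2-) wf_koszul dest: deg_wf,
     auto intro: wf_gen offdiag_trans dia_grade grade_add grade_smult)

lemma clsI: "s \<approx> t \<Longrightarrow> cls s = cls t"
  unfolding stl_class_def by (blast intro: stl_eq.sym stl_eq.trans)

lemma mem_cls: "wf t \<Longrightarrow> t \<in> cls t"
  by (simp add: stl_class_def stl_eq.refl)

lemma S_carrierE [elim!]: "\<lbrakk>A \<in> carrier S; \<And>t. \<lbrakk>wf t; A = cls t\<rbrakk> \<Longrightarrow> P\<rbrakk> \<Longrightarrow> P"
  by (auto simp: stl_def)

lemma S_gradeE [elim!]: "\<lbrakk>A \<in> grade S p; \<And>t. \<lbrakk>deg p t; A = cls t\<rbrakk> \<Longrightarrow> P\<rbrakk> \<Longrightarrow> P"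
  by (auto simp: stl_def)

lemma cls_closed [simp, intro]: "wf t \<Longrightarrow> cls t \<in> carrier S"
  by (auto simp: stl_def)

lemma cls_grade [simp, intro]: "deg p t \<Longrightarrow> cls t \<in> grade S p"
  by (auto simp: stl_def)

lemma S_zero: "\<zero>\<^bsub>S\<^esub> = cls Zer"
  by (simp add: stl_def)

lemma S_ops:
  "\<lbrakk>wf s; wf t\<rbrakk> \<Longrightarrow> cls s \<oplus>\<^bsub>S\<^esub> cls t = cls (Plus s t)"
  "\<lbrakk>r \<in> carrier R; wf t\<rbrakk> \<Longrightarrow> r \<odot>\<^bsub>S\<^esub> cls t = cls (Scal r t)"
  "\<lbrakk>wf s; wf t\<rbrakk> \<Longrightarrow> bracket S (cls s) (cls t) = cls (Brk s t)"
proof -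
  show "cls s \<oplus>\<^bsub>S\<^esub> cls t = cls (Plus s t)" if "wf s" "wf t"
  proof -
    have "cls (Plus s' t') = cls (Plus s t)" if "s' \<in> cls s" "t' \<in> cls t" for s' t'
      using that by (intro clsI stl_eq.cong_Plus) (auto simp: stl_class_def intro: stl_eq.sym)
    then have "(\<Union>s'\<in>cls s. \<Union>t'\<in>cls t. cls (Plus s' t')) = cls (Plus s t)"
      using mem_cls[OF that(1)] mem_cls[OF that(2)] by blast
    then show ?thesis by (simp add: stl_def)
  qed
  show "bracket S (cls s) (cls t) = cls (Brk s t)" if "wf s" "wf t"
  proof -
    have "cls (Brk s' t') = cls (Brk s t)" if "s' \<in> cls s" "t' \<in> cls t" for s' t'
      using that by (intro clsI stl_eq.cong_Brk) (auto simp: stl_class_def intro: stl_eq.sym)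
    then have "(\<Union>s'\<in>cls s. \<Union>t'\<in>cls t. cls (Brk s' t')) = cls (Brk s t)"
      using mem_cls[OF that(1)] mem_cls[OF that(2)] by blast
    then show ?thesis by (simp add: stl_def)
  qed
  show "r \<odot>\<^bsub>S\<^esub> cls t = cls (Scal r t)" if "r \<in> carrier R" "wf t"
  proof -
    have "cls (Scal r t') = cls (Scal r t)" if "t' \<in> cls t" for t'
      using that \<open>r \<in> carrier R\<close> by (intro clsI stl_eq.cong_Scal) (auto simp: stl_class_def intro: stl_eq.sym)
    then have "(\<Union>t'\<in>cls t. cls (Scal r t')) = cls (Scal r t)"
      using mem_cls[OF that(2)] by blast
    then show ?thesis by (simp add: stl_def)
  qed
qed

lemmas wf_intros = stl_wf.intros(2-)

lemma cls_zero: "cls Zer = \<zero>\<^bsub>S\<^esub>"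
  by (simp add: stl_def)

lemma S_module: "module R S"
proof (intro moduleI abelian_groupI, goal_cases)
  \<comment> \<open>existence of additive inverses\<close>
  case (7 x)
  then obtain t where t: "wf t" "x = cls t" by blast
  then have "cls (Minus t) \<oplus>\<^bsub>S\<^esub> x = \<zero>\<^bsub>S\<^esub>"
    by (auto simp: S_ops wf_intros S_zero intro!: clsI del: equalityI intro: stl_eq.trans[OF stl_eq.add_comm]
        stl_eq.add_minus wf_intros)
  then show ?case using t wf_intros(3) by blast
qed (auto simp: R.cring_axioms S_ops S_zero wf_intros intro!: clsI del: equalityI intro: stl_eq.intros(8-11,12-15))

sublocale S: module R S by (rule S_module)

lemma S_bracket_bilinear: "bilinear_op R S (bracket S)"
  unfolding bilinear_op_def
  by (auto simp: S_ops wf_intros intro!: clsI del: equalityI intro: stl_eq.intros(16-19))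

lemma cls_Minus: "wf t \<Longrightarrow> cls (Minus t) = \<ominus>\<^bsub>S\<^esub> cls t"
  by (rule S.minus_equality[symmetric])
    (auto simp: S_ops wf_intros S_zero intro!: clsI del: equalityI intro: stl_eq.trans[OF stl_eq.add_comm]
        stl_eq.add_minus wf_intros)

lemma cls_koszul: "wf t \<Longrightarrow> cls (stl_koszul p q t) = koszul S p q (cls t)"
  by (simp add: stl_koszul_def koszul_def cls_Minus)

lemma cls_Gen_zero: "offdiag m n i j \<Longrightarrow> cls (Gen i j \<zero>) = \<zero>\<^bsub>S\<^esub>"
proof -
  assume ij: "offdiag m n i j"
  then have w: "wf (Gen i j \<zero>)" by (auto intro: wf_gen)
  have "Gen i j (\<zero>\<^bsub>R\<^esub> \<odot> \<zero>) \<approx> Scal \<zero>\<^bsub>R\<^esub> (Gen i j \<zero>)"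
    by (rule stl_eq.gen_scal[of _ _ _ _ _ _ _ _ 0]) (use ij in auto)
  then have "cls (Gen i j \<zero>) = cls (Scal \<zero>\<^bsub>R\<^esub> (Gen i j \<zero>))"
    by (simp add: clsI)
  then show ?thesis using w by (simp flip: S_ops)
qed

text \<open>
  The homogeneous components of the class of a term. That they are well defined on classes is the
  reason why only zero is both even and odd in an algebra given by generators and homogeneous
  relations.
\<close>

primrec term_comp :: "('r, 'd) stl_term \<Rightarrow> bit \<Rightarrow> ('r, 'd) stl_term set" where
  "term_comp (Gen i j a) = (\<lambda>p. if a \<in> grade D (p + idx_deg m i + idx_deg m j)
     then cls (Gen i j a) else \<zero>\<^bsub>S\<^esub>)"
| "term_comp Zer = (\<lambda>p. \<zero>\<^bsub>S\<^esub>)"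
| "term_comp (Plus s t) = (\<lambda>p. term_comp s p \<oplus>\<^bsub>S\<^esub> term_comp t p)"
| "term_comp (Minus t) = (\<lambda>p. \<ominus>\<^bsub>S\<^esub> term_comp t p)"
| "term_comp (Scal r t) = (\<lambda>p. r \<odot>\<^bsub>S\<^esub> term_comp t p)"
| "term_comp (Brk s t) = (\<lambda>p. bracket S (term_comp s 0) (term_comp t p) \<oplus>\<^bsub>S\<^esub>
     bracket S (term_comp s 1) (term_comp t (p + 1)))"

lemma term_comp_closed: "wf t \<Longrightarrow> term_comp t p \<in> carrier S"
  by (induction arbitrary: p rule: stl_wf.induct)
    (simp_all add: wf_intros stl_wf.intros(1) S.bilinear_closed[OF S_bracket_bilinear])

lemma term_comp_homogeneous: "deg p t \<Longrightarrow> term_comp t p = cls t \<and> term_comp t (p + 1) = \<zero>\<^bsub>S\<^esub>"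
proof (induction rule: stl_deg.induct)
  case (1 i j a p)
  have "cls (Gen i j a) = \<zero>\<^bsub>S\<^esub>" if "a \<in> grade D (p + 1)"
    using that 1 cls_Gen_zero[of i j] grade_both[of a p "p + 1"] by (simp del: bit_not_zero_iff)
  moreover have "idx_deg m i + idx_deg m j + p + 1 + idx_deg m i + idx_deg m j = p + 1"
    "idx_deg m i + idx_deg m j + p + idx_deg m i + idx_deg m j = p"
    by (simp_all add: ac_simps)
  ultimately show ?case using 1 by simp
next
  case (6 p s q t)
  note w = 6(1,2)[THEN deg_wf]
  note b = S.bilinear_zero[OF S_bracket_bilinear] S.bilinear_closed[OF S_bracket_bilinear]
  from 6 w show ?case
    by (cases p; cases q) (simp_all add: b S_ops(3) wf_intros)
qed (simp_all add: cls_zero S_ops cls_Minus wf_intros deg_wf S.M.a_inv_zero)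

lemma cls_decomposition:
  assumes "wf t"
  shows "\<exists>u v. deg 0 u \<and> deg 1 v \<and> cls t = cls u \<oplus>\<^bsub>S\<^esub> cls v"
  using assms
proof (induction rule: stl_wf.induct)
  case (1 i j a)
  then obtain p where p: "a \<in> grade D p" by blast
  have "deg (idx_deg m i + idx_deg m j + p) (Gen i j a)" by (rule stl_deg.intros(1)) fact+
  moreover have z: "deg q Zer" "wf (Gen i j a)" for q
    using 1 by (auto intro: stl_deg.intros stl_wf.intros)
  ultimately have "deg 0 (Gen i j a) \<or> deg 1 (Gen i j a)"
    by (metis bit.exhaust)
  then show ?case
  proof
    assume "deg 0 (Gen i j a)"
    then show ?thesis using z
      by (intro exI[of _ "Gen i j a"] exI[of _ Zer]) (simp add: cls_zero)
  next
    assume "deg 1 (Gen i j a)"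
    then show ?thesis using z
      by (intro exI[of _ Zer] exI[of _ "Gen i j a"]) (simp add: cls_zero)
  qed
next
  case 2
  show ?case by (auto intro!: exI[of _ Zer] stl_deg.intros simp: cls_zero)
next
  case (3 s t)
  then obtain u v u' v' where
    d: "deg 0 u" "deg 1 v" "deg 0 u'" "deg 1 v'" and
    e: "cls s = cls u \<oplus>\<^bsub>S\<^esub> cls v" "cls t = cls u' \<oplus>\<^bsub>S\<^esub> cls v'" by blast
  have [simp]: "wf u" "wf v" "wf u'" "wf v'" using d deg_wf by auto
  have "cls (Plus s t) = cls (Plus u u') \<oplus>\<^bsub>S\<^esub> cls (Plus v v')"
    using 3 by (simp flip: S_ops add: e S.M.a_ac)
  then show ?case using d stl_deg.intros(3) by blast
next
  case (4 t)
  then obtain u v where d: "deg 0 u" "deg 1 v" and e: "cls t = cls u \<oplus>\<^bsub>S\<^esub> cls v" by blast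
  have [simp]: "wf u" "wf v" using d deg_wf by auto
  have "cls (Minus t) = cls (Minus u) \<oplus>\<^bsub>S\<^esub> cls (Minus v)"
    using 4 by (simp add: cls_Minus e S.M.minus_add)
  then show ?case using d stl_deg.intros(4) by blast
next
  case (5 r t)
  then obtain u v where d: "deg 0 u" "deg 1 v" and e: "cls t = cls u \<oplus>\<^bsub>S\<^esub> cls v" by blast
  have [simp]: "wf u" "wf v" using d deg_wf by auto
  have "cls (Scal r t) = cls (Scal r u) \<oplus>\<^bsub>S\<^esub> cls (Scal r v)"
    using S_ops(2)[of r t] S_ops(2)[of r u] S_ops(2)[of r v] 5(1,2) S.smult_r_distr[of r "cls u" "cls v"]
    by (simp add: e)
  then show ?case
    using stl_deg.intros(5)[OF 5(1) d(1)] stl_deg.intros(5)[OF 5(1) d(2)] by blast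
next
  case (6 s t)
  then obtain u v u' v' where
    d: "deg 0 u" "deg 1 v" "deg 0 u'" "deg 1 v'" and
    e: "cls s = cls u \<oplus>\<^bsub>S\<^esub> cls v" "cls t = cls u' \<oplus>\<^bsub>S\<^esub> cls v'" by blast
  have [simp]: "wf u" "wf v" "wf u'" "wf v'" using d deg_wf by auto
  note b = S.bilinear_closed[OF S_bracket_bilinear] S.bilinear_simps[OF S_bracket_bilinear]
  have "cls (Brk s t) =
      cls (Plus (Brk u u') (Brk v v')) \<oplus>\<^bsub>S\<^esub> cls (Plus (Brk u v') (Brk v u'))"
  proof -
    have c: "bracket S (cls x) (cls y) \<in> carrier S" if "wf x" "wf y" for x y
      using that by (simp add: b)
    have "cls (Brk s t) = bracket S (cls s) (cls t)" using 6 by (simp add: S_ops)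
    also have "\<dots> = (bracket S (cls u) (cls u') \<oplus>\<^bsub>S\<^esub> bracket S (cls v) (cls u')) \<oplus>\<^bsub>S\<^esub>
        (bracket S (cls u) (cls v') \<oplus>\<^bsub>S\<^esub> bracket S (cls v) (cls v'))"
      unfolding e by (simp add: b del: S_ops)
    also have "\<dots> = (bracket S (cls u) (cls u') \<oplus>\<^bsub>S\<^esub> bracket S (cls v) (cls v')) \<oplus>\<^bsub>S\<^esub>
        (bracket S (cls u) (cls v') \<oplus>\<^bsub>S\<^esub> bracket S (cls v) (cls u'))"
      by (intro S.M.abelian_group_axioms[THEN abelian_group_exchange] c) simp_all
    also have "\<dots> = cls (Plus (Brk u u') (Brk v v')) \<oplus>\<^bsub>S\<^esub> cls (Plus (Brk u v') (Brk v u'))"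
      by (simp add: S_ops wf_intros)
    finally show ?thesis .
  qed
  moreover have "deg 0 (Plus (Brk u u') (Brk v v'))" "deg 1 (Plus (Brk u v') (Brk v u'))"
    using d stl_deg.intros(6)[of R m n D 0 u 0 u'] stl_deg.intros(6)[of R m n D 1 v 1 v']
      stl_deg.intros(6)[of R m n D 0 u 1 v'] stl_deg.intros(6)[of R m n D 1 v 0 u']
    by (auto intro!: stl_deg.intros(3))
  ultimately show ?case by blast
qed

text \<open>
  For a relation between homogeneous terms of equal degree, invariance of the components needs no
  computation.
\<close>

lemma term_comp_homogeneous_eq:
  assumes "s \<approx> t" "deg p s" "deg p t"
  shows "term_comp s q = term_comp t q"
  using term_comp_homogeneous[OF assms(2)] term_comp_homogeneous[OF assms(3)] clsI[OF assms(1)]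
  by (cases p; cases q) auto

lemma deg_koszul: "deg p t \<Longrightarrow> deg p (stl_koszul q r t)"
  by (simp add: stl_koszul_def stl_deg.intros)

lemma deg_Brk: "\<lbrakk>deg p s; deg q t; r = p + q\<rbrakk> \<Longrightarrow> deg r (Brk s t)"
  by (simp add: stl_deg.intros)

lemma deg_Gen: "\<lbrakk>offdiag m n i j; a \<in> grade D p; r = idx_deg m i + idx_deg m j + p\<rbrakk> \<Longrightarrow> deg r (Gen i j a)"
  by (simp add: stl_deg.intros)

lemma term_comp_cong: "s \<approx> t \<Longrightarrow> term_comp s q = term_comp t q"
proof (induction arbitrary: q rule: stl_eq.induct)
  case (leibniz p s q' t r u)
  show ?case
    by (rule term_comp_homogeneous_eq[OF stl_eq.leibniz[OF leibniz], of "p + (q' + r)"])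
      (use leibniz in \<open>auto intro!: deg_Brk[OF _ deg_Brk] stl_deg.intros(3,4) deg_koszul
        deg_Brk[OF deg_Brk] simp: ac_simps\<close>)
next
  case (gen_add i j a p b)
  show ?case
    by (rule term_comp_homogeneous_eq[OF stl_eq.gen_add[OF gen_add], of "idx_deg m i + idx_deg m j + p"])
      (use gen_add in \<open>auto intro!: stl_deg.intros(1,3)\<close>)
next
  case (gen_scal i j r a p)
  show ?case
    by (rule term_comp_homogeneous_eq[OF stl_eq.gen_scal[OF gen_scal], of "idx_deg m i + idx_deg m j + p"])
      (use gen_scal in \<open>auto intro!: stl_deg.intros(1,5)\<close>)
next
  case (rel_left i j l a p b q')
  show ?case
    by (rule term_comp_homogeneous_eq[OF stl_eq.rel_left[OF rel_left], of "idx_deg m i + idx_deg m l + (p + q')"])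
      (use rel_left offdiag_trans[of i j l] in \<open>auto intro!: deg_Brk[OF deg_Gen deg_Gen] deg_Gen simp: ac_simps\<close>)
next
  case (rel_right i j k a p b q')
  show ?case
    by (rule term_comp_homogeneous_eq[OF stl_eq.rel_right[OF rel_right], of "idx_deg m k + idx_deg m j + (q' + p)"])
      (use rel_right offdiag_trans[of k i j] in \<open>auto intro!: deg_Brk[OF deg_Gen deg_Gen] stl_deg.intros(4)
        deg_koszul deg_Gen simp: ac_simps\<close>)
next
  case (rel_zero i j k l a p b q')
  show ?case
    by (rule term_comp_homogeneous_eq[OF stl_eq.rel_zero[OF rel_zero]])
      (use rel_zero in \<open>auto intro!: deg_Brk[OF deg_Gen deg_Gen HOL.refl] stl_deg.intros(2)\<close>)
qed (simp_all add: term_comp_closed S.M.a_ac S.M.r_neg S.smult_l_distr S.smult_r_distr S.smult_assoc1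
    S.bilinear_closed[OF S_bracket_bilinear] S.bilinear_simps[OF S_bracket_bilinear])

lemma S_supermodule: "supermodule R S"
proof (intro supermodule.intro supermodule_axioms.intro S_module S.submoduleI)
  fix x assume "x \<in> carrier S"
  then show "\<exists>y\<in>grade S 0. \<exists>z\<in>grade S 1. x = y \<oplus>\<^bsub>S\<^esub> z"
    using cls_decomposition by blast
next
  show "grade S 0 \<inter> grade S 1 = {\<zero>\<^bsub>S\<^esub>}"
  proof (intro equalityI subsetI)
    fix x assume "x \<in> grade S 0 \<inter> grade S 1"
    then obtain s t where s: "deg 0 s" "x = cls s" and t: "deg 1 t" "x = cls t" by blast
    then have "s \<approx> t"
      using mem_cls[OF deg_wf[OF t(1)]] by (simp add: stl_class_def)
    then show "x \<in> {\<zero>\<^bsub>S\<^esub>}"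
      using term_comp_homogeneous[OF s(1)] term_comp_homogeneous[OF t(1)] s(2)
        term_comp_cong[of s t 0] by simp
  next
    have "\<zero>\<^bsub>S\<^esub> \<in> grade S p" for p using cls_grade[OF stl_deg.intros(2)] by (simp add: cls_zero)
    then show "x \<in> grade S 0 \<inter> grade S 1" if "x \<in> {\<zero>\<^bsub>S\<^esub>}" for x using that by simp
  qed
next
  fix p
  show "\<zero>\<^bsub>S\<^esub> \<in> grade S p"
    using cls_grade[OF stl_deg.intros(2)] by (simp add: cls_zero)
  show "\<ominus>\<^bsub>S\<^esub> x \<in> grade S p" if "x \<in> grade S p" for x
    using that cls_grade[OF stl_deg.intros(4)] deg_wf by (force simp: cls_Minus[symmetric])
  show "x \<oplus>\<^bsub>S\<^esub> y \<in> grade S p" if "x \<in> grade S p" "y \<in> grade S p" for x y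
    using that cls_grade[OF stl_deg.intros(3)] deg_wf by (force simp: S_ops)
  show "r \<odot>\<^bsub>S\<^esub> x \<in> grade S p" if "r \<in> carrier R" "x \<in> grade S p" for r x
    using that cls_grade[OF stl_deg.intros(5)] deg_wf by (force simp: S_ops)
qed (auto dest: deg_wf)

lemma S_leibniz: "leibniz_superalgebra R S"
proof (intro leibniz_superalgebra.intro leibniz_superalgebra_axioms.intro S_supermodule S_bracket_bilinear)
  show "graded_op S (bracket S)"
    unfolding graded_op_def
  proof (intro allI ballI)
    fix p q x y assume "x \<in> grade S p" "y \<in> grade S q"
    then obtain s t where "deg p s" "deg q t" "x = cls s" "y = cls t" by blast
    then show "bracket S x y \<in> grade S (p + q)"
      using cls_grade[OF stl_deg.intros(6)[of R m n D p s q t]] by (simp add: S_ops deg_wf)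
  qed
  fix x y z p q r assume "x \<in> grade S p" "y \<in> grade S q" "z \<in> grade S r"
  then obtain s t u where d: "deg p s" "deg q t" "deg r u" and e: "x = cls s" "y = cls t" "z = cls u"
    by blast
  show "bracket S x (bracket S y z) =
    bracket S (bracket S x y) z \<ominus>\<^bsub>S\<^esub> koszul S q r (bracket S (bracket S x z) y)"
    using clsI[OF stl_eq.leibniz[OF d]] d[THEN deg_wf] unfolding e a_minus_def
    by (simp add: S_ops wf_intros wf_koszul flip: cls_koszul cls_Minus)
qed

sublocale S: leibniz_superalgebra R S by (rule S_leibniz)

end

section \<open>The universal property of the Steinberg Leibniz superalgebra\<close>

primrec term_eval ::
  "('r, 'a, 'z) leibniz_superalgebra_scheme \<Rightarrow> (nat \<Rightarrow> nat \<Rightarrow> 'd \<Rightarrow> 'a) \<Rightarrow> ('r, 'd) stl_term \<Rightarrow> 'a" where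
  "term_eval L F (Gen i j a) = F i j a"
| "term_eval L F Zer = \<zero>\<^bsub>L\<^esub>"
| "term_eval L F (Plus s t) = term_eval L F s \<oplus>\<^bsub>L\<^esub> term_eval L F t"
| "term_eval L F (Minus t) = \<ominus>\<^bsub>L\<^esub> term_eval L F t"
| "term_eval L F (Scal r t) = r \<odot>\<^bsub>L\<^esub> term_eval L F t"
| "term_eval L F (Brk s t) = bracket L (term_eval L F s) (term_eval L F t)"

text \<open>
  A class is evaluated at an arbitrary representative; for a family that satisfies the Steinberg
  relations all representatives have the same value.
\<close>

definition stl_lift ::
  "('r, 'a, 'z) leibniz_superalgebra_scheme \<Rightarrow> (nat \<Rightarrow> nat \<Rightarrow> 'd \<Rightarrow> 'a) \<Rightarrow>
   ('r, 'd) stl_term set \<Rightarrow> 'a" where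
  "stl_lift L F A = term_eval L F (SOME t. t \<in> A)"

text \<open>
  Families of elements of a Leibniz superalgebra that satisfy the defining relations of the
  Steinberg algebra; by the universal property they are its homomorphic images.
\<close>

locale steinberg_family = steinberg R D m n + L: leibniz_superalgebra R L
  for R :: "('r, 's) ring_scheme" and D :: "('r, 'd) superdialgebra" (structure)
    and m n :: nat and L :: "('r, 'a, 'z) leibniz_superalgebra_scheme" +
  fixes F :: "nat \<Rightarrow> nat \<Rightarrow> 'd \<Rightarrow> 'a"
  assumes F_grade: "\<lbrakk>offdiag m n i j; a \<in> grade D p\<rbrakk> \<Longrightarrow> F i j a \<in> grade L (idx_deg m i + idx_deg m j + p)"
    and F_add: "\<lbrakk>offdiag m n i j; a \<in> grade D p; b \<in> grade D p\<rbrakk> \<Longrightarrow> F i j (a \<oplus> b) = F i j a \<oplus>\<^bsub>L\<^esub> F i j b"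
    and F_smult: "\<lbrakk>offdiag m n i j; r \<in> carrier R; a \<in> grade D p\<rbrakk> \<Longrightarrow> F i j (r \<odot> a) = r \<odot>\<^bsub>L\<^esub> F i j a"
    and F_left: "\<lbrakk>offdiag m n i j; offdiag m n j l; i \<noteq> l; a \<in> grade D p; b \<in> grade D q\<rbrakk> \<Longrightarrow>
      bracket L (F i j a) (F j l b) = F i l (a \<stileturn> b)"
    and F_right: "\<lbrakk>offdiag m n i j; offdiag m n k i; j \<noteq> k; a \<in> grade D p; b \<in> grade D q\<rbrakk> \<Longrightarrow>
      bracket L (F i j a) (F k i b) =
        \<ominus>\<^bsub>L\<^esub> koszul L (idx_deg m i + idx_deg m j + p) (idx_deg m k + idx_deg m i + q) (F k j (b \<turnstile> a))"
    and F_zero: "\<lbrakk>offdiag m n i j; offdiag m n k l; i \<noteq> l; j \<noteq> k; a \<in> grade D p; b \<in> grade D q\<rbrakk> \<Longrightarrow>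
      bracket L (F i j a) (F k l b) = \<zero>\<^bsub>L\<^esub>"
begin

abbreviation ev :: "('r, 'd) stl_term \<Rightarrow> 'a" where "ev \<equiv> term_eval L F"

lemma F_closed: "\<lbrakk>offdiag m n i j; a \<in> grade D p\<rbrakk> \<Longrightarrow> F i j a \<in> carrier L"
  using F_grade L.grade_carrier by blast

lemma ev_deg: "deg p t \<Longrightarrow> ev t \<in> grade L p"
  by (induction rule: stl_deg.induct) (auto intro: F_grade)

lemma ev_closed: "wf t \<Longrightarrow> ev t \<in> carrier L"
  by (induction rule: stl_wf.induct) (auto intro: F_closed)

lemma ev_koszul: "ev (stl_koszul p q t) = koszul L p q (ev t)"
  by (simp add: stl_koszul_def koszul_def)

lemma ev_cong: "s \<approx> t \<Longrightarrow> ev s = ev t"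
proof (induction rule: stl_eq.induct)
  case (leibniz p s q t r u)
  then show ?case
    using L.leibniz[of "ev s" p "ev t" q "ev u" r] by (simp add: ev_deg ev_koszul a_minus_def)
qed (simp_all add: ev_closed ev_koszul L.a_ac L.r_neg L.smult_l_distr L.smult_r_distr L.smult_assoc1
    L.bracket_add L.bracket_smult F_add F_smult F_left F_right F_zero)

lemma stl_lift_cls: "wf t \<Longrightarrow> stl_lift L F (cls t) = ev t"
  using someI[of "\<lambda>s. s \<in> cls t" t] mem_cls[of t] ev_cong[of t]
  by (auto simp: stl_lift_def stl_class_def)

lemma stl_lift_hom: "stl_lift L F \<in> leibniz_hom R S L"
proof -
  have "stl_lift L F x \<in> carrier L" if "x \<in> carrier S" for x
    using that by (auto simp: stl_lift_cls ev_closed)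
  moreover have "stl_lift L F x \<in> grade L p" if "x \<in> grade S p" for x p
    using that by (auto simp: stl_lift_cls ev_deg deg_wf)
  moreover have "stl_lift L F (x \<oplus>\<^bsub>S\<^esub> y) = stl_lift L F x \<oplus>\<^bsub>L\<^esub> stl_lift L F y"
    "stl_lift L F (bracket S x y) = bracket L (stl_lift L F x) (stl_lift L F y)"
    if "x \<in> carrier S" "y \<in> carrier S" for x y
    using that by (auto simp: stl_lift_cls S_ops wf_intros)
  moreover have "stl_lift L F (r \<odot>\<^bsub>S\<^esub> x) = r \<odot>\<^bsub>L\<^esub> stl_lift L F x"
    if "x \<in> carrier S" "r \<in> carrier R" for x r
    using that by (auto simp: stl_lift_cls S_ops wf_intros)
  ultimately show ?thesis by (auto simp: leibniz_hom_def)
qed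

lemma stl_lift_Gen: "\<lbrakk>offdiag m n i j; a \<in> grade D p\<rbrakk> \<Longrightarrow> stl_lift L F (cls (Gen i j a)) = F i j a"
  by (simp add: stl_lift_cls wf_gen)

end

context steinberg
begin

text \<open>
  By the Leibniz identity a right bracket with \<open>[s, t]\<close> is a combination of iterated right brackets
  with \<open>s\<close> and \<open>t\<close>. So it suffices that \<open>X\<close> is closed under right brackets with generators: the
  algebra is spanned by left-normed brackets.
\<close>

lemma S_left_normed_induct:
  assumes X: "submodule X R S"
    and gen: "\<And>i j a p. \<lbrakk>offdiag m n i j; a \<in> grade D p\<rbrakk> \<Longrightarrow> cls (Gen i j a) \<in> X"
    and brk: "\<And>x i j a p. \<lbrakk>x \<in> X; offdiag m n i j; a \<in> grade D p\<rbrakk> \<Longrightarrow> bracket S x (cls (Gen i j a)) \<in> X"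
  shows "X = carrier S"
proof -
  note sub = S.submoduleE[OF X]
  have c [simp]: "x \<in> carrier S" if "x \<in> X" for x using sub(1) that by blast
  have z: "\<zero>\<^bsub>S\<^esub> \<in> X" by (rule S.submodule_zero[OF X])
  have main: "cls t \<in> X \<and> (\<forall>x\<in>X. bracket S x (cls t) \<in> X)" if "deg p t" for p t
    using that
  proof (induction rule: stl_deg.induct)
    case (1 i j a p)
    then show ?case using gen brk by blast
  next
    case (2 p)
    show ?case using z by (simp add: cls_zero)
  next
    case (3 p s t)
    then have "wf s" "wf t" by (simp_all add: deg_wf)
    then show ?case using 3 sub(5) by (simp add: S.bracket_add flip: S_ops)
  next
    case (4 p t)
    then have "wf t" by (simp_all add: deg_wf)
    then show ?case using 4 sub(3) by (simp add: S.bracket_minus cls_Minus)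
  next
    case (5 r p t)
    then have "wf t" by (simp_all add: deg_wf)
    then show ?case using 5 sub(4) by (simp add: S.bracket_smult flip: S_ops)
  next
    case (6 p s q t)
    then have w: "wf s" "wf t" by (simp_all add: deg_wf)
    have d: "cls s \<in> grade S p" "cls t \<in> grade S q" using 6 by auto
    have "bracket S x (cls (Brk s t)) \<in> X" if "x \<in> X" for x
    proof -
      have "bracket S x (cls (Brk s t)) = bracket S (bracket S x (cls s)) (cls t) \<ominus>\<^bsub>S\<^esub>
          koszul S p q (bracket S (bracket S x (cls t)) (cls s))"
        using S.leibniz_right_homogeneous[OF c[OF that] d] w by (simp add: S_ops)
      also have "\<dots> \<in> X"
        using 6 that sub(3,5) by (simp add: a_minus_def koszul_def)
      finally show ?thesis .
    qed
    moreover have "cls (Brk s t) \<in> X" using 6 w by (simp flip: S_ops)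
    ultimately show ?case by blast
  qed
  have "x \<in> X" if "x \<in> carrier S" for x
    using that by (induction x rule: S.homogeneous_induct) (auto intro: sub(5) dest: main)
  then show ?thesis using c by blast
qed

end

section \<open>Matrix units\<close>

lemma (in superdialgebra) mat_mult_mat_unit:
  assumes f: "bilinear_op R D f" and j: "j \<in> {1..N}" and ab: "a \<in> carrier D" "b \<in> carrier D"
  shows "mat_mult N D f (mat_unit D i j a) (mat_unit D k l b) =
    (if j = k then mat_unit D i l (f a b) else (\<lambda>i j. \<zero>))"
proof (intro ext)
  fix i' j'
  have "mat_mult N D f (mat_unit D i j a) (mat_unit D k l b) i' j' =
    (\<Oplus>x\<in>{1..N}. if j = x then if i' = i \<and> j = k \<and> j' = l then f a b else \<zero> else \<zero>)"
    unfolding mat_mult_def mat_unit_def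
    by (rule finsum_cong') (use ab in \<open>auto simp: bilinear_zero[OF f] bilinear_closed[OF f]\<close>)
  also have "\<dots> = (if i' = i \<and> j = k \<and> j' = l then f a b else \<zero>)"
    using j ab by (subst finsum_singleton) (auto simp: bilinear_closed[OF f])
  finally show "mat_mult N D f (mat_unit D i j a) (mat_unit D k l b) i' j' =
    (if j = k then mat_unit D i l (f a b) else (\<lambda>i j. \<zero>)) i' j'"
    by (simp add: mat_unit_def)
qed

lemma gl_simps [simp]:
  "carrier (gl m n D) = carrier (gl_supermodule m n D)"
  "add (gl m n D) = (\<lambda>x y i j. x i j \<oplus>\<^bsub>D\<^esub> y i j)"
  "zero (gl m n D) = (\<lambda>i j. \<zero>\<^bsub>D\<^esub>)" "smult (gl m n D) = (\<lambda>r x i j. r \<odot>\<^bsub>D\<^esub> x i j)"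
  "grade (gl m n D) = grade (gl_supermodule m n D)" "bracket (gl m n D) = gl_bracket m n D"
  by (simp_all add: gl_def gl_supermodule_simps)

context superdialgebra
begin

lemma gl_a_inv:
  assumes "x \<in> carrier (gl_supermodule m n D)"
  shows "\<ominus>\<^bsub>gl m n D\<^esub> x = (\<lambda>i j. \<ominus> x i j)"
proof -
  interpret G: leibniz_superalgebra R "gl m n D" by (rule leibniz_superalgebra_gl)
  show ?thesis
    by (rule G.minus_equality)
      (use assms in \<open>auto simp: fun_eq_iff l_neg a_inv_zero gl_outside intro!: gl_carrierI\<close>)
qed

lemma gl_koszul:
  "x \<in> carrier (gl_supermodule m n D) \<Longrightarrow>
   koszul (gl m n D) p q x = (\<lambda>i j. koszul D p q (x i j))"
  by (simp add: koszul_def gl_a_inv)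

lemma gl_a_minus:
  "y \<in> carrier (gl_supermodule m n D) \<Longrightarrow> x \<ominus>\<^bsub>gl m n D\<^esub> y = (\<lambda>i j. x i j \<ominus> y i j)"
  by (simp add: a_minus_def gl_a_inv)

lemma mat_unit_closed [simp, intro]:
  "\<lbrakk>i \<in> {1..m + n}; j \<in> {1..m + n}; a \<in> carrier D\<rbrakk> \<Longrightarrow> mat_unit D i j a \<in> carrier (gl_supermodule m n D)"
  by (rule gl_carrierI) (auto simp: mat_unit_def)

lemma mat_unit_grade:
  assumes "i \<in> {1..m + n}" "j \<in> {1..m + n}" "a \<in> grade D p"
  shows "mat_unit D i j a \<in> grade (gl_supermodule m n D) (idx_deg m i + idx_deg m j + p)"
proof -
  have "idx_deg m i + idx_deg m j + p + idx_deg m i + idx_deg m j = p"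
    by (simp add: ac_simps)
  then show ?thesis
    using assms mat_unit_closed[OF assms(1,2)] grade_carrier
    by (auto simp: gl_supermodule_simps(5) mat_unit_def simp del: add.assoc)
qed

lemma gl_bracket_mat_unit:
  assumes ij: "i \<in> {1..m + n}" "j \<in> {1..m + n}" "k \<in> {1..m + n}" "l \<in> {1..m + n}"
    and a: "a \<in> grade D p" and b: "b \<in> grade D q"
  shows "gl_bracket m n D (mat_unit D i j a) (mat_unit D k l b) =
    (\<lambda>x y. (if j = k then mat_unit D i l (a \<stileturn> b) else (\<lambda>i j. \<zero>)) x y \<ominus>
      koszul D (idx_deg m i + idx_deg m j + p) (idx_deg m k + idx_deg m l + q)
        ((if i = l then mat_unit D k j (b \<turnstile> a) else (\<lambda>i j. \<zero>)) x y))"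
proof -
  let ?M = "mat_dialgebra m n D"
  interpret gl: superdialgebra R ?M by (rule superdialgebra_mat)
  interpret G: leibniz_superalgebra R "gl m n D" by (rule leibniz_superalgebra_gl)
  note c = a[THEN grade_carrier] b[THEN grade_carrier]
  have "a_inv ?M = a_inv (gl m n D)" by (rule a_inv_cong) (simp_all add: gl_supermodule_simps)
  then have inv: "(\<ominus>\<^bsub>?M\<^esub> x) = (\<lambda>i j. \<ominus> x i j)" if "x \<in> carrier (gl_supermodule m n D)" for x
    using gl_a_inv[OF that] by simp
  define u where "u = (if j = k then mat_unit D i l (a \<stileturn> b) else (\<lambda>i j. \<zero>))"
  define v where "v = (if i = l then mat_unit D k j (b \<turnstile> a) else (\<lambda>i j. \<zero>))"
  have uv: "u \<in> carrier (gl_supermodule m n D)" "v \<in> carrier (gl_supermodule m n D)"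
    using ij c by (auto simp: u_def v_def intro!: gl_carrierI simp: mat_unit_def)
  have "gl_bracket m n D (mat_unit D i j a) (mat_unit D k l b) =
      super_commutator ?M (mat_unit D i j a) (mat_unit D k l b)"
    using ij c by (intro gl_bracket_eq_super_commutator) auto
  also have "\<dots> = mat_ldia (m + n) D (mat_unit D i j a) (mat_unit D k l b) \<ominus>\<^bsub>?M\<^esub>
      koszul ?M (idx_deg m i + idx_deg m j + p) (idx_deg m k + idx_deg m l + q)
        (mat_rdia (m + n) D (mat_unit D k l b) (mat_unit D i j a))"
    using gl.super_commutator_homogeneous[of "mat_unit D i j a" "idx_deg m i + idx_deg m j + p"
      "mat_unit D k l b" "idx_deg m k + idx_deg m l + q"] mat_unit_grade ij a b by simp
  also have "mat_ldia (m + n) D (mat_unit D i j a) (mat_unit D k l b) = u"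
    using ij c by (simp add: u_def mat_dia_eq_mat_mult mat_mult_mat_unit[OF ldia_bilinear])
  also have "mat_rdia (m + n) D (mat_unit D k l b) (mat_unit D i j a) = v"
    using ij c by (auto simp: v_def mat_dia_eq_mat_mult mat_mult_mat_unit[OF rdia_bilinear])
  also have "u \<ominus>\<^bsub>?M\<^esub> koszul ?M r s v = (\<lambda>x y. u x y \<ominus> koszul D r s (v x y))" for r s
  proof -
    have "(\<lambda>i j. \<ominus> v i j) \<in> carrier (gl_supermodule m n D)"
      using gl.a_inv_closed[of v] uv by (simp add: inv)
    then show ?thesis
      using uv by (auto simp: fun_eq_iff a_minus_def koszul_def inv gl_supermodule_simps(3))
  qed
  finally show ?thesis unfolding u_def v_def .
qed

lemma gl_unit_span:
  assumes N: "submodule N R (gl m n D)"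
    and unit: "\<And>i j a p. \<lbrakk>i \<in> {1..m + n}; j \<in> {1..m + n}; a \<in> grade D p\<rbrakk> \<Longrightarrow> mat_unit D i j a \<in> N"
  shows "N = carrier (gl m n D)"
proof -
  interpret G: leibniz_superalgebra R "gl m n D" by (rule leibniz_superalgebra_gl)
  note sub = G.submoduleE[OF N]
  have unit': "mat_unit D i j a \<in> N" if "i \<in> {1..m + n}" "j \<in> {1..m + n}" "a \<in> carrier D" for i j a
  proof -
    have "mat_unit D i j a = mat_unit D i j (homog_comp D 0 a) \<oplus>\<^bsub>gl m n D\<^esub> mat_unit D i j (homog_comp D 1 a)"
      using homog_comp_sum[OF that(3), of 0] by (auto simp: mat_unit_def fun_eq_iff)
    moreover have "\<dots> \<in> N"
      by (intro sub(5) unit[OF that(1,2) homog_comp_grade[OF that(3)]])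
    ultimately show ?thesis by metis
  qed
  have "x \<in> N" if x: "x \<in> carrier (gl m n D)" for x
  proof -
    let ?I = "{1..m + n} \<times> {1..m + n}"
    define f where "f s = mat_unit D (fst s) (snd s) (x (fst s) (snd s))" for s
    have f: "f s \<in> N" if "s \<in> ?I" for s using that unit' x by (auto simp: f_def)
    then have fc: "f \<in> ?I \<rightarrow> carrier (gl m n D)" using sub(1) by (auto simp del: gl_simps)
    have "finsum (gl m n D) f ?I \<in> N" 
    proof -
      have "finsum (gl m n D) f T \<in> N" if "T \<subseteq> ?I" for T
        using finite_subset[OF that finite_SigmaI[OF finite_atLeastAtMost finite_atLeastAtMost]] that
      proof (induction T rule: finite_induct)
        case empty
        show ?case using G.submodule_zero[OF N] by simp
      next
        case (insert s T)
        have "finsum (gl m n D) f (insert s T) = f s \<oplus>\<^bsub>gl m n D\<^esub> finsum (gl m n D) f T"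
          using insert fc by (intro G.finsum_insert) blast+
        then show ?case using insert f sub(5) by auto
      qed
      then show ?thesis by blast
    qed
    moreover have "finsum (gl m n D) f ?I = x"
    proof (intro ext)
      fix i j
      have "finsum (gl m n D) f ?I i j = (\<Oplus>s\<in>?I. f s i j)"
        using additive_map_finsum[OF G.abelian_group_axioms abelian_group_axioms, of "\<lambda>x. x i j" f ?I] fc
        by (simp add: additive_map_def)
      also have "\<dots> = (\<Oplus>s\<in>?I. if (i, j) = s then x (fst s) (snd s) else \<zero>)"
        using x by (intro finsum_cong') (auto simp: mat_unit_def f_def)
      also have "\<dots> = x i j"
      proof (cases "(i, j) \<in> ?I")
        case True
        then show ?thesis using x finsum_singleton[of "(i, j)" ?I "\<lambda>s. x (fst s) (snd s)"] by auto
      next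
        case False
        then have "(\<Oplus>s\<in>?I. if (i, j) = s then x (fst s) (snd s) else \<zero>) = \<zero>"
          by (intro add.finprod_one_eqI) auto
        then show ?thesis using gl_outside[of x m n i j] x False by auto
      qed
      finally show "finsum (gl m n D) f ?I i j = x i j" .
    qed
    ultimately show ?thesis by simp
  qed
  then show ?thesis using sub(1) by blast
qed

end

section \<open>The canonical homomorphism onto the special linear algebra\<close>

locale steinberg4 = steinberg R D 4 0
  for R :: "('r, 's) ring_scheme" and D :: "('r, 'd) superdialgebra" (structure) +
  fixes e :: 'd
  assumes bar_unit: "bar_unit D e"
begin

abbreviation G :: "('r, nat \<Rightarrow> nat \<Rightarrow> 'd) leibniz_superalgebra" where "G \<equiv> gl 4 0 D"
abbreviation E :: "nat \<Rightarrow> nat \<Rightarrow> 'd \<Rightarrow> nat \<Rightarrow> nat \<Rightarrow> 'd" where "E \<equiv> mat_unit D"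
abbreviation gF :: "nat \<Rightarrow> nat \<Rightarrow> 'd \<Rightarrow> ('r, 'd) stl_term set" where "gF i j a \<equiv> cls (Gen i j a)"
abbreviation \<phi> :: "('r, 'd) stl_term set \<Rightarrow> nat \<Rightarrow> nat \<Rightarrow> 'd" where "\<phi> \<equiv> stl_to_sl 4 0 D"
abbreviation I :: "nat set" where "I \<equiv> {1..4}"

lemma e_grade [simp, intro]: "e \<in> grade D 0"
  and e_closed [simp, intro]: "e \<in> carrier D"
  and ldia_e [simp]: "a \<in> carrier D \<Longrightarrow> a \<stileturn> e = a"
  and rdia_e [simp]: "a \<in> carrier D \<Longrightarrow> e \<turnstile> a = a"
  using bar_unit grade_carrier by (auto simp: bar_unit_def)

lemma idx_deg_I [simp]: "i \<in> I \<Longrightarrow> idx_deg 4 i = 0"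
  by (simp add: idx_deg_def)

lemma offdiag_iff: "offdiag 4 0 i j \<longleftrightarrow> i \<in> I \<and> j \<in> I \<and> i \<noteq> j"
  by (simp add: offdiag_def)

lemma fourth_index: "\<exists>k\<in>I. k \<noteq> i \<and> k \<noteq> j \<and> k \<noteq> (l::nat)"
proof -
  have "card ({1..4} - {i, j, l}) \<ge> card {1..4::nat} - card {i, j, l}" by (rule diff_card_le_card_Diff) simp
  moreover have "card {i, j, l} \<le> 3" by (simp add: card_insert_if)
  ultimately have "card ({1..4} - {i, j, l}) > 0" by simp
  then show ?thesis unfolding card_gt_0_iff by blast
qed

sublocale G: leibniz_superalgebra R G by (rule leibniz_superalgebra_gl)

lemma E_closed [simp, intro]: "\<lbrakk>i \<in> I; j \<in> I; a \<in> carrier D\<rbrakk> \<Longrightarrow> E i j a \<in> carrier G"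
  using mat_unit_closed[of i 4 0 j a] by simp

lemma E_grade [simp, intro]: "\<lbrakk>i \<in> I; j \<in> I; a \<in> grade D p\<rbrakk> \<Longrightarrow> E i j a \<in> grade G p"
  using mat_unit_grade[of i 4 0 j a p] by simp

lemma E_add: "\<lbrakk>a \<in> carrier D; b \<in> carrier D\<rbrakk> \<Longrightarrow> E i j (a \<oplus> b) = E i j a \<oplus>\<^bsub>G\<^esub> E i j b"
  by (simp add: mat_unit_def fun_eq_iff)

lemma E_smult: "r \<in> carrier R \<Longrightarrow> E i j (r \<odot> a) = r \<odot>\<^bsub>G\<^esub> E i j a"
  by (simp add: mat_unit_def fun_eq_iff)

lemma G_minus: "x \<in> carrier G \<Longrightarrow> \<ominus>\<^bsub>G\<^esub> x = (\<lambda>i j. \<ominus> x i j)"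
  by (simp add: gl_a_inv)

lemma G_bracket_E:
  assumes "i \<in> I" "j \<in> I" "k \<in> I" "l \<in> I" and a: "a \<in> grade D p" and b: "b \<in> grade D q"
  shows "bracket G (E i j a) (E k l b) = (if j = k then E i l (a \<stileturn> b) else \<zero>\<^bsub>G\<^esub>) \<ominus>\<^bsub>G\<^esub>
    koszul G p q (if i = l then E k j (b \<turnstile> a) else \<zero>\<^bsub>G\<^esub>)"
proof -
  define v where "v = (if i = l then E k j (b \<turnstile> a) else \<zero>\<^bsub>G\<^esub>)"
  have v: "v \<in> carrier G" using assms(1-4) a b grade_carrier by (simp add: v_def del: gl_simps)
  then have kc: "koszul G p q v \<in> carrier G" by blast
  have "u \<ominus>\<^bsub>G\<^esub> koszul G p q v = (\<lambda>x y. u x y \<ominus> koszul D p q (v x y))" for u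
    using v kc by (simp add: gl_koszul gl_a_minus)
  then show ?thesis
    using gl_bracket_mat_unit[of i 4 0 j k l a p b q] assms unfolding v_def by simp
qed

lemma G_bracket_E_left:
  "\<lbrakk>i \<in> I; j \<in> I; l \<in> I; i \<noteq> l; a \<in> grade D p; b \<in> grade D q\<rbrakk> \<Longrightarrow>
   bracket G (E i j a) (E j l b) = E i l (a \<stileturn> b)"
  using G_bracket_E[of i j j l a p b q] G.diff_zero[of "E i l (a \<stileturn> b)"] grade_carrier
  by (simp del: gl_simps)

lemma G_bracket_E_right:
  "\<lbrakk>i \<in> I; j \<in> I; k \<in> I; j \<noteq> k; a \<in> grade D p; b \<in> grade D q\<rbrakk> \<Longrightarrow>
   bracket G (E i j a) (E k i b) = \<ominus>\<^bsub>G\<^esub> koszul G p q (E k j (b \<turnstile> a))"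
  using G_bracket_E[of i j k i a p b q] G.zero_diff[of "koszul G p q (E k j (b \<turnstile> a))"] grade_carrier
  by (simp del: gl_simps)

lemma G_bracket_E_zero:
  "\<lbrakk>i \<in> I; j \<in> I; k \<in> I; l \<in> I; i \<noteq> l; j \<noteq> k; a \<in> grade D p; b \<in> grade D q\<rbrakk> \<Longrightarrow>
   bracket G (E i j a) (E k l b) = \<zero>\<^bsub>G\<^esub>"
  using G_bracket_E[of i j k l a p b q] G.diff_zero[OF G.zero_closed] by (simp del: gl_simps)

sublocale can: steinberg_family R D 4 0 G E
  by unfold_locales
    (auto simp: offdiag_iff E_add E_smult G_bracket_E_left G_bracket_E_right G_bracket_E_zero
      simp del: gl_simps simp: grade_carrier)

lemma stl_eval_eq_ev: "wf t \<Longrightarrow> stl_eval 4 0 D t = can.ev t"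
  by (induction rule: stl_wf.induct)
    (simp_all del: gl_simps add: G_minus can.ev_closed)

lemma stl_to_sl_eq_lift: "x \<in> carrier S \<Longrightarrow> \<phi> x = stl_lift G E x"
proof -
  assume "x \<in> carrier S"
  then obtain t where t: "wf t" "x = cls t" by blast
  then have "(SOME t. t \<in> x) \<in> x" using someI[of "\<lambda>s. s \<in> x" t] mem_cls by blast
  then have "wf (SOME t. t \<in> x)" using t eqv_wf by (auto simp: stl_class_def)
  then show ?thesis by (simp add: stl_to_sl_def stl_lift_def stl_eval_eq_ev)
qed

lemma \<phi>_hom: "\<phi> \<in> leibniz_hom R S G"
  using can.stl_lift_hom S.grade_carrier unfolding leibniz_hom_def
  by (auto simp: stl_to_sl_eq_lift simp del: gl_simps) 

lemmas \<phi>_simps = leibniz_hom_add[OF \<phi>_hom] leibniz_hom_smult[OF \<phi>_hom] leibniz_hom_bracket[OF \<phi>_hom]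
  and \<phi>_closed [simp, intro] = leibniz_hom_closed[OF \<phi>_hom]
  and \<phi>_grade [simp, intro] = leibniz_hom_grade[OF \<phi>_hom]
  and \<phi>_additive = leibniz_hom_linear[OF \<phi>_hom, THEN linear_map_additive]

lemma \<phi>_minus: "x \<in> carrier S \<Longrightarrow> \<phi> (\<ominus>\<^bsub>S\<^esub> x) = \<ominus>\<^bsub>G\<^esub> \<phi> x"
  and \<phi>_zero: "\<phi> \<zero>\<^bsub>S\<^esub> = \<zero>\<^bsub>G\<^esub>"
  using additive_map_minus[OF S.abelian_group_axioms G.abelian_group_axioms \<phi>_additive]
    additive_map_zero[OF S.abelian_group_axioms G.abelian_group_axioms \<phi>_additive]
  by (simp_all del: gl_simps)

lemma gF_closed [simp, intro]: "\<lbrakk>i \<in> I; j \<in> I; i \<noteq> j; a \<in> grade D p\<rbrakk> \<Longrightarrow> gF i j a \<in> carrier S"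
  by (rule cls_closed[OF wf_gen]) (auto simp: offdiag_iff)

lemma gF_grade [simp, intro]: "\<lbrakk>i \<in> I; j \<in> I; i \<noteq> j; a \<in> grade D p\<rbrakk> \<Longrightarrow> gF i j a \<in> grade S p"
  by (rule cls_grade[OF deg_Gen]) (auto simp: offdiag_iff)

lemma \<phi>_gF [simp]: "\<lbrakk>i \<in> I; j \<in> I; i \<noteq> j; a \<in> grade D p\<rbrakk> \<Longrightarrow> \<phi> (gF i j a) = E i j a"
  using can.stl_lift_Gen[of i j a p] gF_closed[of i j a p]
  by (simp add: stl_to_sl_eq_lift offdiag_iff del: gl_simps)

lemma S_submodule_vimage:
  assumes N: "submodule N R G"
  shows "submodule {x \<in> carrier S. \<phi> x \<in> N} R S"
proof (rule S.submoduleI)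
  note sub = G.submoduleE[OF N]
  have z: "\<zero>\<^bsub>G\<^esub> \<in> N" by (rule G.submodule_zero[OF N])
  show "\<zero>\<^bsub>S\<^esub> \<in> {x \<in> carrier S. \<phi> x \<in> N}" using z by (simp add: \<phi>_zero del: gl_simps)
qed (use G.submoduleE[OF N] in \<open>auto simp: \<phi>_simps \<phi>_minus simp del: gl_simps\<close>)

lemma E_bracket_form:
  assumes "i \<in> I" "l \<in> I" "i \<noteq> l" "a \<in> grade D p"
  shows "\<exists>j\<in>I. j \<noteq> i \<and> j \<noteq> l \<and> E i l a = bracket G (E i j a) (E j l e)"
proof -
  obtain j where j: "j \<in> I" "j \<noteq> i" "j \<noteq> l" using fourth_index[of i l l] by blast
  then show ?thesis using G_bracket_E_left[of i j l a p e 0] assms grade_carrier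
    by (intro bexI[of _ j]) (simp_all del: gl_simps)
qed

lemma image_\<phi>_submodule: "submodule (\<phi> ` carrier S) R G"
proof (rule G.submoduleI)
  show "\<zero>\<^bsub>G\<^esub> \<in> \<phi> ` carrier S" using \<phi>_zero S.zero_closed by (metis imageI)
qed (auto simp flip: \<phi>_minus \<phi>_simps(1,2) simp del: gl_simps)

lemma E_in_image: "\<lbrakk>i \<in> I; j \<in> I; i \<noteq> j; a \<in> grade D p\<rbrakk> \<Longrightarrow> E i j a \<in> \<phi> ` carrier S"
  using \<phi>_gF gF_closed by (metis imageI)

text \<open>
  A single diagonal unit is in general not in the image, but the difference of two diagonal units
  with the same coefficient is the bracket of two opposite units.
\<close>

lemma E_diag_in_image:
  assumes "i \<in> I" "j \<in> I" "a \<in> grade D p"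
  shows "E i i a \<ominus>\<^bsub>G\<^esub> E j j a \<in> \<phi> ` carrier S"
proof (cases "i = j")
  case True
  then show ?thesis
    using G.submoduleE(2,4)[OF image_\<phi>_submodule] assms \<phi>_zero S.zero_closed grade_carrier
    by (metis E_closed G.diff_self imageI)
next
  case False
  have "E i i a \<ominus>\<^bsub>G\<^esub> E j j a = bracket G (E i j a) (E j i e)"
    using G_bracket_E[of i j j i a p e 0] assms grade_carrier by (simp del: gl_simps)
  also have "\<dots> = \<phi> (bracket S (gF i j a) (gF j i e))"
    using assms False by (simp add: \<phi>_simps gF_closed[of _ _ _ p] gF_closed[of _ _ _ 0] \<phi>_gF[of _ _ _ p] \<phi>_gF[of _ _ _ 0] del: gl_simps)
  finally show ?thesis using assms False gF_closed[of i j a p] gF_closed[of j i e 0] by auto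
qed

lemma bracket_units_in_image:
  assumes "i \<in> I" "j \<in> I" "k \<in> I" "l \<in> I" and a: "a \<in> grade D p" and b: "b \<in> grade D q"
  shows "bracket G (E i j a) (E k l b) \<in> \<phi> ` carrier S"
proof -
  note J = G.submoduleE[OF image_\<phi>_submodule]
  note c = a[THEN grade_carrier] b[THEN grade_carrier]
  have z: "\<zero>\<^bsub>G\<^esub> \<in> \<phi> ` carrier S" using \<phi>_zero S.zero_closed by (metis imageI)
  have kJ: "koszul G r s x \<in> \<phi> ` carrier S" if "x \<in> \<phi> ` carrier S" for r s x
    using that J(3) by (simp add: koszul_def)
  have dJ: "x \<ominus>\<^bsub>G\<^esub> y \<in> \<phi> ` carrier S" if "x \<in> \<phi> ` carrier S" "y \<in> \<phi> ` carrier S" for x y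
    using that J(3,5) by (simp add: a_minus_def)
  have ba: "b \<turnstile> a \<in> grade D (q + p)" "a \<stileturn> b \<in> grade D (p + q)" using a b by blast+
  show ?thesis
  proof (cases "j = k \<and> i = l")
    case False
    then show ?thesis unfolding G_bracket_E[OF assms] using ba
      by (intro dJ kJ) (auto simp del: gl_simps intro: z E_in_image[OF _ _ _ ba(1)] E_in_image[OF _ _ _ ba(2)] assms)
  next
    case True
    note jk = True
    show ?thesis
    proof (cases "i = j")
      case False
      have "bracket G (E i j a) (E k l b) = \<phi> (bracket S (gF i j a) (gF k l b))"
        using assms False jk by (simp add: \<phi>_simps gF_closed[OF _ _ _ a] gF_closed[OF _ _ _ b]
            \<phi>_gF[OF _ _ _ a] \<phi>_gF[OF _ _ _ b] del: gl_simps)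
      then show ?thesis using assms False jk gF_closed[OF _ _ _ a] gF_closed[OF _ _ _ b] by auto
    next
      case True
      \<comment> \<open>Move one of the two diagonal entries to another place, where it is part of a bracket
        of off-diagonal units.\<close>
      obtain h where h: "h \<in> I" "h \<noteq> i" using fourth_index[of i i i] by blast
      have "bracket G (E i j a) (E k l b) = E i i (a \<stileturn> b) \<ominus>\<^bsub>G\<^esub> koszul G p q (E i i (b \<turnstile> a))"
        using jk True unfolding G_bracket_E[OF assms] by auto
      also have "\<dots> = (E i i (a \<stileturn> b) \<ominus>\<^bsub>G\<^esub> koszul G p q (E h h (b \<turnstile> a))) \<ominus>\<^bsub>G\<^esub>
          koszul G p q (E i i (b \<turnstile> a) \<ominus>\<^bsub>G\<^esub> E h h (b \<turnstile> a))"
      proof -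
        have "E i i (a \<stileturn> b) \<in> carrier G" "E i i (b \<turnstile> a) \<in> carrier G" "E h h (b \<turnstile> a) \<in> carrier G"
          using assms h c by (auto simp del: gl_simps)
        then show ?thesis unfolding koszul_def by (simp del: gl_simps; algebra)
      qed
      also have "E i i (a \<stileturn> b) \<ominus>\<^bsub>G\<^esub> koszul G p q (E h h (b \<turnstile> a)) = bracket G (E i h a) (E h i b)"
        using G_bracket_E[of i h h i a p b q] assms h by (simp del: gl_simps)
      also have "\<dots> = \<phi> (bracket S (gF i h a) (gF h i b))"
        using assms h by (simp add: \<phi>_simps gF_closed[OF _ _ _ a] gF_closed[OF _ _ _ b]
            \<phi>_gF[OF _ _ _ a] \<phi>_gF[OF _ _ _ b] del: gl_simps)
      also have "\<phi> (bracket S (gF i h a) (gF h i b)) \<ominus>\<^bsub>G\<^esub>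
          koszul G p q (E i i (b \<turnstile> a) \<ominus>\<^bsub>G\<^esub> E h h (b \<turnstile> a)) \<in> \<phi> ` carrier S"
        using gF_closed[OF _ _ _ a, of i h] gF_closed[OF _ _ _ b, of h i] assms h
        by (intro dJ kJ E_diag_in_image[OF _ _ ba(1)]) auto
      finally show ?thesis .
    qed
  qed
qed

lemma G_brackets_in_submodule:
  assumes N: "submodule N R G"
    and units: "\<And>i j k l a b p q. \<lbrakk>i \<in> I; j \<in> I; k \<in> I; l \<in> I; a \<in> grade D p; b \<in> grade D q\<rbrakk> \<Longrightarrow>
      bracket G (E i j a) (E k l b) \<in> N"
    and xy: "x \<in> carrier G" "y \<in> carrier G"
  shows "bracket G x y \<in> N"
proof -
  note J = G.submoduleE[OF N]
  have z: "\<zero>\<^bsub>G\<^esub> \<in> N" by (rule G.submodule_zero[OF N])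
  have 1: "{y \<in> carrier G. bracket G (E i j a) y \<in> N} = carrier G"
    if "i \<in> I" "j \<in> I" "a \<in> grade D p" for i j a p
  proof (rule gl_unit_span[OF G.submoduleI])
    have c: "E i j a \<in> carrier G" using that grade_carrier by blast
    show "\<zero>\<^bsub>G\<^esub> \<in> {y \<in> carrier G. bracket G (E i j a) y \<in> N}"
      using c z by (simp del: gl_simps)
    show "E k l b \<in> {y \<in> carrier G. bracket G (E i j a) y \<in> N}"
      if "k \<in> {1..4 + 0}" "l \<in> {1..4 + 0}" "b \<in> grade D q" for k l b q
      using that units[OF \<open>i \<in> I\<close> \<open>j \<in> I\<close> _ _ \<open>a \<in> grade D p\<close>] grade_carrier by (auto simp del: gl_simps)
  qed (use J grade_carrier that in \<open>auto simp: G.bracket_add G.bracket_minus G.bracket_smult simp del: gl_simps\<close>)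
  have "{x \<in> carrier G. \<forall>y\<in>carrier G. bracket G x y \<in> N} = carrier G"
  proof (rule gl_unit_span[OF G.submoduleI])
    show "\<zero>\<^bsub>G\<^esub> \<in> {x \<in> carrier G. \<forall>y\<in>carrier G. bracket G x y \<in> N}"
      using z by (simp del: gl_simps)
    show "E i j a \<in> {x \<in> carrier G. \<forall>y\<in>carrier G. bracket G x y \<in> N}"
      if "i \<in> {1..4 + 0}" "j \<in> {1..4 + 0}" "a \<in> grade D p" for i j a p
      using that 1[of i j a p] grade_carrier by (auto simp del: gl_simps)
  qed (use J in \<open>auto simp: G.bracket_add G.bracket_minus G.bracket_smult simp del: gl_simps\<close>)
  then show ?thesis using xy by blast
qed

text \<open>
  The generators map to brackets of matrix units, because a further index is available; conversely
  all brackets of matrix units are images of elements of \<open>S\<close>.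
\<close>

lemma carrier_sl: "carrier (sl R 4 0 D) = \<phi> ` carrier S"
proof -
  let ?C = "\<Inter>{N. submodule N R G \<and> (\<forall>x\<in>carrier G. \<forall>y\<in>carrier G. bracket G x y \<in> N)}"
  have "\<phi> ` carrier S \<subseteq> N"
    if N: "submodule N R G" and b: "\<forall>x\<in>carrier G. \<forall>y\<in>carrier G. bracket G x y \<in> N" for N
  proof -
    have "{x \<in> carrier S. \<phi> x \<in> N} = carrier S"
    proof (rule S_left_normed_induct[OF S_submodule_vimage[OF N]])
      show "gF i j a \<in> {x \<in> carrier S. \<phi> x \<in> N}" if "offdiag 4 0 i j" "a \<in> grade D p" for i j a p
        using that E_bracket_form[of i j a p] b gF_closed[of i j a p] \<phi>_gF[of i j a p] grade_carrier
        by (auto simp: offdiag_iff simp del: gl_simps intro!: b)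
      show "bracket S x (gF i j a) \<in> {x \<in> carrier S. \<phi> x \<in> N}"
        if "x \<in> {x \<in> carrier S. \<phi> x \<in> N}" "offdiag 4 0 i j" "a \<in> grade D p" for x i j a p
      proof -
        have "gF i j a \<in> carrier S" using that gF_closed[of i j a p] by (simp add: offdiag_iff)
        then have "bracket S x (gF i j a) \<in> carrier S"
          "\<phi> (bracket S x (gF i j a)) = bracket G (\<phi> x) (\<phi> (gF i j a))"
          "\<phi> x \<in> carrier G" "\<phi> (gF i j a) \<in> carrier G"
          using that by (auto simp: \<phi>_simps simp del: gl_simps)
        then show ?thesis using b by (simp del: gl_simps)
      qed
    qed
    then show ?thesis by blast
  qed
  moreover have "?C \<subseteq> \<phi> ` carrier S"
  proof -
    have "bracket G x y \<in> \<phi> ` carrier S" if "x \<in> carrier G" "y \<in> carrier G" for x y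
      by (rule G_brackets_in_submodule[OF image_\<phi>_submodule _ that]) (rule bracket_units_in_image)
    then show ?thesis using image_\<phi>_submodule by blast
  qed
  ultimately have "?C = \<phi> ` carrier S" by blast
  then show ?thesis by (simp add: sl_def derived_algebra_def Let_def)
qed

lemma sl_eq: "sl R 4 0 D = G\<lparr>carrier := \<phi> ` carrier S, grade := (\<lambda>p. grade G p \<inter> \<phi> ` carrier S)\<rparr>"
  using carrier_sl by (simp add: sl_def derived_algebra_def Let_def)

abbreviation L :: "('r, nat \<Rightarrow> nat \<Rightarrow> 'd) leibniz_superalgebra" where "L \<equiv> sl R 4 0 D"

lemma sl_simps:
  "add L = add G" "zero L = zero G" "smult L = smult G" "bracket L = bracket G"
  "grade L p = grade G p \<inter> carrier L"
  by (simp_all add: sl_eq del: gl_simps)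

lemma sl_carrier_G: "x \<in> carrier L \<Longrightarrow> x \<in> carrier G"
  by (auto simp: carrier_sl simp del: gl_simps)

lemma sl_leibniz: "leibniz_superalgebra R L"
  unfolding sl_eq
proof (rule G.leibniz_superalgebra_sub[OF image_\<phi>_submodule])
  show "bracket G x y \<in> \<phi> ` carrier S" if "x \<in> \<phi> ` carrier S" "y \<in> \<phi> ` carrier S" for x y
    using that by (auto simp flip: \<phi>_simps simp del: gl_simps)
  show "homog_comp G p x \<in> \<phi> ` carrier S" if x: "x \<in> \<phi> ` carrier S" for x p
  proof -
    obtain s where s: "s \<in> carrier S" "x = \<phi> s" using x by blast
    have "x = \<phi> (homog_comp S p s) \<oplus>\<^bsub>G\<^esub> \<phi> (homog_comp S (p + 1) s)"
      using s S.homog_comp_sum[of s p] by (simp flip: \<phi>_simps(1) del: gl_simps)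
    then have "homog_comp G p x = \<phi> (homog_comp S p s)"
      using s by (simp add: G.homog_comp_eq[of _ p] \<phi>_grade del: gl_simps)
    then show ?thesis using s by blast
  qed
qed

sublocale L: leibniz_superalgebra R L by (rule sl_leibniz)

lemma \<phi>_hom_sl: "\<phi> \<in> leibniz_hom R S L"
  using \<phi>_hom unfolding leibniz_hom_def
  by (auto simp: sl_simps carrier_sl simp del: gl_simps elim!: S_gradeE intro!: imageI dest: deg_wf)

lemma \<phi>_surj: "\<phi> ` carrier S = carrier L"
  by (simp add: carrier_sl)

end

section \<open>The kernel of the canonical homomorphism is central\<close>

context steinberg4
begin

lemma gF_add: "\<lbrakk>i \<in> I; j \<in> I; i \<noteq> j; a \<in> grade D p; b \<in> grade D p\<rbrakk> \<Longrightarrow>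
    gF i j (a \<oplus> b) = gF i j a \<oplus>\<^bsub>S\<^esub> gF i j b"
  using clsI[OF stl_eq.gen_add[of 4 0 i j a D p b R]] wf_gen[of i j] by (simp add: offdiag_iff S_ops)

lemma gF_smult: "\<lbrakk>i \<in> I; j \<in> I; i \<noteq> j; a \<in> grade D p; r \<in> carrier R\<rbrakk> \<Longrightarrow>
    gF i j (r \<odot> a) = r \<odot>\<^bsub>S\<^esub> gF i j a"
  using clsI[OF stl_eq.gen_scal[of 4 0 i j r R a D p]] wf_gen[of i j] by (simp add: offdiag_iff S_ops)

lemma gF_zero: "\<lbrakk>i \<in> I; j \<in> I; i \<noteq> j\<rbrakk> \<Longrightarrow> gF i j \<zero> = \<zero>\<^bsub>S\<^esub>"
  by (simp add: cls_Gen_zero offdiag_iff)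

lemma S_bracket_left:
  "\<lbrakk>i \<in> I; j \<in> I; l \<in> I; i \<noteq> j; j \<noteq> l; i \<noteq> l; a \<in> grade D p; b \<in> grade D q\<rbrakk> \<Longrightarrow>
   bracket S (gF i j a) (gF j l b) = gF i l (a \<stileturn> b)"
  using clsI[OF stl_eq.rel_left[of 4 0 i j l a D p b q R]] wf_gen[of i j a p] wf_gen[of j l b q]
  by (simp add: offdiag_iff S_ops)

lemma S_bracket_right:
  "\<lbrakk>i \<in> I; j \<in> I; k \<in> I; i \<noteq> j; k \<noteq> i; j \<noteq> k; a \<in> grade D p; b \<in> grade D q\<rbrakk> \<Longrightarrow>
   bracket S (gF i j a) (gF k i b) = \<ominus>\<^bsub>S\<^esub> koszul S p q (gF k j (b \<turnstile> a))"
  using clsI[OF stl_eq.rel_right[of 4 0 i j k a D p b q R]] wf_gen[of i j a p] wf_gen[of k i b q]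
    wf_gen[of k j "b \<turnstile> a" "q + p"]
  by (simp add: offdiag_iff S_ops cls_Minus wf_koszul cls_koszul)

lemma S_bracket_zero:
  "\<lbrakk>i \<in> I; j \<in> I; k \<in> I; l \<in> I; i \<noteq> j; k \<noteq> l; i \<noteq> l; j \<noteq> k; a \<in> grade D p; b \<in> grade D q\<rbrakk> \<Longrightarrow>
   bracket S (gF i j a) (gF k l b) = \<zero>\<^bsub>S\<^esub>"
  using clsI[OF stl_eq.rel_zero[of 4 0 i j k l a D p b q R]] wf_gen[of i j a p] wf_gen[of k l b q]
  by (simp add: offdiag_iff S_ops cls_zero)

text \<open>
  The generators are indexed by homogeneous elements; \<open>Fh\<close> extends them linearly to \<open>D\<close>, and its
  image \<open>W i j\<close> is the root space for the root \<open>(i, j)\<close>.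
\<close>

definition Fh :: "nat \<Rightarrow> nat \<Rightarrow> 'd \<Rightarrow> ('r, 'd) stl_term set" where
  "Fh i j a = gF i j (homog_comp D 0 a) \<oplus>\<^bsub>S\<^esub> gF i j (homog_comp D 1 a)"

definition W :: "nat \<Rightarrow> nat \<Rightarrow> ('r, 'd) stl_term set set" where
  "W i j = Fh i j ` carrier D"

context
  fixes i j assumes ij: "i \<in> I" "j \<in> I" "i \<noteq> j"
begin

lemma Fh_homogeneous: "a \<in> grade D p \<Longrightarrow> Fh i j a = gF i j a"
proof -
  assume a: "a \<in> grade D p"
  have "gF i j a \<in> carrier S" using ij a by blast
  then show ?thesis unfolding Fh_def
    using a homog_comp_other[of a 0 1] homog_comp_other[of a 1 0] ij
    by (cases p) (simp_all add: gF_zero)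
qed

lemma Fh_closed [simp, intro]: "a \<in> carrier D \<Longrightarrow> Fh i j a \<in> carrier S"
  unfolding Fh_def using ij homog_comp_grade by (blast intro: S.M.a_closed)

lemma Fh_add: "\<lbrakk>a \<in> carrier D; b \<in> carrier D\<rbrakk> \<Longrightarrow> Fh i j (a \<oplus> b) = Fh i j a \<oplus>\<^bsub>S\<^esub> Fh i j b"
proof -
  assume ab: "a \<in> carrier D" "b \<in> carrier D"
  then have *: "gF i j (homog_comp D p x) \<in> carrier S" if "x \<in> {a, b}" for p x
    using that ij homog_comp_grade[of x p] by blast
  have "Fh i j (a \<oplus> b) = (gF i j (homog_comp D 0 a) \<oplus>\<^bsub>S\<^esub> gF i j (homog_comp D 0 b)) \<oplus>\<^bsub>S\<^esub>
      (gF i j (homog_comp D 1 a) \<oplus>\<^bsub>S\<^esub> gF i j (homog_comp D 1 b))"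
    using ab ij by (simp add: Fh_def homog_comp_add gF_add[OF ij homog_comp_grade homog_comp_grade])
  also have "\<dots> = Fh i j a \<oplus>\<^bsub>S\<^esub> Fh i j b"
    unfolding Fh_def using * by (simp add: S.M.a_ac)
  finally show ?thesis .
qed

lemma Fh_smult: "\<lbrakk>a \<in> carrier D; r \<in> carrier R\<rbrakk> \<Longrightarrow> Fh i j (r \<odot> a) = r \<odot>\<^bsub>S\<^esub> Fh i j a"
proof -
  assume a: "a \<in> carrier D" "r \<in> carrier R"
  then have *: "gF i j (homog_comp D p a) \<in> carrier S" for p
    using ij homog_comp_grade[of a p] by blast
  show ?thesis
    using a ij * by (simp add: Fh_def homog_comp_smult S.smult_r_distr gF_smult[OF ij homog_comp_grade])
qed

lemma Fh_zero: "Fh i j \<zero> = \<zero>\<^bsub>S\<^esub>"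
  using Fh_homogeneous[OF grade_zero] gF_zero ij by simp

lemma \<phi>_Fh: "a \<in> carrier D \<Longrightarrow> \<phi> (Fh i j a) = E i j a"
proof -
  assume a: "a \<in> carrier D"
  then have *: "gF i j (homog_comp D p a) \<in> carrier S" for p
    using ij homog_comp_grade[of a p] by blast
  have "\<phi> (Fh i j a) = E i j (homog_comp D 0 a) \<oplus>\<^bsub>G\<^esub> E i j (homog_comp D 1 a)"
    unfolding Fh_def using * ij \<phi>_gF[OF ij homog_comp_grade[OF a]] by (simp add: \<phi>_simps del: gl_simps)
  also have "\<dots> = E i j a"
    using a homog_comp_sum[of a 0] by (simp flip: E_add del: gl_simps)
  finally show ?thesis .
qed

lemma W_submodule: "submodule (W i j) R S"
proof (rule S.submoduleI)
  show "\<ominus>\<^bsub>S\<^esub> x \<in> W i j" if x: "x \<in> W i j" for x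
  proof -
    obtain a where a: "a \<in> carrier D" "x = Fh i j a" using x by (auto simp: W_def)
    have "\<ominus>\<^bsub>S\<^esub> x = Fh i j (\<ominus> a)"
      by (rule S.M.minus_equality) (use a in \<open>auto simp flip: Fh_add simp: l_neg Fh_zero\<close>)
    then show ?thesis using a by (auto simp: W_def)
  qed
  show "\<zero>\<^bsub>S\<^esub> \<in> W i j" using Fh_zero by (force simp: W_def)
qed (auto simp: W_def Fh_add[symmetric] Fh_smult[symmetric])

lemmas W_sub = S.submoduleE[OF W_submodule]

lemma W_closed: "x \<in> W i j \<Longrightarrow> x \<in> carrier S"
  using W_sub(1) by blast

lemma W_zero: "\<zero>\<^bsub>S\<^esub> \<in> W i j"
  using Fh_zero by (force simp: W_def)

lemma W_koszul: "x \<in> W i j \<Longrightarrow> koszul S p q x \<in> W i j"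
  using W_sub(3) by (simp add: koszul_def)

lemma W_diff: "\<lbrakk>x \<in> W i j; y \<in> W i j\<rbrakk> \<Longrightarrow> x \<ominus>\<^bsub>S\<^esub> y \<in> W i j"
  using W_sub(3,5) by (simp add: a_minus_def)

lemma gF_W: "a \<in> grade D p \<Longrightarrow> gF i j a \<in> W i j"
  unfolding W_def by (rule image_eqI[of _ _ a]) (simp_all add: Fh_homogeneous grade_carrier)

end

lemma W_induct [consumes 4, case_names gen add]:
  assumes ij: "i \<in> I" "j \<in> I" "i \<noteq> j" and w: "w \<in> W i j"
    and gen: "\<And>a p. a \<in> grade D p \<Longrightarrow> P (gF i j a)"
    and add: "\<And>u v. \<lbrakk>u \<in> carrier S; v \<in> carrier S; P u; P v\<rbrakk> \<Longrightarrow> P (u \<oplus>\<^bsub>S\<^esub> v)"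
  shows "P w"
proof -
  obtain a where a: "a \<in> carrier D" "w = Fh i j a" using w by (auto simp: W_def)
  show ?thesis unfolding a(2) Fh_def
    by (intro add gen[OF homog_comp_grade] gF_closed[OF ij homog_comp_grade] a)
qed

lemma W_bracket_left:
  assumes idx: "i \<in> I" "j \<in> I" "l \<in> I" "i \<noteq> j" "j \<noteq> l" "i \<noteq> l" and u: "u \<in> W i j" and v: "v \<in> W j l"
  shows "bracket S u v \<in> W i l"
proof -
  note W = W_sub(5)[of i l] gF_W[of i l]
  have "bracket S (gF i j a) v \<in> W i l" if a: "a \<in> grade D p" for a p
    using idx(2,3,5) v
  proof (induction v rule: W_induct)
    case (gen b q)
    then show ?case using idx a W(2)[OF _ _ _ dia_grade(1)] by (simp add: S_bracket_left[OF idx a])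
  next
    case (add u v)
    then show ?case using idx a W(1) gF_closed[of i j a p] by (simp add: S.bracket_add)
  qed
  with idx(1,2,4) u show ?thesis
  proof (induction u rule: W_induct)
    case (add u v')
    then show ?case using idx W(1) W_closed[OF idx(2,3,5) v] by (simp add: S.bracket_add)
  qed
qed

lemma W_bracket_right:
  assumes idx: "i \<in> I" "j \<in> I" "k \<in> I" "i \<noteq> j" "k \<noteq> i" "j \<noteq> k" and u: "u \<in> W i j" and v: "v \<in> W k i"
  shows "bracket S u v \<in> W k j"
proof -
  note W = W_sub(3,5)[of k j] gF_W[of k j] W_koszul[of k j]
  have "bracket S (gF i j a) v \<in> W k j" if a: "a \<in> grade D p" for a p
    using idx(3,1,5) v
  proof (induction v rule: W_induct)
    case (gen b q)
    then show ?case using idx a W(1,4) W(3)[OF _ _ _ dia_grade(2)] by (simp add: S_bracket_right[OF idx a])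
  next
    case (add u v)
    then show ?case using idx a W(2) gF_closed[of i j a p] by (simp add: S.bracket_add)
  qed
  with idx(1,2,4) u show ?thesis
  proof (induction u rule: W_induct)
    case (add u v')
    then show ?case using idx W(2) W_closed[OF idx(3,1,5) v] by (simp add: S.bracket_add)
  qed
qed

lemma W_bracket_zero:
  assumes idx: "i \<in> I" "j \<in> I" "k \<in> I" "l \<in> I" "i \<noteq> j" "k \<noteq> l" "i \<noteq> l" "j \<noteq> k"
    and u: "u \<in> W i j" and v: "v \<in> W k l"
  shows "bracket S u v = \<zero>\<^bsub>S\<^esub>"
proof -
  have "bracket S (gF i j a) v = \<zero>\<^bsub>S\<^esub>" if a: "a \<in> grade D p" for a p
    using idx(3,4,6) v
  proof (induction v rule: W_induct)
    case (gen b q)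
    then show ?case using a by (simp add: S_bracket_zero[OF idx a])
  next
    case (add u v)
    then show ?case using idx a gF_closed[of i j a p] by (simp add: S.bracket_add)
  qed
  with idx(1,2,5) u show ?thesis
  proof (induction u rule: W_induct)
    case (add u v')
    then show ?case using idx W_closed[OF idx(3,4,6) v] by (simp add: S.bracket_add)
  qed
qed

definition stable :: "('r, 'd) stl_term set \<Rightarrow> nat \<Rightarrow> nat \<Rightarrow> bool" where
  "stable h k l \<longleftrightarrow> (\<forall>w\<in>W k l. bracket S h w \<in> W k l \<and> bracket S w h \<in> W k l)"

text \<open>
  The elements that normalise every root space; they play the role of the Cartan subalgebra.
\<close>

definition Cart :: "('r, 'd) stl_term set set" where
  "Cart = {h \<in> carrier S. \<forall>k\<in>I. \<forall>l\<in>I. k \<noteq> l \<longrightarrow> stable h k l}"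

lemma stableI:
  assumes kl: "k \<in> I" "l \<in> I" "k \<noteq> l" and h: "h \<in> carrier S"
    and b: "\<And>c r. c \<in> grade D r \<Longrightarrow> bracket S h (gF k l c) \<in> W k l"
      "\<And>c r. c \<in> grade D r \<Longrightarrow> bracket S (gF k l c) h \<in> W k l"
  shows "stable h k l"
  unfolding stable_def
proof
  fix w assume "w \<in> W k l"
  with kl show "bracket S h w \<in> W k l \<and> bracket S w h \<in> W k l"
  proof (induction w rule: W_induct)
    case (gen c r)
    then show ?case using b by blast
  next
    case (add u v)
    then show ?case using h W_sub(5)[OF kl] by (simp add: S.bracket_add)
  qed
qed

text \<open>
  The roots \<open>(i, j)\<close> and \<open>(j, i)\<close> add up to zero, so the iterated brackets lie in the root space of
  \<open>(k, l)\<close>, or vanish if the first sum is not a root. For \<open>(k, l)\<close> equal to one of the two roots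
  the first sum could be zero, and no relation controls the bracket.
\<close>

lemma triple_bracket_W:
  assumes idx: "i \<in> I" "j \<in> I" "k \<in> I" "l \<in> I" "i \<noteq> j" "k \<noteq> l" "(k, l) \<noteq> (i, j)" "(k, l) \<noteq> (j, i)"
    and u: "u \<in> W i j" and v: "v \<in> W j i" and w: "w \<in> W k l"
  shows "bracket S u (bracket S v w) \<in> W k l" "bracket S (bracket S u w) v \<in> W k l"
    "bracket S (bracket S w u) v \<in> W k l"
proof -
  have c [simp]: "u \<in> carrier S" "v \<in> carrier S" "w \<in> carrier S" using W_closed idx u v w by metis+
  have z [simp]: "\<zero>\<^bsub>S\<^esub> \<in> W k l" using W_zero idx by blast
  show "bracket S u (bracket S v w) \<in> W k l"
  proof -
    consider "i = k" | "j = l" | "i \<noteq> k" "j \<noteq> l" by blast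
    then show ?thesis
    proof cases
      case 1
      then show ?thesis
        using idx W_bracket_left[of i j l u] W_bracket_left[of j i l v w] u v w by auto
    next
      case 2
      then show ?thesis
        using idx W_bracket_right[of i j k u] W_bracket_right[of j i k v w] u v w by auto
    next
      case 3
      then show ?thesis using idx W_bracket_zero[of j i k l v w] u v w by auto
    qed
  qed
  show "bracket S (bracket S u w) v \<in> W k l"
  proof -
    consider "j = k" | "i = l" | "j \<noteq> k" "i \<noteq> l" by blast
    then show ?thesis
    proof cases
      case 1
      then show ?thesis
        using idx W_bracket_right[of i l j _ v] W_bracket_left[of i j l u w] u v w by auto
    next
      case 2
      then show ?thesis
        using idx W_bracket_left[of k j i _ v] W_bracket_right[of i j k u w] u v w by auto
    next
      case 3
      then show ?thesis using idx W_bracket_zero[of i j k l u w] u v w by auto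
    qed
  qed
  show "bracket S (bracket S w u) v \<in> W k l"
  proof -
    consider "l = i" | "k = j" | "l \<noteq> i" "k \<noteq> j" by blast
    then show ?thesis
    proof cases
      case 1
      then show ?thesis
        using idx W_bracket_left[of k j i _ v] W_bracket_left[of k i j w u] u v w by auto
    next
      case 2
      then show ?thesis
        using idx W_bracket_right[of i l j _ v] W_bracket_right[of j l i w u] u v w by auto
    next
      case 3
      then show ?thesis using idx W_bracket_zero[of k l i j w u] u v w by auto
    qed
  qed
qed

text \<open>
  As \<open>W k l\<close> is spanned by brackets of \<open>W k r\<close> with \<open>W r l\<close>, the Leibniz identity reduces the root
  \<open>(k, l)\<close> to the roots \<open>(k, r)\<close> and \<open>(r, l)\<close>.
\<close>

lemma stable_compose:
  assumes idx: "k \<in> I" "r \<in> I" "l \<in> I" "k \<noteq> r" "r \<noteq> l" "k \<noteq> l"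
    and h: "h \<in> grade S s" and st: "stable h k r" "stable h r l"
  shows "stable h k l"
proof (rule stableI[OF idx(1,3,6)])
  show hc [simp]: "h \<in> carrier S" using h S.grade_carrier by blast
  fix c q assume c: "c \<in> grade D q"
  have g: "gF k r c \<in> grade S q" "gF r l e \<in> grade S 0"
    and w: "gF k r c \<in> W k r" "gF r l e \<in> W r l" using idx c gF_W e_grade by blast+
  note gc [simp] = g[THEN S.grade_carrier]
  have eq: "gF k l c = bracket S (gF k r c) (gF r l e)"
    using S_bracket_left[of k r l c q e 0] idx c grade_carrier by simp
  have *: "bracket S h (gF k r c) \<in> W k r" "bracket S (gF k r c) h \<in> W k r"
    "bracket S h (gF r l e) \<in> W r l" "bracket S (gF r l e) h \<in> W r l"
    using st w by (auto simp: stable_def)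
  note [intro] = W_bracket_left[of k r l, OF idx(1-3,4,5,6)] W_bracket_right[of r l k, OF idx(2,3,1,5,4)]
  show "bracket S h (gF k l c) \<in> W k l"
    unfolding eq S.leibniz_right_homogeneous[OF hc g]
    by (intro W_diff W_koszul) (use * w idx in auto)
  show "bracket S (gF k l c) h \<in> W k l"
    unfolding eq S.bracket_bracket_left[OF gc(1) g(2) h]
    by (intro W_sub(5) W_koszul) (use * w idx in auto)
qed

text \<open>
  Roots other than \<open>(i, j)\<close> and \<open>(j, i)\<close> are covered by \<open>triple_bracket_W\<close>. These two are sums of
  two of the other roots, because there is a third index.
\<close>

lemma bracket_opposite_Cart:
  assumes idx: "i \<in> I" "j \<in> I" "i \<noteq> j" and a: "a \<in> grade D p" and b: "b \<in> grade D q"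
  shows "bracket S (gF i j a) (gF j i b) \<in> Cart"
proof -
  let ?h = "bracket S (gF i j a) (gF j i b)"
  have ji: "j \<noteq> i" using idx by blast
  have g: "gF i j a \<in> grade S p" "gF j i b \<in> grade S q" "?h \<in> grade S (p + q)"
    using idx a b by (blast intro: S.bracket_grade)+
  have w: "gF i j a \<in> W i j" "gF j i b \<in> W j i" using idx a b gF_W by blast+
  note gc [simp] = g[THEN S.grade_carrier]
  have 1: "stable ?h k l" if kl: "k \<in> I" "l \<in> I" "k \<noteq> l" "(k, l) \<noteq> (i, j)" "(k, l) \<noteq> (j, i)" for k l
  proof (rule stableI[OF kl(1-3) gc(3)])
    fix c r assume c: "c \<in> grade D r"
    have z: "gF k l c \<in> grade S r" "gF k l c \<in> W k l" using kl c gF_W by blast+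
    note zc = z(1)[THEN S.grade_carrier]
    note t = triple_bracket_W[OF idx(1,2) kl(1,2) idx(3) kl(3-5) w z(2)]
      triple_bracket_W[OF idx(2,1) kl(1,2) ji kl(3,5,4) w(2,1) z(2)]
    show "bracket S ?h (gF k l c) \<in> W k l"
      unfolding S.bracket_bracket_left[OF gc(1) g(2) z(1)]
      by (intro W_sub(5)[OF kl(1-3)] W_koszul[OF kl(1-3)] t)
    show "bracket S (gF k l c) ?h \<in> W k l"
      unfolding S.leibniz_right_homogeneous[OF zc g(1,2)]
      by (intro W_diff[OF kl(1-3)] W_koszul[OF kl(1-3)] t)
  qed
  have "stable ?h k l" if kl: "k \<in> I" "l \<in> I" "k \<noteq> l" for k l
  proof (cases "(k, l) = (i, j) \<or> (k, l) = (j, i)")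
    case True
    obtain r where r: "r \<in> I" "r \<noteq> i" "r \<noteq> j" using fourth_index[of i j j] by blast
    show ?thesis
      by (rule stable_compose[OF kl(1) r(1) kl(2) _ _ kl(3) g(3)]) (use True r kl in \<open>auto intro!: 1\<close>)
  qed (use kl 1 in auto)
  then show ?thesis by (simp add: Cart_def)
qed

lemma Cart_submodule: "submodule Cart R S"
proof (rule S.submoduleI)
  note [simp] = W_closed W_zero W_sub(3,4,5)
  show "\<zero>\<^bsub>S\<^esub> \<in> Cart" by (simp add: Cart_def stable_def)
  show "\<ominus>\<^bsub>S\<^esub> x \<in> Cart" if "x \<in> Cart" for x using that by (simp add: Cart_def stable_def S.bracket_minus)
  show "x \<oplus>\<^bsub>S\<^esub> y \<in> Cart" if "x \<in> Cart" "y \<in> Cart" for x y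
    using that by (simp add: Cart_def stable_def S.bracket_add)
  show "r \<odot>\<^bsub>S\<^esub> x \<in> Cart" if "r \<in> carrier R" "x \<in> Cart" for r x
    using that by (simp add: Cart_def stable_def S.bracket_smult)
qed (auto simp: Cart_def)

definition roots :: "(nat \<times> nat) set" where "roots = {(i, j). i \<in> I \<and> j \<in> I \<and> i \<noteq> j}"

lemma finite_roots [simp]: "finite roots"
  by (rule finite_subset[of _ "I \<times> I"]) (auto simp: roots_def)

text \<open>
  The linear combination of generators whose coefficients are the off-diagonal entries of a matrix.
\<close>

definition sect :: "(nat \<Rightarrow> nat \<Rightarrow> 'd) \<Rightarrow> ('r, 'd) stl_term set" where
  "sect x = (\<Oplus>\<^bsub>S\<^esub>s\<in>roots. Fh (fst s) (snd s) (x (fst s) (snd s)))"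

lemma sect_fun: "x \<in> carrier G \<Longrightarrow> (\<lambda>s. Fh (fst s) (snd s) (x (fst s) (snd s))) \<in> roots \<rightarrow> carrier S"
  by (auto simp: roots_def)

lemma sect_closed [simp, intro]: "x \<in> carrier G \<Longrightarrow> sect x \<in> carrier S"
  unfolding sect_def by (rule S.M.finsum_closed) (rule sect_fun)

lemma sect_add: "\<lbrakk>x \<in> carrier G; y \<in> carrier G\<rbrakk> \<Longrightarrow> sect (x \<oplus>\<^bsub>G\<^esub> y) = sect x \<oplus>\<^bsub>S\<^esub> sect y"
  unfolding sect_def S.M.finsum_addf[OF sect_fun sect_fun, symmetric]
  by (rule S.M.finsum_cong'[OF HOL.refl]) (auto simp: roots_def Fh_add)

lemma sect_smult: "\<lbrakk>x \<in> carrier G; r \<in> carrier R\<rbrakk> \<Longrightarrow> sect (r \<odot>\<^bsub>G\<^esub> x) = r \<odot>\<^bsub>S\<^esub> sect x"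
  unfolding sect_def S.finsum_smult_ldistr[OF finite_roots _ sect_fun]
  by (rule S.M.finsum_cong'[OF HOL.refl]) (auto simp: roots_def Fh_smult)

lemma sect_additive: "additive_map G S sect"
  unfolding additive_map_def by (auto simp: sect_add simp del: gl_simps)

lemma sect_minus: "x \<in> carrier G \<Longrightarrow> sect (\<ominus>\<^bsub>G\<^esub> x) = \<ominus>\<^bsub>S\<^esub> sect x"
  by (rule additive_map_minus[OF G.abelian_group_axioms S.abelian_group_axioms sect_additive])

lemma sect_diagonal: "(\<And>i j. \<lbrakk>i \<in> I; j \<in> I; i \<noteq> j\<rbrakk> \<Longrightarrow> x i j = \<zero>) \<Longrightarrow> sect x = \<zero>\<^bsub>S\<^esub>"
  unfolding sect_def by (rule S.M.add.finprod_one_eqI) (auto simp: roots_def Fh_zero)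

lemma sect_E:
  assumes "i \<in> I" "j \<in> I" "i \<noteq> j" "a \<in> carrier D"
  shows "sect (E i j a) = Fh i j a"
proof -
  have "sect (E i j a) = (\<Oplus>\<^bsub>S\<^esub>s\<in>roots. if (i, j) = s then Fh (fst s) (snd s) a else \<zero>\<^bsub>S\<^esub>)"
    unfolding sect_def
    by (rule S.M.finsum_cong'[OF HOL.refl]) (use assms in \<open>auto simp: roots_def mat_unit_def Fh_zero\<close>)
  also have "\<dots> = Fh i j a"
  proof -
    have "(i, j) \<in> roots" "(\<lambda>s. Fh (fst s) (snd s) a) \<in> roots \<rightarrow> carrier S"
      using assms by (auto simp: roots_def)
    then show ?thesis using S.M.finsum_singleton[of "(i, j)" roots "\<lambda>s. Fh (fst s) (snd s) a"] by simp
  qed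
  finally show ?thesis .
qed

text \<open>
  Up to an element that normalises the root spaces, every \<open>x\<close> is the combination of generators
  that its image \<open>\<phi> x\<close> prescribes. The elements with this property form a submodule that is closed
  under right brackets with generators: a bracket of generators is a generator, zero, or a bracket
  of opposite generators, whose image is diagonal.
\<close>

lemma root_decomposition: "x \<in> carrier S \<Longrightarrow> x \<ominus>\<^bsub>S\<^esub> sect (\<phi> x) \<in> Cart"
proof -
  define X where "X = {x \<in> carrier S. x \<ominus>\<^bsub>S\<^esub> sect (\<phi> x) \<in> Cart}"
  note C = S.submoduleE[OF Cart_submodule]
  have Cz: "\<zero>\<^bsub>S\<^esub> \<in> Cart" by (rule S.submodule_zero[OF Cart_submodule])
  have X: "submodule X R S"
  proof (rule S.submoduleI)
    show "\<zero>\<^bsub>S\<^esub> \<in> X" 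
      using Cz sect_diagonal[of "\<zero>\<^bsub>G\<^esub>"] by (simp add: X_def \<phi>_zero S.M.diff_zero)
    show "\<ominus>\<^bsub>S\<^esub> x \<in> X" if "x \<in> X" for x
    proof -
      have "x \<in> carrier S" "\<ominus>\<^bsub>S\<^esub> (x \<ominus>\<^bsub>S\<^esub> sect (\<phi> x)) \<in> Cart" using that C(3) by (auto simp: X_def)
      moreover have "sect (\<phi> x) \<in> carrier S" using that by (simp add: X_def del: gl_simps)
      moreover from this have "\<ominus>\<^bsub>S\<^esub> (x \<ominus>\<^bsub>S\<^esub> sect (\<phi> x)) = \<ominus>\<^bsub>S\<^esub> x \<ominus>\<^bsub>S\<^esub> sect (\<phi> (\<ominus>\<^bsub>S\<^esub> x))"
        using \<open>x \<in> carrier S\<close> by (simp add: \<phi>_minus sect_minus a_minus_def S.M.minus_add del: gl_simps)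
      ultimately show ?thesis by (simp add: X_def)
    qed
    show "x \<oplus>\<^bsub>S\<^esub> y \<in> X" if "x \<in> X" "y \<in> X" for x y
    proof -
      have xy: "x \<in> carrier S" "y \<in> carrier S" using that by (auto simp: X_def)
      then have s: "sect (\<phi> x) \<in> carrier S" "sect (\<phi> y) \<in> carrier S" by (simp_all del: gl_simps)
      have "(x \<ominus>\<^bsub>S\<^esub> sect (\<phi> x)) \<oplus>\<^bsub>S\<^esub> (y \<ominus>\<^bsub>S\<^esub> sect (\<phi> y)) \<in> Cart" using that C(5) by (auto simp: X_def)
      also have "(x \<ominus>\<^bsub>S\<^esub> sect (\<phi> x)) \<oplus>\<^bsub>S\<^esub> (y \<ominus>\<^bsub>S\<^esub> sect (\<phi> y)) =
          (x \<oplus>\<^bsub>S\<^esub> y) \<ominus>\<^bsub>S\<^esub> (sect (\<phi> x) \<oplus>\<^bsub>S\<^esub> sect (\<phi> y))" using xy s by algebra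
      also have "sect (\<phi> x) \<oplus>\<^bsub>S\<^esub> sect (\<phi> y) = sect (\<phi> (x \<oplus>\<^bsub>S\<^esub> y))"
        using xy by (simp add: \<phi>_simps sect_add del: gl_simps)
      finally show ?thesis using xy by (simp add: X_def)
    qed
    show "r \<odot>\<^bsub>S\<^esub> x \<in> X" if "r \<in> carrier R" "x \<in> X" for r x
    proof -
      have "x \<in> carrier S" "r \<odot>\<^bsub>S\<^esub> (x \<ominus>\<^bsub>S\<^esub> sect (\<phi> x)) \<in> Cart" using that C(4) by (auto simp: X_def)
      moreover have "sect (\<phi> x) \<in> carrier S" using that by (simp add: X_def del: gl_simps)
      moreover from this have "r \<odot>\<^bsub>S\<^esub> (x \<ominus>\<^bsub>S\<^esub> sect (\<phi> x)) = r \<odot>\<^bsub>S\<^esub> x \<ominus>\<^bsub>S\<^esub> sect (\<phi> (r \<odot>\<^bsub>S\<^esub> x))"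
        using \<open>x \<in> carrier S\<close> that
        by (simp add: \<phi>_simps sect_smult a_minus_def S.smult_r_distr S.smult_r_minus del: gl_simps)
      ultimately show ?thesis using that by (simp add: X_def)
    qed
  qed (auto simp: X_def)
  note Xs = S.submoduleE[OF X]
  have Xz: "\<zero>\<^bsub>S\<^esub> \<in> X" by (rule S.submodule_zero[OF X])
  have WX: "w \<in> X" if idx: "i \<in> I" "j \<in> I" "i \<noteq> j" and w: "w \<in> W i j" for i j w
  proof -
    obtain a where a: "a \<in> carrier D" "w = Fh i j a" using w by (auto simp: W_def)
    then show ?thesis using idx Cz by (simp add: X_def \<phi>_Fh sect_E S.M.diff_self)
  qed
  have opp: "bracket S (gF i j a) (gF j i b) \<in> X"
    if idx: "i \<in> I" "j \<in> I" "i \<noteq> j" and a: "a \<in> grade D p" and b: "b \<in> grade D q" for i j a b p q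
  proof -
    have c [simp]: "gF i j a \<in> carrier S" "gF j i b \<in> carrier S" using idx a b by blast+
    have ba: "b \<turnstile> a \<in> carrier D" "a \<stileturn> b \<in> carrier D" using a b grade_carrier by auto
    have "\<phi> (bracket S (gF i j a) (gF j i b)) = bracket G (E i j a) (E j i b)"
      using idx by (simp add: \<phi>_simps \<phi>_gF[OF _ _ _ a] \<phi>_gF[OF _ _ _ b] del: gl_simps)
    also have "\<dots> = E i i (a \<stileturn> b) \<ominus>\<^bsub>G\<^esub> koszul G p q (E j j (b \<turnstile> a))"
      using G_bracket_E[OF idx(1,2,2,1) a b] by (simp del: gl_simps)
    also have "\<dots> = (\<lambda>x y. E i i (a \<stileturn> b) x y \<ominus> koszul D p q (E j j (b \<turnstile> a) x y))"
    proof -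
      have v: "E j j (b \<turnstile> a) \<in> carrier G" using idx ba by blast
      show ?thesis
        using v G.koszul_closed[OF v, of p q] gl_a_minus[of "koszul G p q (E j j (b \<turnstile> a))" 4 0] by (simp add: gl_koszul)
    qed
    finally have "sect (\<phi> (bracket S (gF i j a) (gF j i b))) = \<zero>\<^bsub>S\<^esub>"
      using idx by (simp only:, intro sect_diagonal) (auto simp: mat_unit_def diff_zero)
    then show ?thesis
      using bracket_opposite_Cart[OF idx a b] by (simp add: X_def S.M.diff_zero)
  qed
  have WX_bracket: "bracket S w (gF k l b) \<in> X"
    if idx: "i \<in> I" "j \<in> I" "i \<noteq> j" "k \<in> I" "l \<in> I" "k \<noteq> l" and w: "w \<in> W i j" and b: "b \<in> grade D q"
    for i j k l w b q
  proof -
    have g: "gF k l b \<in> W k l" using idx b gF_W by blast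
    consider "j = k" "i \<noteq> l" | "i = l" "j \<noteq> k" | "i \<noteq> l" "j \<noteq> k" | "j = k" "i = l" by blast
    then show ?thesis
    proof cases
      case 1
      then show ?thesis using W_bracket_left[of i j l w "gF k l b"] idx w g WX[of i l] by auto
    next
      case 2
      then show ?thesis using W_bracket_right[of i j k w "gF k l b"] idx w g WX[of k j] by auto
    next
      case 3
      then show ?thesis using W_bracket_zero[of i j k l w "gF k l b"] idx w g Xz by auto
    next
      case 4
      show ?thesis using idx(1-3) w
      proof (induction w rule: W_induct)
        case (gen a p)
        then show ?case using opp[OF idx(1-3) gen b] 4 by simp
      next
        case (add u v)
        then show ?case using idx b Xs(5) gF_closed[of k l b q] by (simp add: S.bracket_add)
      qed
    qed
  qed
  have "X = carrier S"
  proof (rule S_left_normed_induct[OF X])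
    show "gF i j a \<in> X" if "offdiag 4 0 i j" "a \<in> grade D p" for i j a p
      using that WX[of i j] gF_W[of i j a p] by (auto simp: offdiag_iff)
    show "bracket S x (gF k l b) \<in> X" if x: "x \<in> X" and kl: "offdiag 4 0 k l" and b: "b \<in> grade D q" for x k l b q
    proof -
      have idx: "k \<in> I" "l \<in> I" "k \<noteq> l" using kl by (auto simp: offdiag_iff)
      have g: "gF k l b \<in> carrier S" "gF k l b \<in> W k l" using idx b gF_W by blast+
      have xc: "x \<in> carrier S" "sect (\<phi> x) \<in> carrier S" using x by (auto simp: X_def simp del: gl_simps)
      define f where "f s = Fh (fst s) (snd s) (\<phi> x (fst s) (snd s))" for s
      have fW: "f s \<in> W (fst s) (snd s)" for s
        using gl_entry[of "\<phi> x" 4 0] \<phi>_closed[OF xc(1)] by (auto simp: f_def W_def)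
      have fc: "f \<in> roots \<rightarrow> carrier S" using fW W_closed by (force simp: roots_def)
      have "bracket S (sect (\<phi> x)) (gF k l b) = (\<Oplus>\<^bsub>S\<^esub>s\<in>roots. bracket S (f s) (gF k l b))"
        unfolding sect_def f_def[symmetric] by (rule S.bracket_finsum(1)[OF fc g(1)])
      also have "\<dots> \<in> X"
      proof -
        have "(\<Oplus>\<^bsub>S\<^esub>s\<in>T. bracket S (f s) (gF k l b)) \<in> X" if "T \<subseteq> roots" for T
          using finite_subset[OF that finite_roots] that
        proof (induction T rule: finite_induct)
          case empty
          show ?case using Xz by simp
        next
          case (insert s T)
          have s: "bracket S (f s) (gF k l b) \<in> X"
            using insert WX_bracket[of "fst s" "snd s" k l "f s" b q] idx b fW[of s] by (auto simp: roots_def)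
          have "(\<lambda>s. bracket S (f s) (gF k l b)) \<in> T \<rightarrow> carrier S"
          proof
            fix t assume "t \<in> T"
            then have "f t \<in> carrier S" using insert(4) fc by blast
            then show "bracket S (f t) (gF k l b) \<in> carrier S" using g(1) by (rule S.bracket_closed)
          qed
          then have "(\<Oplus>\<^bsub>S\<^esub>s\<in>insert s T. bracket S (f s) (gF k l b)) =
              bracket S (f s) (gF k l b) \<oplus>\<^bsub>S\<^esub> (\<Oplus>\<^bsub>S\<^esub>s\<in>T. bracket S (f s) (gF k l b))"
            by (rule S.M.finsum_insert[OF insert(1,2)]) (use s Xs(1) in blast)
          then show ?case using s insert Xs(5) by simp
        qed
        then show ?thesis by blast
      qed
      finally have 1: "bracket S (sect (\<phi> x)) (gF k l b) \<in> X" .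
      have 2: "bracket S (x \<ominus>\<^bsub>S\<^esub> sect (\<phi> x)) (gF k l b) \<in> X"
        using x g idx WX[OF idx] by (auto simp: X_def Cart_def stable_def)
      have "x = sect (\<phi> x) \<oplus>\<^bsub>S\<^esub> (x \<ominus>\<^bsub>S\<^esub> sect (\<phi> x))" using xc by algebra
      then have "bracket S x (gF k l b) = bracket S (sect (\<phi> x)) (gF k l b) \<oplus>\<^bsub>S\<^esub>
          bracket S (x \<ominus>\<^bsub>S\<^esub> sect (\<phi> x)) (gF k l b)"
        using xc g S.bracket_add(1)[of "sect (\<phi> x)" "x \<ominus>\<^bsub>S\<^esub> sect (\<phi> x)" "gF k l b"] by simp
      then show ?thesis using 1 2 Xs(5) by simp
    qed
  qed
  then show "x \<in> carrier S \<Longrightarrow> x \<ominus>\<^bsub>S\<^esub> sect (\<phi> x) \<in> Cart" by (auto simp: X_def)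
qed

text \<open>
  An element of the kernel normalises the root spaces by \<open>root_decomposition\<close>. Its brackets with
  generators therefore lie both in a root space and in the kernel, and \<open>\<phi>\<close> is injective on root
  spaces.
\<close>

lemma kernel_annihilates_generators:
  assumes x: "x \<in> carrier S" "\<phi> x = \<zero>\<^bsub>G\<^esub>" and idx: "k \<in> I" "l \<in> I" "k \<noteq> l" and b: "b \<in> grade D q"
  shows "bracket S x (gF k l b) = \<zero>\<^bsub>S\<^esub>" "bracket S (gF k l b) x = \<zero>\<^bsub>S\<^esub>"
proof -
  have g [simp]: "gF k l b \<in> carrier S" and w: "gF k l b \<in> W k l" using idx b gF_W by blast+
  have "sect (\<phi> x) = \<zero>\<^bsub>S\<^esub>" unfolding x(2) by (rule sect_diagonal) simp
  then have "x \<in> Cart" using root_decomposition[OF x(1)] x(1) by (simp add: S.M.diff_zero)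
  then have *: "bracket S x (gF k l b) \<in> W k l" "bracket S (gF k l b) x \<in> W k l"
    using idx w by (auto simp: Cart_def stable_def)
  have W0: "y = \<zero>\<^bsub>S\<^esub>" if "y \<in> W k l" "\<phi> y = \<zero>\<^bsub>G\<^esub>" for y
  proof -
    obtain c where c: "c \<in> carrier D" "y = Fh k l c" using \<open>y \<in> W k l\<close> by (auto simp: W_def)
    then have "E k l c = (\<lambda>i j. \<zero>)" using that idx \<phi>_Fh[of k l c] by simp
    then have "c = \<zero>" by (metis mat_unit_def)
    then show ?thesis using c Fh_zero idx by simp
  qed
  show "bracket S x (gF k l b) = \<zero>\<^bsub>S\<^esub>" "bracket S (gF k l b) x = \<zero>\<^bsub>S\<^esub>"
    using * x by (auto intro!: W0 simp: \<phi>_simps simp del: gl_simps)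
qed

text \<open>
  Annihilation extends from generators to all terms by \<open>annihilator_bracket\<close> for homogeneous
  elements of the kernel; since \<open>\<phi>\<close> is graded, the components of an element of the kernel are in
  the kernel.
\<close>

theorem kernel_central: "{x \<in> carrier S. \<phi> x = \<zero>\<^bsub>G\<^esub>} \<subseteq> leibniz_centre S"
proof
  fix x assume "x \<in> {x \<in> carrier S. \<phi> x = \<zero>\<^bsub>G\<^esub>}"
  then have x: "x \<in> carrier S" "\<phi> x = \<zero>\<^bsub>G\<^esub>" by blast+
  have hom: "bracket S y (cls t) = \<zero>\<^bsub>S\<^esub> \<and> bracket S (cls t) y = \<zero>\<^bsub>S\<^esub>"
    if y: "y \<in> grade S p" "\<phi> y = \<zero>\<^bsub>G\<^esub>" and t: "deg q t" for y p q t
    using t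
  proof (induction rule: stl_deg.induct)
    case (1 i j a r)
    then show ?case using kernel_annihilates_generators[OF S.grade_carrier[OF y(1)] y(2), of i j a r]
      by (simp add: offdiag_iff)
  next
    case (6 r s q t)
    then have w: "wf s" "wf t" by (simp_all add: deg_wf)
    show ?case
      using S.annihilator_bracket[OF S.grade_carrier[OF y(1)] cls_grade[OF 6(1)] cls_grade[OF 6(2)] _ _ _ _ y(1)]
        6(3,4) w by (simp add: S_ops)
  qed (use S.grade_carrier[OF y(1)] in \<open>simp_all add: cls_zero deg_wf cls_Minus S.bracket_minus
    S.bracket_add S.bracket_smult S.M.a_inv_zero flip: S_ops\<close>)
  have hom': "bracket S y z = \<zero>\<^bsub>S\<^esub> \<and> bracket S z y = \<zero>\<^bsub>S\<^esub>"
    if y: "y \<in> grade S p" "\<phi> y = \<zero>\<^bsub>G\<^esub>" and z: "z \<in> carrier S" for y z p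
    using z
  proof (induction z rule: S.homogeneous_induct)
    case (add u v)
    then show ?case using S.grade_carrier[OF y(1)] by (simp add: S.bracket_add)
  qed (use hom[OF y] in blast)
  have "\<phi> (homog_comp S p x) = \<zero>\<^bsub>G\<^esub>" for p
  proof -
    have "\<phi> (homog_comp S p x) \<oplus>\<^bsub>G\<^esub> \<phi> (homog_comp S (p + 1) x) = \<zero>\<^bsub>G\<^esub> \<oplus>\<^bsub>G\<^esub> \<zero>\<^bsub>G\<^esub>"
      using x S.homog_comp_sum[of x p] by (simp flip: \<phi>_simps(1) del: gl_simps)
    then show ?thesis
      using G.grade_decomp_unique[of "\<phi> (homog_comp S p x)" p "\<phi> (homog_comp S (p + 1) x)" "\<zero>\<^bsub>G\<^esub>" "\<zero>\<^bsub>G\<^esub>"] x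
      by (simp add: \<phi>_grade del: gl_simps)
  qed
  then have c: "bracket S (homog_comp S p x) z = \<zero>\<^bsub>S\<^esub> \<and> bracket S z (homog_comp S p x) = \<zero>\<^bsub>S\<^esub>"
    if "z \<in> carrier S" for p z
    using hom'[OF S.homog_comp_grade[OF x(1)]] that by blast
  have "bracket S x z = \<zero>\<^bsub>S\<^esub> \<and> bracket S z x = \<zero>\<^bsub>S\<^esub>" if "z \<in> carrier S" for z
    using S.homog_comp_sum[OF x(1), of 0] c[OF that, of 0] c[OF that, of 1] x(1) that
      S.bracket_add(1)[of "homog_comp S 0 x" "homog_comp S 1 x" z]
      S.bracket_add(2)[of z "homog_comp S 0 x" "homog_comp S 1 x"] by simp
  then show "x \<in> leibniz_centre S" using x by (simp add: leibniz_centre_def)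
qed

end

section \<open>Quotients, powers and direct sums of supermodules\<close>

context supermodule
begin

context
  fixes J
  assumes J: "submodule J R M" and J_homog: "\<And>x p. x \<in> J \<Longrightarrow> homog_comp M p x \<in> J"
begin

interpretation J: abelian_subgroup J M
  by (rule abelian_subgroupI3[OF additive_subgroupI M.abelian_group_axioms])
    (rule submodule.axioms(1)[OF J])

lemma coset_eq_iff:
  assumes "x \<in> carrier M" "y \<in> carrier M"
  shows "J +>\<^bsub>M\<^esub> x = J +>\<^bsub>M\<^esub> y \<longleftrightarrow> x \<ominus>\<^bsub>M\<^esub> y \<in> J"
  using assms M.a_coset_add_inv1[of J x y] M.a_coset_add_inv2[of J x y] J.a_subset
    M.a_coset_join1[of J "x \<ominus>\<^bsub>M\<^esub> y"] M.a_coset_join2[of "x \<ominus>\<^bsub>M\<^esub> y" J] J.a_subgroup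
  unfolding a_minus_def by blast

lemma coset_zero_iff: "x \<in> carrier M \<Longrightarrow> J +>\<^bsub>M\<^esub> x = J \<longleftrightarrow> x \<in> J"
  using coset_eq_iff[of x "\<zero>\<^bsub>M\<^esub>"] J.a_subset by (simp add: M.diff_zero)

lemma quotient_carrier: "carrier (quotient_supermodule M J) = (\<lambda>x. J +>\<^bsub>M\<^esub> x) ` carrier M"
  by (auto simp: quotient_supermodule_def A_RCOSETS_def')

lemma quotient_zero: "\<zero>\<^bsub>quotient_supermodule M J\<^esub> = J +>\<^bsub>M\<^esub> \<zero>\<^bsub>M\<^esub>"
  using J.a_subset by (simp add: quotient_supermodule_def)

lemma quotient_add:
  "\<lbrakk>x \<in> carrier M; y \<in> carrier M\<rbrakk> \<Longrightarrow>
   (J +>\<^bsub>M\<^esub> x) \<oplus>\<^bsub>quotient_supermodule M J\<^esub> (J +>\<^bsub>M\<^esub> y) = J +>\<^bsub>M\<^esub> (x \<oplus>\<^bsub>M\<^esub> y)"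
  by (simp add: quotient_supermodule_def J.a_rcos_sum)

lemma coset_mem_diff: "\<lbrakk>x \<in> carrier M; y \<in> J +>\<^bsub>M\<^esub> x\<rbrakk> \<Longrightarrow> y \<in> carrier M \<and> y \<ominus>\<^bsub>M\<^esub> x \<in> J"
proof -
  assume x: "x \<in> carrier M" and y: "y \<in> J +>\<^bsub>M\<^esub> x"
  have "y \<in> carrier M" using M.a_r_coset_subset_G[OF J.a_subset x] y by blast
  moreover have "J +>\<^bsub>M\<^esub> x = J +>\<^bsub>M\<^esub> y" by (rule M.a_repr_independence[OF y x J.a_subgroup])
  ultimately show ?thesis using coset_eq_iff[of y x] x by simp
qed

lemma quotient_smult:
  assumes r: "r \<in> carrier R" and x: "x \<in> carrier M"
  shows "r \<odot>\<^bsub>quotient_supermodule M J\<^esub> (J +>\<^bsub>M\<^esub> x) = J +>\<^bsub>M\<^esub> (r \<odot>\<^bsub>M\<^esub> x)"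
proof -
  have "J +>\<^bsub>M\<^esub> (r \<odot>\<^bsub>M\<^esub> y) = J +>\<^bsub>M\<^esub> (r \<odot>\<^bsub>M\<^esub> x)" if "y \<in> J +>\<^bsub>M\<^esub> x" for y
  proof -
    have y: "y \<in> carrier M" "y \<ominus>\<^bsub>M\<^esub> x \<in> J" using coset_mem_diff[OF x that] by auto
    then have "r \<odot>\<^bsub>M\<^esub> (y \<ominus>\<^bsub>M\<^esub> x) \<in> J" using submoduleE(4)[OF J r] by blast
    moreover have "r \<odot>\<^bsub>M\<^esub> (y \<ominus>\<^bsub>M\<^esub> x) = r \<odot>\<^bsub>M\<^esub> y \<ominus>\<^bsub>M\<^esub> r \<odot>\<^bsub>M\<^esub> x"
      using x y(1) r by (simp add: a_minus_def smult_r_distr smult_r_minus)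
    ultimately show ?thesis
      using x y(1) r by (simp add: coset_eq_iff)
  qed
  then have "(\<Union>y\<in>J +>\<^bsub>M\<^esub> x. J +>\<^bsub>M\<^esub> (r \<odot>\<^bsub>M\<^esub> y)) = J +>\<^bsub>M\<^esub> (r \<odot>\<^bsub>M\<^esub> x)"
    using J.a_rcos_self[OF x] by blast
  then show ?thesis by (simp add: quotient_supermodule_def)
qed

lemma quotient_grade: "grade (quotient_supermodule M J) p = (\<lambda>x. J +>\<^bsub>M\<^esub> x) ` grade M p"
  by (simp add: quotient_supermodule_def)

lemma quotient_supermodule: "supermodule R (quotient_supermodule M J)"
proof (rule supermoduleI, goal_cases)
  \<comment> \<open>existence of additive inverses\<close>
  case (7 x)
  then obtain y where "y \<in> carrier M" "x = J +>\<^bsub>M\<^esub> y" by (auto simp: quotient_carrier)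
  then show ?case
    by (intro bexI[of _ "J +>\<^bsub>M\<^esub> (\<ominus>\<^bsub>M\<^esub> y)"]) (auto simp: quotient_add quotient_zero quotient_carrier M.l_neg)
next
  \<comment> \<open>decomposition into homogeneous parts\<close>
  case (17 x)
  then obtain y where "y \<in> carrier M" "x = J +>\<^bsub>M\<^esub> y" by (auto simp: quotient_carrier)
  then show ?case
    using homog_comp_sum[of y 0] 
    by (intro bexI[of _ "J +>\<^bsub>M\<^esub> homog_comp M 0 y"] bexI[of _ "J +>\<^bsub>M\<^esub> homog_comp M 1 y"])
      (auto simp: quotient_add quotient_grade)
next
  case (18 x)
  then obtain y z where yz: "y \<in> grade M 0" "z \<in> grade M 1" "x = J +>\<^bsub>M\<^esub> y" "x = J +>\<^bsub>M\<^esub> z"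
    by (auto simp: quotient_grade)
  then have c: "y \<in> carrier M" "z \<in> carrier M" by (auto dest: grade_carrier)
  then have "y \<ominus>\<^bsub>M\<^esub> z \<in> J" using yz by (simp flip: coset_eq_iff)
  then have "homog_comp M 0 (y \<ominus>\<^bsub>M\<^esub> z) \<in> J" by (rule J_homog)
  then have "y \<in> J"
    using homog_comp_eq[of y 0 "\<ominus>\<^bsub>M\<^esub> z"] yz by (simp add: a_minus_def)
  then show ?case using c yz J.a_subset by (simp add: coset_zero_iff quotient_zero)
qed (auto simp: quotient_carrier quotient_zero quotient_add quotient_smult R.cring_axioms M.a_ac smult_l_distr
  smult_r_distr smult_assoc1 quotient_grade grade_carrier intro!: imageI)

end

lemma power_simps:
  "carrier (power_supermodule M n) = {1..n} \<rightarrow>\<^sub>E carrier M"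
  "\<zero>\<^bsub>power_supermodule M n\<^esub> = (\<lambda>s\<in>{1..n}. \<zero>\<^bsub>M\<^esub>)"
  "u \<oplus>\<^bsub>power_supermodule M n\<^esub> v = (\<lambda>s\<in>{1..n}. u s \<oplus>\<^bsub>M\<^esub> v s)"
  "r \<odot>\<^bsub>power_supermodule M n\<^esub> u = (\<lambda>s\<in>{1..n}. r \<odot>\<^bsub>M\<^esub> u s)"
  "grade (power_supermodule M n) p = {1..n} \<rightarrow>\<^sub>E grade M p"
  by (simp_all add: power_supermodule_def)

lemma power_supermodule: "supermodule R (power_supermodule M n)"
proof (rule supermoduleI, goal_cases)
  case (7 u)
  then show ?case
    by (intro bexI[of _ "\<lambda>s\<in>{1..n}. \<ominus>\<^bsub>M\<^esub> u s"])
      (auto simp: power_simps PiE_iff M.l_neg intro!: restrict_ext)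
next
  case (17 u)
  define h where "h p = (\<lambda>s\<in>{1..n}. homog_comp M p (u s))" for p
  have "u = h 0 \<oplus>\<^bsub>power_supermodule M n\<^esub> h 1"
    using 17 homog_comp_sum[of "u _" 0] by (auto simp: h_def power_simps PiE_iff extensional_def fun_eq_iff)
  moreover have "h p \<in> grade (power_supermodule M n) p" for p
    using 17 by (auto simp: h_def power_simps PiE_iff)
  ultimately show ?case by blast
next
  case (18 u)
  then show ?case
    by (auto simp: power_simps PiE_iff extensional_def fun_eq_iff intro: grade_both[of _ 0 1])
qed (auto simp: power_simps R.cring_axioms PiE_iff extensional_def fun_eq_iff M.a_ac smult_l_distr
  smult_r_distr smult_assoc1 dest: grade_carrier)

end

lemma dsum_simps:
  "carrier (dsum_supermodule M N) = carrier M \<times> carrier N"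
  "\<zero>\<^bsub>dsum_supermodule M N\<^esub> = (\<zero>\<^bsub>M\<^esub>, \<zero>\<^bsub>N\<^esub>)"
  "(x, u) \<oplus>\<^bsub>dsum_supermodule M N\<^esub> (y, v) = (x \<oplus>\<^bsub>M\<^esub> y, u \<oplus>\<^bsub>N\<^esub> v)"
  "r \<odot>\<^bsub>dsum_supermodule M N\<^esub> (x, u) = (r \<odot>\<^bsub>M\<^esub> x, r \<odot>\<^bsub>N\<^esub> u)"
  "grade (dsum_supermodule M N) p = grade M p \<times> grade N p"
  by (simp_all add: dsum_supermodule_def)

lemma dsum_supermodule:
  fixes R (structure)
  assumes "supermodule R M" "supermodule R N"
  shows "supermodule R (dsum_supermodule M N)"
proof -
  interpret M: supermodule R M by fact
  interpret N: supermodule R N by fact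
  show ?thesis
  proof (rule supermoduleI, goal_cases)
    \<comment> \<open>existence of additive inverses\<close>
    case (7 x)
    then show ?case
      by (cases x) (auto simp: dsum_simps M.M.l_neg N.M.l_neg intro!: bexI[of _ "(\<ominus>\<^bsub>M\<^esub> _, \<ominus>\<^bsub>N\<^esub> _)"])
  next
    \<comment> \<open>decomposition into homogeneous parts\<close>
    case (17 x)
    then obtain y u where "x = (y, u)" "y \<in> carrier M" "u \<in> carrier N" by (auto simp: dsum_simps)
    then show ?case
      using M.homog_comp_sum[of y 0] N.homog_comp_sum[of u 0]
      by (intro bexI[of _ "(homog_comp M 0 y, homog_comp N 0 u)"] bexI[of _ "(homog_comp M 1 y, homog_comp N 1 u)"])
        (auto simp: dsum_simps)
  next
    case (18 x)
    then show ?case by (auto simp: dsum_simps intro: M.grade_both[of _ 0 1] N.grade_both[of _ 0 1])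
  qed (auto simp: dsum_simps M.R.cring_axioms M.M.a_ac N.M.a_ac M.smult_l_distr N.smult_l_distr
      M.smult_r_distr N.smult_r_distr M.smult_assoc1 N.smult_assoc1 dest: M.grade_carrier N.grade_carrier)
qed

section \<open>The commutator ideal\<close>

context superdialgebra
begin

context
  fixes k :: int
begin

definition commutator_gens :: "'a set" where
  "commutator_gens = {[k] \<cdot> a | a. a \<in> carrier D} \<union>
     {a \<stileturn> b \<ominus> koszul D p q (b \<turnstile> a) | a b p q. a \<in> grade D p \<and> b \<in> grade D q}"

lemma commutator_ideal_alt:
  "commutator_ideal R D k = \<Inter>{N. dialgebra_ideal R D N \<and> commutator_gens \<subseteq> N}"
  by (simp add: commutator_ideal_def dialgebra_ideal_generated_def commutator_gens_def)

lemma dialgebra_ideal_carrier: "dialgebra_ideal R D (carrier D)"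
  by (simp add: dialgebra_ideal_def carrier_is_submodule)

lemma commutator_gens_closed: "commutator_gens \<subseteq> carrier D"
  using grade_carrier by (auto simp: commutator_gens_def intro!: minus_closed koszul_closed add.int_pow_closed)

lemma commutator_gens_ideal: "commutator_gens \<subseteq> commutator_ideal R D k"
  unfolding commutator_ideal_alt by blast

lemma commutator_ideal_least:
  "\<lbrakk>dialgebra_ideal R D N; commutator_gens \<subseteq> N\<rbrakk> \<Longrightarrow> commutator_ideal R D k \<subseteq> N"
  unfolding commutator_ideal_alt by blast

lemma dialgebra_ideal_commutator_ideal: "dialgebra_ideal R D (commutator_ideal R D k)"
  unfolding dialgebra_ideal_def
proof
  let ?F = "{N. dialgebra_ideal R D N \<and> commutator_gens \<subseteq> N}"
  have ne: "carrier D \<in> ?F" using dialgebra_ideal_carrier commutator_gens_closed by blast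
  have sub: "submodule N R D" if "N \<in> ?F" for N using that by (simp add: dialgebra_ideal_def)
  have z: "\<zero> \<in> N" if "N \<in> ?F" for N
    by (rule submodule_zero[OF sub[OF that]])
  show "submodule (commutator_ideal R D k) R D"
    unfolding commutator_ideal_alt
  proof (rule submoduleI)
    show "\<Inter>?F \<subseteq> carrier D" using ne by blast
    show "\<zero> \<in> \<Inter>?F" using z by blast
    show "\<ominus> a \<in> \<Inter>?F" if "a \<in> \<Inter>?F" for a
      using that submoduleE(3)[OF sub] by (intro InterI) blast
    show "a \<oplus> b \<in> \<Inter>?F" if "a \<in> \<Inter>?F" "b \<in> \<Inter>?F" for a b
      using that submoduleE(5)[OF sub] by (intro InterI) blast
    show "r \<odot> a \<in> \<Inter>?F" if "r \<in> carrier R" "a \<in> \<Inter>?F" for r a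
      using that submoduleE(4)[OF sub] by (intro InterI) blast
  qed
  show "\<forall>x\<in>carrier D. \<forall>y\<in>carrier D. x \<in> commutator_ideal R D k \<or> y \<in> commutator_ideal R D k \<longrightarrow>
      x \<stileturn> y \<in> commutator_ideal R D k \<and> x \<turnstile> y \<in> commutator_ideal R D k"
    unfolding commutator_ideal_alt unfolding dialgebra_ideal_def by blast
qed

lemmas commutator_ideal_submodule = conjunct1[OF dialgebra_ideal_commutator_ideal[unfolded dialgebra_ideal_def]]

lemma commutator_ideal_absorb:
  "\<lbrakk>x \<in> carrier D; y \<in> carrier D; x \<in> commutator_ideal R D k \<or> y \<in> commutator_ideal R D k\<rbrakk> \<Longrightarrow>
   x \<stileturn> y \<in> commutator_ideal R D k \<and> x \<turnstile> y \<in> commutator_ideal R D k"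
  using dialgebra_ideal_commutator_ideal unfolding dialgebra_ideal_def by blast

lemma homog_comp_dia:
  assumes f: "bilinear_op R D f" "graded_op D f" and xy: "x \<in> carrier D" "y \<in> carrier D"
  shows "homog_comp D p (f x y) =
    f (homog_comp D 0 x) (homog_comp D p y) \<oplus> f (homog_comp D 1 x) (homog_comp D (p + 1) y)"
proof -
  let ?h = "homog_comp D"
  have g: "f (?h r x) (?h s y) \<in> grade D (r + s)" for r s
    using f(2) xy by (auto simp: graded_op_def)
  then have c [simp]: "f (?h r x) (?h s y) \<in> carrier D" for r s using grade_carrier by blast
  have "f x y = f (?h 0 x \<oplus> ?h (0 + 1) x) (?h p y \<oplus> ?h (p + 1) y)"
    using xy by (simp only: homog_comp_sum)
  also have "\<dots> = (f (?h 0 x) (?h p y) \<oplus> f (?h 1 x) (?h (p + 1) y)) \<oplus>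
      (f (?h 1 x) (?h p y) \<oplus> f (?h 0 x) (?h (p + 1) y))"
    using xy by (simp add: bilinear_simps[OF f(1)] a_ac)
  also have "?h p \<dots> = f (?h 0 x) (?h p y) \<oplus> f (?h 1 x) (?h (p + 1) y)"
    using g[of 0 p] g[of 1 "p + 1"] g[of 1 p] g[of 0 "p + 1"]
    by (intro homog_comp_eq grade_add) (simp_all add: ac_simps)
  finally show ?thesis .
qed

text \<open>
  The elements all of whose homogeneous components lie in the ideal form an ideal. It contains the
  generators, since commutators of homogeneous elements are homogeneous and the components of a
  multiple of \<open>k\<close> are multiples of \<open>k\<close>.
\<close>

lemma commutator_ideal_homog_comp:
  assumes "x \<in> commutator_ideal R D k"
  shows "homog_comp D p x \<in> commutator_ideal R D k"
proof -
  let ?I = "commutator_ideal R D k"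
  note sub = submoduleE[OF commutator_ideal_submodule]
  have z: "\<zero> \<in> ?I" by (rule submodule_zero[OF commutator_ideal_submodule])
  have Ic: "x \<in> carrier D" if "x \<in> ?I" for x using that sub(1) by blast
  let ?N = "{x \<in> ?I. \<forall>p. homog_comp D p x \<in> ?I}"
  have "commutator_gens \<subseteq> ?N"
  proof
    fix x assume x: "x \<in> commutator_gens"
    then have xI: "x \<in> ?I" using commutator_gens_ideal by blast
    from x consider a where "a \<in> carrier D" "x = [k] \<cdot> a"
      | a b p q where "a \<in> grade D p" "b \<in> grade D q" "x = a \<stileturn> b \<ominus> koszul D p q (b \<turnstile> a)"
      by (auto simp: commutator_gens_def)
    then show "x \<in> ?N"
    proof cases
      case 1
      have "homog_comp D p ([k] \<cdot> a) = [k] \<cdot> homog_comp D p a" for p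
      proof -
        have hom: "homog_comp D p \<in> hom (add_monoid D) (add_monoid D)"
          by (auto simp: hom_def homog_comp_add)
        interpret group_hom "add_monoid D" "add_monoid D" "homog_comp D p"
          by (intro group_hom.intro a_group group_hom_axioms.intro hom)
        show ?thesis using hom_int_pow[of a k] 1 by (simp add: add_pow_def)
      qed
      moreover have "[k] \<cdot> homog_comp D p a \<in> ?I" for p
        using commutator_gens_ideal homog_comp_closed[OF 1(1)] unfolding commutator_gens_def by blast
      ultimately show ?thesis using 1 xI by simp
    next
      case 2
      have "b \<turnstile> a \<in> grade D (p + q)" using 2 dia_grade(2)[of b q a p] by (simp add: add.commute)
      then have "x \<in> grade D (p + q)" using 2 by (simp add: dia_grade)
      then have "homog_comp D r x = x \<or> homog_comp D r x = \<zero>" for r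
        using homog_comp_other[of x "p + q" r] homog_comp_same[of x "p + q"] by (cases "r = p + q") auto
      then show ?thesis using xI z by auto metis
    qed
  qed
  moreover have "dialgebra_ideal R D ?N"
    unfolding dialgebra_ideal_def
  proof (intro conjI ballI impI)
    show "submodule ?N R D"
    proof (rule submoduleI)
      show "\<zero> \<in> ?N" using z by (simp add: homog_comp_same[OF grade_zero])
      show "\<ominus> a \<in> ?N" if "a \<in> ?N" for a
        using that sub(3) additive_map_minus[OF abelian_group_axioms abelian_group_axioms
            homog_comp_linear[THEN linear_map_additive]] by (simp add: Ic)
      show "a \<oplus> b \<in> ?N" if "a \<in> ?N" "b \<in> ?N" for a b
        using that sub(5) by (simp add: homog_comp_add Ic)
      show "r \<odot> a \<in> ?N" if "r \<in> carrier R" "a \<in> ?N" for r a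
        using that sub(4) by (simp add: homog_comp_smult Ic)
    qed (use sub in auto)
    fix x y assume xy: "x \<in> carrier D" "y \<in> carrier D" "x \<in> ?N \<or> y \<in> ?N"
    then have "f x y \<in> ?I" and "homog_comp D p (f x y) \<in> ?I"
      if "bilinear_op R D f" "graded_op D f"
        and "\<And>x y. \<lbrakk>x \<in> carrier D; y \<in> carrier D; x \<in> ?I \<or> y \<in> ?I\<rbrakk> \<Longrightarrow> f x y \<in> ?I" for f p
      using that sub(5) by (auto simp: homog_comp_dia[OF that(1,2)])
    then show "x \<stileturn> y \<in> ?N" "x \<turnstile> y \<in> ?N"
      using commutator_ideal_absorb ldia_bilinear rdia_bilinear ldia_graded rdia_graded by auto
  qed
  ultimately show ?thesis using commutator_ideal_least[of ?N] assms by blast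
qed

lemma commutator_quotient_supermodule: "supermodule R (commutator_quotient R D k)"
  unfolding commutator_quotient_def
  by (rule quotient_supermodule[OF commutator_ideal_submodule commutator_ideal_homog_comp])

end

end

section \<open>Sums over lists and cancellation in groups of exponent two\<close>

definition lsum :: "('a, 'z) ring_scheme \<Rightarrow> ('i \<Rightarrow> 'a) \<Rightarrow> 'i list \<Rightarrow> 'a" where
  "lsum A f xs = foldr (\<lambda>s v. f s \<oplus>\<^bsub>A\<^esub> v) xs \<zero>\<^bsub>A\<^esub>"

text \<open>
  Reduction of a list modulo two: equal entries are removed in pairs. In a group of exponent two
  the sum over the list does not change, and the identity of two sums becomes a computation with
  their lists of indices.
\<close>

fun cancel :: "'i list \<Rightarrow> 'i list" where
  "cancel [] = []"
| "cancel (s # xs) = (let ys = cancel xs in if s \<in> set ys then remove1 s ys else s # ys)"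

lemma lsum_simps [simp]: "lsum A f [] = \<zero>\<^bsub>A\<^esub>" "lsum A f (s # xs) = f s \<oplus>\<^bsub>A\<^esub> lsum A f xs"
  by (simp_all add: lsum_def)

lemma lsum_cong: "(\<And>s. s \<in> set xs \<Longrightarrow> f s = g s) \<Longrightarrow> lsum A f xs = lsum A g xs"
  by (induction xs) auto

context abelian_group
begin

lemma lsum_closed [simp, intro]: "(\<And>s. s \<in> set xs \<Longrightarrow> f s \<in> carrier G) \<Longrightarrow> lsum G f xs \<in> carrier G"
  by (induction xs) auto

lemma lsum_add: "\<lbrakk>\<And>s. s \<in> set xs \<Longrightarrow> f s \<in> carrier G; \<And>s. s \<in> set xs \<Longrightarrow> g s \<in> carrier G\<rbrakk> \<Longrightarrow>
    lsum G (\<lambda>s. f s \<oplus> g s) xs = lsum G f xs \<oplus> lsum G g xs"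
proof (induction xs)
  case (Cons s xs)
  then have "f s \<in> carrier G" "g s \<in> carrier G" "lsum G f xs \<in> carrier G" "lsum G g xs \<in> carrier G" by auto
  then show ?case using Cons by (simp add: a_ac)
qed simp

lemma lsum_append: "\<lbrakk>\<And>s. s \<in> set xs \<union> set ys \<Longrightarrow> f s \<in> carrier G\<rbrakk> \<Longrightarrow>
    lsum G f (xs @ ys) = lsum G f xs \<oplus> lsum G f ys"
  by (induction xs) (auto simp: a_assoc)

lemma lsum_concat_map: "(\<And>s t. s \<in> set xs \<Longrightarrow> t \<in> set (g s) \<Longrightarrow> f t \<in> carrier G) \<Longrightarrow>
    lsum G f (concat (map g xs)) = lsum G (\<lambda>s. lsum G f (g s)) xs"
proof (induction xs)
  case (Cons s xs)
  have "lsum G f (g s @ concat (map g xs)) = lsum G f (g s) \<oplus> lsum G f (concat (map g xs))"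
    by (rule lsum_append) (use Cons(2) in auto)
  moreover have "lsum G f (concat (map g xs)) = lsum G (\<lambda>s. lsum G f (g s)) xs"
    by (rule Cons(1)) (use Cons(2) in auto)
  ultimately show ?case by simp
qed simp

lemma lsum_eq_finsum:
  "\<lbrakk>distinct xs; \<And>s. s \<in> set xs \<Longrightarrow> f s \<in> carrier G\<rbrakk> \<Longrightarrow> lsum G f xs = finsum G f (set xs)"
  by (induction xs) (auto simp: finsum_insert Pi_def)

lemma lsum_zero: "(\<And>s. s \<in> set xs \<Longrightarrow> f s = \<zero>) \<Longrightarrow> lsum G f xs = \<zero>"
  by (induction xs) auto

context
  assumes exponent_two: "\<And>x. x \<in> carrier G \<Longrightarrow> x \<oplus> x = \<zero>"
begin

lemma exponent_two_cancel: "\<lbrakk>x \<in> carrier G; y \<in> carrier G\<rbrakk> \<Longrightarrow> x \<oplus> (x \<oplus> y) = y"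
  by (simp add: exponent_two flip: a_assoc)

lemma lsum_remove1: "\<lbrakk>\<And>s. s \<in> set xs \<Longrightarrow> f s \<in> carrier G; s \<in> set xs\<rbrakk> \<Longrightarrow>
    lsum G f (remove1 s xs) = f s \<oplus> lsum G f xs"
proof (induction xs)
  case (Cons t xs)
  have c: "f t \<in> carrier G" "lsum G f xs \<in> carrier G" "f s \<in> carrier G" using Cons(2,3) by auto
  show ?case
  proof (cases "s = t")
    case True
    then show ?thesis using c by (simp add: exponent_two_cancel)
  next
    case False
    then show ?thesis using c Cons by (simp add: a_lcomm)
  qed
qed simp

lemma set_cancel: "set (cancel xs) \<subseteq> set xs"
proof (induction xs)
  case (Cons s xs)
  then show ?case using set_remove1_subset[of s "cancel xs"] by (auto simp: Let_def)
qed simp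

lemma lsum_cancel: "(\<And>s. s \<in> set xs \<Longrightarrow> f s \<in> carrier G) \<Longrightarrow> lsum G f (cancel xs) = lsum G f xs"
proof (induction xs)
  case (Cons s xs)
  then show ?case using set_cancel[of xs] by (auto simp: Let_def lsum_remove1 subset_iff)
qed simp

end

end

lemma (in supermodule) lsum_grade: "(\<And>s. s \<in> set xs \<Longrightarrow> f s \<in> grade M p) \<Longrightarrow> lsum M f xs \<in> grade M p"
  by (induction xs) auto

lemma (in module) lsum_smult: "\<lbrakk>r \<in> carrier R; \<And>s. s \<in> set xs \<Longrightarrow> f s \<in> carrier M\<rbrakk> \<Longrightarrow>
    lsum M (\<lambda>s. r \<odot>\<^bsub>M\<^esub> f s) xs = r \<odot>\<^bsub>M\<^esub> lsum M f xs"
  by (induction xs) (auto simp: smult_r_distr)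

section \<open>The cocycle\<close>

text \<open>
  The positions of the pairs of entries whose products are summed in the component \<open>s\<close> of \<open>\<psi>\<close>,
  as a list that can be evaluated.
\<close>

definition quads :: "nat \<Rightarrow> (nat \<times> nat \<times> nat \<times> nat) list" where
  "quads s = filter (\<lambda>(i, j, k, l). distinct [i, j, k, l] \<and> pair_index i k = s)
     (List.product [1, 2, 3, 4] (List.product [1, 2, 3, 4] (List.product [1, 2, 3, 4] [1, 2, 3, 4])))"

lemma perm4_iff: "{i, j, k, l} = {1..4::nat} \<longleftrightarrow> distinct [i, j, k, l] \<and> {i, j, k, l} \<subseteq> {1..4}"
proof
  assume *: "{i, j, k, l} = {1..4}"
  have "card (set [i, j, k, l]) = length [i, j, k, l]" using * by simp
  then have "distinct [i, j, k, l]" by (rule card_distinct)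
  then show "distinct [i, j, k, l] \<and> {i, j, k, l} \<subseteq> {1..4}" using * by simp
next
  assume *: "distinct [i, j, k, l] \<and> {i, j, k, l} \<subseteq> {1..4}"
  then have "card {i, j, k, l} = card {1..4::nat}" using distinct_card[of "[i, j, k, l]"] by simp
  then show "{i, j, k, l} = {1..4}" using * by (intro card_subset_eq) auto
qed

lemma atLeastAtMost_1_4: "{1..4::nat} = set [1, 2, 3, 4]"
  by auto

lemma set_quads: "set (quads s) = {(i, j, k, l). {i, j, k, l} = {1..4} \<and> pair_index i k = s}"
  unfolding perm4_iff quads_def set_filter set_product atLeastAtMost_1_4[symmetric] by auto

lemma distinct_quads: "distinct (quads s)"
  unfolding quads_def by (intro distinct_filter distinct_product) simp_all

text \<open>
  The cocycle identity for matrices \<open>x\<close>, \<open>y\<close> and \<open>z\<close> expands into products of an entry of each; such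
  a product is recorded by the six indices of the three entries. The families \<open>0\<close>, \<open>1\<close> and \<open>2\<close> are
  the expansions of \<open>\<psi> x [y, z]\<close>, \<open>\<psi> [x, y] z\<close> and \<open>\<psi> [x, z] y\<close>. In the families \<open>3\<close>, \<open>4\<close> and \<open>5\<close> the
  diagonal entries of \<open>x\<close>, \<open>y\<close> or \<open>z\<close> are summed, so that each of them has the trace of a matrix as
  a factor.
\<close>

definition cocycle_terms :: "nat \<Rightarrow> nat \<Rightarrow> (nat \<times> nat \<times> nat \<times> nat \<times> nat \<times> nat) list" where
  "cocycle_terms h s = concat (map (\<lambda>(i, j, k, l). concat (map (\<lambda>m.
     if h = 0 then [(i, j, k, m, m, l), (i, j, m, l, k, m)]
     else if h = 1 then [(i, m, m, j, k, l), (m, j, i, m, k, l)]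
     else if h = 2 then [(i, m, k, l, m, j), (m, j, k, l, i, m)]
     else if h = 3 then [(m, m, i, j, k, l)]
     else if h = 4 then [(i, j, m, m, k, l)]
     else [(i, j, k, l, m, m)]) [1, 2, 3, 4])) (quads s))"

text \<open>
  The reason for the cancellation is that \<open>\<psi>\<close> has the form of a polarised minor modulo two. A matrix
  that is concentrated in the two diagonal blocks, formed by the rows and by the columns of the
  minor, acts on the minor by its trace, which accounts for the families \<open>3\<close>, \<open>4\<close> and \<open>5\<close>.
\<close>

lemma cancel_cocycle_terms:
  "list_all (\<lambda>s. cancel (concat (map (\<lambda>h. cocycle_terms h s) [0, 1, 2, 3, 4, 5])) = []) [1, 2, 3, 4, 5, 6]"
  by code_simp

context steinberg4
begin

abbreviation I2 :: "'d set" where "I2 \<equiv> commutator_ideal R D 2"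
abbreviation Dq :: "('r, 'd set) supermodule" where "Dq \<equiv> commutator_quotient R D 2"
abbreviation \<pi> :: "'d \<Rightarrow> 'd set" where "\<pi> x \<equiv> I2 +> x"
abbreviation \<psi> :: "(nat \<Rightarrow> nat \<Rightarrow> 'd) \<Rightarrow> (nat \<Rightarrow> nat \<Rightarrow> 'd) \<Rightarrow> nat \<Rightarrow> 'd set"
  where "\<psi> \<equiv> stl4_cocycle R D"

sublocale Dq: supermodule R Dq by (rule commutator_quotient_supermodule)

lemmas quot = commutator_ideal_submodule[of 2] commutator_ideal_homog_comp[of _ 2]

lemma \<pi>_closed [simp, intro]: "x \<in> carrier D \<Longrightarrow> \<pi> x \<in> carrier Dq"
  and \<pi>_add: "\<lbrakk>x \<in> carrier D; y \<in> carrier D\<rbrakk> \<Longrightarrow> \<pi> (x \<oplus> y) = \<pi> x \<oplus>\<^bsub>Dq\<^esub> \<pi> y"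
  and \<pi>_smult: "\<lbrakk>r \<in> carrier R; x \<in> carrier D\<rbrakk> \<Longrightarrow> \<pi> (r \<odot> x) = r \<odot>\<^bsub>Dq\<^esub> \<pi> x"
  and \<pi>_grade [simp, intro]: "x \<in> grade D p \<Longrightarrow> \<pi> x \<in> grade Dq p"
  and \<pi>_zero: "\<pi> \<zero> = \<zero>\<^bsub>Dq\<^esub>"
  unfolding commutator_quotient_def
  by (auto simp: quotient_carrier[OF quot] quotient_add[OF quot] quotient_smult[OF quot]
      quotient_zero[OF quot] quotient_grade[OF quot])

lemma \<pi>_additive: "additive_map D Dq \<pi>"
  by (simp add: additive_map_def \<pi>_add)

lemma \<pi>_eq_iff: "\<lbrakk>x \<in> carrier D; y \<in> carrier D\<rbrakk> \<Longrightarrow> \<pi> x = \<pi> y \<longleftrightarrow> x \<ominus> y \<in> I2"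
  by (rule coset_eq_iff[OF quot])

lemma \<pi>_zero_iff: "x \<in> carrier D \<Longrightarrow> \<pi> x = \<zero>\<^bsub>Dq\<^esub> \<longleftrightarrow> x \<in> I2"
  using \<pi>_eq_iff[of x \<zero>] by (simp add: \<pi>_zero diff_zero)

lemma Dq_carrierE: "\<lbrakk>X \<in> carrier Dq; \<And>x. \<lbrakk>x \<in> carrier D; X = \<pi> x\<rbrakk> \<Longrightarrow> P\<rbrakk> \<Longrightarrow> P"
  unfolding commutator_quotient_def by (auto simp: quotient_carrier[OF quot])

lemma Dq_exponent_two: "X \<in> carrier Dq \<Longrightarrow> X \<oplus>\<^bsub>Dq\<^esub> X = \<zero>\<^bsub>Dq\<^esub>"
proof (elim Dq_carrierE)
  fix x assume x: "x \<in> carrier D" "X = \<pi> x"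
  have "[(2::int)] \<cdot> x = x \<oplus> x"
    using x add.int_pow_mult[of x 1 1] by simp
  moreover have "[(2::int)] \<cdot> x \<in> I2"
    using commutator_gens_ideal[of 2] x unfolding commutator_gens_def by blast
  ultimately show ?thesis using x by (simp flip: \<pi>_add add: \<pi>_zero_iff)
qed

lemma Dq_minus: "X \<in> carrier Dq \<Longrightarrow> \<ominus>\<^bsub>Dq\<^esub> X = X"
  by (rule Dq.minus_equality) (simp_all add: Dq_exponent_two)

lemma \<pi>_minus: "x \<in> carrier D \<Longrightarrow> \<pi> (\<ominus> x) = \<pi> x"
  using additive_map_minus[OF abelian_group_axioms Dq.abelian_group_axioms \<pi>_additive] by (simp add: Dq_minus)

lemma \<pi>_koszul: "x \<in> carrier D \<Longrightarrow> \<pi> (koszul D p q x) = \<pi> x"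
  by (simp add: koszul_def \<pi>_minus)

lemma \<pi>_finsum: "f \<in> A \<rightarrow> carrier D \<Longrightarrow> \<pi> (finsum D f A) = (\<Oplus>\<^bsub>Dq\<^esub>s\<in>A. \<pi> (f s))"
  by (rule additive_map_finsum[OF abelian_group_axioms Dq.abelian_group_axioms \<pi>_additive])

text \<open>
  In the quotient the two products differ only in the order of their factors, and signs disappear.
\<close>

lemma \<pi>_comm: 
  assumes "a \<in> carrier D" "b \<in> carrier D"
  shows "\<pi> (a \<stileturn> b) = \<pi> (b \<turnstile> a)"
  using assms
proof (induction a rule: homogeneous_induct)
  case (homogeneous p a)
  note a = homogeneous(1)
  from homogeneous(2) show ?case
  proof (induction b rule: homogeneous_induct)
    case (homogeneous q b)
    have c: "a \<in> carrier D" "b \<in> carrier D" using a homogeneous grade_carrier by auto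
    have "a \<stileturn> b \<ominus> koszul D p q (b \<turnstile> a) \<in> I2"
      using commutator_gens_ideal[of 2] a homogeneous unfolding commutator_gens_def by blast
    then have "\<pi> (a \<stileturn> b) = \<pi> (koszul D p q (b \<turnstile> a))" using c by (simp add: \<pi>_eq_iff)
    then show ?case using c by (simp add: \<pi>_koszul)
  next
    case (add u v)
    then show ?case using a grade_carrier by (simp add: dia_simps \<pi>_add)
  qed
next
  case (add u v)
  then show ?case by (simp add: dia_simps \<pi>_add)
qed

lemma \<pi>_cong_dia:
  assumes "a \<in> carrier D" "b \<in> carrier D" "c \<in> carrier D" "\<pi> b = \<pi> c"
  shows "\<pi> (a \<stileturn> b) = \<pi> (a \<stileturn> c)" "\<pi> (b \<stileturn> a) = \<pi> (c \<stileturn> a)"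
proof -
  have "b \<ominus> c \<in> I2" using assms by (simp add: \<pi>_eq_iff)
  then have "a \<stileturn> (b \<ominus> c) \<in> I2" "(b \<ominus> c) \<stileturn> a \<in> I2"
    using commutator_ideal_absorb[of a "b \<ominus> c" 2] commutator_ideal_absorb[of "b \<ominus> c" a 2] assms by auto
  then show "\<pi> (a \<stileturn> b) = \<pi> (a \<stileturn> c)" "\<pi> (b \<stileturn> a) = \<pi> (c \<stileturn> a)"
    using assms by (simp_all add: \<pi>_eq_iff dia_simps)
qed

text \<open>
  By the dialgebra axioms and the relations of the quotient a product of three elements is
  determined by its middle, which is the factor \<open>u\<close> that both product signs point to, and by the
  other two factors in either order.
\<close>

definition triple :: "'d \<Rightarrow> 'd \<Rightarrow> 'd \<Rightarrow> 'd set" where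
  "triple u v w = \<pi> (u \<stileturn> (v \<stileturn> w))"

context
  fixes u v w assumes uvw: "u \<in> carrier D" "v \<in> carrier D" "w \<in> carrier D"
begin

lemma triple_closed [simp, intro]: "triple u v w \<in> carrier Dq"
  using uvw by (simp add: triple_def)

lemma triple_swap: "triple u v w = triple u w v"
proof -
  have "triple u v w = \<pi> (u \<stileturn> (w \<turnstile> v))"
    unfolding triple_def using uvw by (intro \<pi>_cong_dia) (simp_all add: \<pi>_comm)
  then show ?thesis using uvw by (simp add: triple_def dia_right)
qed

lemma triple_alts:
  "\<pi> (u \<stileturn> (v \<turnstile> w)) = triple u v w" "\<pi> ((u \<stileturn> v) \<stileturn> w) = triple u v w"
  "\<pi> ((v \<turnstile> u) \<stileturn> w) = triple u v w"
proof -
  show "\<pi> (u \<stileturn> (v \<turnstile> w)) = triple u v w" "\<pi> ((u \<stileturn> v) \<stileturn> w) = triple u v w"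
    using uvw by (simp_all add: triple_def dia_right ldia_assoc)
  have "\<pi> ((v \<turnstile> u) \<stileturn> w) = \<pi> ((u \<stileturn> v) \<stileturn> w)"
    using uvw by (intro \<pi>_cong_dia) (simp_all add: \<pi>_comm)
  then show "\<pi> ((v \<turnstile> u) \<stileturn> w) = triple u v w" using uvw by (simp add: triple_def ldia_assoc)
qed

end

lemma triple_finsum:
  assumes "finite A" "\<And>s. s \<in> A \<Longrightarrow> f s \<in> carrier D" "u \<in> carrier D" "v \<in> carrier D"
  shows "triple (finsum D f A) u v = (\<Oplus>\<^bsub>Dq\<^esub>s\<in>A. triple (f s) u v)"
    "triple u (finsum D f A) v = (\<Oplus>\<^bsub>Dq\<^esub>s\<in>A. triple u (f s) v)"
    "triple u v (finsum D f A) = (\<Oplus>\<^bsub>Dq\<^esub>s\<in>A. triple u v (f s))"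
proof -
  have [simp]: "f \<in> A \<rightarrow> carrier D" using assms by auto
  have [simp]: "(\<lambda>s. g (f s)) \<in> A \<rightarrow> carrier D" if "\<And>x. x \<in> carrier D \<Longrightarrow> g x \<in> carrier D" for g
    using assms that by auto
  note fs = bilinear_finsum[OF ldia_bilinear]
  show "triple (finsum D f A) u v = (\<Oplus>\<^bsub>Dq\<^esub>s\<in>A. triple (f s) u v)"
    "triple u (finsum D f A) v = (\<Oplus>\<^bsub>Dq\<^esub>s\<in>A. triple u (f s) v)"
    "triple u v (finsum D f A) = (\<Oplus>\<^bsub>Dq\<^esub>s\<in>A. triple u v (f s))"
    unfolding triple_def using assms by (auto simp: fs \<pi>_finsum Pi_def)
qed

section \<open>The trace\<close>

definition tr :: "(nat \<Rightarrow> nat \<Rightarrow> 'd) \<Rightarrow> 'd" where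
  "tr x = (\<Oplus>i\<in>I. x i i)"

lemma tr_closed [simp, intro]: "x \<in> carrier G \<Longrightarrow> tr x \<in> carrier D"
  by (auto simp: tr_def intro!: finsum_closed)

lemma tr_additive: "additive_map G D tr"
  unfolding additive_map_def tr_def by (auto simp: Pi_def intro!: finsum_closed)

lemmas tr_diff = additive_map_diff[OF G.abelian_group_axioms abelian_group_axioms tr_additive]
  and tr_minus = additive_map_minus[OF G.abelian_group_axioms abelian_group_axioms tr_additive]
  and tr_koszul = additive_map_koszul[OF G.abelian_group_axioms abelian_group_axioms tr_additive]
  and tr_zero = additive_map_zero[OF G.abelian_group_axioms abelian_group_axioms tr_additive]
  and tr_add = additive_map_add[OF G.abelian_group_axioms abelian_group_axioms tr_additive]

lemma tr_smult: "\<lbrakk>r \<in> carrier R; x \<in> carrier G\<rbrakk> \<Longrightarrow> tr (r \<odot>\<^bsub>G\<^esub> x) = r \<odot> tr x"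
  unfolding tr_def by (subst finsum_smult_ldistr) auto

lemma tr_E:
  assumes "i \<in> I" "j \<in> I" "a \<in> carrier D"
  shows "tr (E i j a) = (if i = j then a else \<zero>)"
proof -
  have "tr (E i j a) = (\<Oplus>k\<in>I. if i = k then if i = j then a else \<zero> else \<zero>)"
    unfolding tr_def by (rule finsum_cong'[OF HOL.refl]) (use assms in \<open>auto simp: mat_unit_def\<close>)
  also have "\<dots> = (if i = j then a else \<zero>)"
    using assms finsum_singleton[of i I "\<lambda>k. if i = j then a else \<zero>"] by simp
  finally show ?thesis .
qed

text \<open>
  The only brackets of matrix units whose trace is not zero are those of opposite units, and their
  traces \<open>a \<stileturn> b \<ominus> koszul D p q (b \<turnstile> a)\<close> are generators of the ideal.
\<close>

lemma tr_in_I2: "x \<in> carrier L \<Longrightarrow> tr x \<in> I2"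
proof -
  let ?N = "{x \<in> carrier G. tr x \<in> I2}"
  note sub = submoduleE[OF quot(1)]
  have z: "\<zero> \<in> I2" by (rule submodule_zero[OF quot(1)])
  have N: "submodule ?N R G"
    by (rule G.submoduleI) (use sub z in \<open>auto simp: tr_zero tr_minus tr_add tr_smult simp del: gl_simps\<close>)
  have units: "bracket G (E i j a) (E k l b) \<in> ?N"
    if idx: "i \<in> I" "j \<in> I" "k \<in> I" "l \<in> I" and a: "a \<in> grade D p" and b: "b \<in> grade D q"
    for i j k l a b p q
  proof -
    note c = a[THEN grade_carrier] b[THEN grade_carrier]
    define u where "u = (if j = k then E i l (a \<stileturn> b) else \<zero>\<^bsub>G\<^esub>)"
    define v where "v = (if i = l then E k j (b \<turnstile> a) else \<zero>\<^bsub>G\<^esub>)"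
    have uv: "u \<in> carrier G" "v \<in> carrier G" using idx c by (auto simp: u_def v_def simp del: gl_simps)
    have eq: "bracket G (E i j a) (E k l b) = u \<ominus>\<^bsub>G\<^esub> koszul G p q v"
      unfolding u_def v_def by (rule G_bracket_E[OF idx a b])
    have "tr (u \<ominus>\<^bsub>G\<^esub> koszul G p q v) = tr u \<ominus> koszul D p q (tr v)"
      using uv by (simp add: tr_diff tr_koszul del: gl_simps)
    also have "\<dots> = (if j = k \<and> i = l then a \<stileturn> b \<ominus> koszul D p q (b \<turnstile> a) else \<zero>)"
      using idx c by (auto simp: u_def v_def tr_E tr_zero diff_zero simp del: gl_simps)
    also have "\<dots> \<in> I2"
    proof -
      have "a \<stileturn> b \<ominus> koszul D p q (b \<turnstile> a) \<in> I2"
        using commutator_gens_ideal[of 2] a b unfolding commutator_gens_def by blast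
      then show ?thesis using z by simp
    qed
    finally show ?thesis using uv by (simp add: eq del: gl_simps)
  qed
  have "bracket G x y \<in> ?N" if "x \<in> carrier G" "y \<in> carrier G" for x y
    by (rule G_brackets_in_submodule[OF N _ that]) (rule units)
  then have "carrier L \<subseteq> ?N"
    using N unfolding sl_def derived_algebra_def Let_def by (simp del: gl_simps) blast
  then show "x \<in> carrier L \<Longrightarrow> tr x \<in> I2" by blast
qed

section \<open>The cocycle condition\<close>

definition ent :: "(nat \<Rightarrow> nat \<Rightarrow> 'd) \<Rightarrow> (nat \<Rightarrow> nat \<Rightarrow> 'd) \<Rightarrow> nat \<times> nat \<times> nat \<times> nat \<Rightarrow> 'd set" where
  "ent x y = (\<lambda>(i, j, k, l). \<pi> (x i j \<stileturn> y k l))"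

lemma ent_closed: "\<lbrakk>x \<in> carrier G; y \<in> carrier G\<rbrakk> \<Longrightarrow> ent x y q \<in> carrier Dq"
  by (auto simp: ent_def split: prod.split)

lemma \<psi>_eq_lsum:
  assumes "x \<in> carrier G" "y \<in> carrier G"
  shows "\<psi> x y = (\<lambda>s\<in>{1..6}. lsum Dq (ent x y) (quads s))"
proof -
  have "\<pi> (finsum D (\<lambda>(i, j, k, l). x i j \<stileturn> y k l)
      {(i, j, k, l). {i, j, k, l} = {1..4} \<and> pair_index i k = s}) = lsum Dq (ent x y) (quads s)" for s
  proof -
    have "lsum Dq (ent x y) (quads s) = finsum Dq (ent x y) (set (quads s))"
      using assms by (intro Dq.lsum_eq_finsum distinct_quads ent_closed)
    also have "\<dots> = \<pi> (finsum D (\<lambda>(i, j, k, l). x i j \<stileturn> y k l) (set (quads s)))"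
      using assms by (subst \<pi>_finsum) (auto simp: ent_def case_prod_unfold)
    finally show ?thesis unfolding set_quads by simp
  qed
  then show ?thesis by (simp add: stl4_cocycle_def)
qed

abbreviation Dq6 :: "('r, nat \<Rightarrow> 'd set) supermodule" where "Dq6 \<equiv> power_supermodule Dq 6"

sublocale Dq6: supermodule R Dq6 by (rule Dq.power_supermodule)

lemma \<psi>_closed [simp, intro]: "\<lbrakk>x \<in> carrier G; y \<in> carrier G\<rbrakk> \<Longrightarrow> \<psi> x y \<in> carrier Dq6"
  by (auto simp: \<psi>_eq_lsum Dq.power_simps ent_closed simp del: gl_simps)

lemma \<psi>_linear:
  "\<lbrakk>x \<in> carrier G; y \<in> carrier G; z \<in> carrier G\<rbrakk> \<Longrightarrow> \<psi> (x \<oplus>\<^bsub>G\<^esub> y) z = \<psi> x z \<oplus>\<^bsub>Dq6\<^esub> \<psi> y z"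
  "\<lbrakk>x \<in> carrier G; y \<in> carrier G; z \<in> carrier G\<rbrakk> \<Longrightarrow> \<psi> x (y \<oplus>\<^bsub>G\<^esub> z) = \<psi> x y \<oplus>\<^bsub>Dq6\<^esub> \<psi> x z"
  "\<lbrakk>r \<in> carrier R; x \<in> carrier G; y \<in> carrier G\<rbrakk> \<Longrightarrow> \<psi> (r \<odot>\<^bsub>G\<^esub> x) y = r \<odot>\<^bsub>Dq6\<^esub> \<psi> x y"
  "\<lbrakk>r \<in> carrier R; x \<in> carrier G; y \<in> carrier G\<rbrakk> \<Longrightarrow> \<psi> x (r \<odot>\<^bsub>G\<^esub> y) = r \<odot>\<^bsub>Dq6\<^esub> \<psi> x y"
proof -
  have 1: "ent (x \<oplus>\<^bsub>G\<^esub> y) z q = ent x z q \<oplus>\<^bsub>Dq\<^esub> ent y z q" "ent z (x \<oplus>\<^bsub>G\<^esub> y) q = ent z x q \<oplus>\<^bsub>Dq\<^esub> ent z y q"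
    if "x \<in> carrier G" "y \<in> carrier G" "z \<in> carrier G" for x y z q
    using that by (auto simp: ent_def dia_simps \<pi>_add split: prod.split)
  have 2: "ent (r \<odot>\<^bsub>G\<^esub> x) z q = r \<odot>\<^bsub>Dq\<^esub> ent x z q" "ent z (r \<odot>\<^bsub>G\<^esub> x) q = r \<odot>\<^bsub>Dq\<^esub> ent z x q"
    if "x \<in> carrier G" "r \<in> carrier R" "z \<in> carrier G" for x r z q
    using that by (auto simp: ent_def dia_simps \<pi>_smult split: prod.split)
  have 3: "ent (x \<oplus>\<^bsub>G\<^esub> y) z = (\<lambda>q. ent x z q \<oplus>\<^bsub>Dq\<^esub> ent y z q)" "ent z (x \<oplus>\<^bsub>G\<^esub> y) = (\<lambda>q. ent z x q \<oplus>\<^bsub>Dq\<^esub> ent z y q)"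
    if "x \<in> carrier G" "y \<in> carrier G" "z \<in> carrier G" for x y z
    using 1 that by auto
  have 4: "ent (r \<odot>\<^bsub>G\<^esub> x) z = (\<lambda>q. r \<odot>\<^bsub>Dq\<^esub> ent x z q)" "ent z (r \<odot>\<^bsub>G\<^esub> x) = (\<lambda>q. r \<odot>\<^bsub>Dq\<^esub> ent z x q)"
    if "x \<in> carrier G" "r \<in> carrier R" "z \<in> carrier G" for x r z
    using 2 that by auto
  { assume "x \<in> carrier G" "y \<in> carrier G" "z \<in> carrier G"
    note [simp] = this and c = this G.a_closed[OF this(1,2)] G.a_closed[OF this(2,3)]
    show "\<psi> (x \<oplus>\<^bsub>G\<^esub> y) z = \<psi> x z \<oplus>\<^bsub>Dq6\<^esub> \<psi> y z"
      unfolding \<psi>_eq_lsum[OF c(4,3)] \<psi>_eq_lsum[OF c(1,3)] \<psi>_eq_lsum[OF c(2,3)] 3[OF c(1,2,3)] Dq.power_simps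
      by (rule restrict_ext) (simp add: Dq.lsum_add ent_closed del: gl_simps)
    show "\<psi> x (y \<oplus>\<^bsub>G\<^esub> z) = \<psi> x y \<oplus>\<^bsub>Dq6\<^esub> \<psi> x z"
      unfolding \<psi>_eq_lsum[OF c(1,5)] \<psi>_eq_lsum[OF c(1,2)] \<psi>_eq_lsum[OF c(1,3)] 3[OF c(2,3,1)] Dq.power_simps
      by (rule restrict_ext) (simp add: Dq.lsum_add ent_closed del: gl_simps) }
  { assume "r \<in> carrier R" "x \<in> carrier G" "y \<in> carrier G"
    note [simp] = this and c = this G.smult_closed[OF this(1,2)] G.smult_closed[OF this(1,3)]
    show "\<psi> (r \<odot>\<^bsub>G\<^esub> x) y = r \<odot>\<^bsub>Dq6\<^esub> \<psi> x y"
      unfolding \<psi>_eq_lsum[OF c(4,3)] \<psi>_eq_lsum[OF c(2,3)] 4[OF c(2,1,3)] Dq.power_simps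
      by (rule restrict_ext) (simp add: Dq.lsum_smult ent_closed del: gl_simps)
    show "\<psi> x (r \<odot>\<^bsub>G\<^esub> y) = r \<odot>\<^bsub>Dq6\<^esub> \<psi> x y"
      unfolding \<psi>_eq_lsum[OF c(2,5)] \<psi>_eq_lsum[OF c(2,3)] 4[OF c(3,1,2)] Dq.power_simps
      by (rule restrict_ext) (simp add: Dq.lsum_smult ent_closed del: gl_simps) }
qed

lemma \<psi>_grade: "\<lbrakk>x \<in> grade G p; y \<in> grade G q\<rbrakk> \<Longrightarrow> \<psi> x y \<in> grade Dq6 (p + q)"
proof -
  assume xy: "x \<in> grade G p" "y \<in> grade G q"
  have g: "x i j \<in> grade D p" "y i j \<in> grade D q" if "i \<in> I" "j \<in> I" for i j
    using that xy by (auto simp: gl_supermodule_simps(5))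
  have "ent x y t \<in> grade Dq (p + q)" if "t \<in> set (quads s)" for s t
    using that g unfolding set_quads perm4_iff by (auto simp: ent_def)
  then have "lsum Dq (ent x y) (quads s) \<in> grade Dq (p + q)" for s
    by (rule Dq.lsum_grade)
  then show ?thesis using xy[THEN G.grade_carrier] by (simp add: \<psi>_eq_lsum Dq.power_simps del: gl_simps)
qed

lemma G_bracket_entry:
  assumes y: "y \<in> grade G q" and z: "z \<in> grade G r"
  shows "bracket G y z k l = (\<Oplus>m\<in>I. y k m \<stileturn> z m l) \<ominus> koszul D q r (\<Oplus>m\<in>I. z k m \<turnstile> y m l)"
proof -
  let ?M = "mat_dialgebra 4 0 D"
  interpret gl: superdialgebra R ?M by (rule superdialgebra_mat)
  note c = y[THEN G.grade_carrier] z[THEN G.grade_carrier]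
  have "a_inv ?M = a_inv G" by (rule a_inv_cong) (simp_all add: gl_supermodule_simps)
  then have M: "koszul ?M q r u = koszul G q r u" "u \<ominus>\<^bsub>?M\<^esub> v = u \<ominus>\<^bsub>G\<^esub> v" for u v
    by (simp_all add: koszul_def a_minus_def gl_supermodule_simps)
  have v: "mat_rdia 4 D z y \<in> carrier G" using gl.dia_closed(2)[of z y] c by simp
  then have kv: "koszul G q r (mat_rdia 4 D z y) \<in> carrier G" by (rule G.koszul_closed)
  have "bracket G y z = mat_ldia 4 D y z \<ominus>\<^bsub>G\<^esub> koszul G q r (mat_rdia 4 D z y)"
    using c gl.super_commutator_homogeneous[of y q z r] y z
    by (simp add: gl_bracket_eq_super_commutator M)
  then show ?thesis
    using v kv by (simp add: gl_a_minus gl_koszul mat_ldia_def mat_rdia_def)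
qed

text \<open>
  The value of a term of the cocycle identity, in the encoding of \<open>cocycle_terms\<close>.
\<close>

definition \<tau> :: "(nat \<Rightarrow> nat \<Rightarrow> 'd) \<Rightarrow> (nat \<Rightarrow> nat \<Rightarrow> 'd) \<Rightarrow> (nat \<Rightarrow> nat \<Rightarrow> 'd) \<Rightarrow>
    nat \<times> nat \<times> nat \<times> nat \<times> nat \<times> nat \<Rightarrow> 'd set" where
  "\<tau> x y z = (\<lambda>(i, j, k, l, m, n). triple (x i j) (y k l) (z m n))"

context
  fixes x y z
  assumes x: "x \<in> carrier G" and y: "y \<in> carrier G" and z: "z \<in> carrier G"
begin

lemma entry_closed: "x i j \<in> carrier D" "y i j \<in> carrier D" "z i j \<in> carrier D"
  using x y z by simp_all

lemma \<tau>_closed: "\<tau> x y z t \<in> carrier Dq"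
  using entry_closed by (auto simp: \<tau>_def split: prod.split)

lemma lsum_quads:
  assumes "\<And>i j k l m. lsum Dq (\<tau> x y z) (B i j k l m) = g (i, j, k, l) m"
    and g: "\<And>t m. g t m \<in> carrier Dq"
  shows "lsum Dq (\<tau> x y z) (concat (map (\<lambda>(i, j, k, l). concat (map (\<lambda>m. B i j k l m) [1, 2, 3, 4])) qs)) =
    lsum Dq (\<lambda>t. \<Oplus>\<^bsub>Dq\<^esub>m\<in>I. g t m) qs"
proof (induction qs)
  case (Cons t qs)
  obtain i j k l where t: "t = (i, j, k, l)" by (cases t) auto
  have "lsum Dq (\<tau> x y z) (concat (map (\<lambda>m. B i j k l m) [1, 2, 3, 4])) =
      lsum Dq (\<lambda>m. lsum Dq (\<tau> x y z) (B i j k l m)) [1, 2, 3, 4]"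
    by (rule Dq.lsum_concat_map) (rule \<tau>_closed)
  also have "\<dots> = (\<Oplus>\<^bsub>Dq\<^esub>m\<in>I. g t m)"
    unfolding atLeastAtMost_1_4 assms(1) t by (rule Dq.lsum_eq_finsum) (simp_all add: g)
  finally have *: "lsum Dq (\<tau> x y z) (concat (map (\<lambda>m. B i j k l m) [1, 2, 3, 4])) = (\<Oplus>\<^bsub>Dq\<^esub>m\<in>I. g t m)" .
  show ?case
    unfolding list.map concat.simps lsum_simps Cons[symmetric] *[symmetric]
    by (subst Dq.lsum_append) (simp_all only: \<tau>_closed t prod.case)
qed simp

lemma triple_simps [simp]: "triple (x i j) (y k l) (z m n) \<in> carrier Dq"
  using entry_closed by blast

lemma lsum_trace_terms:
  assumes "tr x \<in> I2" "tr y \<in> I2" "tr z \<in> I2" "h \<in> {3, 4, 5}"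
  shows "lsum Dq (\<tau> x y z) (cocycle_terms h s) = \<zero>\<^bsub>Dq\<^esub>"
proof -
  note [simp] = entry_closed
  have n: "triple u v w = \<zero>\<^bsub>Dq\<^esub>"
    if "u \<in> I2 \<or> v \<in> I2 \<or> w \<in> I2" "u \<in> carrier D" "v \<in> carrier D" "w \<in> carrier D" for u v w
  proof -
    have "u \<stileturn> (v \<stileturn> w) \<in> I2"
      using that commutator_ideal_absorb[of v w 2] commutator_ideal_absorb[of u "v \<stileturn> w" 2] by auto
    then show ?thesis using that by (simp add: triple_def \<pi>_zero_iff)
  qed
  have c: "tr x \<in> carrier D" "tr y \<in> carrier D" "tr z \<in> carrier D" using x y z by blast+
  have z3: "(\<Oplus>\<^bsub>Dq\<^esub>m\<in>I. triple (x m m) (y i j) (z k l)) = \<zero>\<^bsub>Dq\<^esub>" for i j k l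
    using n[of "tr x" "y i j" "z k l"] assms(1) c triple_finsum(1)[of I "\<lambda>m. x m m" "y i j" "z k l"] by (simp add: tr_def)
  have z4: "(\<Oplus>\<^bsub>Dq\<^esub>m\<in>I. triple (x i j) (y m m) (z k l)) = \<zero>\<^bsub>Dq\<^esub>" for i j k l
    using n[of "x i j" "tr y" "z k l"] assms(2) c triple_finsum(2)[of I "\<lambda>m. y m m" "x i j" "z k l"] by (simp add: tr_def)
  have z5: "(\<Oplus>\<^bsub>Dq\<^esub>m\<in>I. triple (x i j) (y k l) (z m m)) = \<zero>\<^bsub>Dq\<^esub>" for i j k l
    using n[of "x i j" "y k l" "tr z"] assms(3) c triple_finsum(3)[of I "\<lambda>m. z m m" "x i j" "y k l"] by (simp add: tr_def)
  define g where "g = (\<lambda>(i, j, k, l) m. if h = 3 then triple (x m m) (y i j) (z k l)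
    else if h = 4 then triple (x i j) (y m m) (z k l) else triple (x i j) (y k l) (z m m))"
  have "lsum Dq (\<tau> x y z) (cocycle_terms h s) = lsum Dq (\<lambda>t. \<Oplus>\<^bsub>Dq\<^esub>m\<in>I. g t m) (quads s)"
    unfolding cocycle_terms_def
    by (rule lsum_quads) (use assms(4) in \<open>auto simp: g_def \<tau>_def split: prod.split\<close>)
  also have "\<dots> = \<zero>\<^bsub>Dq\<^esub>"
    by (rule Dq.lsum_zero) (use assms(4) in \<open>auto simp: g_def z3 z4 z5 simp del: One_nat_def split: prod.split\<close>)
  finally show ?thesis .
qed

end

text \<open>
  Signs disappear, and both summands of the bracket contribute triples whose middle comes from the
  left operand of the outer product.
\<close>

lemma \<pi>_ldia_bracket:
  assumes u: "u \<in> carrier D" and y: "y \<in> grade G q" and z: "z \<in> grade G r"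
  shows "\<pi> (u \<stileturn> bracket G y z k l) =
    (\<Oplus>\<^bsub>Dq\<^esub>m\<in>I. triple u (y k m) (z m l) \<oplus>\<^bsub>Dq\<^esub> triple u (y m l) (z k m))"
    "\<pi> (bracket G y z k l \<stileturn> u) =
    (\<Oplus>\<^bsub>Dq\<^esub>m\<in>I. triple (y k m) (z m l) u \<oplus>\<^bsub>Dq\<^esub> triple (y m l) (z k m) u)"
proof -
  have c [simp]: "y i j \<in> carrier D" "z i j \<in> carrier D" for i j
    using G.grade_carrier[OF y] G.grade_carrier[OF z] by simp_all
  note [simp] = u
  have s: "finsum D f I \<in> carrier D" if "\<And>m. f m \<in> carrier D" for f using that by (auto intro: finsum_closed)
  note b = G_bracket_entry[OF y z] dia_simps \<pi>_add a_minus_def \<pi>_minus \<pi>_koszul s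
    bilinear_finsum[OF ldia_bilinear] \<pi>_finsum Pi_def triple_alts
  have "\<pi> (u \<stileturn> bracket G y z k l) = (\<Oplus>\<^bsub>Dq\<^esub>m\<in>I. triple u (y k m) (z m l)) \<oplus>\<^bsub>Dq\<^esub>
      (\<Oplus>\<^bsub>Dq\<^esub>m\<in>I. triple u (y m l) (z k m))"
    by (simp add: b triple_def[symmetric] triple_swap[of u "z _ _" "y _ _"] del: gl_simps One_nat_def)
  also have "\<dots> = (\<Oplus>\<^bsub>Dq\<^esub>m\<in>I. triple u (y k m) (z m l) \<oplus>\<^bsub>Dq\<^esub> triple u (y m l) (z k m))"
    by (rule Dq.finsum_addf[symmetric]) (auto intro: triple_closed)
  finally show "\<pi> (u \<stileturn> bracket G y z k l) =
    (\<Oplus>\<^bsub>Dq\<^esub>m\<in>I. triple u (y k m) (z m l) \<oplus>\<^bsub>Dq\<^esub> triple u (y m l) (z k m))" .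
  have "\<pi> (bracket G y z k l \<stileturn> u) = (\<Oplus>\<^bsub>Dq\<^esub>m\<in>I. triple (y k m) (z m l) u) \<oplus>\<^bsub>Dq\<^esub>
      (\<Oplus>\<^bsub>Dq\<^esub>m\<in>I. triple (y m l) (z k m) u)"
    by (simp add: b del: gl_simps One_nat_def)
  also have "\<dots> = (\<Oplus>\<^bsub>Dq\<^esub>m\<in>I. triple (y k m) (z m l) u \<oplus>\<^bsub>Dq\<^esub> triple (y m l) (z k m) u)"
    by (rule Dq.finsum_addf[symmetric]) (auto intro: triple_closed)
  finally show "\<pi> (bracket G y z k l \<stileturn> u) =
    (\<Oplus>\<^bsub>Dq\<^esub>m\<in>I. triple (y k m) (z m l) u \<oplus>\<^bsub>Dq\<^esub> triple (y m l) (z k m) u)" .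
qed

theorem \<psi>_cocycle:
  assumes xL: "x \<in> grade L p" and yL: "y \<in> grade L q" and zL: "z \<in> grade L r"
  shows "\<psi> x (bracket G y z) = \<psi> (bracket G x y) z \<ominus>\<^bsub>Dq6\<^esub> koszul Dq6 q r (\<psi> (bracket G x z) y)"
proof -
  have x: "x \<in> grade G p" and y: "y \<in> grade G q" and z: "z \<in> grade G r" and
    L: "x \<in> carrier L" "y \<in> carrier L" "z \<in> carrier L"
    using xL yL zL by (auto simp: sl_simps simp del: gl_simps)
  note c = x[THEN G.grade_carrier] y[THEN G.grade_carrier] z[THEN G.grade_carrier]
  have e [simp]: "x i j \<in> carrier D" "y i j \<in> carrier D" "z i j \<in> carrier D" for i j
    using c by simp_all
  note bc = G.bracket_closed[OF c(2,3)] G.bracket_closed[OF c(1,2)] G.bracket_closed[OF c(1,3)]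
  note q = lsum_quads[OF c, where qs = "quads s" for s]
  \<comment> \<open>The three terms of the identity are the families 0, 1 and 2 of \<open>cocycle_terms\<close>.\<close>
  have 0: "lsum Dq (ent x (bracket G y z)) (quads s) = lsum Dq (\<tau> x y z) (cocycle_terms 0 s)" for s
  proof -
    have "lsum Dq (\<tau> x y z) (cocycle_terms 0 s) = lsum Dq (\<lambda>t. \<Oplus>\<^bsub>Dq\<^esub>m\<in>I.
        (\<lambda>(i, j, k, l). triple (x i j) (y k m) (z m l) \<oplus>\<^bsub>Dq\<^esub> triple (x i j) (y m l) (z k m)) t) (quads s)"
      unfolding cocycle_terms_def by (rule q) (auto simp: \<tau>_def split: prod.split)
    also have "\<dots> = lsum Dq (ent x (bracket G y z)) (quads s)"
      by (rule lsum_cong) (simp add: ent_def \<pi>_ldia_bracket(1)[OF _ y z] split: prod.split del: gl_simps One_nat_def)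
    finally show ?thesis by simp
  qed
  have 1: "lsum Dq (ent (bracket G x y) z) (quads s) = lsum Dq (\<tau> x y z) (cocycle_terms 1 s)" for s
  proof -
    have "lsum Dq (\<tau> x y z) (cocycle_terms 1 s) = lsum Dq (\<lambda>t. \<Oplus>\<^bsub>Dq\<^esub>m\<in>I.
        (\<lambda>(i, j, k, l). triple (x i m) (y m j) (z k l) \<oplus>\<^bsub>Dq\<^esub> triple (x m j) (y i m) (z k l)) t) (quads s)"
      unfolding cocycle_terms_def by (rule q) (auto simp: \<tau>_def split: prod.split)
    also have "\<dots> = lsum Dq (ent (bracket G x y) z) (quads s)"
      by (rule lsum_cong) (simp add: ent_def \<pi>_ldia_bracket(2)[OF _ x y] split: prod.split del: gl_simps One_nat_def)
    finally show ?thesis by simp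
  qed
  have 2: "lsum Dq (ent (bracket G x z) y) (quads s) = lsum Dq (\<tau> x y z) (cocycle_terms 2 s)" for s
  proof -
    have "lsum Dq (\<tau> x y z) (cocycle_terms 2 s) = lsum Dq (\<lambda>t. \<Oplus>\<^bsub>Dq\<^esub>m\<in>I.
        (\<lambda>(i, j, k, l). triple (x i m) (z m j) (y k l) \<oplus>\<^bsub>Dq\<^esub> triple (x m j) (z i m) (y k l)) t) (quads s)"
      unfolding cocycle_terms_def
      by (rule q) (auto simp: \<tau>_def triple_swap[of "x _ _" "z _ _" "y _ _"] split: prod.split)
    also have "\<dots> = lsum Dq (ent (bracket G x z) y) (quads s)"
      by (rule lsum_cong) (simp add: ent_def \<pi>_ldia_bracket(2)[OF _ x z] split: prod.split del: gl_simps One_nat_def)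
    finally show ?thesis by simp
  qed
  have "lsum Dq (ent x (bracket G y z)) (quads s) =
      lsum Dq (ent (bracket G x y) z) (quads s) \<oplus>\<^bsub>Dq\<^esub> lsum Dq (ent (bracket G x z) y) (quads s)"
    if s: "s \<in> {1..6}" for s
  proof -
    have "s \<in> set [1, 2, 3, 4, 5, 6]" using s by auto
    then have can: "cancel (concat (map (\<lambda>h. cocycle_terms h s) [0, 1, 2, 3, 4, 5])) = []"
      by (rule bspec[OF cancel_cocycle_terms[unfolded list_all_iff]])
    note tc = \<tau>_closed[OF c]
    define T where "T h = lsum Dq (\<tau> x y z) (cocycle_terms h s)" for h
    have Tc: "T h \<in> carrier Dq" for h unfolding T_def using tc by blast
    \<comment> \<open>All six families together cancel, and the last three vanish separately.\<close>
    have "lsum Dq T [0, 1, 2, 3, 4, 5] = lsum Dq (\<tau> x y z) (concat (map (\<lambda>h. cocycle_terms h s) [0, 1, 2, 3, 4, 5]))"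
      unfolding T_def by (rule Dq.lsum_concat_map[symmetric]) (rule tc)
    also have "\<dots> = lsum Dq (\<tau> x y z) (cancel (concat (map (\<lambda>h. cocycle_terms h s) [0, 1, 2, 3, 4, 5])))"
      by (rule Dq.lsum_cancel[symmetric]) (rule Dq_exponent_two tc; assumption?)+
    also have "\<dots> = \<zero>\<^bsub>Dq\<^esub>" unfolding can by simp
    finally have "T 0 \<oplus>\<^bsub>Dq\<^esub> (T 1 \<oplus>\<^bsub>Dq\<^esub> T 2) = \<zero>\<^bsub>Dq\<^esub>"
      using lsum_trace_terms[OF c L[THEN tr_in_I2], of _ s] Tc by (simp add: T_def)
    then have "T 0 = \<ominus>\<^bsub>Dq\<^esub> (T 1 \<oplus>\<^bsub>Dq\<^esub> T 2)" using Tc by (intro Dq.minus_equality[symmetric]) auto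
    then show ?thesis unfolding 0 1 2 using Tc by (simp add: Dq_minus T_def)
  qed
  then have "\<psi> x (bracket G y z) = \<psi> (bracket G x y) z \<oplus>\<^bsub>Dq6\<^esub> \<psi> (bracket G x z) y"
    unfolding \<psi>_eq_lsum[OF c(1) bc(1)] \<psi>_eq_lsum[OF bc(2) c(3)] \<psi>_eq_lsum[OF bc(3) c(2)] Dq.power_simps
    by (intro restrict_ext) simp
  moreover have "\<ominus>\<^bsub>Dq6\<^esub> u = u" if "u \<in> carrier Dq6" for u
  proof (rule Dq6.minus_equality)
    show "u \<oplus>\<^bsub>Dq6\<^esub> u = \<zero>\<^bsub>Dq6\<^esub>"
      using that unfolding Dq.power_simps by (intro restrict_ext Dq_exponent_two) auto
  qed (use that in auto)
  ultimately show ?thesis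
    using \<psi>_closed[OF bc(3) c(2)] by (simp add: a_minus_def koszul_def del: gl_simps)
qed

text \<open>
  There is at most one nonzero product of an entry of the first matrix and an entry of the second.
\<close>

lemma \<psi>_E:
  assumes idx: "i \<in> I" "j \<in> I" "k \<in> I" "l \<in> I" and ab: "a \<in> carrier D" "b \<in> carrier D"
  shows "\<psi> (E i j a) (E k l b) =
    (\<lambda>s\<in>{1..6}. if distinct [i, j, k, l] \<and> pair_index i k = s then \<pi> (a \<stileturn> b) else \<zero>\<^bsub>Dq\<^esub>)"
proof -
  have "lsum Dq (ent (E i j a) (E k l b)) (quads s) =
      (if distinct [i, j, k, l] \<and> pair_index i k = s then \<pi> (a \<stileturn> b) else \<zero>\<^bsub>Dq\<^esub>)" for s
  proof -
    have ent: "ent (E i j a) (E k l b) t = (if (i, j, k, l) = t then \<pi> (a \<stileturn> b) else \<zero>\<^bsub>Dq\<^esub>)" for t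
      using ab by (cases t) (auto simp: ent_def mat_unit_def \<pi>_zero)
    show ?thesis
    proof (cases "(i, j, k, l) \<in> set (quads s)")
      case True
      then have "distinct [i, j, k, l] \<and> pair_index i k = s" unfolding set_quads perm4_iff by blast
      moreover have "lsum Dq (ent (E i j a) (E k l b)) (quads s) = finsum Dq (ent (E i j a) (E k l b)) (set (quads s))"
        using idx ab by (intro Dq.lsum_eq_finsum distinct_quads ent_closed E_closed)
      moreover have "\<dots> = \<pi> (a \<stileturn> b)"
        using Dq.finsum_singleton[OF True, of "\<lambda>t. \<pi> (a \<stileturn> b)"] ab by (simp add: ent[abs_def])
      ultimately show ?thesis by simp
    next
      case False
      then have n: "\<not> (distinct [i, j, k, l] \<and> pair_index i k = s)"
        using idx unfolding set_quads perm4_iff by auto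
      moreover have "lsum Dq (ent (E i j a) (E k l b)) (quads s) = \<zero>\<^bsub>Dq\<^esub>"
        by (rule Dq.lsum_zero) (use False ent in auto)
      ultimately show ?thesis unfolding if_not_P[OF n] by blast
    qed
  qed
  then show ?thesis
    using \<psi>_eq_lsum[OF E_closed[OF idx(1,2) ab(1)] E_closed[OF idx(3,4) ab(2)]] by simp
qed

end

section \<open>The extension by the cocycle\<close>

context steinberg4
begin

abbreviation U0 :: "('r, ('r, 'd) stl_term set \<times> (nat \<Rightarrow> 'd set)) supermodule" where
  "U0 \<equiv> dsum_supermodule S Dq6"
abbreviation U :: "('r, ('r, 'd) stl_term set \<times> (nat \<Rightarrow> 'd set)) leibniz_superalgebra" where
  "U \<equiv> with_bracket U0 (stl4_bracket R D)"
abbreviation proj :: "('r, 'd) stl_term set \<times> (nat \<Rightarrow> 'd set) \<Rightarrow> nat \<Rightarrow> nat \<Rightarrow> 'd" where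
  "proj \<equiv> \<lambda>(x, u). \<phi> x"

sublocale U0: supermodule R U0 by (rule dsum_supermodule[OF S_supermodule Dq6.supermodule_axioms])

lemma \<psi>_bilinear_simps:
  "x \<in> carrier G \<Longrightarrow> \<psi> \<zero>\<^bsub>G\<^esub> x = \<zero>\<^bsub>Dq6\<^esub>" "x \<in> carrier G \<Longrightarrow> \<psi> x \<zero>\<^bsub>G\<^esub> = \<zero>\<^bsub>Dq6\<^esub>"
proof -
  assume x: "x \<in> carrier G"
  have "additive_map G Dq6 (\<lambda>y. \<psi> y x)" "additive_map G Dq6 (\<psi> x)"
    unfolding additive_map_def using x \<psi>_linear(1,2) \<psi>_closed by blast+
  then show "\<psi> \<zero>\<^bsub>G\<^esub> x = \<zero>\<^bsub>Dq6\<^esub>" "\<psi> x \<zero>\<^bsub>G\<^esub> = \<zero>\<^bsub>Dq6\<^esub>"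
    using additive_map_zero[OF G.abelian_group_axioms Dq6.abelian_group_axioms] by blast+
qed

lemma stl4_bracket_pair [simp]:
  "stl4_bracket R D (x, u) (y, v) = (bracket S x y, \<psi> (\<phi> x) (\<phi> y))"
  by (simp add: stl4_bracket_def)

lemma U0_minus: "\<lbrakk>x \<in> carrier S; u \<in> carrier Dq6\<rbrakk> \<Longrightarrow> \<ominus>\<^bsub>U0\<^esub> (x, u) = (\<ominus>\<^bsub>S\<^esub> x, \<ominus>\<^bsub>Dq6\<^esub> u)"
  by (rule U0.minus_equality) (simp_all add: dsum_simps S.M.l_neg Dq6.l_neg)

lemma U_leibniz: "leibniz_superalgebra R U"
proof (rule U0.leibniz_superalgebra_with_bracketI)
  show "bilinear_op R U0 (stl4_bracket R D)"
    unfolding bilinear_op_def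
    by (auto simp: dsum_simps S.bracket_add S.bracket_smult \<phi>_simps \<psi>_linear simp del: gl_simps)
  show "graded_op U0 (stl4_bracket R D)"
    unfolding graded_op_def
    by (auto simp: dsum_simps \<psi>_grade simp del: gl_simps)
  fix a b c p q r
  assume "a \<in> grade U0 p" "b \<in> grade U0 q" "c \<in> grade U0 r"
  then obtain x u y v z w where e: "a = (x, u)" "b = (y, v)" "c = (z, w)"
    and g: "x \<in> grade S p" "y \<in> grade S q" "z \<in> grade S r" by (auto simp: dsum_simps)
  note sc [simp] = g[THEN S.grade_carrier]
  note gL = g[THEN leibniz_hom_grade[OF \<phi>_hom_sl]]
  have k: "koszul U0 q r (x, u) = (koszul S q r x, koszul Dq6 q r u)"
    if "x \<in> carrier S" "u \<in> carrier Dq6" for x u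
    using that by (simp add: koszul_def U0_minus)
  have "\<psi> (\<phi> x) (\<phi> (bracket S y z)) =
      \<psi> (\<phi> (bracket S x y)) (\<phi> z) \<ominus>\<^bsub>Dq6\<^esub> koszul Dq6 q r (\<psi> (\<phi> (bracket S x z)) (\<phi> y))"
    using \<psi>_cocycle[OF gL] by (simp add: \<phi>_simps del: gl_simps)
  moreover have "bracket S (bracket S x z) y \<in> carrier S" "\<psi> (\<phi> (bracket S x z)) (\<phi> y) \<in> carrier Dq6"
    by (simp_all del: gl_simps)
  ultimately show "stl4_bracket R D a (stl4_bracket R D b c) =
      stl4_bracket R D (stl4_bracket R D a b) c \<ominus>\<^bsub>U0\<^esub>
      koszul U0 q r (stl4_bracket R D (stl4_bracket R D a c) b)"
    unfolding e by (simp add: k a_minus_def U0_minus dsum_simps S.leibniz[OF g] del: gl_simps)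
qed

sublocale U: leibniz_superalgebra R U by (rule U_leibniz)

lemma proj_hom: "proj \<in> leibniz_hom R U L"
proof -
  have "\<phi> x \<in> carrier L" if "x \<in> carrier S" for x
    using that by (rule leibniz_hom_closed[OF \<phi>_hom_sl])
  moreover have "\<phi> x \<in> grade L p" if "x \<in> grade S p" for x p
    using that by (rule leibniz_hom_grade[OF \<phi>_hom_sl])
  ultimately show ?thesis
    by (auto simp: leibniz_hom_def dsum_simps sl_simps(1-4) \<phi>_simps simp del: gl_simps)
qed

lemma proj_central_extension: "central_extension R U L proj"
  unfolding central_extension_def
proof (intro conjI U_leibniz sl_leibniz proj_hom)
  have "(\<zero>\<^bsub>Dq6\<^esub>) \<in> carrier Dq6" by blast
  then show "proj ` carrier U = carrier L"
    unfolding \<phi>_surj[symmetric] by (force simp: dsum_simps)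
  show "{x \<in> carrier U. proj x = \<zero>\<^bsub>L\<^esub>} \<subseteq> leibniz_centre U"
  proof clarsimp
    fix x u assume *: "(x, u) \<in> carrier U0" "\<phi> x = \<zero>\<^bsub>L\<^esub>"
    then have x: "x \<in> carrier S" "\<phi> x = \<zero>\<^bsub>G\<^esub>" and u: "u \<in> carrier Dq6"
      by (auto simp: dsum_simps sl_simps simp del: gl_simps)
    then have "x \<in> leibniz_centre S" using kernel_central by blast
    then show "(x, u) \<in> leibniz_centre U"
      using x u by (auto simp: leibniz_centre_def dsum_simps \<psi>_bilinear_simps simp del: gl_simps)
  qed
qed

text \<open>
  One representative for each of the six pairs \<open>{i, k}\<close>: the first quadruple covers \<open>s = 1, 2, 3\<close>,
  the second one \<open>s = 4, 5, 6\<close>.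
\<close>

lemma quads_nonempty:
  assumes "s \<in> {1..6}"
  shows "\<exists>i j k l. (i, j, k, l) \<in> set (quads s)"
proof -
  have "s \<in> {1, 2, 3, 4, 5, 6}" using assms by auto
  then have "(1, if s = 1 then 3 else 2, if s = 1 then 2 else if s = 2 then 3 else 4, if s = 3 then 3 else 4) \<in> set (quads s)
      \<or> (if s = 6 then 3 else 2, 1, if s = 4 then 3 else 4, if s = 4 then 4 else if s = 5 then 3 else 2) \<in> set (quads s)"
    unfolding set_quads perm4_iff by (auto simp: pair_index_def)
  then show ?thesis by blast
qed

text \<open>
  The extension is spanned by brackets. Brackets of generators with four distinct indices vanish
  in \<open>S\<close> and have an arbitrary element of one copy of the quotient as second component; so the
  second summand is reached, and modulo it every generator of \<open>S\<close> is a bracket of generators.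
\<close>

lemma U_perfect:
  assumes X: "submodule X R U" and br: "\<And>x y. \<lbrakk>x \<in> carrier U; y \<in> carrier U\<rbrakk> \<Longrightarrow> bracket U x y \<in> X"
  shows "X = carrier U"
proof -
  note sub = U.submoduleE[OF X]
  have z: "(\<zero>\<^bsub>S\<^esub>, \<zero>\<^bsub>Dq6\<^esub>) \<in> X" using U.submodule_zero[OF X] by (simp add: dsum_simps)
  have add: "(x \<oplus>\<^bsub>S\<^esub> y, u \<oplus>\<^bsub>Dq6\<^esub> v) \<in> X" if "(x, u) \<in> X" "(y, v) \<in> X" for x y u v
    using sub(5)[OF that] by (simp add: dsum_simps)
  have smult: "(r \<odot>\<^bsub>S\<^esub> x, r \<odot>\<^bsub>Dq6\<^esub> u) \<in> X" if "(x, u) \<in> X" "r \<in> carrier R" for r x u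
    using sub(4)[OF that(2,1)] by (simp add: dsum_simps)
  have minus: "(\<ominus>\<^bsub>S\<^esub> x, \<ominus>\<^bsub>Dq6\<^esub> u) \<in> X" if "(x, u) \<in> X" for x u
    using sub(3)[OF that] that sub(1) by (auto simp: U0_minus dsum_simps)
  have br': "(bracket S x y, \<psi> (\<phi> x) (\<phi> y)) \<in> X" if "x \<in> carrier S" "y \<in> carrier S" for x y
    using br[of "(x, \<zero>\<^bsub>Dq6\<^esub>)" "(y, \<zero>\<^bsub>Dq6\<^esub>)"] that by (simp add: dsum_simps)
  \<comment> \<open>the second summand\<close>
  have right: "(\<zero>\<^bsub>S\<^esub>, v) \<in> X" if v: "v \<in> carrier Dq6" for v
  proof -
    define sg where "sg s Y = (\<lambda>t\<in>{1..6}. if t = s then Y else \<zero>\<^bsub>Dq\<^esub>)" for s :: nat and Y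
    have hom: "(\<zero>\<^bsub>S\<^esub>, sg s (\<pi> a)) \<in> X" if s: "s \<in> {1..6}" and a: "a \<in> grade D p" for s a p
    proof -
      obtain i j k l where q: "(i, j, k, l) \<in> set (quads s)" using quads_nonempty[OF s] by blast
      then have d: "distinct [i, j, k, l]" "pair_index i k = s" and idx: "i \<in> I" "j \<in> I" "k \<in> I" "l \<in> I"
        unfolding set_quads perm4_iff by auto
      have ac: "a \<in> carrier D" using a by (rule grade_carrier)
      have "bracket S (gF i j a) (gF k l e) = \<zero>\<^bsub>S\<^esub>"
        by (rule S_bracket_zero[OF idx _ _ _ _ a e_grade]) (use d in auto)
      moreover have "\<phi> (gF i j a) = E i j a" "\<phi> (gF k l e) = E k l e"
        using d by (auto intro!: \<phi>_gF[OF idx(1,2) _ a] \<phi>_gF[OF idx(3,4) _ e_grade])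
      moreover have "gF i j a \<in> carrier S" "gF k l e \<in> carrier S"
        using d by (auto intro!: gF_closed[OF idx(1,2) _ a] gF_closed[OF idx(3,4) _ e_grade])
      moreover have "\<psi> (E i j a) (E k l e) = sg s (\<pi> a)"
        unfolding \<psi>_E[OF idx ac e_closed] sg_def using d ac by (intro restrict_ext) auto
      ultimately show ?thesis using br'[of "gF i j a" "gF k l e"] by simp
    qed
    have single: "(\<zero>\<^bsub>S\<^esub>, sg s Y) \<in> X" if s: "s \<in> {1..6}" and Y: "Y \<in> carrier Dq" for s Y
    proof -
      obtain a where a: "a \<in> carrier D" "Y = \<pi> a" using Y by (rule Dq_carrierE)
      have "sg s Y = sg s (\<pi> (homog_comp D 0 a)) \<oplus>\<^bsub>Dq6\<^esub> sg s (\<pi> (homog_comp D 1 a))"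
        unfolding sg_def Dq.power_simps
        by (rule restrict_ext) (use a homog_comp_sum[of a 0] in \<open>simp flip: \<pi>_add\<close>)
      then show ?thesis
        using add[OF hom[OF s homog_comp_grade[OF a(1)]] hom[OF s homog_comp_grade[OF a(1)]], of 0 1] by simp
    qed
    have vc: "v s \<in> carrier Dq" if "s \<in> {1..6}" for s using v that by (auto simp: Dq.power_simps)
    have sgc: "sg s (v s) \<in> carrier Dq6" if "s \<in> {1..6}" for s
      using vc[OF that] by (auto simp: sg_def Dq.power_simps)
    have partial: "(\<zero>\<^bsub>S\<^esub>, (\<Oplus>\<^bsub>Dq6\<^esub>s\<in>T. sg s (v s))) \<in> X" if "T \<subseteq> {1..6}" for T
      using finite_subset[OF that finite_atLeastAtMost] that
    proof (induction T rule: finite_induct)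
      case empty
      show ?case using z by simp
    next
      case (insert s T)
      have s: "s \<in> {1..6}" and T: "T \<subseteq> {1..6}" using insert(4) by auto
      have "(\<Oplus>\<^bsub>Dq6\<^esub>s\<in>insert s T. sg s (v s)) = sg s (v s) \<oplus>\<^bsub>Dq6\<^esub> (\<Oplus>\<^bsub>Dq6\<^esub>s\<in>T. sg s (v s))"
        by (rule Dq6.finsum_insert[OF insert(1,2)]) (use T sgc s in blast)+
      then show ?case
        using add[OF single[OF s vc[OF s]] insert(3)[OF T]] by simp
    qed
    have "(\<Oplus>\<^bsub>Dq6\<^esub>s\<in>{1..6}. sg s (v s)) = v"
    proof (rule extensionalityI[of _ "{1..6}"])
      have "(\<Oplus>\<^bsub>Dq6\<^esub>s\<in>{1..6}. sg s (v s)) \<in> carrier Dq6" using sgc by (intro Dq6.finsum_closed) auto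
      then show "(\<Oplus>\<^bsub>Dq6\<^esub>s\<in>{1..6}. sg s (v s)) \<in> extensional {1..6}" by (auto simp: Dq.power_simps PiE_iff)
      show "v \<in> extensional {1..6}" using v by (auto simp: Dq.power_simps PiE_iff)
      fix t :: nat assume t: "t \<in> {1..6}"
      have "additive_map Dq6 Dq (\<lambda>u. u t)" using t by (auto simp: additive_map_def Dq.power_simps)
      from additive_map_finsum[OF Dq6.abelian_group_axioms Dq.abelian_group_axioms this, of "\<lambda>s. sg s (v s)" "{1..6}"]
      have "(\<Oplus>\<^bsub>Dq6\<^esub>s\<in>{1..6}. sg s (v s)) t = (\<Oplus>\<^bsub>Dq\<^esub>s\<in>{1..6}. sg s (v s) t)" using sgc by auto
      also have "\<dots> = (\<Oplus>\<^bsub>Dq\<^esub>s\<in>{1..6}. if t = s then v s else \<zero>\<^bsub>Dq\<^esub>)"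
        using t vc by (intro Dq.finsum_cong') (auto simp: sg_def)
      also have "\<dots> = v t" using t vc by (intro Dq.finsum_singleton) auto
      finally show "(\<Oplus>\<^bsub>Dq6\<^esub>s\<in>{1..6}. sg s (v s)) t = v t" .
    qed
    with partial[OF subset_refl] show ?thesis by (simp only:)
  qed
  \<comment> \<open>the first summand\<close>
  let ?Y = "{x \<in> carrier S. (x, \<zero>\<^bsub>Dq6\<^esub>) \<in> X}"
  have "?Y = carrier S"
  proof (rule S_left_normed_induct)
    show "submodule ?Y R S"
    proof (rule S.submoduleI)
      show "\<ominus>\<^bsub>S\<^esub> x \<in> ?Y" if "x \<in> ?Y" for x
        using minus[of x "\<zero>\<^bsub>Dq6\<^esub>"] that by (simp add: Dq6.a_inv_zero)
      show "x \<oplus>\<^bsub>S\<^esub> y \<in> ?Y" if "x \<in> ?Y" "y \<in> ?Y" for x y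
        using add[of x "\<zero>\<^bsub>Dq6\<^esub>" y "\<zero>\<^bsub>Dq6\<^esub>"] that by simp
      show "r \<odot>\<^bsub>S\<^esub> x \<in> ?Y" if "r \<in> carrier R" "x \<in> ?Y" for r x
        using smult[of x "\<zero>\<^bsub>Dq6\<^esub>" r] that by simp
    qed (use z in auto)
    have brY: "bracket S x y \<in> ?Y" if xy: "x \<in> carrier S" "y \<in> carrier S" for x y
    proof -
      have c: "\<psi> (\<phi> x) (\<phi> y) \<in> carrier Dq6" using xy by (simp del: gl_simps)
      have "(\<zero>\<^bsub>S\<^esub>, \<ominus>\<^bsub>Dq6\<^esub> \<psi> (\<phi> x) (\<phi> y)) \<in> X" using c by (intro right) simp
      from add[OF br'[OF xy] this] show ?thesis using xy c by (simp add: Dq6.r_neg)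
    qed
    fix x i j a p assume ij: "offdiag 4 0 i j" and a: "a \<in> grade D p"
    then have idx: "i \<in> I" "j \<in> I" "i \<noteq> j" by (auto simp: offdiag_iff)
    show "gF i j a \<in> ?Y"
    proof -
      obtain k where k: "k \<in> I" "k \<noteq> i" "k \<noteq> j" using fourth_index[of i j j] by blast
      have "gF i j a = bracket S (gF i k a) (gF k j e)"
        using S_bracket_left[of i k j a p e 0] idx k a grade_carrier by simp
      moreover have "bracket S (gF i k a) (gF k j e) \<in> ?Y"
        using idx k by (intro brY gF_closed[OF _ _ _ a] gF_closed[OF _ _ _ e_grade]) auto
      ultimately show ?thesis by (simp only:)
    qed
    show "bracket S x (gF i j a) \<in> ?Y" if "x \<in> ?Y"
      by (rule brY[OF _ gF_closed[OF idx a]]) (use that in simp)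
  qed
  then have left: "(x, \<zero>\<^bsub>Dq6\<^esub>) \<in> X" if "x \<in> carrier S" for x using that by blast
  have "w \<in> X" if w: "w \<in> carrier U" for w
  proof -
    obtain x u where xu: "w = (x, u)" "x \<in> carrier S" "u \<in> carrier Dq6" using w by (auto simp: dsum_simps)
    then show ?thesis using add[OF left[OF xu(2)] right[OF xu(3)]] by simp
  qed
  then show ?thesis using sub(1) by blast
qed

end

text \<open>
  From here on matrices enter through their brackets and no longer through their entries.
\<close>

declare gl_simps [simp del]

section \<open>Lifting brackets to a central extension\<close>

text \<open>
  The index \<open>s\<close> determines the set \<open>{i, k}\<close> and hence its complement \<open>{j, l}\<close>, so that quadruples
  with the same index differ by transpositions of \<open>i\<close> with \<open>k\<close> and of \<open>j\<close> with \<open>l\<close>.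
\<close>

lemma quads_same_index:
  assumes "(i, j, k, l) \<in> set (quads s)" "(i', j', k', l') \<in> set (quads s)" "s \<in> {1..6}"
  shows "(i', j', k', l') \<in> {(i, j, k, l), (i, l, k, j), (k, j, i, l), (k, l, i, j)}"
proof -
  have *: "list_all (\<lambda>s. list_all (\<lambda>(i, j, k, l). list_all (\<lambda>q.
      List.member [(i, j, k, l), (i, l, k, j), (k, j, i, l), (k, l, i, j)] q) (quads s)) (quads s)) [1, 2, 3, 4, 5, 6]"
    by code_simp
  have s: "s \<in> set [1, 2, 3, 4, 5, 6]" using assms(3) by auto
  show ?thesis
    using bspec[OF bspec[OF bspec[OF *[unfolded list_all_iff] s] assms(1), simplified, unfolded list_all_iff] assms(2)]
    by simp
qed

definition perm4 :: "nat \<Rightarrow> nat \<Rightarrow> nat \<Rightarrow> nat \<Rightarrow> bool" where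
  "perm4 i j k l \<longleftrightarrow> distinct [i, j, k, l] \<and> {i, j, k, l} \<subseteq> {1..4}"

locale central_extension4 = steinberg4 R D e
  for R :: "('r, 's) ring_scheme" and D :: "('r, 'd) superdialgebra" (structure) and e +
  fixes M :: "('r, 'm) leibniz_superalgebra" and \<chi> :: "'m \<Rightarrow> nat \<Rightarrow> nat \<Rightarrow> 'd"
  assumes ext: "central_extension R M L \<chi>"
begin

lemma ext_facts: "leibniz_superalgebra R M" "\<chi> \<in> leibniz_hom R M L" "\<chi> ` carrier M = carrier L"
    "{m \<in> carrier M. \<chi> m = \<zero>\<^bsub>L\<^esub>} \<subseteq> leibniz_centre M"
  using ext by (auto simp: central_extension_def)

sublocale M: leibniz_superalgebra R M by (rule ext_facts)

lemmas \<chi>_closed [simp, intro] = leibniz_hom_closed[OF ext_facts(2)]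
  and \<chi>_grade = leibniz_hom_grade[OF ext_facts(2)]
  and \<chi>_simps = leibniz_hom_add[OF ext_facts(2), unfolded sl_simps]
    leibniz_hom_smult[OF ext_facts(2), unfolded sl_simps] leibniz_hom_bracket[OF ext_facts(2), unfolded sl_simps]
  and \<chi>_additive = leibniz_hom_linear[OF ext_facts(2), THEN linear_map_additive]

lemma L_minus: "x \<in> carrier L \<Longrightarrow> \<ominus>\<^bsub>L\<^esub> x = \<ominus>\<^bsub>G\<^esub> x"
  using L.M.l_neg[of x] G.minus_equality[of "\<ominus>\<^bsub>L\<^esub> x" x] sl_carrier_G L.M.a_inv_closed by (simp add: sl_simps)

lemma G_minus_L: "x \<in> carrier L \<Longrightarrow> \<ominus>\<^bsub>G\<^esub> x \<in> carrier L"
  using L_minus L.M.a_inv_closed by metis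

lemma G_koszul_L: "x \<in> carrier L \<Longrightarrow> koszul G p q x \<in> carrier L"
  by (simp add: koszul_def G_minus_L)

lemma L_closed:
  "\<lbrakk>x \<in> carrier L; y \<in> carrier L\<rbrakk> \<Longrightarrow> x \<oplus>\<^bsub>G\<^esub> y \<in> carrier L"
  "\<lbrakk>r \<in> carrier R; x \<in> carrier L\<rbrakk> \<Longrightarrow> r \<odot>\<^bsub>G\<^esub> x \<in> carrier L"
  "\<lbrakk>x \<in> carrier L; y \<in> carrier L\<rbrakk> \<Longrightarrow> bracket G x y \<in> carrier L"
  "\<zero>\<^bsub>G\<^esub> \<in> carrier L"
  using L.M.a_closed L.smult_closed L.bracket_closed L.M.zero_closed by (simp_all add: sl_simps)

lemma \<chi>_minus: "m \<in> carrier M \<Longrightarrow> \<chi> (\<ominus>\<^bsub>M\<^esub> m) = \<ominus>\<^bsub>G\<^esub> \<chi> m"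
  using additive_map_minus[OF M.abelian_group_axioms L.abelian_group_axioms \<chi>_additive] by (simp add: L_minus)

lemma \<chi>_zero: "\<chi> \<zero>\<^bsub>M\<^esub> = \<zero>\<^bsub>G\<^esub>"
  using additive_map_zero[OF M.abelian_group_axioms L.abelian_group_axioms \<chi>_additive] by (simp add: sl_simps)

definition rep :: "(nat \<Rightarrow> nat \<Rightarrow> 'd) \<Rightarrow> 'm" where
  "rep x = (SOME m. m \<in> carrier M \<and> \<chi> m = x)"

lemma rep: "x \<in> carrier L \<Longrightarrow> rep x \<in> carrier M" "x \<in> carrier L \<Longrightarrow> \<chi> (rep x) = x"
proof -
  assume "x \<in> carrier L"
  then have "x \<in> \<chi> ` carrier M" using ext_facts(3) by simp
  then have "\<exists>m. m \<in> carrier M \<and> \<chi> m = x" by blast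
  from someI_ex[OF this] show "rep x \<in> carrier M" "\<chi> (rep x) = x" by (auto simp: rep_def)
qed

text \<open>
  Elements of \<open>M\<close> with the same image differ by a central element, so their brackets agree; this
  makes the bracket of \<open>M\<close> a bilinear map on \<open>L\<close>, whatever representatives are chosen.
\<close>

definition B :: "(nat \<Rightarrow> nat \<Rightarrow> 'd) \<Rightarrow> (nat \<Rightarrow> nat \<Rightarrow> 'd) \<Rightarrow> 'm" where
  "B x y = bracket M (rep x) (rep y)"

lemma kernel_central_M: "\<lbrakk>m \<in> carrier M; \<chi> m = \<zero>\<^bsub>G\<^esub>\<rbrakk> \<Longrightarrow> m \<in> leibniz_centre M"
  using ext_facts(4) by (auto simp: sl_simps)

lemma bracket_cong_M:
  assumes "m \<in> carrier M" "n \<in> carrier M" "k \<in> carrier M" "\<chi> m = \<chi> n"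
  shows "bracket M m k = bracket M n k" "bracket M k m = bracket M k n"
proof -
  have "\<chi> (m \<ominus>\<^bsub>M\<^esub> n) = \<zero>\<^bsub>G\<^esub>"
    using assms sl_carrier_G \<chi>_closed by (simp add: a_minus_def \<chi>_simps \<chi>_minus G.M.r_neg)
  then have "m \<ominus>\<^bsub>M\<^esub> n \<in> leibniz_centre M" using assms by (intro kernel_central_M) auto
  then have "bracket M (m \<ominus>\<^bsub>M\<^esub> n) k = \<zero>\<^bsub>M\<^esub>" "bracket M k (m \<ominus>\<^bsub>M\<^esub> n) = \<zero>\<^bsub>M\<^esub>"
    using assms by (auto simp: leibniz_centre_def)
  then show "bracket M m k = bracket M n k" "bracket M k m = bracket M k n"
    using assms by (simp_all add: M.bracket_diff M.M.diff_eq_zero_iff)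
qed

lemma B_eq: "\<lbrakk>m \<in> carrier M; n \<in> carrier M\<rbrakk> \<Longrightarrow> bracket M m n = B (\<chi> m) (\<chi> n)"
  unfolding B_def using bracket_cong_M[of m "rep (\<chi> m)" n] bracket_cong_M[of n "rep (\<chi> n)" "rep (\<chi> m)"] rep
  by simp

lemma B_closed [simp, intro]: "\<lbrakk>x \<in> carrier L; y \<in> carrier L\<rbrakk> \<Longrightarrow> B x y \<in> carrier M"
  by (simp add: B_def rep)

lemma \<chi>_B: "\<lbrakk>x \<in> carrier L; y \<in> carrier L\<rbrakk> \<Longrightarrow> \<chi> (B x y) = bracket G x y"
  by (simp add: B_def rep \<chi>_simps)

lemma B_add:
  assumes "x \<in> carrier L" "y \<in> carrier L" "z \<in> carrier L"
  shows "B (x \<oplus>\<^bsub>G\<^esub> y) z = B x z \<oplus>\<^bsub>M\<^esub> B y z" "B z (x \<oplus>\<^bsub>G\<^esub> y) = B z x \<oplus>\<^bsub>M\<^esub> B z y"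
  using B_eq[of "rep x \<oplus>\<^bsub>M\<^esub> rep y" "rep z"] B_eq[of "rep z" "rep x \<oplus>\<^bsub>M\<^esub> rep y"]
    B_eq[of "rep x" "rep z"] B_eq[of "rep y" "rep z"] B_eq[of "rep z" "rep x"] B_eq[of "rep z" "rep y"] assms
  by (simp_all add: rep \<chi>_simps M.bracket_add)

lemma B_smult:
  assumes "x \<in> carrier L" "z \<in> carrier L" "r \<in> carrier R"
  shows "B (r \<odot>\<^bsub>G\<^esub> x) z = r \<odot>\<^bsub>M\<^esub> B x z" "B z (r \<odot>\<^bsub>G\<^esub> x) = r \<odot>\<^bsub>M\<^esub> B z x"
  using B_eq[of "r \<odot>\<^bsub>M\<^esub> rep x" "rep z"] B_eq[of "rep z" "r \<odot>\<^bsub>M\<^esub> rep x"]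
    B_eq[of "rep x" "rep z"] B_eq[of "rep z" "rep x"] assms
  by (simp_all add: rep \<chi>_simps M.bracket_smult)

lemma B_minus:
  assumes "x \<in> carrier L" "z \<in> carrier L"
  shows "B (\<ominus>\<^bsub>G\<^esub> x) z = \<ominus>\<^bsub>M\<^esub> B x z" "B z (\<ominus>\<^bsub>G\<^esub> x) = \<ominus>\<^bsub>M\<^esub> B z x"
  using B_eq[of "\<ominus>\<^bsub>M\<^esub> rep x" "rep z"] B_eq[of "rep z" "\<ominus>\<^bsub>M\<^esub> rep x"]
    B_eq[of "rep x" "rep z"] B_eq[of "rep z" "rep x"] assms
  by (simp_all add: rep \<chi>_minus M.bracket_minus)

lemma B_koszul:
  assumes "x \<in> carrier L" "z \<in> carrier L"
  shows "B (koszul G p q x) z = koszul M p q (B x z)" "B z (koszul G p q x) = koszul M p q (B z x)"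
  using B_minus[OF assms] by (simp_all add: koszul_def)

lemma B_zero [simp]: "x \<in> carrier L \<Longrightarrow> B \<zero>\<^bsub>G\<^esub> x = \<zero>\<^bsub>M\<^esub>" "x \<in> carrier L \<Longrightarrow> B x \<zero>\<^bsub>G\<^esub> = \<zero>\<^bsub>M\<^esub>"
proof -
  assume x: "x \<in> carrier L"
  show "B \<zero>\<^bsub>G\<^esub> x = \<zero>\<^bsub>M\<^esub>"
    using B_eq[OF M.zero_closed rep(1)[OF x]] rep[OF x] by (simp add: \<chi>_zero)
  show "B x \<zero>\<^bsub>G\<^esub> = \<zero>\<^bsub>M\<^esub>"
    using B_eq[OF rep(1)[OF x] M.zero_closed] rep[OF x] by (simp add: \<chi>_zero)
qed

text \<open>
  The homogeneous component of any preimage is a preimage as well, since \<open>\<chi>\<close> respects degrees.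
\<close>

lemma homogeneous_lift:
  assumes x: "x \<in> grade L p"
  shows "\<exists>m\<in>grade M p. \<chi> m = x"
proof -
  have xL: "x \<in> carrier L" using x by (rule L.grade_carrier)
  let ?h = "\<lambda>p. homog_comp M p (rep x)"
  have h: "?h p \<in> grade M p" for p using rep[OF xL] by blast
  have "\<chi> (?h p) \<oplus>\<^bsub>L\<^esub> \<chi> (?h (p + 1)) = \<chi> (?h p \<oplus>\<^bsub>M\<^esub> ?h (p + 1))"
    using rep[OF xL] by (simp add: \<chi>_simps sl_simps)
  also have "\<dots> = x \<oplus>\<^bsub>L\<^esub> \<zero>\<^bsub>L\<^esub>" using rep[OF xL] xL by (simp add: M.homog_comp_sum)
  finally have "\<chi> (?h p) = x"
    using L.grade_decomp_unique[of "\<chi> (?h p)" p "\<chi> (?h (p + 1))" x "\<zero>\<^bsub>L\<^esub>"] x h \<chi>_grade by blast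
  then show ?thesis using h by blast
qed

lemma B_grade:
  assumes "x \<in> grade L p" "y \<in> grade L q"
  shows "B x y \<in> grade M (p + q)"
proof -
  obtain m n where "m \<in> grade M p" "n \<in> grade M q" "\<chi> m = x" "\<chi> n = y"
    using homogeneous_lift assms by meson
  then show ?thesis using B_eq[of m n] M.grade_carrier M.bracket_grade[of m p n q] by auto
qed

lemma B_leibniz:
  assumes x: "x \<in> carrier L" and y: "y \<in> grade L q" and z: "z \<in> grade L r"
  shows "B x (bracket G y z) = B (bracket G x y) z \<ominus>\<^bsub>M\<^esub> koszul M q r (B (bracket G x z) y)"
proof -
  obtain n k where n: "n \<in> grade M q" "\<chi> n = y" and k: "k \<in> grade M r" "\<chi> k = z"
    using homogeneous_lift y z by meson
  note c [simp] = rep(1)[OF x] n(1)[THEN M.grade_carrier] k(1)[THEN M.grade_carrier]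
  show ?thesis
    using M.leibniz_right_homogeneous[OF c(1) n(1) k(1)] x
    by (simp add: B_eq \<chi>_simps rep n(2) k(2) \<chi>_B L.grade_carrier[OF y] L.grade_carrier[OF z])
qed

lemma B_leibniz_left:
  assumes x: "x \<in> carrier L" and y: "y \<in> grade L q" and z: "z \<in> grade L r"
  shows "B (bracket G x y) z = B x (bracket G y z) \<oplus>\<^bsub>M\<^esub> koszul M q r (B (bracket G x z) y)"
proof -
  note c = x y[THEN L.grade_carrier] z[THEN L.grade_carrier]
  have "B (bracket G x y) z \<in> carrier M" "koszul M q r (B (bracket G x z) y) \<in> carrier M"
    using c by (auto intro: L_closed)
  then show ?thesis unfolding B_leibniz[OF x y z] by algebra
qed

section \<open>Lifts of the generators\<close>

lemma E_L: "\<lbrakk>i \<in> I; j \<in> I; i \<noteq> j; a \<in> carrier D\<rbrakk> \<Longrightarrow> E i j a \<in> carrier L"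
  using \<phi>_Fh[of i j a] leibniz_hom_closed[OF \<phi>_hom_sl, of "Fh i j a"] Fh_closed[of i j a] by simp

lemma E_L_grade: "\<lbrakk>i \<in> I; j \<in> I; i \<noteq> j; a \<in> grade D p\<rbrakk> \<Longrightarrow> E i j a \<in> grade L p"
  using E_L E_grade grade_carrier by (auto simp: sl_simps(5))

abbreviation BE :: "nat \<Rightarrow> nat \<Rightarrow> 'd \<Rightarrow> nat \<Rightarrow> nat \<Rightarrow> 'd \<Rightarrow> 'm" where
  "BE i j a k l b \<equiv> B (E i j a) (E k l b)"

lemma BE_closed: "\<lbrakk>i \<in> I; j \<in> I; k \<in> I; l \<in> I; i \<noteq> j; k \<noteq> l; a \<in> carrier D; b \<in> carrier D\<rbrakk> \<Longrightarrow>
    BE i j a k l b \<in> carrier M"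
  by (intro B_closed E_L)

lemma BE_add:
  assumes "i \<in> I" "j \<in> I" "k \<in> I" "l \<in> I" "i \<noteq> j" "k \<noteq> l" "a \<in> carrier D" "a' \<in> carrier D" "b \<in> carrier D"
  shows "BE i j (a \<oplus> a') k l b = BE i j a k l b \<oplus>\<^bsub>M\<^esub> BE i j a' k l b"
    "BE i j b k l (a \<oplus> a') = BE i j b k l a \<oplus>\<^bsub>M\<^esub> BE i j b k l a'"
  using assms by (simp_all add: E_add B_add E_L)

text \<open>
  If two of the indices coincide, there is an index \<open>h\<close> different from all of them. Both factors of
  \<open>E k l b = [E k h b, E h l e]\<close> have zero bracket with \<open>E i j a\<close>, and the Leibniz identity applies.
\<close>

lemma BE_null:
  assumes idx: "i \<in> I" "j \<in> I" "k \<in> I" "l \<in> I" "i \<noteq> j" "k \<noteq> l" "i \<noteq> l" "j \<noteq> k" and d: "i = k \<or> j = l"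
    and a: "a \<in> grade D p" and b: "b \<in> grade D q"
  shows "BE i j a k l b = \<zero>\<^bsub>M\<^esub>"
proof -
  obtain h where h: "h \<in> I" "h \<noteq> i" "h \<noteq> j" "h \<noteq> k" "h \<noteq> l"
    using fourth_index[of i j k] fourth_index[of i j l] d by metis
  note E = E_L_grade[OF idx(1,2,5) a] E_L_grade[of k h b q] E_L_grade[of h l e 0]
  have "E k l b = bracket G (E k h b) (E h l e)"
    using G_bracket_E_left[of k h l b q e 0] idx h b grade_carrier by simp
  then have "BE i j a k l b = B (bracket G (E i j a) (E k h b)) (E h l e) \<ominus>\<^bsub>M\<^esub>
      koszul M q 0 (B (bracket G (E i j a) (E h l e)) (E k h b))"
    using B_leibniz[OF L.grade_carrier[OF E(1)] E(2,3)] idx h a b by simp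
  also have "bracket G (E i j a) (E k h b) = \<zero>\<^bsub>G\<^esub>"
    by (rule G_bracket_E_zero[OF idx(1,2,3) h(1) _ _ a b]) (use idx h in auto)
  also have "bracket G (E i j a) (E h l e) = \<zero>\<^bsub>G\<^esub>"
    by (rule G_bracket_E_zero[OF idx(1,2) h(1) idx(4) _ _ a e_grade]) (use idx h in auto)
  also have "B \<zero>\<^bsub>G\<^esub> (E h l e) \<ominus>\<^bsub>M\<^esub> koszul M q 0 (B \<zero>\<^bsub>G\<^esub> (E k h b)) = \<zero>\<^bsub>M\<^esub>"
    using E(2,3)[THEN L.grade_carrier] idx h b by (simp add: M.M.diff_zero)
  finally show ?thesis .
qed

lemma perm4D:
  assumes "perm4 i j k l"
  shows "i \<in> I" "j \<in> I" "k \<in> I" "l \<in> I" "i \<noteq> j" "i \<noteq> k" "i \<noteq> l" "j \<noteq> i" "j \<noteq> k" "j \<noteq> l"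
    "k \<noteq> i" "k \<noteq> j" "k \<noteq> l" "l \<noteq> i" "l \<noteq> j" "l \<noteq> k"
  using assms by (auto simp: perm4_def)

lemma perm4_rotations:
  "perm4 i j k l \<Longrightarrow> perm4 i l k j" "perm4 i j k l \<Longrightarrow> perm4 k j i l" "perm4 i j k l \<Longrightarrow> perm4 k l i j"
  by (auto simp: perm4_def)

text \<open>
  The Leibniz identity for \<open>E i k a\<close>, \<open>E k l b\<close> and \<open>E l j c\<close>, whose outer factors have zero bracket,
  replaces the intermediate index \<open>k\<close> by \<open>l\<close>.
\<close>

lemma BE_path:
  assumes q: "perm4 i j k l" and a: "a \<in> grade D p" and b: "b \<in> grade D s" and c: "c \<in> grade D r"
  shows "BE i k a k j (b \<stileturn> c) = BE i l (a \<stileturn> b) l j c"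
proof -
  note q = perm4D[OF q]
  note cc = a[THEN grade_carrier] b[THEN grade_carrier] c[THEN grade_carrier]
  note E = E_L_grade[OF q(1,3,6) a] E_L_grade[OF q(3,4,13) b] E_L_grade[OF q(4,2,15) c]
  have "E k j (b \<stileturn> c) = bracket G (E k l b) (E l j c)"
    by (rule G_bracket_E_left[symmetric, OF q(3,4,2,12) b c])
  then have "BE i k a k j (b \<stileturn> c) = B (bracket G (E i k a) (E k l b)) (E l j c) \<ominus>\<^bsub>M\<^esub>
      koszul M s r (B (bracket G (E i k a) (E l j c)) (E k l b))"
    using B_leibniz[OF L.grade_carrier[OF E(1)] E(2,3)] by simp
  also have "bracket G (E i k a) (E k l b) = E i l (a \<stileturn> b)"
    by (rule G_bracket_E_left[OF q(1,3,4,7) a b])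
  also have "bracket G (E i k a) (E l j c) = \<zero>\<^bsub>G\<^esub>"
    by (rule G_bracket_E_zero[OF q(1,3,4,2,5,13) a c])
  finally show ?thesis
    using E(2)[THEN L.grade_carrier] BE_closed[OF q(1,4,4,2,7,15), of "a \<stileturn> b" c] cc by (simp add: M.M.diff_zero)
qed

text \<open>
  The lift of \<open>E i j a\<close> by way of an intermediate index; by \<open>BE_left\<close> the choice of this index does
  not matter.
\<close>

definition Ft :: "nat \<Rightarrow> nat \<Rightarrow> 'd \<Rightarrow> 'm" where
  "Ft i j a = (let k = (SOME k. k \<in> I \<and> k \<noteq> i \<and> k \<noteq> j) in BE i k a k j e)"

lemma Ft_obtain: "\<exists>k. k \<in> I \<and> k \<noteq> i \<and> k \<noteq> j \<and> Ft i j = (\<lambda>a. BE i k a k j e)"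
proof -
  have "\<exists>k. k \<in> I \<and> k \<noteq> i \<and> k \<noteq> j" using fourth_index[of i j j] by blast
  from someI_ex[OF this] show ?thesis by (auto simp: Ft_def[abs_def] Let_def)
qed

lemma BE_left:
  assumes idx: "i \<in> I" "k \<in> I" "j \<in> I" "i \<noteq> k" "k \<noteq> j" "i \<noteq> j" and a: "a \<in> grade D p" and b: "b \<in> grade D s"
  shows "BE i k a k j b = Ft i j (a \<stileturn> b)"
proof -
  obtain t where t: "t \<in> I" "t \<noteq> i" "t \<noteq> j" "Ft i j = (\<lambda>a. BE i t a t j e)" using Ft_obtain by blast
  note cc = a[THEN grade_carrier] b[THEN grade_carrier]
  have ab: "a \<stileturn> b \<in> grade D (p + s)" using a b by blast
  show ?thesis
  proof (cases "t = k")
    case True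
    obtain l where l: "l \<in> I" "l \<noteq> i" "l \<noteq> j" "l \<noteq> k" using fourth_index[of i j k] by blast
    have q: "perm4 i j k l" using idx l by (auto simp: perm4_def)
    have "BE i k a k j b = BE i l (a \<stileturn> b) l j e" using BE_path[OF q a b e_grade] cc by simp
    also have "\<dots> = BE i k (a \<stileturn> b) k j e" using BE_path[OF q ab e_grade e_grade] cc by simp
    finally show ?thesis using True t by simp
  next
    case False
    then have "perm4 i j k t" using idx t by (auto simp: perm4_def)
    from BE_path[OF this a b e_grade] show ?thesis using t cc by simp
  qed
qed

lemma Ft_E: "\<lbrakk>i \<in> I; j \<in> I; k \<in> I; i \<noteq> j; i \<noteq> k; k \<noteq> j; a \<in> grade D p\<rbrakk> \<Longrightarrow> BE i k a k j e = Ft i j a"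
  using BE_left[of i k j a p e 0] grade_carrier by simp

lemma Ft_grade: "\<lbrakk>i \<in> I; j \<in> I; i \<noteq> j; a \<in> grade D p\<rbrakk> \<Longrightarrow> Ft i j a \<in> grade M p"
  using Ft_obtain[of i j] B_grade[OF E_L_grade E_L_grade, of i _ a p _ j e 0] by force

lemma \<chi>_Ft: "\<lbrakk>i \<in> I; j \<in> I; i \<noteq> j; a \<in> grade D p\<rbrakk> \<Longrightarrow> \<chi> (Ft i j a) = E i j a"
proof -
  assume *: "i \<in> I" "j \<in> I" "i \<noteq> j" "a \<in> grade D p"
  obtain t where t: "t \<in> I" "t \<noteq> i" "t \<noteq> j" "Ft i j = (\<lambda>a. BE i t a t j e)" using Ft_obtain by blast
  then show ?thesis
    using * G_bracket_E_left[of i t j a p e 0] E_L[of i t a] E_L[of t j e] grade_carrier by (simp add: \<chi>_B)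
qed

lemma Ft_add: "\<lbrakk>i \<in> I; j \<in> I; i \<noteq> j; a \<in> carrier D; b \<in> carrier D\<rbrakk> \<Longrightarrow> Ft i j (a \<oplus> b) = Ft i j a \<oplus>\<^bsub>M\<^esub> Ft i j b"
  using Ft_obtain[of i j] BE_add(1)[of i _ _ j a b e] by force

lemma Ft_smult: "\<lbrakk>i \<in> I; j \<in> I; i \<noteq> j; a \<in> carrier D; r \<in> carrier R\<rbrakk> \<Longrightarrow> Ft i j (r \<odot> a) = r \<odot>\<^bsub>M\<^esub> Ft i j a"
proof -
  assume *: "i \<in> I" "j \<in> I" "i \<noteq> j" "a \<in> carrier D" "r \<in> carrier R"
  obtain t where t: "t \<in> I" "t \<noteq> i" "t \<noteq> j" "Ft i j = (\<lambda>a. BE i t a t j e)" using Ft_obtain by blast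
  then show ?thesis using * by (simp add: E_smult B_smult E_L)
qed

lemma BE_right:
  assumes idx: "i \<in> I" "j \<in> I" "k \<in> I" "i \<noteq> j" "i \<noteq> k" "j \<noteq> k" and a: "a \<in> grade D p" and b: "b \<in> grade D s"
  shows "BE i j a k i b = \<ominus>\<^bsub>M\<^esub> koszul M p s (Ft k j (b \<turnstile> a))"
proof -
  obtain l where l: "l \<in> I" "l \<noteq> i" "l \<noteq> j" "l \<noteq> k" using fourth_index[of i j k] by blast
  note cc = a[THEN grade_carrier] b[THEN grade_carrier]
  have ki: "k \<noteq> i" and il: "i \<noteq> l" and kl: "k \<noteq> l" using idx l by auto
  have ba: "b \<turnstile> a \<in> grade D (s + p)" using a b by blast
  note E = E_L_grade[OF idx(1) l(1) il a] E_L_grade[OF l(1) idx(2) l(3) e_grade] E_L_grade[OF idx(3,1) ki b]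
  have kE: "E k l (b \<turnstile> a) \<in> carrier L" using idx l kl cc by (intro E_L) auto
  have "E i j a = bracket G (E i l a) (E l j e)"
    using G_bracket_E_left[OF idx(1) l(1) idx(2) idx(4) a e_grade] cc by simp
  then have "BE i j a k i b = B (E i l a) (bracket G (E l j e) (E k i b)) \<oplus>\<^bsub>M\<^esub>
      koszul M 0 s (B (bracket G (E i l a) (E k i b)) (E l j e))"
    using B_leibniz_left[OF L.grade_carrier[OF E(1)] E(2,3)] by simp
  also have "bracket G (E l j e) (E k i b) = \<zero>\<^bsub>G\<^esub>"
    by (rule G_bracket_E_zero[OF l(1) idx(2,3,1) l(2) idx(6) e_grade b])
  also have "bracket G (E i l a) (E k i b) = \<ominus>\<^bsub>G\<^esub> koszul G p s (E k l (b \<turnstile> a))"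
    by (rule G_bracket_E_right[OF idx(1) l(1) idx(3) l(4) a b])
  also have "B (\<ominus>\<^bsub>G\<^esub> koszul G p s (E k l (b \<turnstile> a))) (E l j e) = \<ominus>\<^bsub>M\<^esub> koszul M p s (BE k l (b \<turnstile> a) l j e)"
    using kE E(2)[THEN L.grade_carrier] by (simp add: B_minus B_koszul G_koszul_L)
  also have "BE k l (b \<turnstile> a) l j e = Ft k j (b \<turnstile> a)"
    using idx l kl ba by (intro Ft_E) auto
  finally show ?thesis
    using E(1)[THEN L.grade_carrier] Ft_grade[of k j "b \<turnstile> a" "s + p"] idx ba M.grade_carrier by simp
qed

end

section \<open>Brackets of generators with disjoint indices\<close>

lemma koszul_swap: "koszul G p q = koszul G q p"
  by (simp add: koszul_def fun_eq_iff mult.commute)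

context central_extension4
begin

text \<open>
  The Leibniz identity with the second argument written as a bracket through the index \<open>j\<close>, in
  either order of the factors, or through the index \<open>i\<close>: in each case one of the two resulting terms
  is zero, and the other one has a factor of the product moved to its first argument.
\<close>

lemma BE_grow:
  assumes q: "perm4 i j k l" and a: "a \<in> grade D p" and b: "b \<in> grade D s" and c: "c \<in> grade D r"
  shows "BE i j a k l (b \<stileturn> c) = \<ominus>\<^bsub>M\<^esub> koszul M s r (BE i l (a \<stileturn> c) k j b)"
    "BE i j a k l (b \<turnstile> c) = \<ominus>\<^bsub>M\<^esub> koszul M s r (BE i l (a \<stileturn> c) k j b)"
    "BE i j a k l (b \<stileturn> c) = \<ominus>\<^bsub>M\<^esub> koszul M p s (BE k j (b \<turnstile> a) i l c)"
proof -
  note q = perm4D[OF q]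
  note cc [simp] = a[THEN grade_carrier] b[THEN grade_carrier] c[THEN grade_carrier]
  have xL: "E i j a \<in> carrier L" and jl: "E j l c \<in> grade L r" and kj: "E k j b \<in> grade L s"
    and ki: "E k i b \<in> grade L s" and il: "E i l c \<in> grade L r"
    by (rule E_L[OF q(1,2,5) cc(1)] E_L_grade[OF q(2,4,10) c] E_L_grade[OF q(3,2,12) b]
        E_L_grade[OF q(3,1,11) b] E_L_grade[OF q(1,4,7) c])+
  note L = jl[THEN L.grade_carrier] kj[THEN L.grade_carrier] ki[THEN L.grade_carrier] il[THEN L.grade_carrier]
  have BE [simp]: "BE i l (a \<stileturn> c) k j b \<in> carrier M" "BE k j (b \<turnstile> a) i l c \<in> carrier M"
    by (rule BE_closed[OF q(1,4,3,2,7,12)] BE_closed[OF q(3,2,1,4,12,7)]; simp)+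
  have 1: "bracket G (E i j a) (E k j b) = \<zero>\<^bsub>G\<^esub>" by (rule G_bracket_E_zero[OF q(1,2,3,2,5,9) a b])
  have 2: "bracket G (E i j a) (E j l c) = E i l (a \<stileturn> c)" by (rule G_bracket_E_left[OF q(1,2,4,7) a c])
  have 3: "bracket G (E i j a) (E k i b) = \<ominus>\<^bsub>G\<^esub> koszul G p s (E k j (b \<turnstile> a))"
    by (rule G_bracket_E_right[OF q(1,2,3,9) a b])
  have 4: "bracket G (E i j a) (E i l c) = \<zero>\<^bsub>G\<^esub>" by (rule G_bracket_E_zero[OF q(1,2,1,4,7,8) a c])
  have "BE i j a k l (b \<stileturn> c) = B (E i j a) (bracket G (E k j b) (E j l c))"
    using G_bracket_E_left[OF q(3,2,4,13) b c] by simp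
  also have "\<dots> = \<zero>\<^bsub>M\<^esub> \<ominus>\<^bsub>M\<^esub> koszul M s r (BE i l (a \<stileturn> c) k j b)"
    unfolding B_leibniz[OF xL kj jl] 1 2 using L by simp
  finally show "BE i j a k l (b \<stileturn> c) = \<ominus>\<^bsub>M\<^esub> koszul M s r (BE i l (a \<stileturn> c) k j b)"
    by (simp add: M.M.zero_diff)
  have bc: "E k l (b \<turnstile> c) \<in> carrier L" by (rule E_L[OF q(3,4,13)]) simp
  have "bracket G (E j l c) (E k j b) = \<ominus>\<^bsub>G\<^esub> koszul G r s (E k l (b \<turnstile> c))"
    by (rule G_bracket_E_right[OF q(2,4,3,16) c b])
  then have "B (E i j a) (bracket G (E j l c) (E k j b)) = \<ominus>\<^bsub>M\<^esub> koszul M r s (BE i j a k l (b \<turnstile> c))"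
    using xL bc by (simp add: B_minus B_koszul G_koszul_L)
  moreover have "B (E i j a) (bracket G (E j l c) (E k j b)) = BE i l (a \<stileturn> c) k j b"
    unfolding B_leibniz[OF xL jl kj] 1 2 using L by (simp add: M.M.diff_zero)
  ultimately have "\<ominus>\<^bsub>M\<^esub> koszul M r s (\<ominus>\<^bsub>M\<^esub> koszul M r s (BE i j a k l (b \<turnstile> c))) =
      \<ominus>\<^bsub>M\<^esub> koszul M r s (BE i l (a \<stileturn> c) k j b)" by simp
  then show "BE i j a k l (b \<turnstile> c) = \<ominus>\<^bsub>M\<^esub> koszul M s r (BE i l (a \<stileturn> c) k j b)"
    using B_closed[OF xL bc] by (simp add: M.M.koszul_minus koszul_swap[of M s r])
  have bkj: "E k j (b \<turnstile> a) \<in> carrier L" by (rule E_L[OF q(3,2,12)]) simp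
  have "BE i j a k l (b \<stileturn> c) = B (E i j a) (bracket G (E k i b) (E i l c))"
    using G_bracket_E_left[OF q(3,1,4,13) b c] by simp
  also have "\<dots> = \<ominus>\<^bsub>M\<^esub> koszul M p s (BE k j (b \<turnstile> a) i l c) \<ominus>\<^bsub>M\<^esub> \<zero>\<^bsub>M\<^esub>"
    unfolding B_leibniz[OF xL ki il] 3 4 using L bkj by (simp add: B_minus B_koszul G_koszul_L)
  finally show "BE i j a k l (b \<stileturn> c) = \<ominus>\<^bsub>M\<^esub> koszul M p s (BE k j (b \<turnstile> a) i l c)"
    by (simp add: M.M.diff_zero)
qed

text \<open>
  Let \<open>x\<close> and \<open>y\<close> be the two units and \<open>h\<close> the diagonal matrix with entries \<open>e\<close> and \<open>-e\<close> in the
  positions \<open>i\<close> and \<open>j\<close>. Then \<open>[x, y] = 0\<close>, \<open>[x, h] = -2x\<close> and \<open>[y, h] = 0\<close>, so that the Leibniz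
  identity for \<open>x\<close>, \<open>y\<close> and \<open>h\<close> reads \<open>2 B x y = 0\<close>.
\<close>

lemma BE_double:
  assumes q: "perm4 i j k l" and a: "a \<in> grade D p" and b: "b \<in> grade D s"
  shows "BE i j a k l b \<oplus>\<^bsub>M\<^esub> BE i j a k l b = \<zero>\<^bsub>M\<^esub>"
proof -
  note q = perm4D[OF q]
  note cc [simp] = a[THEN grade_carrier] b[THEN grade_carrier]
  let ?x = "E i j a" and ?y = "E k l b"
  define h where "h = bracket G (E i j e) (E j i e)"
  have E: "E i j e \<in> grade L 0" "E j i e \<in> grade L 0" "?x \<in> carrier L" "?y \<in> grade L s" "?y \<in> carrier L"
    by (rule E_L_grade[OF q(1,2,5) e_grade] E_L_grade[OF q(2,1,8) e_grade] E_L[OF q(1,2,5) cc(1)]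
        E_L_grade[OF q(3,4,13) b] E_L[OF q(3,4,13) cc(2)])+
  have "bracket L (E i j e) (E j i e) \<in> grade L (0 + 0)" using E by (intro L.bracket_grade)
  then have h: "h \<in> grade L 0" by (simp add: h_def sl_simps(4))
  have G: "E i i e \<in> carrier G" "E j j e \<in> carrier G" "?x \<in> carrier G" "?y \<in> carrier G" using q by auto
  have "h = E i i e \<ominus>\<^bsub>G\<^esub> E j j e"
    using G_bracket_E[OF q(1,2,2,1) e_grade e_grade] by (simp add: h_def)
  then have br: "bracket G z h = bracket G z (E i i e) \<ominus>\<^bsub>G\<^esub> bracket G z (E j j e)" if "z \<in> carrier G" for z
    using that G by (simp add: G.bracket_diff)
  have xh: "bracket G ?x h = \<ominus>\<^bsub>G\<^esub> (?x \<oplus>\<^bsub>G\<^esub> ?x)"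
  proof -
    have "bracket G ?x (E i i e) = \<ominus>\<^bsub>G\<^esub> ?x" "bracket G ?x (E j j e) = ?x"
      using G_bracket_E_right[OF q(1,2,1,8) a e_grade] G_bracket_E_left[OF q(1,2,2,5) a e_grade] by simp_all
    then show ?thesis using br[OF G(3)] G(3) by (simp add: a_minus_def G.M.minus_add)
  qed
  have yh: "bracket G ?y h = \<zero>\<^bsub>G\<^esub>"
    using br[OF G(4)] G_bracket_E_zero[OF q(3,4,1,1,11,14) b e_grade] G_bracket_E_zero[OF q(3,4,2,2,12,15) b e_grade]
    by (simp add: G.M.diff_zero)
  have "bracket G ?x ?y = \<zero>\<^bsub>G\<^esub>" by (rule G_bracket_E_zero[OF q(1-4,7,9) a b])
  then have "\<zero>\<^bsub>M\<^esub> = B ?x (bracket G ?y h) \<oplus>\<^bsub>M\<^esub> koszul M s 0 (B (bracket G ?x h) ?y)"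
    using B_leibniz_left[OF E(3,4) h] h[THEN L.grade_carrier] by simp
  also have "\<dots> = \<ominus>\<^bsub>M\<^esub> (B ?x ?y \<oplus>\<^bsub>M\<^esub> B ?x ?y)"
    unfolding xh yh using E by (simp add: B_minus B_add L_closed)
  finally have *: "\<ominus>\<^bsub>M\<^esub> (B ?x ?y \<oplus>\<^bsub>M\<^esub> B ?x ?y) = \<zero>\<^bsub>M\<^esub>" by simp
  have c: "B ?x ?y \<oplus>\<^bsub>M\<^esub> B ?x ?y \<in> carrier M" using E by blast
  show ?thesis using M.M.minus_minus[OF c] unfolding * by (simp add: M.M.a_inv_zero)
qed

lemma BE_sign:
  assumes q: "perm4 i j k l" and a: "a \<in> grade D p" and b: "b \<in> grade D s"
  shows "\<ominus>\<^bsub>M\<^esub> BE i j a k l b = BE i j a k l b" "koszul M r t (BE i j a k l b) = BE i j a k l b"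
proof -
  have c: "BE i j a k l b \<in> carrier M"
    by (rule BE_closed[OF perm4D(1-5,13)[OF q] a[THEN grade_carrier] b[THEN grade_carrier]])
  show "\<ominus>\<^bsub>M\<^esub> BE i j a k l b = BE i j a k l b"
    by (rule M.minus_equality) (use BE_double[OF q a b] c in auto)
  then show "koszul M r t (BE i j a k l b) = BE i j a k l b" by (simp add: koszul_def)
qed

definition \<Lambda> :: "nat \<Rightarrow> nat \<Rightarrow> nat \<Rightarrow> nat \<Rightarrow> 'd \<Rightarrow> 'm" where
  "\<Lambda> i j k l a = BE i j a k l e"

context
  fixes i j k l assumes q: "perm4 i j k l"
begin

lemma \<Lambda>_closed [simp, intro]: "a \<in> carrier D \<Longrightarrow> \<Lambda> i j k l a \<in> carrier M"
  unfolding \<Lambda>_def by (rule BE_closed[OF perm4D(1-5,13)[OF q] _ e_closed])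

lemma \<Lambda>_add: "\<lbrakk>a \<in> carrier D; b \<in> carrier D\<rbrakk> \<Longrightarrow> \<Lambda> i j k l (a \<oplus> b) = \<Lambda> i j k l a \<oplus>\<^bsub>M\<^esub> \<Lambda> i j k l b"
  unfolding \<Lambda>_def by (rule BE_add(1)[OF perm4D(1-5,13)[OF q] _ _ e_closed])

lemma \<Lambda>_additive: "additive_map D M (\<Lambda> i j k l)"
  unfolding additive_map_def using \<Lambda>_add by auto

lemma \<Lambda>_smult: "\<lbrakk>a \<in> carrier D; r \<in> carrier R\<rbrakk> \<Longrightarrow> \<Lambda> i j k l (r \<odot> a) = r \<odot>\<^bsub>M\<^esub> \<Lambda> i j k l a"
  unfolding \<Lambda>_def using E_L[OF perm4D(1,2,5)[OF q]] E_L[OF perm4D(3,4,13)[OF q] e_closed]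
  by (simp add: E_smult B_smult)

lemma \<Lambda>_grade: "a \<in> grade D p \<Longrightarrow> \<Lambda> i j k l a \<in> grade M p"
  using B_grade[OF E_L_grade[OF perm4D(1,2,5)[OF q]] E_L_grade[OF perm4D(3,4,13)[OF q] e_grade]]
  by (simp add: \<Lambda>_def)

lemma \<chi>_\<Lambda>: 
  assumes "a \<in> carrier D" shows "\<chi> (\<Lambda> i j k l a) = \<zero>\<^bsub>G\<^esub>"
  using assms
proof (induction a rule: homogeneous_induct)
  case (homogeneous p a)
  then show ?case
    using G_bracket_E_zero[OF perm4D(1-4,7,9)[OF q] homogeneous e_grade]
      E_L[OF perm4D(1,2,5)[OF q]] E_L[OF perm4D(3,4,13)[OF q] e_closed] grade_carrier
    by (simp add: \<Lambda>_def \<chi>_B)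
next
  case (add a b)
  then show ?case by (simp add: \<Lambda>_add \<chi>_simps)
qed

text \<open>
  Two applications of \<open>BE_grow\<close> with trivial factors move the second coefficient to the first
  argument and the indices back to their places; signs do not matter by \<open>BE_double\<close>.
\<close>

lemma \<Lambda>_BE_homogeneous:
  assumes a: "a \<in> grade D p" and b: "b \<in> grade D s"
  shows "BE i j a k l b = \<Lambda> i j k l (a \<stileturn> b)"
proof -
  note cc = a[THEN grade_carrier] b[THEN grade_carrier]
  note q' = perm4_rotations(1)[OF q]
  have ab: "a \<stileturn> b \<in> grade D (p + s)" using a b by blast
  have "BE i j a k l b = BE i j a k l (e \<turnstile> b)" using cc by simp
  also have "\<dots> = BE i l (a \<stileturn> b) k j e"
    using BE_grow(2)[OF q a e_grade b] BE_sign[OF q' ab e_grade] by simp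
  also have "\<dots> = BE i j (a \<stileturn> b) k l e"
    using BE_grow(1)[OF q' ab e_grade e_grade] BE_sign[OF q ab e_grade] cc by simp
  finally show ?thesis by (simp add: \<Lambda>_def)
qed

lemma \<Lambda>_double: "a \<in> carrier D \<Longrightarrow> \<Lambda> i j k l a \<oplus>\<^bsub>M\<^esub> \<Lambda> i j k l a = \<zero>\<^bsub>M\<^esub>"
proof (induction a rule: homogeneous_induct)
  case (homogeneous p a)
  then show ?case using BE_double[OF q _ e_grade] by (simp add: \<Lambda>_def)
next
  case (add a b)
  have c: "\<Lambda> i j k l a \<in> carrier M" "\<Lambda> i j k l b \<in> carrier M" using add by auto
  have "(\<Lambda> i j k l a \<oplus>\<^bsub>M\<^esub> \<Lambda> i j k l b) \<oplus>\<^bsub>M\<^esub> (\<Lambda> i j k l a \<oplus>\<^bsub>M\<^esub> \<Lambda> i j k l b) =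
      (\<Lambda> i j k l a \<oplus>\<^bsub>M\<^esub> \<Lambda> i j k l a) \<oplus>\<^bsub>M\<^esub> (\<Lambda> i j k l b \<oplus>\<^bsub>M\<^esub> \<Lambda> i j k l b)"
    using c by (simp add: M.M.a_ac)
  then show ?case using add by (simp add: \<Lambda>_add)
qed

lemma \<Lambda>_minus: "a \<in> carrier D \<Longrightarrow> \<ominus>\<^bsub>M\<^esub> \<Lambda> i j k l a = \<Lambda> i j k l a"
  by (rule M.minus_equality) (use \<Lambda>_double in auto)

end

text \<open>
  The cases of \<open>BE_grow\<close> in which all coefficients but one are \<open>e\<close>.
\<close>

lemma \<Lambda>_swap:
  assumes q: "perm4 i j k l" and a: "a \<in> carrier D"
  shows "\<Lambda> i l k j a = \<Lambda> i j k l a" "\<Lambda> k j i l a = \<Lambda> i j k l a" "\<Lambda> k l i j a = \<Lambda> i j k l a"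
proof -
  have 1: "\<Lambda> i l k j a = \<Lambda> i j k l a" if q: "perm4 i j k l" for i j k l
    using a
  proof (induction a rule: homogeneous_induct)
    case (homogeneous p a)
    then show ?case
      using BE_grow(1)[OF q homogeneous e_grade e_grade] BE_sign[OF perm4_rotations(1)[OF q] homogeneous e_grade]
        grade_carrier by (simp add: \<Lambda>_def)
  next
    case (add a b)
    then show ?case using \<Lambda>_add[OF q] \<Lambda>_add[OF perm4_rotations(1)[OF q]] by simp
  qed
  have 2: "\<Lambda> k j i l a = \<Lambda> i j k l a" if q: "perm4 i j k l" for i j k l
    using a
  proof (induction a rule: homogeneous_induct)
    case (homogeneous p a)
    note ac = homogeneous[THEN grade_carrier]
    have "BE i j a k l (e \<stileturn> e) = BE k j a i l e"
      using BE_grow(3)[OF q homogeneous e_grade e_grade] BE_sign[OF perm4_rotations(2)[OF q] homogeneous e_grade] ac by simp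
    then show ?case by (simp add: \<Lambda>_def)
  next
    case (add a b)
    then show ?case using \<Lambda>_add[OF q] \<Lambda>_add[OF perm4_rotations(2)[OF q]] by simp
  qed
  show "\<Lambda> i l k j a = \<Lambda> i j k l a" "\<Lambda> k j i l a = \<Lambda> i j k l a" using 1[OF q] 2[OF q] .
  show "\<Lambda> k l i j a = \<Lambda> i j k l a" using 1[OF q] 2[OF perm4_rotations(1)[OF q]] by simp
qed

context
  fixes i j k l assumes q: "perm4 i j k l"
begin

text \<open>
  Moving \<open>b\<close> to the first argument through the index \<open>i\<close> places it to the left of \<open>a\<close>.
\<close>

lemma \<Lambda>_comm:
  assumes "a \<in> carrier D" "b \<in> carrier D"
  shows "\<Lambda> i j k l (a \<stileturn> b) = \<Lambda> i j k l (b \<turnstile> a)"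
  using assms
proof (induction a rule: homogeneous_induct)
  case (homogeneous p a)
  note a = homogeneous(1)
  from homogeneous(2) show ?case
  proof (induction b rule: homogeneous_induct)
    case (homogeneous s b)
    note cc = a[THEN grade_carrier] homogeneous[THEN grade_carrier]
    have ba: "b \<turnstile> a \<in> grade D (s + p)" using a homogeneous by blast
    note q' = perm4_rotations(2)[OF q]
    have "\<Lambda> i j k l (a \<stileturn> b) = BE i j a k l (b \<stileturn> e)"
      using \<Lambda>_BE_homogeneous[OF q a homogeneous] cc by simp
    also have "\<dots> = \<Lambda> k j i l (b \<turnstile> a)"
      using BE_grow(3)[OF q a homogeneous e_grade] BE_sign[OF q' ba e_grade] by (simp add: \<Lambda>_def)
    also have "\<dots> = \<Lambda> i j k l (b \<turnstile> a)" using \<Lambda>_swap(2)[OF q] cc by simp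
    finally show ?case .
  next
    case (add u v)
    then show ?case using a[THEN grade_carrier] by (simp add: dia_simps \<Lambda>_add[OF q])
  qed
next
  case (add u v)
  then show ?case by (simp add: dia_simps \<Lambda>_add[OF q])
qed

text \<open>
  Moving \<open>c\<close> alone to the first argument, and then \<open>b\<close>, reverses the order of the two.
\<close>

lemma \<Lambda>_comm_right:
  assumes "a \<in> carrier D" "b \<in> carrier D" "c \<in> carrier D"
  shows "\<Lambda> i j k l (a \<stileturn> (b \<stileturn> c)) = \<Lambda> i j k l (a \<stileturn> (c \<stileturn> b))"
  using assms
proof (induction a rule: homogeneous_induct)
  case (homogeneous p a)
  note a = homogeneous(1)
  from homogeneous(2,3) show ?case
  proof (induction b rule: homogeneous_induct)
    case (homogeneous s b)
    note b = homogeneous(1)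
    from homogeneous(2) show ?case
    proof (induction c rule: homogeneous_induct)
      case (homogeneous r c)
      note c = homogeneous
      note cc = a[THEN grade_carrier] b[THEN grade_carrier] c[THEN grade_carrier]
      note q' = perm4_rotations(1)[OF q]
      have ac: "a \<stileturn> c \<in> grade D (p + r)" and bc: "b \<stileturn> c \<in> grade D (s + r)" using a b c by blast+
      have "\<Lambda> i j k l (a \<stileturn> (b \<stileturn> c)) = BE i j a k l (b \<stileturn> c)"
        by (rule \<Lambda>_BE_homogeneous[OF q a bc, symmetric])
      also have "\<dots> = BE i l (a \<stileturn> c) k j b"
        using BE_grow(1)[OF q a b c] BE_sign[OF q' ac b] by simp
      also have "\<dots> = \<Lambda> i l k j ((a \<stileturn> c) \<stileturn> b)" by (rule \<Lambda>_BE_homogeneous[OF q' ac b])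
      also have "\<dots> = \<Lambda> i j k l (a \<stileturn> (c \<stileturn> b))" using \<Lambda>_swap(1)[OF q] cc by (simp add: ldia_assoc)
      finally show ?case .
    next
      case (add u v)
      then show ?case using a[THEN grade_carrier] b[THEN grade_carrier] by (simp add: dia_simps \<Lambda>_add[OF q])
    qed
  next
    case (add u v)
    then show ?case using a[THEN grade_carrier] by (simp add: dia_simps \<Lambda>_add[OF q])
  qed
next
  case (add u v)
  then show ?case by (simp add: dia_simps \<Lambda>_add[OF q])
qed

text \<open>
  The elements all of whose one-sided multiples \<open>\<Lambda>\<close> kills form an ideal, by the commutation rules
  for the arguments of \<open>\<Lambda>\<close>, and this ideal contains the generators of \<open>I2\<close>. One of the multiples
  is the product with the bar-unit.
\<close>

lemma \<Lambda>_vanishes: "x \<in> I2 \<Longrightarrow> \<Lambda> i j k l x = \<zero>\<^bsub>M\<^esub>"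
proof -
  let ?\<Lambda> = "\<Lambda> i j k l"
  let ?N = "{x \<in> carrier D. \<forall>c\<in>carrier D. ?\<Lambda> (x \<stileturn> c) = \<zero>\<^bsub>M\<^esub> \<and> ?\<Lambda> (c \<stileturn> x) = \<zero>\<^bsub>M\<^esub>}"
  note add = \<Lambda>_add[OF q] and c = \<Lambda>_closed[OF q] and comm = \<Lambda>_comm and right = \<Lambda>_comm_right
  have z: "?\<Lambda> \<zero> = \<zero>\<^bsub>M\<^esub>" by (rule additive_map_zero[OF abelian_group_axioms M.abelian_group_axioms \<Lambda>_additive[OF q]])
  have minus: "?\<Lambda> (\<ominus> a) = ?\<Lambda> a" if "a \<in> carrier D" for a
    using additive_map_minus[OF abelian_group_axioms M.abelian_group_axioms \<Lambda>_additive[OF q] that] \<Lambda>_minus[OF q that] by simp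
  have "dialgebra_ideal R D ?N"
    unfolding dialgebra_ideal_def
  proof (intro conjI ballI impI)
    show "submodule ?N R D"
      by (rule submoduleI) (auto simp: z dia_simps add minus \<Lambda>_smult[OF q])
    fix x y assume xy: "x \<in> carrier D" "y \<in> carrier D" "x \<in> ?N \<or> y \<in> ?N"
    have x1: "?\<Lambda> (x \<stileturn> (y \<stileturn> d)) = \<zero>\<^bsub>M\<^esub>" "?\<Lambda> (x \<stileturn> d) = \<zero>\<^bsub>M\<^esub>" "?\<Lambda> (d \<stileturn> x) = \<zero>\<^bsub>M\<^esub>"
      if "x \<in> ?N" "x \<in> carrier D" "y \<in> carrier D" "d \<in> carrier D" for x y d using that by auto
    have x2: "?\<Lambda> (d \<stileturn> (x \<stileturn> y)) = \<zero>\<^bsub>M\<^esub>" if x: "x \<in> ?N" and cc: "y \<in> carrier D" "d \<in> carrier D" for x y d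
    proof -
      have xc: "x \<in> carrier D" using x by blast
      have "?\<Lambda> (d \<stileturn> (x \<stileturn> y)) = ?\<Lambda> (d \<stileturn> (y \<stileturn> x))" using cc xc by (intro right)
      also have "\<dots> = ?\<Lambda> ((d \<stileturn> y) \<stileturn> x)" using cc xc by (simp add: ldia_assoc)
      also have "\<dots> = \<zero>\<^bsub>M\<^esub>" using x cc by blast
      finally show ?thesis .
    qed
    have rd: "?\<Lambda> (u \<turnstile> v) = ?\<Lambda> (v \<stileturn> u)" if "u \<in> carrier D" "v \<in> carrier D" for u v
      using comm[OF that(2,1)] by simp
    have all: "?\<Lambda> ((x \<stileturn> y) \<stileturn> d) = \<zero>\<^bsub>M\<^esub> \<and> ?\<Lambda> (d \<stileturn> (x \<stileturn> y)) = \<zero>\<^bsub>M\<^esub> \<and>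
        ?\<Lambda> ((x \<turnstile> y) \<stileturn> d) = \<zero>\<^bsub>M\<^esub> \<and> ?\<Lambda> (d \<stileturn> (x \<turnstile> y)) = \<zero>\<^bsub>M\<^esub>" if d: "d \<in> carrier D" for d
    proof -
      have 1: "?\<Lambda> (d \<stileturn> (x \<turnstile> y)) = ?\<Lambda> (d \<stileturn> (x \<stileturn> y))" using xy d by (simp add: dia_right)
      have 2: "?\<Lambda> ((x \<turnstile> y) \<stileturn> d) = ?\<Lambda> ((y \<stileturn> d) \<stileturn> x)" using xy d by (simp add: dia_mid rd)
      have 3: "?\<Lambda> ((x \<stileturn> y) \<stileturn> d) = ?\<Lambda> (x \<stileturn> (y \<stileturn> d))" using xy d by (simp add: ldia_assoc)
      show ?thesis
      proof (cases "x \<in> ?N")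
        case True
        have "y \<stileturn> d \<in> carrier D" using xy d by blast
        then show ?thesis using True x2[OF True xy(2) d] unfolding 1 2 3 by blast
      next
        case False
        then have y: "y \<in> ?N" using xy by blast
        have cc: "d \<stileturn> x \<in> carrier D" using xy d by blast
        have "?\<Lambda> (d \<stileturn> (x \<stileturn> y)) = \<zero>\<^bsub>M\<^esub>" using y cc xy d by (simp flip: ldia_assoc)
        moreover have "?\<Lambda> ((y \<stileturn> d) \<stileturn> x) = \<zero>\<^bsub>M\<^esub>" using y xy d by (simp add: ldia_assoc)
        moreover have "?\<Lambda> (x \<stileturn> (y \<stileturn> d)) = \<zero>\<^bsub>M\<^esub>" using x2[OF y d xy(1)] .
        ultimately show ?thesis unfolding 1 2 3 by blast
      qed
    qed
    show "x \<stileturn> y \<in> ?N" "x \<turnstile> y \<in> ?N" using all xy by auto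
  qed
  moreover have "commutator_gens 2 \<subseteq> ?N"
  proof
    fix x assume "x \<in> commutator_gens 2"
    then consider a where "a \<in> carrier D" "x = [(2::int)] \<cdot> a"
      | a b p s where "a \<in> grade D p" "b \<in> grade D s" "x = a \<stileturn> b \<ominus> koszul D p s (b \<turnstile> a)"
      by (auto simp: commutator_gens_def)
    then show "x \<in> ?N"
    proof cases
      case 1
      have "x = a \<oplus> a" using 1 add.int_pow_mult[of a 1 1] by simp
      then show ?thesis using 1 \<Lambda>_double[OF q] by (auto simp: dia_simps add)
    next
      case 2
      then have cc: "a \<in> carrier D" "b \<in> carrier D" by (auto dest: grade_carrier)
      define y where "y = koszul D p s (b \<turnstile> a)"
      have yc: "y \<in> carrier D" using cc by (simp add: y_def)
      have y: "?\<Lambda> (y \<stileturn> d) = ?\<Lambda> ((b \<turnstile> a) \<stileturn> d)" "?\<Lambda> (d \<stileturn> y) = ?\<Lambda> (d \<stileturn> (b \<turnstile> a))" if "d \<in> carrier D" for d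
        using cc that by (simp_all add: y_def koszul_def dia_simps minus)
      have "?\<Lambda> (x \<stileturn> d) = \<zero>\<^bsub>M\<^esub> \<and> ?\<Lambda> (d \<stileturn> x) = \<zero>\<^bsub>M\<^esub>" if d: "d \<in> carrier D" for d
      proof -
        have "?\<Lambda> ((b \<turnstile> a) \<stileturn> d) = ?\<Lambda> (b \<turnstile> (a \<stileturn> d))" using cc d by (simp add: dia_mid)
        also have "\<dots> = ?\<Lambda> ((a \<stileturn> d) \<stileturn> b)" using cc d comm[of "a \<stileturn> d" b] by simp
        also have "\<dots> = ?\<Lambda> ((a \<stileturn> b) \<stileturn> d)" using cc d right[of a d b] by (simp add: ldia_assoc)
        finally have L1: "?\<Lambda> (y \<stileturn> d) = ?\<Lambda> ((a \<stileturn> b) \<stileturn> d)" using y(1)[OF d] by simp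
        have L2: "?\<Lambda> (d \<stileturn> y) = ?\<Lambda> (d \<stileturn> (a \<stileturn> b))"
          using y(2)[OF d] right[of d b a] cc d by (simp add: dia_right)
        have "?\<Lambda> (x \<stileturn> d) = ?\<Lambda> ((a \<stileturn> b) \<stileturn> d) \<oplus>\<^bsub>M\<^esub> ?\<Lambda> (y \<stileturn> d)"
          "?\<Lambda> (d \<stileturn> x) = ?\<Lambda> (d \<stileturn> (a \<stileturn> b)) \<oplus>\<^bsub>M\<^esub> ?\<Lambda> (d \<stileturn> y)"
          unfolding 2(3) y_def[symmetric] a_minus_def using cc yc d by (simp_all add: dia_simps add minus)
        then show ?thesis unfolding L1 L2 using cc d \<Lambda>_double[OF q] by simp
      qed
      then show ?thesis using 2 cc yc unfolding y_def by auto
    qed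
  qed
  ultimately have I: "I2 \<subseteq> ?N" by (rule commutator_ideal_least)
  assume "x \<in> I2"
  then have "x \<in> ?N" using I by blast
  then have "?\<Lambda> (x \<stileturn> e) = \<zero>\<^bsub>M\<^esub>" "x \<in> carrier D" using e_closed by blast+
  then show ?thesis by simp
qed

end

end

section \<open>Universality\<close>

context central_extension4
begin

lemma quads_perm4: "(i, j, k, l) \<in> set (quads s) \<longleftrightarrow> perm4 i j k l \<and> pair_index i k = s"
  unfolding set_quads perm4_iff perm4_def by simp

lemma pair_index_range: "perm4 i j k l \<Longrightarrow> pair_index i k \<in> {1..6}"
  unfolding perm4_def pair_index_def by auto

text \<open>
  By \<open>\<Lambda>_swap\<close> the map \<open>\<Lambda> i j k l\<close> depends only on the copy of the quotient that \<open>{i, k}\<close> names.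
\<close>

definition lam :: "nat \<Rightarrow> 'd \<Rightarrow> 'm" where
  "lam s a = (case SOME t. t \<in> set (quads s) of (i, j, k, l) \<Rightarrow> \<Lambda> i j k l a)"

lemma lam_obtain:
  assumes "s \<in> {1..6}"
  shows "\<exists>i j k l. perm4 i j k l \<and> lam s = \<Lambda> i j k l"
proof -
  have "\<exists>t. t \<in> set (quads s)" using quads_nonempty[OF assms] by blast
  then have t: "(SOME t. t \<in> set (quads s)) \<in> set (quads s)" by (rule someI_ex)
  obtain i j k l where eq: "(SOME t. t \<in> set (quads s)) = (i, j, k, l)" by (rule prod_cases4)
  have "perm4 i j k l" using t unfolding eq quads_perm4 by blast
  moreover have "lam s = \<Lambda> i j k l" by (simp add: fun_eq_iff lam_def eq)
  ultimately show ?thesis by blast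
qed

lemma lam_eq:
  assumes q: "perm4 i j k l" and a: "a \<in> carrier D"
  shows "lam (pair_index i k) a = \<Lambda> i j k l a"
proof -
  have t: "(i, j, k, l) \<in> set (quads (pair_index i k))" using q by (simp add: quads_perm4)
  obtain i' j' k' l' where t': "(SOME t. t \<in> set (quads (pair_index i k))) = (i', j', k', l')"
    by (cases "SOME t. t \<in> set (quads (pair_index i k))") auto
  have "(i', j', k', l') \<in> set (quads (pair_index i k))"
    using someI[of "\<lambda>t. t \<in> set (quads (pair_index i k))", OF t] by (simp only: t')
  from quads_same_index[OF t this pair_index_range[OF q]]
  have "\<Lambda> i' j' k' l' a = \<Lambda> i j k l a" using \<Lambda>_swap[OF q a] by auto
  then show ?thesis by (simp add: lam_def t')
qed

context
  fixes s :: nat assumes s: "s \<in> {1..6}"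
begin

lemma lam_closed [simp, intro]: "a \<in> carrier D \<Longrightarrow> lam s a \<in> carrier M"
  using lam_obtain[OF s] \<Lambda>_closed by auto

lemma lam_add: "\<lbrakk>a \<in> carrier D; b \<in> carrier D\<rbrakk> \<Longrightarrow> lam s (a \<oplus> b) = lam s a \<oplus>\<^bsub>M\<^esub> lam s b"
  using lam_obtain[OF s] \<Lambda>_add by auto

lemma lam_smult: "\<lbrakk>a \<in> carrier D; r \<in> carrier R\<rbrakk> \<Longrightarrow> lam s (r \<odot> a) = r \<odot>\<^bsub>M\<^esub> lam s a"
  using lam_obtain[OF s] \<Lambda>_smult by auto

lemma lam_grade: "a \<in> grade D p \<Longrightarrow> lam s a \<in> grade M p"
  using lam_obtain[OF s] \<Lambda>_grade by auto

lemma \<chi>_lam: "a \<in> carrier D \<Longrightarrow> \<chi> (lam s a) = \<zero>\<^bsub>G\<^esub>"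
  using lam_obtain[OF s] \<chi>_\<Lambda> by auto

lemma lam_cong: "\<lbrakk>a \<in> carrier D; b \<in> carrier D; \<pi> a = \<pi> b\<rbrakk> \<Longrightarrow> lam s a = lam s b"
proof -
  assume ab: "a \<in> carrier D" "b \<in> carrier D" and "\<pi> a = \<pi> b"
  then have "a \<ominus> b \<in> I2" by (simp add: \<pi>_eq_iff)
  then have "lam s (a \<ominus> b) = \<zero>\<^bsub>M\<^esub>" using lam_obtain[OF s] \<Lambda>_vanishes by auto
  moreover have "lam s a = lam s ((a \<ominus> b) \<oplus> b)"
  proof -
    have "(a \<ominus> b) \<oplus> b = a" using ab by algebra
    then show ?thesis by simp
  qed
  ultimately show ?thesis using ab by (simp add: lam_add)
qed

end

text \<open>
  As \<open>\<Lambda>\<close> vanishes on \<open>I2\<close>, the maps \<open>lam s\<close> factor through the quotient; \<open>\<nu>\<close> will be the map on the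
  direct sum with these components.
\<close>

definition lamq :: "nat \<Rightarrow> 'd set \<Rightarrow> 'm" where
  "lamq s Y = lam s (SOME a. a \<in> carrier D \<and> Y = \<pi> a)"

lemma lamq_\<pi>: "\<lbrakk>s \<in> {1..6}; a \<in> carrier D\<rbrakk> \<Longrightarrow> lamq s (\<pi> a) = lam s a"
proof -
  assume s: "s \<in> {1..6}" and a: "a \<in> carrier D"
  define b where "b = (SOME b. b \<in> carrier D \<and> \<pi> a = \<pi> b)"
  have "\<exists>b. b \<in> carrier D \<and> \<pi> a = \<pi> b" using a by blast
  from someI_ex[OF this] have "b \<in> carrier D" "\<pi> a = \<pi> b" unfolding b_def by blast+
  then have "lam s a = lam s b" by (rule lam_cong[OF s a])
  then show ?thesis by (simp add: lamq_def b_def)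
qed

lemma lamq_facts:
  assumes s: "s \<in> {1..6}"
  shows "Y \<in> carrier Dq \<Longrightarrow> lamq s Y \<in> carrier M"
    "\<lbrakk>Y \<in> carrier Dq; Z \<in> carrier Dq\<rbrakk> \<Longrightarrow> lamq s (Y \<oplus>\<^bsub>Dq\<^esub> Z) = lamq s Y \<oplus>\<^bsub>M\<^esub> lamq s Z"
    "\<lbrakk>Y \<in> carrier Dq; r \<in> carrier R\<rbrakk> \<Longrightarrow> lamq s (r \<odot>\<^bsub>Dq\<^esub> Y) = r \<odot>\<^bsub>M\<^esub> lamq s Y"
    "Y \<in> carrier Dq \<Longrightarrow> \<chi> (lamq s Y) = \<zero>\<^bsub>G\<^esub>"
    "Y \<in> grade Dq p \<Longrightarrow> lamq s Y \<in> grade M p"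
proof -
  note q = lamq_\<pi>[OF s]
  show "Y \<in> carrier Dq \<Longrightarrow> lamq s Y \<in> carrier M"
    by (elim Dq_carrierE) (simp add: q lam_closed[OF s])
  show "Y \<in> carrier Dq \<Longrightarrow> \<chi> (lamq s Y) = \<zero>\<^bsub>G\<^esub>"
    by (elim Dq_carrierE) (simp add: q \<chi>_lam[OF s])
  show "\<lbrakk>Y \<in> carrier Dq; Z \<in> carrier Dq\<rbrakk> \<Longrightarrow> lamq s (Y \<oplus>\<^bsub>Dq\<^esub> Z) = lamq s Y \<oplus>\<^bsub>M\<^esub> lamq s Z"
    by (elim Dq_carrierE) (simp add: q lam_add[OF s] flip: \<pi>_add)
  show "\<lbrakk>Y \<in> carrier Dq; r \<in> carrier R\<rbrakk> \<Longrightarrow> lamq s (r \<odot>\<^bsub>Dq\<^esub> Y) = r \<odot>\<^bsub>M\<^esub> lamq s Y"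
    by (elim Dq_carrierE) (simp add: q lam_smult[OF s] flip: \<pi>_smult)
  show "Y \<in> grade Dq p \<Longrightarrow> lamq s Y \<in> grade M p"
  proof -
    assume "Y \<in> grade Dq p"
    then obtain a where "a \<in> grade D p" "Y = \<pi> a"
      unfolding commutator_quotient_def by (auto simp: quotient_grade[OF quot])
    then show ?thesis using grade_carrier by (simp add: q lam_grade[OF s])
  qed
qed

definition \<nu> :: "(nat \<Rightarrow> 'd set) \<Rightarrow> 'm" where
  "\<nu> u = (\<Oplus>\<^bsub>M\<^esub>s\<in>{1..6}. lamq s (u s))"

lemma Dq6_entry: "\<lbrakk>u \<in> carrier Dq6; s \<in> {1..6}\<rbrakk> \<Longrightarrow> u s \<in> carrier Dq"
  by (auto simp: Dq.power_simps)

lemma \<nu>_fun: "u \<in> carrier Dq6 \<Longrightarrow> (\<lambda>s. lamq s (u s)) \<in> {1..6} \<rightarrow> carrier M"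
  using lamq_facts(1) Dq6_entry by blast

lemma \<nu>_closed [simp, intro]: "u \<in> carrier Dq6 \<Longrightarrow> \<nu> u \<in> carrier M"
  unfolding \<nu>_def by (rule M.M.finsum_closed) (rule \<nu>_fun)

lemma \<nu>_add: "\<lbrakk>u \<in> carrier Dq6; v \<in> carrier Dq6\<rbrakk> \<Longrightarrow> \<nu> (u \<oplus>\<^bsub>Dq6\<^esub> v) = \<nu> u \<oplus>\<^bsub>M\<^esub> \<nu> v"
proof -
  assume uv: "u \<in> carrier Dq6" "v \<in> carrier Dq6"
  have "\<nu> (u \<oplus>\<^bsub>Dq6\<^esub> v) = (\<Oplus>\<^bsub>M\<^esub>s\<in>{1..6}. lamq s (u s) \<oplus>\<^bsub>M\<^esub> lamq s (v s))"
    unfolding \<nu>_def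
    by (rule M.M.finsum_cong'[OF HOL.refl])
      (use uv[THEN Dq6_entry] lamq_facts(1,2) in \<open>auto simp: Dq.power_simps(3)\<close>)
  also have "\<dots> = \<nu> u \<oplus>\<^bsub>M\<^esub> \<nu> v" unfolding \<nu>_def by (rule M.M.finsum_addf[OF uv[THEN \<nu>_fun]])
  finally show ?thesis .
qed

lemma \<nu>_smult: "\<lbrakk>u \<in> carrier Dq6; r \<in> carrier R\<rbrakk> \<Longrightarrow> \<nu> (r \<odot>\<^bsub>Dq6\<^esub> u) = r \<odot>\<^bsub>M\<^esub> \<nu> u"
proof -
  assume u: "u \<in> carrier Dq6" "r \<in> carrier R"
  have "\<nu> (r \<odot>\<^bsub>Dq6\<^esub> u) = (\<Oplus>\<^bsub>M\<^esub>s\<in>{1..6}. r \<odot>\<^bsub>M\<^esub> lamq s (u s))"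
    unfolding \<nu>_def
    by (rule M.M.finsum_cong'[OF HOL.refl])
      (use u Dq6_entry[OF u(1)] lamq_facts(1,3) in \<open>auto simp: Dq.power_simps(4)\<close>)
  then show ?thesis unfolding \<nu>_def using M.finsum_smult_ldistr[OF _ u(2) \<nu>_fun[OF u(1)]] by simp
qed

lemma \<nu>_additive: "additive_map Dq6 M \<nu>"
  by (simp add: additive_map_def \<nu>_add)

lemma \<nu>_grade: "u \<in> grade Dq6 p \<Longrightarrow> \<nu> u \<in> grade M p"
  unfolding \<nu>_def by (rule M.grade_finsum, rule lamq_facts(5)) (auto simp: Dq.power_simps)

lemma \<chi>_\<nu>: "u \<in> carrier Dq6 \<Longrightarrow> \<chi> (\<nu> u) = \<zero>\<^bsub>G\<^esub>"
proof -
  assume u: "u \<in> carrier Dq6"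
  have "\<chi> (\<nu> u) = (\<Oplus>\<^bsub>L\<^esub>s\<in>{1..6}. \<chi> (lamq s (u s)))"
    unfolding \<nu>_def
    by (rule additive_map_finsum[OF M.abelian_group_axioms L.abelian_group_axioms \<chi>_additive \<nu>_fun[OF u]])
  also have "\<dots> = \<zero>\<^bsub>L\<^esub>"
    by (rule L.add.finprod_one_eqI) (use lamq_facts(4) Dq6_entry[OF u] in \<open>simp add: sl_simps\<close>)
  finally show ?thesis by (simp add: sl_simps)
qed

lemma \<nu>_minus: "u \<in> carrier Dq6 \<Longrightarrow> \<nu> (\<ominus>\<^bsub>Dq6\<^esub> u) = \<ominus>\<^bsub>M\<^esub> \<nu> u"
  by (rule additive_map_minus[OF Dq6.abelian_group_axioms M.abelian_group_axioms \<nu>_additive])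

lemma \<nu>_zero: "\<nu> \<zero>\<^bsub>Dq6\<^esub> = \<zero>\<^bsub>M\<^esub>"
  by (rule additive_map_zero[OF Dq6.abelian_group_axioms M.abelian_group_axioms \<nu>_additive])

text \<open>
  The failure of the Steinberg relations in \<open>M\<close>: the maps \<open>\<Lambda>\<close> give the brackets of generators with
  distinct indices.
\<close>

lemma \<nu>_\<psi>_E:
  assumes idx: "i \<in> I" "j \<in> I" "k \<in> I" "l \<in> I" and a: "a \<in> carrier D" and b: "b \<in> carrier D"
  shows "\<nu> (\<psi> (E i j a) (E k l b)) = (if perm4 i j k l then \<Lambda> i j k l (a \<stileturn> b) else \<zero>\<^bsub>M\<^esub>)"
proof (cases "perm4 i j k l")
  case False
  then have n: "\<not> distinct [i, j, k, l]" using idx by (auto simp: perm4_def)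
  have "\<psi> (E i j a) (E k l b) = \<zero>\<^bsub>Dq6\<^esub>"
    unfolding \<psi>_E[OF idx a b] Dq.power_simps using n by (intro restrict_ext) (simp only: if_False simp_thms)
  then show ?thesis using False \<nu>_zero by simp
next
  case True
  then have d: "distinct [i, j, k, l]" by (simp add: perm4_def)
  have z: "lamq s \<zero>\<^bsub>Dq\<^esub> = \<zero>\<^bsub>M\<^esub>" if "s \<in> {1..6}" for s
    using additive_map_zero[OF Dq.abelian_group_axioms M.abelian_group_axioms, of "lamq s"] lamq_facts(1,2)[OF that]
    by (simp add: additive_map_def)
  have ab: "a \<stileturn> b \<in> carrier D" using a b by blast
  have "\<nu> (\<psi> (E i j a) (E k l b)) =
      (\<Oplus>\<^bsub>M\<^esub>s\<in>{1..6}. if pair_index i k = s then lam s (a \<stileturn> b) else \<zero>\<^bsub>M\<^esub>)"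
    unfolding \<nu>_def \<psi>_E[OF idx a b]
    by (rule M.M.finsum_cong'[OF HOL.refl]) (use d ab in \<open>auto simp: z lamq_\<pi> lam_closed\<close>)
  also have "\<dots> = lam (pair_index i k) (a \<stileturn> b)"
    by (rule M.M.finsum_singleton[OF pair_index_range[OF True]]) (use ab in \<open>auto intro: lam_closed\<close>)
  finally show ?thesis using True lam_eq[OF True ab] by simp
qed

text \<open>
  Subtracting the pulled back cocycle from the bracket of \<open>M\<close> makes the brackets of generators with
  distinct indices vanish. The result is a Leibniz superalgebra because \<open>\<psi>\<close> is a cocycle and \<open>\<nu>\<close> has
  central values.
\<close>

definition \<gamma> :: "'m \<Rightarrow> 'm \<Rightarrow> 'm" where
  "\<gamma> m n = \<ominus>\<^bsub>M\<^esub> \<nu> (\<psi> (\<chi> m) (\<chi> n))"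

abbreviation M' :: "('r, 'm) leibniz_superalgebra" where
  "M' \<equiv> with_bracket M (\<lambda>m n. bracket M m n \<oplus>\<^bsub>M\<^esub> \<gamma> m n)"

lemma \<chi>_G: "m \<in> carrier M \<Longrightarrow> \<chi> m \<in> carrier G"
  by (intro sl_carrier_G \<chi>_closed)

lemma \<psi>_\<chi>: "\<lbrakk>m \<in> carrier M; n \<in> carrier M\<rbrakk> \<Longrightarrow> \<psi> (\<chi> m) (\<chi> n) \<in> carrier Dq6"
  by (intro \<psi>_closed \<chi>_G)

lemma \<gamma>_closed: "\<lbrakk>m \<in> carrier M; n \<in> carrier M\<rbrakk> \<Longrightarrow> \<gamma> m n \<in> carrier M"
  using \<psi>_\<chi> by (simp add: \<gamma>_def)

lemma \<chi>_\<gamma>: "\<lbrakk>m \<in> carrier M; n \<in> carrier M\<rbrakk> \<Longrightarrow> \<chi> (\<gamma> m n) = \<zero>\<^bsub>G\<^esub>"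
  using \<psi>_\<chi> by (simp add: \<gamma>_def \<chi>_minus \<chi>_\<nu> G.M.a_inv_zero)

lemma M'_leibniz: "leibniz_superalgebra R M'"
proof (rule M.leibniz_superalgebra_twist)
  show "bilinear_op R M \<gamma>"
    unfolding bilinear_op_def
    using \<psi>_\<chi> by (auto simp: \<gamma>_def \<chi>_simps \<psi>_linear \<chi>_G \<nu>_add \<nu>_smult M.M.minus_add M.smult_r_minus)
  show "graded_op M \<gamma>"
    unfolding graded_op_def
  proof (intro allI ballI)
    fix p q m n assume "m \<in> grade M p" "n \<in> grade M q"
    then have "\<chi> m \<in> grade G p" "\<chi> n \<in> grade G q" using \<chi>_grade by (auto simp: sl_simps(5))
    then show "\<gamma> m n \<in> grade M (p + q)" unfolding \<gamma>_def by (intro M.grade_minus \<nu>_grade \<psi>_grade)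
  qed
  show "\<gamma> m n \<in> leibniz_centre M" if "m \<in> carrier M" "n \<in> carrier M" for m n
    using that by (intro kernel_central_M \<gamma>_closed \<chi>_\<gamma>)
  show "\<gamma> (\<gamma> m n) k = \<zero>\<^bsub>M\<^esub> \<and> \<gamma> k (\<gamma> m n) = \<zero>\<^bsub>M\<^esub>"
    if "m \<in> carrier M" "n \<in> carrier M" "k \<in> carrier M" for m n k
    using that \<chi>_\<gamma>[OF that(1,2)] \<psi>_bilinear_simps[OF \<chi>_G[OF that(3)]]
    by (simp add: \<gamma>_def[of "\<gamma> m n" k] \<gamma>_def[of k "\<gamma> m n"] \<nu>_zero M.M.a_inv_zero)
  fix m n k p q r assume g: "m \<in> grade M p" "n \<in> grade M q" "k \<in> grade M r"
  note c = g[THEN M.grade_carrier]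
  note gL = g[THEN \<chi>_grade]
  define u v where "u = \<psi> (bracket G (\<chi> m) (\<chi> n)) (\<chi> k)" and "v = \<psi> (bracket G (\<chi> m) (\<chi> k)) (\<chi> n)"
  have uv: "u \<in> carrier Dq6" "v \<in> carrier Dq6" using c \<chi>_G by (auto simp: u_def v_def)
  have "\<psi> (\<chi> m) (bracket G (\<chi> n) (\<chi> k)) = u \<ominus>\<^bsub>Dq6\<^esub> koszul Dq6 q r v"
    unfolding u_def v_def by (rule \<psi>_cocycle[OF gL])
  moreover have "\<ominus>\<^bsub>M\<^esub> \<nu> (u \<ominus>\<^bsub>Dq6\<^esub> koszul Dq6 q r v) = \<ominus>\<^bsub>M\<^esub> \<nu> u \<ominus>\<^bsub>M\<^esub> koszul M q r (\<ominus>\<^bsub>M\<^esub> \<nu> v)"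
    using uv by (simp add: koszul_def a_minus_def \<nu>_add \<nu>_minus M.M.minus_add)
  ultimately show "\<gamma> m (bracket M n k) = \<gamma> (bracket M m n) k \<ominus>\<^bsub>M\<^esub> koszul M q r (\<gamma> (bracket M m k) n)"
    using c by (simp add: \<gamma>_def \<chi>_simps u_def v_def)
qed

sublocale M': leibniz_superalgebra R M' by (rule M'_leibniz)

lemma bracket_M'_Ft:
  assumes idx: "i \<in> I" "j \<in> I" "k \<in> I" "l \<in> I" "i \<noteq> j" "k \<noteq> l" and a: "a \<in> grade D p" and b: "b \<in> grade D q"
  shows "bracket M' (Ft i j a) (Ft k l b) = BE i j a k l b \<ominus>\<^bsub>M\<^esub> \<nu> (\<psi> (E i j a) (E k l b))"
  using \<chi>_Ft[OF idx(1,2,5) a] \<chi>_Ft[OF idx(3,4,6) b]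
    B_eq[OF Ft_grade[OF idx(1,2,5) a, THEN M.grade_carrier] Ft_grade[OF idx(3,4,6) b, THEN M.grade_carrier]]
  by (simp add: \<gamma>_def a_minus_def)

lemma not_perm4: "\<lbrakk>i = k \<or> j = l \<or> j = k \<or> i = l\<rbrakk> \<Longrightarrow> \<not> perm4 i j k l"
  by (auto simp: perm4_def)

text \<open>
  Brackets with a common index are governed by \<open>BE_left\<close>, \<open>BE_right\<close> and \<open>BE_null\<close>, and the correction
  is zero there; for four distinct indices the bracket and the correction cancel.
\<close>

sublocale fam: steinberg_family R D 4 0 M' Ft
proof
  fix i j a p
  assume "offdiag 4 0 i j" "a \<in> grade D p"
  then show "Ft i j a \<in> grade M' (idx_deg 4 i + idx_deg 4 j + p)"
    using Ft_grade[of i j a p] by (simp add: offdiag_iff)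
next
  fix i j a p b
  assume "offdiag 4 0 i j" "a \<in> grade D p" "b \<in> grade D p"
  then show "Ft i j (a \<oplus> b) = Ft i j a \<oplus>\<^bsub>M'\<^esub> Ft i j b"
    using Ft_add[of i j a b] grade_carrier by (simp add: offdiag_iff)
next
  fix i j r a p
  assume "offdiag 4 0 i j" "r \<in> carrier R" "a \<in> grade D p"
  then show "Ft i j (r \<odot> a) = r \<odot>\<^bsub>M'\<^esub> Ft i j a"
    using Ft_smult[of i j a r] grade_carrier by (simp add: offdiag_iff)
next
  fix i j l a p b q
  assume ij: "offdiag 4 0 i j" "offdiag 4 0 j l" and il: "i \<noteq> l" and a: "a \<in> grade D p" and b: "b \<in> grade D q"
  then have idx: "i \<in> I" "j \<in> I" "l \<in> I" "i \<noteq> j" "j \<noteq> l" by (auto simp: offdiag_iff)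
  have ab: "a \<stileturn> b \<in> grade D (p + q)" using a b by blast
  show "bracket M' (Ft i j a) (Ft j l b) = Ft i l (a \<stileturn> b)"
    unfolding bracket_M'_Ft[OF idx(1,2,2,3,4,5) a b] BE_left[OF idx il a b]
      \<nu>_\<psi>_E[OF idx(1,2,2,3) a[THEN grade_carrier] b[THEN grade_carrier]]
    using not_perm4[of i j j l] Ft_grade[OF idx(1,3) il ab, THEN M.grade_carrier] by (simp add: M.M.diff_zero)
next
  fix i j k a p b q
  assume ij: "offdiag 4 0 i j" "offdiag 4 0 k i" and jk: "j \<noteq> k" and a: "a \<in> grade D p" and b: "b \<in> grade D q"
  then have idx: "i \<in> I" "j \<in> I" "k \<in> I" "i \<noteq> j" "k \<noteq> i" "i \<noteq> k" "k \<noteq> j" by (auto simp: offdiag_iff)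
  have ba: "b \<turnstile> a \<in> grade D (q + p)" using a b by blast
  have F: "Ft k j (b \<turnstile> a) \<in> carrier M" using Ft_grade[OF idx(3,2,7) ba] by (rule M.grade_carrier)
  show "bracket M' (Ft i j a) (Ft k i b) = \<ominus>\<^bsub>M'\<^esub> koszul M' (idx_deg 4 i + idx_deg 4 j + p)
      (idx_deg 4 k + idx_deg 4 i + q) (Ft k j (b \<turnstile> a))"
    unfolding bracket_M'_Ft[OF idx(1,2,3,1,4,5) a b] BE_right[OF idx(1-4,6) jk a b]
      \<nu>_\<psi>_E[OF idx(1,2,3,1) a[THEN grade_carrier] b[THEN grade_carrier]]
    using not_perm4[of i k j i] idx F by (simp add: M.M.diff_zero)
next
  fix i j k l a p b q
  assume ij: "offdiag 4 0 i j" "offdiag 4 0 k l" and il: "i \<noteq> l" "j \<noteq> k" and a: "a \<in> grade D p" and b: "b \<in> grade D q"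
  then have idx: "i \<in> I" "j \<in> I" "k \<in> I" "l \<in> I" "i \<noteq> j" "k \<noteq> l" by (auto simp: offdiag_iff)
  note br = bracket_M'_Ft[OF idx a b] \<nu>_\<psi>_E[OF idx(1-4) a[THEN grade_carrier] b[THEN grade_carrier]]
  show "bracket M' (Ft i j a) (Ft k l b) = \<zero>\<^bsub>M'\<^esub>"
  proof (cases "i = k \<or> j = l")
    case True
    show ?thesis
      unfolding br BE_null[OF idx il True a b] using not_perm4[of i k j l] True by (auto simp: M.M.diff_zero)
  next
    case False
    then have q: "perm4 i j k l" using idx il by (auto simp: perm4_def)
    have "\<Lambda> i j k l (a \<stileturn> b) \<in> carrier M" using a b grade_carrier by (intro \<Lambda>_closed[OF q]) blast
    then show ?thesis
      unfolding br \<Lambda>_BE_homogeneous[OF q a b] using q by (simp add: M.M.diff_self)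
  qed
qed

definition g :: "('r, 'd) stl_term set \<Rightarrow> 'm" where
  "g = stl_lift M' Ft"

lemmas g_hom = fam.stl_lift_hom[folded g_def]

lemma g_simps:
  "x \<in> carrier S \<Longrightarrow> g x \<in> carrier M"
  "\<lbrakk>x \<in> carrier S; y \<in> carrier S\<rbrakk> \<Longrightarrow> g (x \<oplus>\<^bsub>S\<^esub> y) = g x \<oplus>\<^bsub>M\<^esub> g y"
  "\<lbrakk>r \<in> carrier R; x \<in> carrier S\<rbrakk> \<Longrightarrow> g (r \<odot>\<^bsub>S\<^esub> x) = r \<odot>\<^bsub>M\<^esub> g x"
  "x \<in> grade S p \<Longrightarrow> g x \<in> grade M p"
  "\<lbrakk>x \<in> carrier S; y \<in> carrier S\<rbrakk> \<Longrightarrow> g (bracket S x y) = bracket M (g x) (g y) \<oplus>\<^bsub>M\<^esub> \<gamma> (g x) (g y)"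
  using leibniz_hom_closed[OF g_hom] leibniz_hom_add[OF g_hom] leibniz_hom_smult[OF g_hom]
    leibniz_hom_grade[OF g_hom] leibniz_hom_bracket[OF g_hom] by simp_all

lemma \<chi>_g: "x \<in> carrier S \<Longrightarrow> \<chi> (g x) = \<phi> x"
proof -
  let ?X = "{x \<in> carrier S. \<chi> (g x) = \<phi> x}"
  have ga: "additive_map S M g" by (simp add: additive_map_def g_simps)
  have "?X = carrier S"
  proof (rule S_left_normed_induct)
    show "submodule ?X R S"
      by (rule S.submoduleI)
        (auto simp: g_simps \<chi>_simps \<phi>_simps \<phi>_zero \<phi>_minus \<chi>_zero \<chi>_minus
          additive_map_zero[OF S.abelian_group_axioms M.abelian_group_axioms ga]
          additive_map_minus[OF S.abelian_group_axioms M.abelian_group_axioms ga])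
    fix i j a p assume ij: "offdiag 4 0 i j" and a: "a \<in> grade D p"
    then have idx: "i \<in> I" "j \<in> I" "i \<noteq> j" by (auto simp: offdiag_iff)
    have gen: "\<chi> (g (gF i j a)) = \<phi> (gF i j a)" "gF i j a \<in> carrier S"
      using fam.stl_lift_Gen[OF ij a] \<chi>_Ft[OF idx a] \<phi>_gF[OF idx a] gF_closed[OF idx a] by (simp_all add: g_def)
    then show "gF i j a \<in> ?X" by simp
    fix x assume "x \<in> ?X"
    then have x: "x \<in> carrier S" "\<chi> (g x) = \<phi> x" by auto
    have c: "bracket M (g x) (g (gF i j a)) \<in> carrier M" "\<gamma> (g x) (g (gF i j a)) \<in> carrier M"
      using x(1) gen(2) by (simp_all add: g_simps \<gamma>_closed)
    have "bracket G (\<phi> x) (\<phi> (gF i j a)) \<in> carrier G"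
      by (intro G.bracket_closed \<phi>_closed x(1) gen(2))
    then have "\<chi> (g (bracket S x (gF i j a))) = \<phi> (bracket S x (gF i j a))"
      using x gen c by (simp add: g_simps \<chi>_simps \<chi>_\<gamma> \<phi>_simps)
    then show "bracket S x (gF i j a) \<in> ?X" using x gen by simp
  qed
  then show "x \<in> carrier S \<Longrightarrow> \<chi> (g x) = \<phi> x" by blast
qed

definition lift :: "('r, 'd) stl_term set \<times> (nat \<Rightarrow> 'd set) \<Rightarrow> 'm" where
  "lift = restrict (\<lambda>(x, u). g x \<oplus>\<^bsub>M\<^esub> \<nu> u) (carrier U)"

lemma lift_pair: "\<lbrakk>x \<in> carrier S; u \<in> carrier Dq6\<rbrakk> \<Longrightarrow> lift (x, u) = g x \<oplus>\<^bsub>M\<^esub> \<nu> u"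
  by (simp add: lift_def dsum_simps)

lemma \<chi>_lift: "w \<in> carrier U \<Longrightarrow> \<chi> (lift w) = proj w"
  using \<phi>_closed by (auto simp: dsum_simps lift_pair \<chi>_simps g_simps \<chi>_g \<chi>_\<nu>)

text \<open>
  The second component of a bracket of the extension restores the cocycle that the bracket of \<open>M'\<close>
  lacks, and the values of \<open>\<nu>\<close> in the arguments are central.
\<close>

lemma lift_bracket:
  assumes x: "x \<in> carrier S" "u \<in> carrier Dq6" and y: "y \<in> carrier S" "v \<in> carrier Dq6"
  shows "lift (bracket S x y, \<psi> (\<phi> x) (\<phi> y)) = bracket M (lift (x, u)) (lift (y, v))"
proof -
  have c: "g x \<in> carrier M" "g y \<in> carrier M" "lift (x, u) \<in> carrier M" "lift (y, v) \<in> carrier M"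
    using x y by (auto simp: lift_pair g_simps)
  have p: "\<psi> (\<phi> x) (\<phi> y) \<in> carrier Dq6" using x y by blast
  have "lift (bracket S x y, \<psi> (\<phi> x) (\<phi> y)) =
      (bracket M (g x) (g y) \<ominus>\<^bsub>M\<^esub> \<nu> (\<psi> (\<phi> x) (\<phi> y))) \<oplus>\<^bsub>M\<^esub> \<nu> (\<psi> (\<phi> x) (\<phi> y))"
    using x y p by (simp add: lift_pair g_simps(5) \<gamma>_def \<chi>_g a_minus_def)
  also have "\<dots> = bracket M (g x) (g y)"
  proof -
    have "bracket M (g x) (g y) \<in> carrier M" "\<nu> (\<psi> (\<phi> x) (\<phi> y)) \<in> carrier M" using c p by auto
    then show ?thesis by algebra
  qed
  also have "\<dots> = bracket M (lift (x, u)) (lift (y, v))"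
    using B_eq[OF c(1,2)] B_eq[OF c(3,4)] \<chi>_lift[of "(x, u)"] \<chi>_lift[of "(y, v)"] x y
    by (simp add: \<chi>_g dsum_simps)
  finally show ?thesis .
qed

lemma lift_hom: "lift \<in> leibniz_hom R U M"
proof -
  have 1: "lift (x \<oplus>\<^bsub>S\<^esub> y, u \<oplus>\<^bsub>Dq6\<^esub> v) = lift (x, u) \<oplus>\<^bsub>M\<^esub> lift (y, v)"
    if "x \<in> carrier S" "u \<in> carrier Dq6" "y \<in> carrier S" "v \<in> carrier Dq6" for x u y v
    using that by (simp add: lift_pair g_simps(2) \<nu>_add g_simps(1) M.M.a_ac)
  have 2: "lift (r \<odot>\<^bsub>S\<^esub> x, r \<odot>\<^bsub>Dq6\<^esub> u) = r \<odot>\<^bsub>M\<^esub> lift (x, u)"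
    if "x \<in> carrier S" "u \<in> carrier Dq6" "r \<in> carrier R" for x u r
    using that by (simp add: lift_pair g_simps(3) \<nu>_smult g_simps(1) M.smult_r_distr)
  have 3: "lift (x, u) \<in> grade M p" if "x \<in> grade S p" "u \<in> grade Dq6 p" for x u p
    using that g_simps(4) \<nu>_grade by (simp add: lift_pair S.grade_carrier Dq6.grade_carrier)
  have 4: "lift (x, u) \<in> carrier M" if "x \<in> carrier S" "u \<in> carrier Dq6" for x u
    using that by (simp add: lift_pair g_simps(1))
  show ?thesis
    unfolding leibniz_hom_def
    by (auto simp: dsum_simps 1 2 4 lift_bracket[symmetric] intro: 3)
qed

text \<open>
  Brackets in \<open>M\<close> depend only on images in \<open>L\<close>; so two lifts agree on brackets, and these span the
  extension.
\<close>

lemma lift_unique: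
  assumes f: "f \<in> leibniz_hom R U M" and fe: "f \<in> extensional (carrier U)"
    and fp: "\<forall>w\<in>carrier U. proj w = \<chi> (f w)"
  shows "f = lift"
proof (rule extensionalityI[OF fe])
  show "lift \<in> extensional (carrier U)" by (simp add: lift_def)
  let ?X = "{w \<in> carrier U. f w = lift w}"
  note fl = leibniz_hom_linear[OF f, THEN linear_map_additive]
    and ll = leibniz_hom_linear[OF lift_hom, THEN linear_map_additive]
  note U = U.abelian_group_axioms M.abelian_group_axioms
  have "?X = carrier U"
  proof (rule U_perfect)
    show "submodule ?X R U"
      by (rule U.submoduleI)
        (use additive_map_zero[OF U fl] additive_map_zero[OF U ll] additive_map_minus[OF U fl]
          additive_map_minus[OF U ll] leibniz_hom_add[OF f] leibniz_hom_add[OF lift_hom]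
          leibniz_hom_smult[OF f] leibniz_hom_smult[OF lift_hom] U.M.zero_closed U.M.a_inv_closed
          U.M.a_closed U.smult_closed in auto)
    fix w z assume wz: "w \<in> carrier U" "z \<in> carrier U"
    note c = leibniz_hom_closed[OF f] leibniz_hom_closed[OF lift_hom]
    have "f (bracket U w z) = bracket M (f w) (f z)" by (rule leibniz_hom_bracket[OF f wz])
    also have "\<dots> = B (\<chi> (f w)) (\<chi> (f z))" by (intro B_eq c wz)
    also have "\<dots> = B (\<chi> (lift w)) (\<chi> (lift z))"
    proof -
      have "\<chi> (f w) = \<chi> (lift w)" "\<chi> (f z) = \<chi> (lift z)"
        using \<chi>_lift[OF wz(1)] \<chi>_lift[OF wz(2)] bspec[OF fp wz(1)] bspec[OF fp wz(2)] by (simp_all only:)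
      then show ?thesis by (simp only:)
    qed
    also have "\<dots> = bracket M (lift w) (lift z)" by (intro B_eq[symmetric] c wz)
    also have "\<dots> = lift (bracket U w z)" by (rule leibniz_hom_bracket[OF lift_hom wz, symmetric])
    finally show "bracket U w z \<in> ?X" using U.bracket_closed[OF wz] by blast
  qed
  then show "f w = lift w" if "w \<in> carrier U" for w using that by blast
qed

lemma lift_exists_unique:
  "\<exists>!f. f \<in> leibniz_hom R U M \<and> f \<in> extensional (carrier U) \<and> (\<forall>w\<in>carrier U. proj w = \<chi> (f w))"
proof (rule ex1I[of _ lift])
  show "lift \<in> leibniz_hom R U M \<and> lift \<in> extensional (carrier U) \<and> (\<forall>w\<in>carrier U. proj w = \<chi> (lift w))"
    using lift_hom \<chi>_lift by (auto simp: lift_def)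
qed (use lift_unique in blast)

end

theorem theorem4p3:
  fixes R :: "('r, 's) ring_scheme"
    and D :: "('r, 'd) superdialgebra"
    and e :: 'd
  assumes "cring R"
    and "superdialgebra R D"
    and "bar_unit D e"
  shows "universal_central_extension TYPE('m) R
           (with_bracket
              (dsum_supermodule (stl R 4 0 D) (power_supermodule (commutator_quotient R D 2) 6))
              (stl4_bracket R D))
           (sl R 4 0 D)
           (\<lambda>(x, u). stl_to_sl 4 0 D x)"
proof -
  interpret steinberg4 R D e
    by (intro steinberg4.intro steinberg.intro steinberg4_axioms.intro assms)
  show ?thesis
    unfolding universal_central_extension_def
  proof (intro conjI allI impI proj_central_extension)
    fix M :: "('r, 'm) leibniz_superalgebra" and \<chi>
    assume "central_extension R M L \<chi>"
    then interpret central_extension4 R D e M \<chi>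
      by (intro central_extension4.intro steinberg4_axioms central_extension4_axioms.intro)
    show "\<exists>!f. f \<in> leibniz_hom R U M \<and> f \<in> extensional (carrier U) \<and> (\<forall>w\<in>carrier U. proj w = \<chi> (f w))"
      by (rule lift_exists_unique)
  qed
qed

end
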